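(* For each quasi-periodic labelling $\rho$, the group $G_\rho$ does not have Kazhdan's property (T), yet it has Serre's property (FA).
   Context: A discrete group $G$ has property (T) if every affine isometric action of $G$ on a real Hilbert space has a fixed point. A group $G$ has Serre's property (FA) if every action of $G$ on a simplicial tree (by simplicial automorphisms) has a global fixed point. Maps act on the right: $x\cdot f$ is the image of $x$ under $f$, and $fg$ means first $f$, then $g$. $\mathrm{Supp}(f)=\{x : x\cdot f\neq x\}$. Thompson's group $F$ is the group of piecewise linear orientation-preserving homeomorphisms of $[0,1]$ that are differentiable except at finitely many dyadic rationals and whose derivatives, where they exist, are integer powers of $2$; $F'=[F,F]$. For dyadic rationals $0\le r<s\le 1$, $F_{[r,s]}$ is the subgroup of elements of $F$ with support in $[r,s]$. Let $\iota_0$ be the map $t\mapsto 1-t$ of $[0,1]$. Fix $c_0\in F$ with $\mathrm{Supp}(c_0)=(0,\tfrac14)$, $x\cdot c_0>x$ for all $x\in(0,\tfrac14)$, and $t\cdot c_0=2t$ for $t\in(0,\tfrac1{16})$. Put $c_1=\iota_0 c_0\iota_0$ and $\nu_1=c_0c_1$. Fix homeomorphisms $\nu_2,\nu_3$ of $[0,1]$ with supports in $(\tfrac1{16},\tfrac{15}{16})$ that generate $F_{[1/16,15/16]}$. Let $H=\langle F',\nu_1\rangle=\langle \nu_1,\nu_2,\nu_3\rangle$. A labelling is a map $\rho:\tfrac12\mathbf{Z}\to\{a,b,a^{-1},b^{-1}\}$ with $\rho(k)\in\{a,a^{-1}\}$ for $k\in\mathbf{Z}$ and $\rho(k)\in\{b,b^{-1}\}$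 for $k\in\tfrac12\mathbf{Z}\setminus\mathbf{Z}$. A block is a set $X=\{k,k+\tfrac12,\ldots,k+\tfrac12 n\}$ with $k\in\tfrac12\mathbf{Z}$, $n\in\mathbf{N}$; its word is $W_\rho(X)=\rho(k)\rho(k+\tfrac12)\cdots\rho(k+\tfrac12n)$, and $W_\rho^{-1}(X)$ is the formal inverse word (reverse the order and invert each letter). The labelling $\rho$ is quasi-periodic if (1) for each block $X$ there is $n\in\mathbf{N}$ such that for every block $Y$ of size at least $n$, $W_\rho(X)$ is a subword (string of consecutive letters) of $W_\rho(Y)$; and (2) for each block $X$ there is a block $Y$ with $W_\rho(Y)=W_\rho^{-1}(X)$. For a labelling $\rho$ and $i\in\{1,2,3\}$ define homeomorphisms $\zeta_i,\chi_i$ of $\mathbf{R}$ by: for $n\in\mathbf{Z}$, $t\in[0,1]$, $(n+t)\cdot\zeta_i=n+t\cdot\nu_i$ if $\rho(n+\tfrac12)=b$ and $(n+t)\cdot\zeta_i=n+t\cdot(\iota_0\nu_i\iota_0)$ if $\rho(n+\tfrac12)=b^{-1}$; $(n-\tfrac12+t)\cdot\chi_i=n-\tfrac12+t\cdot\nu_i$ if $\rho(n)=a$ and $(n-\tfrac12+t)\cdot\chi_i=n-\tfrac12+t\cdot(\iota_0\nu_i\iota_0)$ if $\rho(n)=a^{-1}$. Then $G_\rho=\langle\zeta_1,\zeta_2,\zeta_3,\chi_1,\chi_2,\chi_3\rangle<\mathrm{Homeo}^+(\mathbf{R})$. *)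

theory Defs
  imports
    "HOL-Analysis.Analysis"
    "HOL-Algebra.Group_Action"
    "HOL-Algebra.Generated_Groups"
    "HOL-Algebra.Algebraic_Closure_Type"
    "HOL-Library.Sublist"
begin

section \<open>Property (T) of a discrete group\<close>

text \<open>
  Vector spaces are modules over the field of reals, with an arbitrary carrier set.
  The prefix in \<open>Module.module\<close> separates the carrier-based locale from
  the type-class based \<open>Modules.module\<close>.
\<close>

locale real_inner_space =
  Module.module "ring_of_type_algebra :: real ring" V
  for V :: "(real, 'h) module" (structure) +
  fixes ip :: "'h \<Rightarrow> 'h \<Rightarrow> real"
  assumes ip_sym: "\<lbrakk>x \<in> carrier V; y \<in> carrier V\<rbrakk> \<Longrightarrow> ip x y = ip y x"
    and ip_add: "\<lbrakk>x \<in> carrier V; y \<in> carrier V; z \<in> carrier V\<rbrakk> \<Longrightarrow>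
          ip (x \<oplus> y) z = ip x z + ip y z"
    and ip_smult: "\<lbrakk>x \<in> carrier V; y \<in> carrier V\<rbrakk> \<Longrightarrow> ip (t \<odot> x) y = t * ip x y"
    and ip_pos: "\<lbrakk>x \<in> carrier V; x \<noteq> \<zero>\<rbrakk> \<Longrightarrow> ip x x > 0"

definition ip_dist :: "(real, 'h) module \<Rightarrow> ('h \<Rightarrow> 'h \<Rightarrow> real) \<Rightarrow> 'h \<Rightarrow> 'h \<Rightarrow> real" where
  "ip_dist V ip x y = sqrt (ip (x \<ominus>\<^bsub>V\<^esub> y) (x \<ominus>\<^bsub>V\<^esub> y))"

locale real_hilbert_space = real_inner_space +
  assumes complete:
    "\<lbrakk>\<And>n. s n \<in> carrier V;
      \<And>e. e > 0 \<Longrightarrow> \<exists>N. \<forall>m\<ge>N. \<forall>n\<ge>N. ip_dist V ip (s m) (s n) < e\<rbrakk> \<Longrightarrow>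
     \<exists>x\<in>carrier V. (\<lambda>n::nat. ip_dist V ip (s n) x) \<longlonglongrightarrow> 0"

definition affine_isometry ::
  "(real, 'h) module \<Rightarrow> ('h \<Rightarrow> 'h \<Rightarrow> real) \<Rightarrow> ('h \<Rightarrow> 'h) \<Rightarrow> bool" where
  "affine_isometry V ip f \<longleftrightarrow>
     (\<forall>x\<in>carrier V. \<forall>y\<in>carrier V. ip_dist V ip (f x) (f y) = ip_dist V ip x y) \<and>
     (\<forall>x\<in>carrier V. \<forall>y\<in>carrier V. \<forall>t.
        f ((1 - t) \<odot>\<^bsub>V\<^esub> x \<oplus>\<^bsub>V\<^esub> t \<odot>\<^bsub>V\<^esub> y) = (1 - t) \<odot>\<^bsub>V\<^esub> f x \<oplus>\<^bsub>V\<^esub> t \<odot>\<^bsub>V\<^esub> f y)"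

text \<open>
  HOL does not quantify over types, so the Hilbert spaces range over all Hilbert space
  structures on subsets of the type \<open>'g \<Rightarrow> real\<close>. Nothing is lost: an affine isometric
  action restricts to the closed linear span of the orbit of the origin, a fixed point of the
  whole action projects orthogonally to a fixed point there, and that span is isometric to
  \<open>l2(J)\<close> for a subset \<open>J\<close> of \<open>'g\<close>, hence to a structure on a subset of \<open>'g \<Rightarrow> real\<close>.
\<close>

definition has_property_T :: "('g, 'm) monoid_scheme \<Rightarrow> bool" where
  "has_property_T G \<longleftrightarrow>
     (\<forall>(V :: (real, 'g \<Rightarrow> real) module) ip \<phi>.
        real_hilbert_space V ip \<and> group_action G (carrier V) \<phi> \<and>
        (\<forall>g\<in>carrier G. affine_isometry V ip (\<phi> g)) \<longrightarrow>
        (\<exists>x\<in>carrier V. \<forall>g\<in>carrier G. \<phi> g x = x))"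


section \<open>Property (FA)\<close>

text \<open>A simplicial tree is given by its set \<open>V\<close> of vertices and its set \<open>E\<close> of edges,
  an edge being a two-element set of vertices: nonempty, connected, without circuits.\<close>

definition simplicial_tree :: "'v set \<Rightarrow> 'v set set \<Rightarrow> bool" where
  "simplicial_tree V E \<longleftrightarrow>
     V \<noteq> {} \<and> (\<forall>e\<in>E. e \<subseteq> V \<and> card e = 2) \<and>
     (\<forall>u\<in>V. \<forall>v\<in>V. \<exists>p. p \<noteq> [] \<and> hd p = u \<and> last p = v \<and>
        successively (\<lambda>x y. {x, y} \<in> E) p) \<and>
     \<not> (\<exists>p. length p \<ge> 3 \<and> distinct p \<and> successively (\<lambda>x y. {x, y} \<in> E) p \<and>
          {last p, hd p} \<in> E)"

text \<open>Points of the geometric realization, in barycentric coordinates, and the map induced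
  on them by a map of vertices. A fixed point of a group of automorphisms may be the midpoint
  of an inverted edge.\<close>

definition realization :: "'v set \<Rightarrow> 'v set set \<Rightarrow> ('v \<Rightarrow> real) set" where
  "realization V E =
     {p. (\<forall>v. p v \<ge> 0) \<and> {v. p v \<noteq> 0} \<in> (\<lambda>v. {v}) ` V \<union> E \<and> (\<Sum>v | p v \<noteq> 0. p v) = 1}"

definition realization_map :: "('v \<Rightarrow> 'v) \<Rightarrow> ('v \<Rightarrow> real) \<Rightarrow> 'v \<Rightarrow> real" where
  "realization_map h p = (\<lambda>w. \<Sum>v | p v \<noteq> 0 \<and> h v = w. p v)"

definition has_property_FA :: "'v itself \<Rightarrow> ('g, 'm) monoid_scheme \<Rightarrow> bool" where
  "has_property_FA (_ :: 'v itself) G \<longleftrightarrow>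
     (\<forall>(V :: 'v set) E \<phi>.
        simplicial_tree V E \<and> group_action G V \<phi> \<and>
        (\<forall>g\<in>carrier G. (`) (\<phi> g) ` E = E) \<longrightarrow>
        (\<exists>p\<in>realization V E. \<forall>g\<in>carrier G. realization_map (\<phi> g) p = p))"


section \<open>Groups of homeomorphisms acting on the right\<close>

text \<open>As in \<open>BijGroup\<close>, maps are extensional; but \<open>f \<otimes> g\<close> is first \<open>f\<close>, then \<open>g\<close>.\<close>

definition Homeo :: "real set \<Rightarrow> (real \<Rightarrow> real) monoid" where
  "Homeo S = \<lparr>carrier = {f \<in> extensional S. \<exists>f'. homeomorphism S S f f'},
              mult = (\<lambda>f g. compose S g f),
              one = (\<lambda>x\<in>S. x)\<rparr>"

definition Homeo_plus :: "real set \<Rightarrow> (real \<Rightarrow> real) monoid" where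
  "Homeo_plus S = (Homeo S)\<lparr>carrier := {f \<in> carrier (Homeo S). strict_mono_on S f}\<rparr>"

abbreviation unit_interval :: "real set" where
  "unit_interval \<equiv> {0..1}"

definition Supp :: "(real \<Rightarrow> real) \<Rightarrow> real set" where
  "Supp f = {x \<in> unit_interval. f x \<noteq> x}"

definition dyadic :: "real set" where
  "dyadic = {of_int m / 2 ^ n | (m :: int) (n :: nat). True}"

definition piecewise_linear :: "(real \<Rightarrow> real) \<Rightarrow> bool" where
  "piecewise_linear f \<longleftrightarrow>
     (\<exists>P. finite P \<and>
       (\<forall>u v. 0 \<le> u \<and> u < v \<and> v \<le> 1 \<and> P \<inter> {u<..<v} = {} \<longrightarrow>
          (\<exists>m c. \<forall>x\<in>{u..v}. f x = m * x + c)))"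

definition thompson_F :: "(real \<Rightarrow> real) set" where
  "thompson_F =
     {f \<in> carrier (Homeo_plus unit_interval).
        piecewise_linear f \<and>
        (\<exists>D. finite D \<and> D \<subseteq> dyadic \<and>
           (\<forall>x\<in>unit_interval - D. f differentiable (at x within unit_interval))) \<and>
        (\<forall>x\<in>unit_interval. \<forall>d. (f has_real_derivative d) (at x within unit_interval) \<longrightarrow>
           (\<exists>k::int. d = 2 powi k))}"

definition thompson_F_on :: "real \<Rightarrow> real \<Rightarrow> (real \<Rightarrow> real) set" where
  "thompson_F_on r s = {f \<in> thompson_F. Supp f \<subseteq> {r..s}}"

definition iota0 :: "real \<Rightarrow> real" where
  "iota0 = (\<lambda>t\<in>unit_interval. 1 - t)"

definition flip :: "(real \<Rightarrow> real) \<Rightarrow> real \<Rightarrow> real" where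
  "flip f = iota0 \<otimes>\<^bsub>Homeo unit_interval\<^esub> f \<otimes>\<^bsub>Homeo unit_interval\<^esub> iota0"

definition nu1 :: "(real \<Rightarrow> real) \<Rightarrow> real \<Rightarrow> real" where
  "nu1 c0 = c0 \<otimes>\<^bsub>Homeo unit_interval\<^esub> flip c0"


section \<open>Quasi-periodic labellings\<close>

datatype letter = A | B | A_inv | B_inv

fun letter_inv :: "letter \<Rightarrow> letter" where
  "letter_inv A = A_inv"
| "letter_inv A_inv = A"
| "letter_inv B = B_inv"
| "letter_inv B_inv = B"

definition half_integers :: "real set" where
  "half_integers = {of_int k / 2 | k :: int. True}"

text \<open>Only the values of a labelling on the half-integers are meaningful.\<close>

definition labelling :: "(real \<Rightarrow> letter) \<Rightarrow> bool" where
  "labelling \<rho> \<longleftrightarrow>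
     (\<forall>k\<in>\<int>. \<rho> k \<in> {A, A_inv}) \<and> (\<forall>k\<in>half_integers - \<int>. \<rho> k \<in> {B, B_inv})"

definition is_block :: "real set \<Rightarrow> bool" where
  "is_block S \<longleftrightarrow> (\<exists>k\<in>half_integers. \<exists>n::nat. S = (\<lambda>i. k + of_nat i / 2) ` {0..n})"

definition word :: "(real \<Rightarrow> letter) \<Rightarrow> real set \<Rightarrow> letter list" where
  "word \<rho> S = map \<rho> (sorted_list_of_set S)"

definition inverse_word :: "letter list \<Rightarrow> letter list" where
  "inverse_word w = rev (map letter_inv w)"

definition quasi_periodic :: "(real \<Rightarrow> letter) \<Rightarrow> bool" where
  "quasi_periodic \<rho> \<longleftrightarrow>
     labelling \<rho> \<and>
     (\<forall>S. is_block S \<longrightarrow>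
        (\<exists>n. \<forall>T. is_block T \<and> card T \<ge> n \<longrightarrow> sublist (word \<rho> S) (word \<rho> T))) \<and>
     (\<forall>S. is_block S \<longrightarrow> (\<exists>T. is_block T \<and> word \<rho> T = inverse_word (word \<rho> S)))"


section \<open>The groups \<open>G_\<rho>\<close>\<close>

text \<open>For \<open>n\<close> an integer and \<open>0 \<le> t < 1\<close>, \<open>zeta\<close> is evaluated at \<open>n + t\<close> and \<open>chi\<close> at
  \<open>n - 1/2 + t\<close>. The formulas extend to \<open>t = 1\<close> because \<open>\<nu>\<close> fixes the endpoints; see
  \<open>zeta_eq\<close> and \<open>chi_eq\<close>.\<close>

definition zeta :: "(real \<Rightarrow> letter) \<Rightarrow> (real \<Rightarrow> real) \<Rightarrow> real \<Rightarrow> real" where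
  "zeta \<rho> \<nu> x =
     (let n = of_int \<lfloor>x\<rfloor>; t = frac x
      in n + (if \<rho> (n + 1/2) = B then \<nu> t else flip \<nu> t))"

definition chi :: "(real \<Rightarrow> letter) \<Rightarrow> (real \<Rightarrow> real) \<Rightarrow> real \<Rightarrow> real" where
  "chi \<rho> \<nu> x =
     (let n = of_int \<lfloor>x + 1/2\<rfloor>; t = frac (x + 1/2)
      in n - 1/2 + (if \<rho> n = A then \<nu> t else flip \<nu> t))"

lemma flip_apply: "t \<in> unit_interval \<Longrightarrow> flip f t = iota0 (f (1 - t))"
  by (simp add: flip_def Homeo_def compose_def iota0_def)

lemma zeta_eq:
  assumes "\<nu> 0 = 0" "\<nu> 1 = 1" "t \<in> unit_interval"
  shows "zeta \<rho> \<nu> (of_int n + t) =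
    of_int n + (if \<rho> (of_int n + 1/2) = B then \<nu> t else flip \<nu> t)"
proof (cases "t = 1")
  case True
  then have "\<lfloor>of_int n + t\<rfloor> = n + 1" by linarith
  with True assms show ?thesis
    by (simp add: zeta_def frac_def flip_apply iota0_def)
next
  case False
  with assms have "\<lfloor>of_int n + t\<rfloor> = n" by (simp add: floor_eq_iff)
  then show ?thesis by (simp add: zeta_def frac_def)
qed

lemma chi_eq:
  assumes "\<nu> 0 = 0" "\<nu> 1 = 1" "t \<in> unit_interval"
  shows "chi \<rho> \<nu> (of_int n - 1/2 + t) =
    of_int n - 1/2 + (if \<rho> (of_int n) = A then \<nu> t else flip \<nu> t)"
proof (cases "t = 1")
  case True
  then have "\<lfloor>of_int n - 1/2 + t + 1/2\<rfloor> = n + 1" by linarith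
  with True assms show ?thesis
    by (simp add: chi_def frac_def flip_apply iota0_def)
next
  case False
  with assms have "\<lfloor>of_int n + t\<rfloor> = n" by (simp add: floor_eq_iff)
  then show ?thesis by (simp add: chi_def frac_def)
qed

definition G_rho ::
  "(real \<Rightarrow> letter) \<Rightarrow> (real \<Rightarrow> real) \<Rightarrow> (real \<Rightarrow> real) \<Rightarrow> (real \<Rightarrow> real) \<Rightarrow> (real \<Rightarrow> real) monoid"
where
  "G_rho \<rho> \<nu>1 \<nu>2 \<nu>3 = (Homeo_plus UNIV)\<lparr>carrier :=
     generate (Homeo_plus UNIV)
       {zeta \<rho> \<nu>1, zeta \<rho> \<nu>2, zeta \<rho> \<nu>3, chi \<rho> \<nu>1, chi \<rho> \<nu>2, chi \<rho> \<nu>3}\<rparr>"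

end

theory Submission
  imports Defs
begin

text \<open>Property (FA). Suppose that \<open>m\<close> commutes with a subgroup \<open>K\<close> and that some conjugate of \<open>m\<close> lies
  in \<open>[K, K]\<close>. If \<open>m\<close> acted hyperbolically on a tree, \<open>K\<close> would preserve its axis together with the
  ends and act on it by translations, so \<open>[K, K]\<close> would be elliptic, a contradiction. Maps that act in
  every cell \<open>[n, n + 1]\<close>, or in every cell \<open>[n - 1/2, n + 1/2]\<close>, by a compactly supported element of
  Thompson's group, up to the flips that the labelling prescribes, have this property, since the
  compactly supported elements form a perfect group and displace their supports. The group is generated
  by finitely many such maps with support in the middle halves of the cells, or in half cells on which
  the two labels are prescribed. Any two of these commute or have a product of the same kind. Hence
  the fixed subtrees intersect pairwise, and by Helly's theorem they have a common vertex.

  Property (T). The jump of the binary logarithm of the derivative is a cocycle. Its values are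
  functions with bounded values and supports of bounded density, on which the limit of the averaged
  inner products over \<open>[-N, N]\<close> is an inner product that is invariant under homeomorphisms of bounded
  displacement. The jumps of the powers \<open>\<zeta>\<^sub>1\<^sup>m\<close> at the fixed points \<open>n + 1/4\<close> grow linearly in
  \<open>m\<close>, so the affine isometric action given by the cocycle has an unbounded orbit.\<close>

section \<open>Automorphisms of trees\<close>

text \<open>Two things stand in the way of property (FA). A product of a map in the cells [n, n + 1]
  with a map in the shifted cells respects neither cell structure. What reconciles the two families
  is the half cell, which is half of one cell of either family: a commutator of a map living in one
  half of all cells with a map living in one half of all shifted cells is supported in the half
  cells with a prescribed position in both. Such maps belong to both families at once, so that a
  product of noncommuting generators stays within one family. Moreover, the support of
  \<open>\<nu>1\<close> reaches the ends of the cells and cannot be displaced there. But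
  \<open>\<nu>1\<close> is invariant under the flip, and its ends in adjacent cells form a map with
  compact support in the shifted cell between them. Inversions of edges need no barycentric
  subdivision: the parity of the displacement is a homomorphism to the group of order two and dies
  on commutators. For property (T) the averaged form is only semidefinite; its completion is
  realized by linear forms, so that it has the type in \<open>has_property_T\<close>.\<close>

locale tree_metric =
  fixes T :: "'x set" and d :: "'x \<Rightarrow> 'x \<Rightarrow> int"
  assumes d_nonneg: "\<lbrakk>x \<in> T; y \<in> T\<rbrakk> \<Longrightarrow> d x y \<ge> 0"
    and d_zero: "\<lbrakk>x \<in> T; y \<in> T\<rbrakk> \<Longrightarrow> d x y = 0 \<longleftrightarrow> x = y"
    and d_sym: "\<lbrakk>x \<in> T; y \<in> T\<rbrakk> \<Longrightarrow> d x y = d y x"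
    and four_point: "\<lbrakk>x \<in> T; y \<in> T; z \<in> T; w \<in> T\<rbrakk> \<Longrightarrow>
      d x y + d z w \<le> max (d x z + d y w) (d x w + d y z)"
    and d_parity: "\<lbrakk>x \<in> T; y \<in> T; z \<in> T\<rbrakk> \<Longrightarrow> even (d x y + d y z + d x z)"
    and d_geodesic: "\<lbrakk>x \<in> T; y \<in> T; 0 \<le> k; k \<le> d x y\<rbrakk> \<Longrightarrow>
      \<exists>z\<in>T. d x z = k \<and> d z y = d x y - k"
begin

lemma d_self [simp]: "x \<in> T \<Longrightarrow> d x x = 0"
  by (simp add: d_zero)

lemma d_triangle: "\<lbrakk>x \<in> T; y \<in> T; z \<in> T\<rbrakk> \<Longrightarrow> d x y \<le> d x z + d z y"
  using four_point[of x y z z] d_sym[of y z] by simp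

text \<open>For two points in the same position on a geodesic from x to y, the four-point inequality
  reads \<open>d x y + d z z' \<le> d x y\<close>.\<close>

lemma geodesic_unique:
  assumes "x \<in> T" "y \<in> T" "z \<in> T" "z' \<in> T"
    and "d x z = d x z'" "d z y = d z' y" "d x z + d z y = d x y"
  shows "z = z'"
proof -
  have "d x y + d z z' \<le> d x y"
    using four_point[of x y z z'] d_sym[of y z] d_sym[of y z'] assms by simp
  then show ?thesis
    using assms d_nonneg[of z z'] d_zero[of z z'] by simp
qed

lemma midpoint_unique:
  assumes "x \<in> T" "y \<in> T" "z \<in> T" "z' \<in> T"
    and "2 * d x z = d x y" "2 * d z y = d x y" "2 * d x z' = d x y" "2 * d z' y = d x y"
  shows "z = z'"
  by (rule geodesic_unique[of x y]) (use assms in auto)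

lemma midpoint_exists:
  assumes "x \<in> T" "y \<in> T" "even (d x y)"
  obtains z where "z \<in> T" "2 * d x z = d x y" "2 * d z y = d x y"
proof -
  obtain k where "d x y = 2 * k" using assms(3) by blast
  then show ?thesis
    using d_geodesic[of x y k] that assms d_nonneg[of x y] by auto
qed

text \<open>The median sits on the geodesic from x to y at the Gromov product k of y and z seen from
  x. The parity axiom makes k an integer, and the four-point inequality gives the distance to
  z.\<close>

lemma median_exists:
  assumes "x \<in> T" "y \<in> T" "z \<in> T"
  obtains m where "m \<in> T" "d x m + d m y = d x y" "d x m + d m z = d x z" "d y m + d m z = d y z"
proof -
  have "even (d x y + d x z - d y z)"
    using d_parity[OF assms] by auto
  then obtain k where k: "d x y + d x z - d y z = 2 * k" by blast
  have "0 \<le> k" "k \<le> d x y"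
    using k d_triangle[of y z x] d_triangle[of x z y] d_sym[of x y] assms by auto
  then obtain m where m: "m \<in> T" "d x m = k" "d m y = d x y - k"
    using d_geodesic[of x y k] assms by blast
  have "d x y + d m z \<le> max (d x m + d y z) (d x z + d y m)"
    using four_point[of x y m z] assms m by blast
  then have le: "d m z \<le> d x z - k"
    using k m d_sym[of y m] assms by auto
  have "d x z \<le> d x m + d m z" using d_triangle[of x z m] assms m by blast
  then have "d m z = d x z - k" using le m by simp
  then show ?thesis
    using that[of m] m k d_sym[of y m] assms by simp
qed

section \<open>Convex sets and Helly's theorem\<close>

definition convex_set :: "'x set \<Rightarrow> bool" where
  "convex_set C \<longleftrightarrow> C \<subseteq> T \<and>
     (\<forall>x\<in>C. \<forall>y\<in>C. \<forall>z\<in>T. d x z + d z y = d x y \<longrightarrow> z \<in> C)"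

lemma convex_set_mem: "\<lbrakk>convex_set C; x \<in> C\<rbrakk> \<Longrightarrow> x \<in> T"
  unfolding convex_set_def by blast

lemma convex_set_between:
  "\<lbrakk>convex_set C; x \<in> C; y \<in> C; z \<in> T; d x z + d z y = d x y\<rbrakk> \<Longrightarrow> z \<in> C"
  unfolding convex_set_def by blast

lemma convex_set_Int: "\<lbrakk>convex_set C; convex_set D\<rbrakk> \<Longrightarrow> convex_set (C \<inter> D)"
  unfolding convex_set_def by blast

text \<open>The median of three points chosen in the pairwise intersections lies between any two of
  them, hence in all three sets.\<close>

lemma helly3:
  assumes "convex_set C" "convex_set D" "convex_set E"
    and "C \<inter> D \<noteq> {}" "C \<inter> E \<noteq> {}" "D \<inter> E \<noteq> {}"
  shows "C \<inter> D \<inter> E \<noteq> {}"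
proof -
  obtain x y z where xyz: "x \<in> C" "x \<in> D" "y \<in> C" "y \<in> E" "z \<in> D" "z \<in> E"
    using assms by blast
  then have T: "x \<in> T" "y \<in> T" "z \<in> T"
    using assms(1-3) convex_set_mem by blast+
  obtain m where m: "m \<in> T" "d x m + d m y = d x y" "d x m + d m z = d x z" "d y m + d m z = d y z"
    using median_exists T by blast
  have "m \<in> C" "m \<in> D" "m \<in> E"
    using convex_set_between[OF assms(1) xyz(1,3) m(1,2)]
      convex_set_between[OF assms(2) xyz(2,5) m(1,3)]
      convex_set_between[OF assms(3) xyz(4,6) m(1,4)] .
  then show ?thesis by blast
qed

text \<open>Replacing every remaining set by its intersection with \<open>C i\<close> keeps the
  hypotheses, by the case of three sets.\<close>

lemma helly:
  assumes "finite I" "I \<noteq> {}" "\<And>i. i \<in> I \<Longrightarrow> convex_set (C i)"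
    and "\<And>i j. \<lbrakk>i \<in> I; j \<in> I\<rbrakk> \<Longrightarrow> C i \<inter> C j \<noteq> {}"
  shows "(\<Inter>i\<in>I. C i) \<noteq> {}"
  using assms
proof (induction I arbitrary: C rule: finite_ne_induct)
  case (singleton i)
  then show ?case by auto
next
  case (insert i I)
  have "(\<Inter>j\<in>I. C i \<inter> C j) \<noteq> {}"
  proof (rule insert.IH)
    show "convex_set (C i \<inter> C j)" if "j \<in> I" for j
      using insert.prems(1)[of i] insert.prems(1)[of j] that convex_set_Int by blast
    show "C i \<inter> C j \<inter> (C i \<inter> C k) \<noteq> {}" if "j \<in> I" "k \<in> I" for j k
      using helly3[of "C i" "C j" "C k"] insert.prems that by blast
  qed
  then obtain x where "x \<in> (\<Inter>j\<in>I. C i \<inter> C j)" by blast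
  then have "x \<in> (\<Inter>j\<in>insert i I. C j)" using insert.hyps(2) by blast
  then show ?case by blast
qed

section \<open>Fixed points, axes and Busemann functions of isometries\<close>

definition isom :: "('x \<Rightarrow> 'x) \<Rightarrow> bool" where
  "isom g \<longleftrightarrow> g \<in> T \<rightarrow> T \<and> (\<forall>x\<in>T. \<forall>y\<in>T. d (g x) (g y) = d x y)"

lemma isom_in: "\<lbrakk>isom g; x \<in> T\<rbrakk> \<Longrightarrow> g x \<in> T"
  and isom_d: "\<lbrakk>isom g; x \<in> T; y \<in> T\<rbrakk> \<Longrightarrow> d (g x) (g y) = d x y"
  by (auto simp: isom_def)

lemma isom_inj: "\<lbrakk>isom g; x \<in> T; y \<in> T; g x = g y\<rbrakk> \<Longrightarrow> x = y"
  by (metis d_zero isom_def)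

lemma isom_funpow: "isom g \<Longrightarrow> isom (g ^^ n)"
  by (induction n) (auto simp: isom_def Pi_iff)

lemma convex_fixed:
  assumes "isom g"
  shows "convex_set {x \<in> T. g x = x}"
  unfolding convex_set_def
proof safe
  fix x y z assume *: "x \<in> T" "y \<in> T" "z \<in> T" "d x z + d z y = d x y" "g x = x" "g y = y"
  have "d x (g z) = d x z" "d (g z) y = d z y"
    using isom_d[OF assms, of x z] isom_d[OF assms, of z y] * by auto
  then show "g z = z"
    using geodesic_unique[of x y "g z" z] * isom_in[OF assms] by auto
qed

text \<open>Seen from the fixed point p, the points z and g z are equally far away, so the parity
  axiom decides. This is what provides midpoints of displaced pairs.\<close>

lemma fixed_even:
  assumes "isom g" "p \<in> T" "g p = p" "z \<in> T"
  shows "even (d z (g z))"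
proof -
  have "d (g z) p = d z p"
    using isom_d[OF assms(1), of z p] assms by simp
  then show ?thesis
    using d_parity[of z "g z" p] assms isom_in[of g z] by auto
qed

text \<open>As z and g z are equidistant from p, the midpoint w lies on the geodesics from p to both
  of them. Since g fixes p and carries one geodesic onto the other, it keeps w, which is determined
  by its distance from p.\<close>

lemma midpoint_fixed:
  assumes g: "isom g" and p: "p \<in> T" "g p = p" and z: "z \<in> T" and w: "w \<in> T"
    and "2 * d z w = d z (g z)" "2 * d w (g z) = d z (g z)"
  shows "g w = w"
proof -
  have gz: "g z \<in> T" and gw: "g w \<in> T" using g z w isom_in by auto
  have gzp: "d (g z) p = d z p"
    using isom_d[OF g, of z p] assms by simp
  have "d z (g z) + d p w \<le> max (d z p + d (g z) w) (d z w + d (g z) p)"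
    using four_point[of z "g z" p w] z gz p w by blast
  then have 1: "d p w + d w z \<le> d p z"
    using assms(6,7) gzp d_sym[of w "g z"] d_sym[of z w] d_sym[of z p] z gz p w by auto
  have 2: "d p z \<le> d p w + d w z" using d_triangle z p w by blast
  have e: "d p w + d w (g z) = d p (g z)"
    using 1 2 assms(6,7) gzp d_sym[of w z] d_sym[of "g z" p] d_sym[of z p] z gz p w by auto
  have "d p (g w) = d p w" "d (g w) (g z) = d w z"
    using isom_d[OF g, of p w] isom_d[OF g, of w z] assms by auto
  moreover have "d w z = d w (g z)" using assms(6,7) d_sym[of z w] z w by auto
  ultimately show ?thesis
    using geodesic_unique[of p "g z" w "g w"] e p gz w gw by auto
qed

text \<open>Serre's lemma. As g brings h z back to z, the midpoint of z and h z halves a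
  displacement of both maps and is therefore fixed by both.\<close>

lemma common_fixed_of_product:
  assumes g: "isom g" "p \<in> T" "g p = p" and h: "isom h" "q \<in> T" "h q = q"
    and gh: "z \<in> T" "g (h z) = z"
  shows "\<exists>x\<in>T. g x = x \<and> h x = x"
proof -
  have hz: "h z \<in> T" using h gh isom_in by auto
  obtain w where w: "w \<in> T" "2 * d z w = d z (h z)" "2 * d w (h z) = d z (h z)"
    using midpoint_exists[of z "h z"] fixed_even[OF h] gh hz by blast
  have "h w = w" using midpoint_fixed[OF h gh(1) w] .
  moreover have "g w = w"
  proof (rule midpoint_fixed[OF g hz w(1)])
    show "2 * d (h z) w = d (h z) (g (h z))" "2 * d w (g (h z)) = d (h z) (g (h z))"
      using w gh hz d_sym[of z w] d_sym[of "h z" w] d_sym[of "h z" z] by auto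
  qed
  ultimately show ?thesis using w by blast
qed

text \<open>Commutation makes h p another fixed point of g. The midpoint of p and h p is fixed by g
  because midpoints are unique, and by h because it halves a displacement of h.\<close>

lemma common_fixed_of_commute:
  assumes g: "isom g" "p \<in> T" "g p = p" and h: "isom h" "q \<in> T" "h q = q"
    and comm: "\<And>x. x \<in> T \<Longrightarrow> g (h x) = h (g x)"
  shows "\<exists>x\<in>T. g x = x \<and> h x = x"
proof -
  have hp: "h p \<in> T" using h g isom_in by auto
  have ghp: "g (h p) = h p" using comm g by simp
  obtain w where w: "w \<in> T" "2 * d p w = d p (h p)" "2 * d w (h p) = d p (h p)"
    using midpoint_exists[of p "h p"] fixed_even[OF h] g hp by blast
  have "h w = w" using midpoint_fixed[OF h g(2) w] .
  moreover have "d p (g w) = d p w" "d (g w) (h p) = d w (h p)"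
    using isom_d[OF g(1), of p w] isom_d[OF g(1), of w "h p"] g ghp w hp by auto
  then have "g w = w"
    using midpoint_unique[of p "h p" w "g w"] w hp g isom_in[of g w] by auto
  ultimately show ?thesis using w by blast
qed

text \<open>The axis passes through any point of least displacement l. Evenness excludes l = 1, the
  case of an inverted edge, and so leaves room for a shortcut argument.\<close>

lemma translation_axis:
  assumes g: "isom g" and T: "T \<noteq> {}" and nofix: "\<And>x. x \<in> T \<Longrightarrow> g x \<noteq> x"
    and ev: "\<And>x. x \<in> T \<Longrightarrow> even (d x (g x))"
  obtains x l where "x \<in> T" "l > 0" "\<And>n. d x ((g ^^ n) x) = int n * l"
proof -
  define l where "l = int (LEAST k. \<exists>x\<in>T. nat (d x (g x)) = k)"
  have ex: "\<exists>k. \<exists>x\<in>T. nat (d x (g x)) = k" using T by auto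
  obtain x where x: "x \<in> T" "d x (g x) = l"
    using LeastI_ex[OF ex] d_nonneg isom_in[OF g] unfolding l_def
    by (metis (no_types, lifting) nat_0_le)
  have min: "l \<le> d y (g y)" if "y \<in> T" for y
  proof -
    have "(LEAST k. \<exists>x\<in>T. nat (d x (g x)) = k) \<le> nat (d y (g y))"
      by (rule Least_le) (use that in blast)
    then show ?thesis using d_nonneg[of y "g y"] that isom_in[OF g] unfolding l_def by auto
  qed
  have gx: "g x \<in> T" and ggx: "g (g x) \<in> T" using x isom_in[OF g] by auto
  have "l \<noteq> 0" using d_zero[of x "g x"] nofix[OF x(1)] x gx by auto
  moreover have "l \<ge> 0" "even l" using ev[OF x(1)] d_nonneg[of x "g x"] x gx by auto
  ultimately have l2: "l \<ge> 2" by presburger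
  have gg: "d (g x) (g (g x)) = l" using isom_d[OF g] x gx by simp
  \<comment> \<open>Backtracking at g x would yield a point of smaller displacement.\<close>
  have two: "d x (g (g x)) = 2 * l"
  proof (rule ccontr)
    assume ne: "d x (g (g x)) \<noteq> 2 * l"
    obtain m where m: "m \<in> T" "d (g x) m + d m x = d (g x) x"
      "d (g x) m + d m (g (g x)) = d (g x) (g (g x))" "d x m + d m (g (g x)) = d x (g (g x))"
      using median_exists[of "g x" x "g (g x)"] x gx ggx by blast
    have mpos: "d (g x) m \<ge> 1"
      using m ne x gg gx ggx d_sym[of x "g x"] d_sym[of x m] d_nonneg[of "g x" m] by auto
    \<comment> \<open>The point y is the first step from x towards g x, and u below is the last one.
      Both u and g y are the neighbour of g x in the direction of m, so they agree, and y has
      displacement at most l - 2.\<close>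
    obtain y where y: "y \<in> T" "d x y = 1" "d y (g x) = l - 1"
      using d_geodesic[of x "g x" 1] x gx l2 by auto
    have gy: "g y \<in> T" "d (g x) (g y) = 1" "d (g y) (g (g x)) = l - 1"
      using isom_d[OF g] isom_in[OF g] x y gx by auto
    obtain u where u: "u \<in> T" "d (g x) u = 1" "d u x = l - 1"
      using d_geodesic[of "g x" x 1] x gx l2 d_sym[of x "g x"] by auto
    have "d u m \<le> d (g x) m - 1" "d (g y) m \<le> d (g x) m - 1"
    proof -
      have "d (g x) x + d u m \<le> max (d (g x) u + d x m) (d (g x) m + d x u)"
        using four_point[of "g x" x u m] gx x u m by blast
      then show "d u m \<le> d (g x) m - 1"
        using m u d_sym[of x m] d_sym[of x u] x d_sym[of "g x" x] gx mpos
          d_triangle[of "g x" x m] by auto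
      have "d (g x) (g (g x)) + d (g y) m \<le> max (d (g x) (g y) + d (g (g x)) m) (d (g x) m + d (g (g x)) (g y))"
        using four_point[of "g x" "g (g x)" "g y" m] gx ggx gy m by blast
      then show "d (g y) m \<le> d (g x) m - 1"
        using m gy d_sym[of "g (g x)" m] d_sym[of "g (g x)" "g y"] ggx mpos gg by auto
    qed
    then have "u = g y"
      using geodesic_unique[of "g x" m u "g y"] gx m gy u
        d_triangle[of "g x" m u] d_triangle[of "g x" m "g y"] by auto
    then have "d y (g y) \<le> l - 2"
    proof -
      assume e: "u = g y"
      have "d x (g x) + d y (g y) \<le> max (d x y + d (g x) (g y)) (d x (g y) + d (g x) y)"
        using four_point[of x "g x" y "g y"] x gx y gy by blast
      then show "d y (g y) \<le> l - 2"
        using e u y gy x d_sym[of x "g y"] d_sym[of "g x" y] gx l2 by auto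
    qed
    then show False using min[OF y(1)] by simp
  qed
  \<comment> \<open>Two consecutive steps are geodesic, and successive pairs overlap in a segment of
    positive length l. The four-point inequality therefore prolongs the geodesic by one step at a
    time.\<close>
  have "d x ((g ^^ n) x) = int n * l \<and> d x ((g ^^ Suc n) x) = int (Suc n) * l" for n
  proof (induction n)
    case 0
    then show ?case using x by simp
  next
    case (Suc n)
    let ?p = "\<lambda>k. (g ^^ k) x"
    have P: "?p k \<in> T" for k using isom_in[OF isom_funpow[OF g]] x by blast
    have s: "d (?p n) (?p (Suc n)) = l"
    proof -
      have "d (?p n) (?p (Suc n)) = d ((g^^n) x) ((g^^n) (g x))"
        by (metis comp_apply funpow_Suc_right)
      then show ?thesis using isom_d[OF isom_funpow[OF g]] x gx by simp
    qed
    have s': "d (?p (Suc n)) (?p (Suc (Suc n))) = l"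
      using isom_d[OF g P[of n] P[of "Suc n"]] s by simp
    have s2: "d (?p n) (?p (Suc (Suc n))) = 2 * l"
    proof -
      have "?p (Suc (Suc n)) = (g^^n) (g (g x))"
        by (metis comp_apply funpow_Suc_right)
      then show ?thesis using isom_d[OF isom_funpow[OF g], of x "g (g x)" n] x ggx two by simp
    qed
    have "d x (?p (Suc n)) + d (?p n) (?p (Suc (Suc n)))
       \<le> max (d x (?p n) + d (?p (Suc n)) (?p (Suc (Suc n)))) (d x (?p (Suc (Suc n))) + d (?p (Suc n)) (?p n))"
      using four_point[of x "?p (Suc n)" "?p n" "?p (Suc (Suc n))"] P x by blast
    moreover have "d x (?p (Suc (Suc n))) \<le> d x (?p (Suc n)) + d (?p (Suc n)) (?p (Suc (Suc n)))"
      by (rule d_triangle[OF x(1) P P])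
    moreover have "d (?p (Suc n)) (?p n) = d (?p n) (?p (Suc n))" by (rule d_sym[OF P P])
    moreover have "d x (?p (Suc n)) = int n * l + l" "d x (?p n) = int n * l"
      using Suc by (auto simp: algebra_simps)
    ultimately have "d x (?p (Suc (Suc n))) = int n * l + 2 * l"
      using s s' s2 l2 unfolding le_max_iff_disj by linarith
    then have "d x (?p (Suc (Suc n))) = int (Suc (Suc n)) * l" by (simp add: algebra_simps)
    then show ?case using Suc by blast
  qed
  then show ?thesis using that[of x l] x l2 by auto
qed


text \<open>One step along the orbit adds at most l to the distance from y, so the integers do not
  increase. The triangle inequality bounds them below by \<open>- d x y\<close>, hence they are
  eventually constant.\<close>

lemma busemann_limit:
  assumes "isom m" "x \<in> T" "y \<in> T" and ax: "\<And>n. d x ((m ^^ n) x) = int n * l" and step: "d x (m x) = l"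
  shows "\<exists>b N. \<forall>n\<ge>N. d y ((m ^^ n) x) - int n * l = b"
proof -
  define a where "a n = d y ((m ^^ n) x) - int n * l" for n
  have P: "(m ^^ n) x \<in> T" for n using isom_in[OF isom_funpow[OF assms(1)]] assms by blast
  have mx: "m x \<in> T" using assms isom_in by blast
  have dec: "a (Suc n) \<le> a n" for n
  proof -
    have "d ((m ^^ n) x) ((m ^^ Suc n) x) = l"
      using isom_d[OF isom_funpow[OF assms(1)], of x "m x" n] assms mx
      by (simp add: funpow_swap1)
    then show ?thesis
      using d_triangle[OF assms(3) P[of "Suc n"] P[of n]]
      unfolding a_def by (simp add: algebra_simps)
  qed
  have low: "a n \<ge> - d x y" for n
    using d_triangle[of x "(m ^^ n) x" y] P[of n] assms ax[of n] unfolding a_def by simp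
  have ex: "\<exists>k. \<exists>n. nat (a n + d x y) = k" by blast
  define k where "k = (LEAST k. \<exists>n. nat (a n + d x y) = k)"
  obtain N where N: "nat (a N + d x y) = k"
    using LeastI_ex[OF ex] unfolding k_def by blast
  have "a n = a N" if "n \<ge> N" for n
  proof -
    have "k \<le> nat (a n + d x y)" unfolding k_def by (rule Least_le) blast
    moreover have "a n \<le> a N"
      using that dec by (induction rule: dec_induct) (auto intro: order_trans)
    ultimately show ?thesis using N low[of n] low[of N] by linarith
  qed
  then show ?thesis unfolding a_def by blast
qed

text \<open>Two geodesic rays to the same end of the tree have Busemann functions that differ by a
  constant; hence the isometries commuting with a translation act on its axis by translations, and
  the translation distance is additive.\<close>

lemma busemann_additive:
  assumes m: "isom m" and x: "x \<in> T" and l: "l > 0"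
    and ax: "\<And>n. d x ((m ^^ n) x) = int n * l"
  obtains b :: "'x \<Rightarrow> int" where
    "\<And>y. y \<in> T \<Longrightarrow> \<exists>N. \<forall>n\<ge>N. d y ((m ^^ n) x) - int n * l = b y"
    "\<And>k y. \<lbrakk>isom k; \<And>z. z \<in> T \<Longrightarrow> k (m z) = m (k z); y \<in> T\<rbrakk> \<Longrightarrow> b (k y) - b y = b (k x) - b x"
proof -
  have step: "d x (m x) = l" using ax[of 1] by simp
  define b where "b y = (SOME b. \<exists>N. \<forall>n\<ge>N. d y ((m ^^ n) x) - int n * l = b)" for y
  have b: "\<exists>N. \<forall>n\<ge>N. d y ((m ^^ n) x) - int n * l = b y" if "y \<in> T" for y
    unfolding b_def by (rule someI_ex) (rule busemann_limit[OF m x that ax step])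
  have P: "(m ^^ n) x \<in> T" for n using isom_in[OF isom_funpow[OF m]] x by blast
  have "b (k y) - b y = b (k x) - b x"
    if k: "isom k" and comm: "\<And>z. z \<in> T \<Longrightarrow> k (m z) = m (k z)" and y: "y \<in> T" for k y
  proof -
    have kx: "k x \<in> T" and ky: "k y \<in> T" using k x y isom_in by auto
    have kp: "k ((m ^^ n) x) = (m ^^ n) (k x)" for n
      by (induction n) (use comm P in auto)
    obtain N1 N2 N3 N4 where N:
      "\<forall>n\<ge>N1. d x ((m ^^ n) x) - int n * l = b x"
      "\<forall>n\<ge>N2. d y ((m ^^ n) x) - int n * l = b y"
      "\<forall>n\<ge>N3. d (k x) ((m ^^ n) x) - int n * l = b (k x)"
      "\<forall>n\<ge>N4. d (k y) ((m ^^ n) x) - int n * l = b (k y)"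
      using b x y kx ky by metis
    \<comment> \<open>Bounds all the distances that stay finite along the ray, so that beyond it the
      four-point inequality must take its unbounded alternative.\<close>
    define C where "C = d x y + d x (k x) + d x (k x) + d x (k y)"
    define n where "n = N1 + N2 + N3 + N4 + nat (C + 1)"
    define z where "z = (m ^^ n) x"
    have z: "z \<in> T" and kz: "k z \<in> T" using P k isom_in z_def by auto
    have "C \<ge> 0" unfolding C_def using d_nonneg x y kx ky by (simp add: add_nonneg_nonneg)
    then have "int n \<ge> C + 1" unfolding n_def by simp
    moreover have "int n * l \<ge> int n * 1" using l by (intro mult_left_mono) auto
    ultimately have big: "int n * l > C" by linarith
    have dz: "d x z = int n * l" using ax z_def by simp
    have e1: "d (k y) (k z) = d y z" "d (k x) (k z) = d x z" "d (k y) (k x) = d y x"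
      using isom_d[OF k] x y z by auto
    have e2: "d z (k z) = d x (k x)"
      using isom_d[OF isom_funpow[OF m], of x "k x" n] x kx kp[of n] unfolding z_def by simp
    have f1: "d (k y) z + d (k x) (k z) \<le> max (d (k y) (k x) + d z (k z)) (d (k y) (k z) + d z (k x))"
      using four_point[of "k y" z "k x" "k z"] kx ky z kz by blast
    have f2: "d (k y) (k z) + d (k x) z \<le> max (d (k y) (k x) + d (k z) z) (d (k y) z + d (k z) (k x))"
      using four_point[of "k y" "k z" "k x" z] kx ky z kz by blast
    have t1: "d x z \<le> d x (k y) + d (k y) z" using d_triangle x z ky by blast
    have t2: "d x z \<le> d x (k x) + d (k x) z" using d_triangle x z kx by blast
    have nn: "d (k x) (k z) \<ge> 0" "d (k y) (k z) \<ge> 0" "d x (k y) \<ge> 0" "d x (k x) \<ge> 0" "d x y \<ge> 0"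
      using d_nonneg x y kx ky kz by auto
    have s: "d y x = d x y" "d (k z) z = d z (k z)" "d (k z) (k x) = d (k x) (k z)" "d z (k x) = d (k x) z"
      using d_sym x y z kz kx by auto
    have "d (k y) z + d (k x) (k z) = d (k y) (k z) + d (k x) z"
      using f1 f2 e1 e2 t1 t2 big dz nn s unfolding C_def by linarith
    then have "d (k y) z + d x z = d y z + d (k x) z" using e1 by simp
    moreover have "d x z = b x + int n * l" "d y z = b y + int n * l"
      "d (k x) z = b (k x) + int n * l" "d (k y) z = b (k y) + int n * l"
      using N unfolding z_def n_def by (auto simp: algebra_simps)
    ultimately show ?thesis by linarith
  qed
  then show ?thesis using that[of b] b by blast
qed

text \<open>If k x has the Busemann value 0 of x, then far out both p and q = k p are midpoints of x
  and a later orbit point r. Midpoints are unique, so p = q, and injectivity of the powers of m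
  brings this equality back to x.\<close>

lemma busemann_fixed:
  assumes m: "isom m" and x: "x \<in> T" and l: "l > 0"
    and ax: "\<And>n. d x ((m ^^ n) x) = int n * l"
    and k: "isom k" and comm: "\<And>z. z \<in> T \<Longrightarrow> k (m z) = m (k z)"
    and b: "\<exists>N. \<forall>n\<ge>N. d (k x) ((m ^^ n) x) - int n * l = 0"
  shows "k x = x"
proof -
  have P: "(m ^^ n) y \<in> T" if "y \<in> T" for n y using isom_in[OF isom_funpow[OF m]] that by blast
  have kx: "k x \<in> T" using k x isom_in by auto
  have kp: "k ((m ^^ n) x) = (m ^^ n) (k x)" for n
    by (induction n) (use comm P x in auto)
  obtain N where N: "\<forall>n\<ge>N. d (k x) ((m ^^ n) x) = int n * l" using b by auto
  define D where "D = d x (k x)"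
  have D0: "D \<ge> 0" using d_nonneg x kx D_def by auto
  define n where "n = N + nat (D + 1)"
  define p q where "p = (m ^^ n) x" and "q = (m ^^ n) (k x)"
  have pq: "p \<in> T" "q \<in> T" using P x kx p_def q_def by auto
  have "int n * l \<ge> int n * 1" using l by (intro mult_left_mono) auto
  moreover have "int n > D" using D0 unfolding n_def by simp
  ultimately have big: "int n * l > D" by linarith
  have dist: "d x p = int n * l" "d (k x) p = int n * l" "d (k x) q = int n * l" "d p q = D"
    using ax N isom_d[OF isom_funpow[OF m], of x "k x" n] x kx isom_d[OF k, of x p] pq kp[of n]
    unfolding p_def q_def n_def D_def by auto
  have "d x p + d (k x) q \<le> max (d x (k x) + d p q) (d x q + d p (k x))"
    using four_point[of x p "k x" q] x kx pq by blast
  then have g1: "d x q \<ge> int n * l"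
    using dist big D_def d_sym[OF pq(1) kx] unfolding le_max_iff_disj by linarith
  have "d x q + d (k x) p \<le> max (d x (k x) + d q p) (d x p + d q (k x))"
    using four_point[of x q "k x" p] x kx pq by blast
  then have g2: "d x q \<le> int n * l"
    using dist big D_def d_sym[OF pq(2) kx] d_sym[OF pq(2,1)] unfolding le_max_iff_disj by linarith
  define r where "r = (m ^^ n) p"
  have r: "r \<in> T" using P pq r_def by auto
  have "d p r = int n * l" "d q r = int n * l"
    using isom_d[OF isom_funpow[OF m], of x p n] isom_d[OF isom_funpow[OF m], of "k x" p n]
      dist x kx pq unfolding r_def p_def q_def by auto
  moreover have "d x r = 2 * (int n * l)"
    using ax[of "n + n"] unfolding r_def p_def by (simp add: funpow_add algebra_simps)
  ultimately have "p = q"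
    using midpoint_unique[of x r p q] x r pq dist g1 g2 by auto
  then show ?thesis
    using isom_inj[OF isom_funpow[OF m] kx x, of n] unfolding p_def q_def by auto
qed

end

section \<open>Groups acting by isometries\<close>

locale tree_group_action = tree_metric T d + group G
  for T :: "'x set" and d :: "'x \<Rightarrow> 'x \<Rightarrow> int" and G :: "('g, 'm) monoid_scheme" (structure) +
  fixes act :: "'g \<Rightarrow> 'x \<Rightarrow> 'x"
  assumes T_nonempty: "T \<noteq> {}"
    and act_isom: "g \<in> carrier G \<Longrightarrow> isom (act g)"
    and act_mult: "\<lbrakk>g \<in> carrier G; h \<in> carrier G; x \<in> T\<rbrakk> \<Longrightarrow> act (g \<otimes> h) x = act g (act h x)"
    and act_one: "x \<in> T \<Longrightarrow> act \<one> x = x"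
begin

definition elliptic :: "'g \<Rightarrow> bool" where
  "elliptic g \<longleftrightarrow> (\<exists>x\<in>T. act g x = x)"

lemma act_in: "\<lbrakk>g \<in> carrier G; x \<in> T\<rbrakk> \<Longrightarrow> act g x \<in> T"
  using act_isom isom_in by blast

lemma act_inv: "\<lbrakk>g \<in> carrier G; x \<in> T\<rbrakk> \<Longrightarrow> act (inv g) (act g x) = x"
  using act_mult[of "inv g" g x] act_one by simp

lemma elliptic_conj:
  assumes "g \<in> carrier G" "h \<in> carrier G" "elliptic (h \<otimes> g \<otimes> inv h)"
  shows "elliptic g"
proof -
  obtain x where x: "x \<in> T" "act (h \<otimes> g \<otimes> inv h) x = x" using assms elliptic_def by blast
  let ?y = "act (inv h) x"
  have y: "?y \<in> T" using act_in assms x by simp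
  have "act h (act g ?y) = x" using x assms act_mult act_in by simp
  then have "act g ?y = ?y" using act_inv[of h "act g ?y"] act_in[OF assms(1) y] assms by simp
  then show ?thesis using y elliptic_def by blast
qed

text \<open>The parity tells whether g preserves or exchanges the two classes of the bipartition of
  the tree.\<close>

lemma dist_parity:
  assumes "g \<in> carrier G" "x \<in> T" "y \<in> T"
  shows "even (d x (act g x)) = even (d y (act g y))"
proof -
  have gx: "act g x \<in> T" "act g y \<in> T" using assms act_in by auto
  have "even (d x y + d y (act g x) + d x (act g x))" "even (d y (act g x) + d (act g x) (act g y) + d y (act g y))"
    using d_parity assms gx by blast+
  moreover have "d (act g x) (act g y) = d x y" using isom_d act_isom assms by blast
  ultimately show ?thesis by presburger
qed

lemma dist_parity_mult:
  assumes "g \<in> carrier G" "h \<in> carrier G" "x \<in> T"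
  shows "even (d x (act (g \<otimes> h) x)) = (even (d x (act g x)) = even (d x (act h x)))"
proof -
  have m: "act h x \<in> T" "act g (act h x) \<in> T" using act_in assms by auto
  have "even (d x (act h x) + d (act h x) (act g (act h x)) + d x (act g (act h x)))"
    using d_parity assms m by blast
  then show ?thesis
    using dist_parity[OF assms(1) assms(3) m(1)] act_mult[OF assms] by (metis even_add)
qed

text \<open>The hypothesis \<open>perf\<close> expresses membership in the derived subgroup of K
  through all subgroups that contain its commutators. It is applied twice: to the elements of G with
  even displacement, which excludes that m has odd displacement, and to the kernel of the
  translation number of K along the axis of m.\<close>

theorem elliptic_if_conj_in_perfect_centralizer:
  assumes m: "m \<in> carrier G" and h: "h \<in> carrier G" and K: "subgroup K G"
    and comm: "\<And>k. k \<in> K \<Longrightarrow> k \<otimes> m = m \<otimes> k"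
    and k0: "h \<otimes> m \<otimes> inv h \<in> K"
    and perf: "\<And>N. \<lbrakk>subgroup N G; \<And>a b. \<lbrakk>a \<in> K; b \<in> K\<rbrakk> \<Longrightarrow> a \<otimes> b \<otimes> inv a \<otimes> inv b \<in> N\<rbrakk>
       \<Longrightarrow> h \<otimes> m \<otimes> inv h \<in> N"
  shows "elliptic m"
proof (rule ccontr)
  assume hyp: "\<not> elliptic m"
  have KG: "k \<in> carrier G" if "k \<in> K" for k using subgroup.mem_carrier[OF K that] .
  obtain x0 where x0: "x0 \<in> T" using T_nonempty by blast
  let ?k0 = "h \<otimes> m \<otimes> inv h"
  have invpar: "even (d x0 (act (inv g) x0)) = even (d x0 (act g x0))" if "g \<in> carrier G" for g
    using dist_parity_mult[of "inv g" g x0] that x0 act_one by auto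
  define N where "N = {g \<in> carrier G. even (d x0 (act g x0))}"
  have "subgroup N G"
    by (rule subgroupI) (auto simp: N_def dist_parity_mult x0 invpar act_one intro!: exI[of _ "\<one>"])
  moreover have "a \<otimes> b \<otimes> inv a \<otimes> inv b \<in> N" if "a \<in> K" "b \<in> K" for a b
    using KG[OF that(1)] KG[OF that(2)] x0 by (auto simp: N_def dist_parity_mult invpar)
  ultimately have "?k0 \<in> N" by (rule perf)
  then have "even (d x0 (act m x0))"
    using m h x0 by (auto simp: N_def dist_parity_mult invpar)
  then have ev: "even (d x (act m x))" if "x \<in> T" for x using dist_parity[OF m that x0] by simp
  have "\<And>x. x \<in> T \<Longrightarrow> act m x \<noteq> x" using hyp elliptic_def by blast
  then obtain x l where x: "x \<in> T" and l: "l > 0" and ax: "\<And>n. d x ((act m ^^ n) x) = int n * l"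
    using translation_axis[OF act_isom[OF m] T_nonempty _ ev] by metis
  obtain b where b: "\<And>y. y \<in> T \<Longrightarrow> \<exists>N. \<forall>n\<ge>N. d y ((act m ^^ n) x) - int n * l = b y"
    and add: "\<And>k y. \<lbrakk>isom k; \<And>z. z \<in> T \<Longrightarrow> k (act m z) = act m (k z); y \<in> T\<rbrakk>
       \<Longrightarrow> b (k y) - b y = b (k x) - b x"
    using busemann_additive[OF act_isom[OF m] x l ax] by metis
  have comm': "act k (act m z) = act m (act k z)" if "k \<in> K" "z \<in> T" for k z
    using act_mult[of k m z] act_mult[of m k z] comm[OF that(1)] KG[OF that(1)] m that by simp
  \<comment> \<open>The signed translation of k along the axis of m. It is additive because k
    changes the Busemann function by the same amount at every point.\<close>
  define \<tau> where "\<tau> k = b (act k x) - b x" for k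
  have tau: "\<tau> (a \<otimes> c) = \<tau> a + \<tau> c" if "a \<in> K" "c \<in> K" for a c
  proof -
    have "b (act a (act c x)) - b (act c x) = b (act a x) - b x"
      by (rule add) (use KG that act_isom comm' act_in x in auto)
    then show ?thesis unfolding \<tau>_def using act_mult[of a c x] KG that x by simp
  qed
  have tau1: "\<tau> \<one> = 0" unfolding \<tau>_def using act_one x by simp
  have taui: "\<tau> (inv a) = - \<tau> a" if "a \<in> K" for a
    using tau[of a "inv a"] subgroup.m_inv_closed[OF K that] KG[OF that] that tau1 by simp
  define N' where "N' = {k \<in> K. \<tau> k = 0}"
  have "subgroup N' G"
  proof (rule subgroupI)
    show "N' \<subseteq> carrier G" using KG N'_def by auto
    show "N' \<noteq> {}" using tau1 subgroup.one_closed[OF K] N'_def by blast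
  qed (use subgroup.m_inv_closed[OF K] subgroup.m_closed[OF K] tau taui in \<open>auto simp: N'_def\<close>)
  moreover have "a \<otimes> c \<otimes> inv a \<otimes> inv c \<in> N'" if "a \<in> K" "c \<in> K" for a c
    using subgroup.m_inv_closed[OF K] subgroup.m_closed[OF K] tau taui that by (auto simp: N'_def)
  ultimately have k0N: "?k0 \<in> N'" by (rule perf)
  \<comment> \<open>The base point is the origin of its own ray, so its Busemann value is the 0 that
    \<open>busemann_fixed\<close> asks for.\<close>
  have "\<exists>N. \<forall>n\<ge>N. d x ((act m ^^ n) x) - int n * l = b x" by (rule b[OF x])
  then have "b x = 0" using ax by auto
  then have "b (act ?k0 x) = 0" using k0N unfolding N'_def \<tau>_def by simp
  then have "\<exists>N. \<forall>n\<ge>N. d (act ?k0 x) ((act m ^^ n) x) - int n * l = 0"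
    using b[OF act_in[OF KG[OF k0] x]] by simp
  then have "act ?k0 x = x"
    using busemann_fixed[OF act_isom[OF m] x l ax act_isom[OF KG[OF k0]]] comm'[OF k0] by blast
  then have "elliptic ?k0" using x elliptic_def by blast
  then show False using elliptic_conj[OF m h] hyp by blast
qed

theorem common_fixed_point:
  assumes S: "finite S" "S \<subseteq> carrier G" and ell: "\<And>s. s \<in> S \<Longrightarrow> elliptic s"
    and pairs: "\<And>s t. \<lbrakk>s \<in> S; t \<in> S\<rbrakk> \<Longrightarrow> s \<otimes> t = t \<otimes> s \<or> elliptic (s \<otimes> t)"
  shows "\<exists>x\<in>T. \<forall>g\<in>generate G S. act g x = x"
proof -
  define C where "C s = {x \<in> T. act s x = x}" for s
  have "\<exists>x\<in>T. \<forall>s\<in>S. act s x = x"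
  proof (cases "S = {}")
    case True
    then show ?thesis using T_nonempty by auto
  next
    case False
    have "(\<Inter>s\<in>S. C s) \<noteq> {}"
    proof (rule helly[OF S(1) False])
      show "convex_set (C s)" if "s \<in> S" for s
        using convex_fixed[OF act_isom] that S unfolding C_def by blast
      show "C s \<inter> C t \<noteq> {}" if st: "s \<in> S" "t \<in> S" for s t
      proof -
        have G: "s \<in> carrier G" "t \<in> carrier G" using st S by auto
        obtain p q where pq: "p \<in> T" "act s p = p" "q \<in> T" "act t q = q"
          using ell[OF st(1)] ell[OF st(2)] unfolding elliptic_def by blast
        have "\<exists>x\<in>T. act s x = x \<and> act t x = x"
        proof (cases "s \<otimes> t = t \<otimes> s")
          case True
          show ?thesis
            by (rule common_fixed_of_commute[OF act_isom[OF G(1)] pq(1,2) act_isom[OF G(2)] pq(3,4)])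
               (use act_mult[OF G] act_mult[OF G(2,1)] True in metis)
        next
          case False
          then have "elliptic (s \<otimes> t)" using pairs[OF st] by blast
          then obtain z where "z \<in> T" "act (s \<otimes> t) z = z" unfolding elliptic_def by blast
          then show ?thesis
            using common_fixed_of_product[OF act_isom[OF G(1)] pq(1,2) act_isom[OF G(2)] pq(3,4), of z]
              act_mult[OF G] by auto
        qed
        then show ?thesis unfolding C_def by blast
      qed
    qed
    then show ?thesis using False unfolding C_def by blast
  qed
  then obtain x where x: "x \<in> T" "\<And>s. s \<in> S \<Longrightarrow> act s x = x" by blast
  have "act g x = x" if "g \<in> generate G S" for g
    using that
  proof induction
    case (inv h)
    then show ?case using act_inv[of h x] x S by auto
  next
    case (eng g h)
    then show ?case using act_mult x generate_in_carrier[OF S(2)] by simp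
  qed (use x act_one in auto)
  then show ?thesis using x by blast
qed

end

section \<open>Simplicial trees as integer metric spaces\<close>

lemma reduced_walk_not_closed:
  assumes tree: "simplicial_tree V E"
    and walk: "\<And>i. i < n \<Longrightarrow> {w i, w (Suc i)} \<in> E"
    and red: "\<And>i. i + 2 \<le> n \<Longrightarrow> w i \<noteq> w (i + 2)"
    and n: "n \<ge> 1"
  shows "w 0 \<noteq> w n"
proof
  assume closed: "w 0 = w n"
  have card2: "card e = 2" if "e \<in> E" for e using tree that unfolding simplicial_tree_def by blast
  \<comment> \<open>A shortest closed segment of the walk has distinct vertices. Two-element edges
    exclude length 1 and reducedness excludes length 2, so it would be a circuit.\<close>
  define P where "P k \<longleftrightarrow> k \<ge> 1 \<and> (\<exists>i. i + k \<le> n \<and> w i = w (i + k))" for k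
  have "P n" unfolding P_def using closed n by auto
  define k where "k = (LEAST k. P k)"
  have Pk: "P k" using LeastI[of P n] \<open>P n\<close> k_def by simp
  then obtain i where i: "i + k \<le> n" "w i = w (i + k)" unfolding P_def by blast
  have min: "\<not> P l" if "l < k" for l using not_less_Least that k_def by blast
  have "k \<noteq> 1" using card2[OF walk[of i]] i by (auto simp: P_def)
  moreover have "k \<noteq> 2" using red[of i] i by auto
  ultimately have k3: "k \<ge> 3" using Pk P_def by auto
  define p where "p = map w [i..<i + k]"
  have "distinct p"
  proof -
    have "inj_on w {i..<i + k}"
    proof (rule inj_onI)
      have "a = b" if "a \<in> {i..<i + k}" "b \<in> {i..<i + k}" "w a = w b" "a \<le> b" for a b
      proof (rule ccontr)
        assume "a \<noteq> b"
        then have "P (b - a)" unfolding P_def using that i by (auto intro!: exI[of _ a])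
        moreover have "b - a < k" using that unfolding atLeastLessThan_iff by linarith
        ultimately show False using min by blast
      qed
      then show "a = b" if "a \<in> {i..<i + k}" "b \<in> {i..<i + k}" "w a = w b" for a b
        using that by (metis nle_le)
    qed
    then show ?thesis unfolding p_def by (simp add: distinct_map)
  qed
  moreover have "length p \<ge> 3" using k3 p_def by simp
  moreover have "successively (\<lambda>x y. {x, y} \<in> E) p"
    unfolding successively_conv_nth p_def using walk i by auto
  moreover have "{last p, hd p} \<in> E"
  proof -
    have "last p = w (i + k - 1)" "hd p = w i"
      using k3 unfolding p_def by (auto simp: last_map hd_map)
    then show ?thesis using walk[of "i + k - 1"] i k3 by auto
  qed
  ultimately show False using tree unfolding simplicial_tree_def by blast
qed

locale rooted_tree =
  fixes V :: "'v set" and E :: "'v set set" and r :: 'v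
  assumes tree: "simplicial_tree V E" and root: "r \<in> V"
begin

definition R :: "('v \<times> 'v) set" where "R = {(x, y). {x, y} \<in> E}"

definition dep :: "'v \<Rightarrow> nat" where "dep x = (LEAST n. (r, x) \<in> R ^^ n)"

lemma edge_V: "{x, y} \<in> E \<Longrightarrow> x \<in> V \<and> y \<in> V"
  using tree unfolding simplicial_tree_def by blast

lemma dep_reach:
  assumes "x \<in> V"
  shows "(r, x) \<in> R ^^ dep x"
proof -
  have path: "(hd p, last p) \<in> R ^^ (length p - 1)"
    if "p \<noteq> []" "successively (\<lambda>x y. {x, y} \<in> E) p" for p
    using that
  proof (induction p)
    case (Cons a p)
    show ?case
    proof (cases p)
      case (Cons b q)
      then have "(a, b) \<in> R" "(b, last p) \<in> R ^^ (length p - 1)"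
        using Cons.prems Cons.IH unfolding R_def by auto
      then have "(a, last p) \<in> R ^^ Suc (length p - 1)" by (rule relpow_Suc_I2)
      then show ?thesis using Cons by simp
    qed simp
  qed simp
  obtain p where "p \<noteq> []" "hd p = r" "last p = x" "successively (\<lambda>x y. {x, y} \<in> E) p"
    using tree assms root unfolding simplicial_tree_def by blast
  then have "\<exists>n. (r, x) \<in> R ^^ n" using path by metis
  then show ?thesis unfolding dep_def by (rule LeastI_ex)
qed

lemma dep_le: "(r, x) \<in> R ^^ n \<Longrightarrow> dep x \<le> n"
  unfolding dep_def by (rule Least_le)

lemma dep_root: "dep r = 0"
  using dep_le[of r 0] by simp

lemma dep_0: "x \<in> V \<Longrightarrow> dep x = 0 \<Longrightarrow> x = r"
  using dep_reach[of x] by simp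

lemma dep_edge: "{x, y} \<in> E \<Longrightarrow> dep y \<le> Suc (dep x)"
  using dep_le[of y "Suc (dep x)"] dep_reach[of x] edge_V[of x y] unfolding R_def by auto

lemma descending_path:
  assumes "x \<in> V"
  obtains a where "a 0 = r" "a (dep x) = x" "\<And>i. i < dep x \<Longrightarrow> {a i, a (Suc i)} \<in> E"
    "\<And>i. i \<le> dep x \<Longrightarrow> dep (a i) = i"
proof -
  obtain a where a: "a 0 = r" "a (dep x) = x" "\<And>i. i < dep x \<Longrightarrow> {a i, a (Suc i)} \<in> E"
    using dep_reach[OF assms] unfolding relpow_fun_conv R_def by auto
  have up: "dep (a (i + j)) \<le> dep (a i) + j" if "i + j \<le> dep x" for i j
    using that
  proof (induction j)
    case (Suc j)
    then show ?case using dep_edge[OF a(3)[of "i + j"]] by auto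
  qed simp
  have "dep (a i) = i" if "i \<le> dep x" for i
    using up[of 0 i] up[of i "dep x - i"] that a(1,2) dep_root by auto
  then show ?thesis using that[of a] a by blast
qed

text \<open>The edge and the paths of length n from the root to its ends would form a closed walk of
  odd length. It is reduced, since vertices two steps apart have different depths.\<close>

lemma no_edge_same_depth:
  assumes "{x, y} \<in> E"
  shows "dep x \<noteq> dep y"
proof
  assume eq: "dep x = dep y"
  define n where "n = dep x"
  obtain a where a: "a 0 = r" "a n = x" "\<And>i. i < n \<Longrightarrow> {a i, a (Suc i)} \<in> E"
    "\<And>i. i \<le> n \<Longrightarrow> dep (a i) = i"
    using descending_path[of x] edge_V[OF assms] n_def by metis
  obtain b where b: "b 0 = r" "b n = y" "\<And>i. i < n \<Longrightarrow> {b i, b (Suc i)} \<in> E"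
    "\<And>i. i \<le> n \<Longrightarrow> dep (b i) = i"
    using descending_path[of y] edge_V[OF assms] n_def eq by metis
  define w where "w i = (if i \<le> n then a i else b (2 * n + 1 - i))" for i
  have "w 0 \<noteq> w (2 * n + 1)"
  proof (rule reduced_walk_not_closed[OF tree])
    show "{w i, w (Suc i)} \<in> E" if "i < 2 * n + 1" for i
    proof -
      consider "i < n" | "i = n" | "i > n" by linarith
      then show ?thesis
      proof cases
        case 3
        then have "{b (2 * n - i), b (Suc (2 * n - i))} \<in> E" using b(3) that by simp
        moreover have "Suc (2 * n - i) = 2 * n + 1 - i" using that by simp
        ultimately show ?thesis using 3 unfolding w_def by (simp add: insert_commute)
      qed (use a assms b in \<open>auto simp: w_def\<close>)
    qed
    show "w i \<noteq> w (i + 2)" if "i + 2 \<le> 2 * n + 1" for i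
    proof
      assume eq: "w i = w (i + 2)"
      consider "i + 2 \<le> n" | "i + 1 = n" | "i = n" | "i > n" by linarith
      then have "dep (w i) \<noteq> dep (w (i + 2))"
        by cases (use a(4) b(4) that in \<open>auto simp: w_def\<close>)
      then show False using eq by simp
    qed
  qed simp
  then show False using a b unfolding w_def by simp
qed

text \<open>Again a closed walk through the root, now turning at v. Only there do vertices two steps
  apart have equal depth, and these are u and u', assumed to be different.\<close>

lemma unique_lower_neighbour:
  assumes "{u, v} \<in> E" "{u', v} \<in> E" "dep v = Suc (dep u)" "dep u' = dep u"
  shows "u = u'"
proof (rule ccontr)
  assume ne: "u \<noteq> u'"
  define n where "n = dep u"
  obtain a where a: "a 0 = r" "a n = u" "\<And>i. i < n \<Longrightarrow> {a i, a (Suc i)} \<in> E"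
    "\<And>i. i \<le> n \<Longrightarrow> dep (a i) = i"
    using descending_path[of u] edge_V[OF assms(1)] n_def by metis
  obtain b where b: "b 0 = r" "b n = u'" "\<And>i. i < n \<Longrightarrow> {b i, b (Suc i)} \<in> E"
    "\<And>i. i \<le> n \<Longrightarrow> dep (b i) = i"
    using descending_path[of u'] edge_V[OF assms(2)] n_def assms(4) by metis
  define w where "w i = (if i \<le> n then a i else if i = n + 1 then v else b (2 * n + 2 - i))" for i
  have dv: "dep v = n + 1" using assms n_def by simp
  have "w 0 \<noteq> w (2 * n + 2)"
  proof (rule reduced_walk_not_closed[OF tree])
    show "{w i, w (Suc i)} \<in> E" if "i < 2 * n + 2" for i
    proof -
      consider "i < n" | "i = n" | "i = n + 1" | "i > n + 1" by linarith
      then show ?thesis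
      proof cases
        case 3
        then show ?thesis using b(2) assms(2) by (simp add: w_def insert_commute)
      next
        case 4
        then have "{b (2 * n + 1 - i), b (Suc (2 * n + 1 - i))} \<in> E" using b(3) that by simp
        moreover have "Suc (2 * n + 1 - i) = 2 * n + 2 - i" using that by simp
        ultimately show ?thesis using 4 unfolding w_def by (simp add: insert_commute)
      qed (use a assms in \<open>auto simp: w_def\<close>)
    qed
    show "w i \<noteq> w (i + 2)" if "i + 2 \<le> 2 * n + 2" for i
    proof
      assume eq: "w i = w (i + 2)"
      consider "i + 2 \<le> n" | "i + 1 = n" | "i = n" | "i = n + 1" | "i > n + 1" by linarith
      then have "dep (w i) \<noteq> dep (w (i + 2)) \<or> i = n"
        by cases (use a(4) b(4) that dv in \<open>auto simp: w_def\<close>)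
      then have "i = n" using eq by simp
      then show False using eq a(2) b(2) ne by (simp add: w_def)
    qed
  qed simp
  then show False using a b unfolding w_def by simp
qed

definition par :: "'v \<Rightarrow> 'v" where "par x = (SOME u. {u, x} \<in> E \<and> dep x = Suc (dep u))"

lemma par:
  assumes "x \<in> V" "dep x \<noteq> 0"
  shows "{par x, x} \<in> E" "dep x = Suc (dep (par x))"
proof -
  obtain a where a: "a (dep x) = x" "\<And>i. i < dep x \<Longrightarrow> {a i, a (Suc i)} \<in> E"
    "\<And>i. i \<le> dep x \<Longrightarrow> dep (a i) = i"
    using descending_path[OF assms(1)] by metis
  have "{a (dep x - 1), x} \<in> E \<and> dep x = Suc (dep (a (dep x - 1)))"
    using a(1) a(2)[of "dep x - 1"] a(3)[of "dep x - 1"] assms(2) by simp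
  then have "{par x, x} \<in> E \<and> dep x = Suc (dep (par x))"
    unfolding par_def by (rule someI)
  then show "{par x, x} \<in> E" "dep x = Suc (dep (par x))" by auto
qed

lemma edge_par:
  assumes "{x, y} \<in> E"
  shows "(dep y \<noteq> 0 \<and> x = par y \<and> dep y = Suc (dep x)) \<or> (dep x \<noteq> 0 \<and> y = par x \<and> dep x = Suc (dep y))"
proof -
  have s: "{y, x} \<in> E" using assms by (simp add: insert_commute)
  have V: "x \<in> V" "y \<in> V" using edge_V assms by auto
  consider "dep y = Suc (dep x)" | "dep x = Suc (dep y)"
    using dep_edge[OF assms] dep_edge[OF s] no_edge_same_depth[OF assms] by linarith
  then show ?thesis
  proof cases
    case 1
    then show ?thesis using unique_lower_neighbour[OF assms, of "par y"] par[OF V(2)] by auto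
  next
    case 2
    then show ?thesis using unique_lower_neighbour[OF s, of "par x"] par[OF V(1)] by auto
  qed
qed

text \<open>The ancestor of x at depth n. If n exceeds the depth of x, truncated subtraction makes
  it x itself.\<close>

definition anc :: "nat \<Rightarrow> 'v \<Rightarrow> 'v" where "anc n x = (par ^^ (dep x - n)) x"

lemma par_pow:
  assumes "x \<in> V" "k \<le> dep x"
  shows "(par ^^ k) x \<in> V \<and> dep ((par ^^ k) x) = dep x - k"
  using assms(2)
proof (induction k)
  case (Suc k)
  then have IH: "(par ^^ k) x \<in> V" "dep ((par ^^ k) x) = dep x - k" by auto
  then show ?case using par[OF IH(1)] edge_V Suc.prems by auto
qed (use assms in simp)

lemma anc_V: "\<lbrakk>x \<in> V; n \<le> dep x\<rbrakk> \<Longrightarrow> anc n x \<in> V"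
  and dep_anc: "\<lbrakk>x \<in> V; n \<le> dep x\<rbrakk> \<Longrightarrow> dep (anc n x) = n"
  using par_pow[of x "dep x - n"] unfolding anc_def by auto

lemma anc_self: "anc (dep x) x = x"
  by (simp add: anc_def)

lemma anc_0: "x \<in> V \<Longrightarrow> anc 0 x = r"
  using dep_0[OF anc_V[of x 0]] dep_anc[of x 0] by simp

lemma anc_anc:
  assumes "x \<in> V" "m \<le> n" "n \<le> dep x"
  shows "anc m (anc n x) = anc m x"
proof -
  have "dep x - m = (n - m) + (dep x - n)" using assms by simp
  then show ?thesis using dep_anc[OF assms(1,3)] unfolding anc_def by (simp add: funpow_add)
qed

text \<open>The depth at which the paths from the root to x and to y branch, that is, the Gromov
  product at the root.\<close>

definition meet :: "'v \<Rightarrow> 'v \<Rightarrow> nat" where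
  "meet x y = Max {n. n \<le> dep x \<and> n \<le> dep y \<and> anc n x = anc n y}"

lemma meet_iff:
  assumes "x \<in> V" "y \<in> V"
  shows "n \<le> meet x y \<longleftrightarrow> n \<le> dep x \<and> n \<le> dep y \<and> anc n x = anc n y"
proof -
  let ?M = "{n. n \<le> dep x \<and> n \<le> dep y \<and> anc n x = anc n y}"
  have fin: "finite ?M" by (rule finite_subset[of _ "{..dep x}"]) auto
  have "0 \<in> ?M" using anc_0 assms by simp
  then have mem: "meet x y \<in> ?M" unfolding meet_def using Max_in[OF fin] by blast
  show ?thesis
  proof
    assume n: "n \<le> meet x y"
    have m: "meet x y \<le> dep x" "meet x y \<le> dep y" "anc (meet x y) x = anc (meet x y) y"
      using mem by auto
    have "anc n x = anc n y"
      using anc_anc[OF assms(1) n m(1)] anc_anc[OF assms(2) n m(2)] m(3) by simp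
    then show "n \<le> dep x \<and> n \<le> dep y \<and> anc n x = anc n y" using m n by auto
  next
    assume "n \<le> dep x \<and> n \<le> dep y \<and> anc n x = anc n y"
    then show "n \<le> meet x y" unfolding meet_def by (intro Max_ge fin) simp
  qed
qed

lemma meet_le: "\<lbrakk>x \<in> V; y \<in> V\<rbrakk> \<Longrightarrow> meet x y \<le> dep x \<and> meet x y \<le> dep y"
  using meet_iff[of x y "meet x y"] by simp

lemma meet_eqI:
  assumes "x \<in> V" "y \<in> V" "\<And>n. n \<le> dep x \<and> n \<le> dep y \<and> anc n x = anc n y \<longleftrightarrow> n \<le> m"
  shows "meet x y = m"
  by (rule antisym) (use meet_iff[OF assms(1,2)] assms(3) in auto)

lemma meet_sym: "\<lbrakk>x \<in> V; y \<in> V\<rbrakk> \<Longrightarrow> meet x y = meet y x"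
  by (rule meet_eqI) (auto simp: meet_iff)

text \<open>Up to the smaller of the two depths, the ancestors of x agree with those of y and these
  with those of z. This ultrametric inequality is 0-hyperbolicity at the root.\<close>

lemma meet_ultra:
  assumes "x \<in> V" "y \<in> V" "z \<in> V"
  shows "min (meet x y) (meet y z) \<le> meet x z"
proof -
  let ?n = "min (meet x y) (meet y z)"
  have "?n \<le> meet x y" "?n \<le> meet y z" by auto
  then show ?thesis using meet_iff[OF assms(1,2), of ?n] meet_iff[OF assms(2,3), of ?n]
    meet_iff[OF assms(1,3), of ?n] by auto
qed

definition td :: "'v \<Rightarrow> 'v \<Rightarrow> int" where
  "td x y = int (dep x) + int (dep y) - 2 * int (meet x y)"

text \<open>The ancestors of x, taken up to the branching vertex, make up the x side of the geodesic
  from x to y.\<close>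

lemma td_anc:
  assumes "x \<in> V" "y \<in> V" "meet x y \<le> n" "n \<le> dep x"
  shows "anc n x \<in> V" "td x (anc n x) = int (dep x) - int n"
    "td (anc n x) y = int n + int (dep y) - 2 * int (meet x y)"
proof -
  let ?z = "anc n x"
  show z: "?z \<in> V" using anc_V assms by blast
  have dz: "dep ?z = n" using dep_anc assms by blast
  have "meet x ?z = n"
    by (rule meet_eqI) (use assms z dz anc_anc in auto)
  then show "td x ?z = int (dep x) - int n" unfolding td_def using dz by simp
  have "meet ?z y = meet x y"
  proof (rule meet_eqI[OF z assms(2)])
    fix m show "m \<le> dep ?z \<and> m \<le> dep y \<and> anc m ?z = anc m y \<longleftrightarrow> m \<le> meet x y"
      using meet_iff[OF assms(1,2), of m] dz anc_anc[OF assms(1) _ assms(4), of m] assms(3,4)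
      by (metis order_trans)
  qed
  then show "td ?z y = int n + int (dep y) - 2 * int (meet x y)" unfolding td_def using dz by simp
qed

lemma td_sym: "\<lbrakk>x \<in> V; y \<in> V\<rbrakk> \<Longrightarrow> td x y = td y x"
  unfolding td_def using meet_sym[of x y] by simp

text \<open>On the near side of the branching vertex the point is an ancestor of x; beyond it, an
  ancestor of y, found with the roles exchanged.\<close>

lemma td_geodesic:
  assumes "x \<in> V" "y \<in> V" "0 \<le> k" "k \<le> td x y"
  shows "\<exists>z\<in>V. td x z = k \<and> td z y = td x y - k"
proof (cases "k \<le> int (dep x) - int (meet x y)")
  case True
  define n where "n = dep x - nat k"
  have n: "meet x y \<le> n" "n \<le> dep x" "int n = int (dep x) - k"
    using True assms(3) meet_le[OF assms(1,2)] unfolding n_def by auto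
  show ?thesis
    using td_anc[OF assms(1,2) n(1,2)] n(3) by (intro bexI[of _ "anc n x"]) (auto simp: td_def)
next
  case False
  define k' where "k' = td x y - k"
  have k': "0 \<le> k'" "k' \<le> int (dep y) - int (meet y x)"
    using False assms meet_sym[OF assms(1,2)] unfolding k'_def td_def by auto
  define n where "n = dep y - nat k'"
  have n: "meet y x \<le> n" "n \<le> dep y" "int n = int (dep y) - k'"
    using k' meet_le[OF assms(2,1)] unfolding n_def by auto
  note t = td_anc[OF assms(2,1) n(1,2)]
  have "td (anc n y) y = k'" "td x (anc n y) = td x y - k'"
    using t n(3) td_sym[OF assms(2) t(1)] td_sym[OF assms(1) t(1)] meet_sym[OF assms(1,2)]
    by (auto simp: td_def[of x y])
  then show ?thesis using t(1) unfolding k'_def by (intro bexI[of _ "anc n y"]) auto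
qed

sublocale tree_metric V td
proof
  fix x y z w k
  assume x: "x \<in> V" and y: "y \<in> V"
  show "td x y \<ge> 0" using meet_le[OF x y] unfolding td_def by simp
  show "td x y = 0 \<longleftrightarrow> x = y"
  proof
    assume "td x y = 0"
    then have "dep x = meet x y" "dep y = meet x y" using meet_le[OF x y] unfolding td_def by auto
    then show "x = y" using meet_iff[OF x y, of "meet x y"] anc_self[of x] anc_self[of y] by simp
  next
    assume "x = y"
    moreover have "meet x x = dep x" by (rule meet_eqI) (use x in auto)
    ultimately show "td x y = 0" unfolding td_def by simp
  qed
  show "td x y = td y x" by (rule td_sym[OF x y])
  show "\<exists>z\<in>V. td x z = k \<and> td z y = td x y - k" if "0 \<le> k" "k \<le> td x y"
    by (rule td_geodesic[OF x y that])
  assume z: "z \<in> V"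
  show "even (td x y + td y z + td x z)" unfolding td_def by simp
  assume w: "w \<in> V"
  note s = meet_sym[OF x y] meet_sym[OF x z] meet_sym[OF x w] meet_sym[OF y z] meet_sym[OF y w] meet_sym[OF z w]
  \<comment> \<open>All four depths occur on both sides. After cancellation only sums of meets
    remain, and four instances of \<open>meet_ultra\<close> compare them.\<close>
  show "td x y + td z w \<le> max (td x z + td y w) (td x w + td y z)"
    using meet_ultra[OF x z y] meet_ultra[OF x w y] meet_ultra[OF z x w] meet_ultra[OF z y w]
      s unfolding td_def le_max_iff_disj min_le_iff_disj by linarith
qed

lemma td_edge: 
  assumes "x \<in> V" "y \<in> V"
  shows "td x y = 1 \<longleftrightarrow> {x, y} \<in> E"
proof
  have up: "{u, v} \<in> E" if V: "u \<in> V" "v \<in> V" and "meet u v = dep u" "dep v = Suc (dep u)" for u v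
  proof -
    have "anc (dep u) u = anc (dep u) v" using meet_iff[OF V, of "dep u"] that by simp
    moreover have "anc (dep u) v = par v" using that(4) unfolding anc_def by simp
    ultimately have eq: "u = par v" unfolding anc_self by simp
    have "dep v \<noteq> 0" using that(4) by simp
    from par(1)[OF V(2) this] show ?thesis unfolding eq .
  qed
  assume "td x y = 1"
  then consider "meet x y = dep x" "dep y = Suc (dep x)" | "meet y x = dep y" "dep x = Suc (dep y)"
    using meet_le[OF assms] meet_sym[OF assms] unfolding td_def by atomize_elim presburger
  then show "{x, y} \<in> E"
  proof cases
    case 1
    then show ?thesis by (rule up[OF assms])
  next
    case 2
    then have "{y, x} \<in> E" by (rule up[OF assms(2,1)])
    then show ?thesis by (simp add: insert_commute)
  qed
next
  have down: "td u v = 1" if "u \<in> V" "v \<in> V" "u = par v" "dep v = Suc (dep u)" for u v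
  proof -
    have "anc (dep u) v = par v" unfolding anc_def that(4) by simp
    then have "anc (dep u) v = anc (dep u) u" unfolding anc_self that(3)[symmetric] .
    then have "meet u v = dep u" using meet_iff[OF that(1,2), of "dep u"] meet_le[OF that(1,2)] that by simp
    then show ?thesis using that unfolding td_def by simp
  qed
  assume "{x, y} \<in> E"
  then show "td x y = 1"
    using edge_par[of x y] down[OF assms] down[OF assms(2,1)] td_sym[OF assms] by metis
qed

text \<open>Induction on the distance: an edge is carried to an edge, and the triangle inequality in
  the image adds the rest of the geodesic.\<close>

lemma td_le_of_edge_map:
  assumes g: "g \<in> V \<rightarrow> V" "\<And>x y. {x, y} \<in> E \<Longrightarrow> {g x, g y} \<in> E"
    and "x \<in> V" "y \<in> V"
  shows "td (g x) (g y) \<le> td x y"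
proof -
  have "td (g x) (g y) \<le> td x y" if "x \<in> V" "y \<in> V" "nat (td x y) = n" for n x
    using that
  proof (induction n arbitrary: x)
    case 0
    then have "x = y" using d_nonneg[of x y] d_zero[of x y] by simp
    then show ?case using d_self[OF funcset_mem[OF g(1) 0(2)]] d_self[OF 0(2)] by simp
  next
    case (Suc n)
    have "1 \<le> td x y" using Suc.prems(3) by linarith
    obtain z where z: "z \<in> V" "td x z = 1" "td z y = td x y - 1"
      using d_geodesic[of x y 1] Suc.prems \<open>1 \<le> td x y\<close> by auto
    have "nat (td z y) = n" using z Suc.prems(3) by linarith
    then have "td (g z) (g y) \<le> td z y" by (rule Suc.IH[OF z(1) Suc.prems(2)])
    moreover have "td (g x) (g z) = 1"
      using g(2)[of x z] td_edge[OF Suc.prems(1) z(1)] z(2)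
        td_edge[OF funcset_mem[OF g(1) Suc.prems(1)] funcset_mem[OF g(1) z(1)]] by simp
    moreover have "td (g x) (g y) \<le> td (g x) (g z) + td (g z) (g y)"
      using d_triangle[OF funcset_mem[OF g(1) Suc.prems(1)] funcset_mem[OF g(1) Suc.prems(2)] funcset_mem[OF g(1) z(1)]] .
    ultimately show ?case using z by simp
  qed
  then show ?thesis using assms by blast
qed

lemma td_automorphism:
  assumes g: "bij_betw g V V" "(`) g ` E = E" and "x \<in> V" "y \<in> V"
  shows "td (g x) (g y) = td x y"
proof (rule antisym)
  have gV: "g \<in> V \<rightarrow> V" using bij_betwE[OF g(1)] by blast
  show "td (g x) (g y) \<le> td x y"
  proof (rule td_le_of_edge_map[OF gV _ assms(3,4)])
    fix x y assume "{x, y} \<in> E"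
    then have "g ` {x, y} \<in> E" using g by blast
    then show "{g x, g y} \<in> E" by simp
  qed
  define h where "h = inv_into V g"
  have hg: "h (g x) = x" if "x \<in> V" for x
    using g that unfolding h_def by (simp add: bij_betw_inv_into_left)
  have hV: "h \<in> V \<rightarrow> V" using g unfolding h_def bij_betw_def by (auto intro: inv_into_into)
  have "td (h (g x)) (h (g y)) \<le> td (g x) (g y)"
  proof (rule td_le_of_edge_map[OF hV])
    fix x y assume "{x, y} \<in> E"
    then obtain e where e: "e \<in> E" "{x, y} = g ` e" using g by blast
    have "e \<subseteq> V" using e tree unfolding simplicial_tree_def by blast
    then have "h ` g ` e = e" using hg by (force simp: image_image)
    moreover have "h ` {x, y} = {h x, h y}" by simp
    ultimately show "{h x, h y} \<in> E" using e by metis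
  qed (use gV assms in auto)
  then show "td x y \<le> td (g x) (g y)" using hg assms by simp
qed

end

text \<open>The point mass at v. This is stronger than the fixed point that the definition asks for,
  which may also be the midpoint of an edge.\<close>

lemma fixed_vertex_realization:
  assumes "v \<in> V" "\<And>g. g \<in> Y \<Longrightarrow> \<phi> g v = v"
  shows "\<exists>p\<in>realization V E. \<forall>g\<in>Y. realization_map (\<phi> g) p = p"
proof -
  define p :: "'a \<Rightarrow> real" where "p w = (if w = v then 1 else 0)" for w
  have supp: "{w. p w \<noteq> 0} = {v}" unfolding p_def by auto
  have "p \<in> realization V E" unfolding realization_def using assms supp by (auto simp: p_def)
  moreover have "realization_map (\<phi> g) p = p" if "g \<in> Y" for g
  proof
    fix w
    have "{u. p u \<noteq> 0 \<and> \<phi> g u = w} = (if w = v then {v} else {})"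
      using assms(2)[OF that] unfolding p_def by auto
    then show "realization_map (\<phi> g) p w = p w" unfolding realization_map_def by (simp add: p_def)
  qed
  ultimately show ?thesis by blast
qed

text \<open>Such an element \<open>m\<close> is elliptic in every action on a tree: otherwise \<open>K\<close> would act on the axis of
  \<open>m\<close> by translations, so that \<open>[K, K]\<close>, which contains the conjugate of \<open>m\<close>, would have no
  hyperbolic element with this axis.\<close>

definition perfectly_displaced :: "('g, 'm) monoid_scheme \<Rightarrow> 'g \<Rightarrow> bool" where
  "perfectly_displaced G m \<longleftrightarrow> m \<in> carrier G \<and> (\<exists>h\<in>carrier G. \<exists>K. subgroup K G \<and>
     (\<forall>k\<in>K. k \<otimes>\<^bsub>G\<^esub> m = m \<otimes>\<^bsub>G\<^esub> k) \<and> h \<otimes>\<^bsub>G\<^esub> m \<otimes>\<^bsub>G\<^esub> inv\<^bsub>G\<^esub> h \<in> K \<and>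
     (\<forall>N. subgroup N G \<and> (\<forall>a\<in>K. \<forall>b\<in>K. a \<otimes>\<^bsub>G\<^esub> b \<otimes>\<^bsub>G\<^esub> inv\<^bsub>G\<^esub> a \<otimes>\<^bsub>G\<^esub> inv\<^bsub>G\<^esub> b \<in> N) \<longrightarrow>
        h \<otimes>\<^bsub>G\<^esub> m \<otimes>\<^bsub>G\<^esub> inv\<^bsub>G\<^esub> h \<in> N))"

theorem has_property_FA_criterion:
  fixes G :: "('g, 'm) monoid_scheme"
  assumes "group G" and S: "finite S" "S \<subseteq> carrier G" "carrier G = generate G S"
    and ell: "\<And>s. s \<in> S \<Longrightarrow> perfectly_displaced G s"
    and pairs: "\<And>s t. \<lbrakk>s \<in> S; t \<in> S\<rbrakk> \<Longrightarrow> s \<otimes>\<^bsub>G\<^esub> t = t \<otimes>\<^bsub>G\<^esub> s \<or> perfectly_displaced G (s \<otimes>\<^bsub>G\<^esub> t)"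
  shows "has_property_FA TYPE('v) G"
  unfolding has_property_FA_def
proof safe
  fix V :: "'v set" and E \<phi>
  assume tree: "simplicial_tree V E" and action: "group_action G V \<phi>"
    and aut: "\<forall>g\<in>carrier G. (`) (\<phi> g) ` E = E"
  obtain r where r: "r \<in> V" using tree unfolding simplicial_tree_def by blast
  interpret rooted_tree V E r by unfold_locales (use tree r in auto)
  interpret group G by fact
  interpret A: group_action G V \<phi> by fact
  have bij: "bij_betw (\<phi> g) V V" if "g \<in> carrier G" for g
    using A.bij_prop0[OF that] unfolding Bij_def by simp
  interpret tree_group_action V td G \<phi>
  proof
    show "V \<noteq> {}" using r by blast
    show "isom (\<phi> g)" if "g \<in> carrier G" for g
    proof -
      have "(`) (\<phi> g) ` E = E" using aut that by blast
      from td_automorphism[OF bij[OF that] this] bij_betwE[OF bij[OF that]]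
      show ?thesis unfolding isom_def by simp
    qed
    show "\<phi> (g \<otimes>\<^bsub>G\<^esub> h) x = \<phi> g (\<phi> h x)" if "g \<in> carrier G" "h \<in> carrier G" "x \<in> V" for g h x
      using A.composition_rule[OF that(3,1,2)] .
    show "\<phi> \<one>\<^bsub>G\<^esub> x = x" if "x \<in> V" for x
      using A.id_eq_one that by (metis restrict_apply')
  qed
  have ell': "elliptic m" if m: "perfectly_displaced G m" for m
  proof -
    obtain h K where hK: "h \<in> carrier G" "subgroup K G" "\<forall>k\<in>K. k \<otimes>\<^bsub>G\<^esub> m = m \<otimes>\<^bsub>G\<^esub> k"
      "h \<otimes>\<^bsub>G\<^esub> m \<otimes>\<^bsub>G\<^esub> inv\<^bsub>G\<^esub> h \<in> K"
      "\<forall>N. subgroup N G \<and> (\<forall>a\<in>K. \<forall>b\<in>K. a \<otimes>\<^bsub>G\<^esub> b \<otimes>\<^bsub>G\<^esub> inv\<^bsub>G\<^esub> a \<otimes>\<^bsub>G\<^esub> inv\<^bsub>G\<^esub> b \<in> N) \<longrightarrow>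
         h \<otimes>\<^bsub>G\<^esub> m \<otimes>\<^bsub>G\<^esub> inv\<^bsub>G\<^esub> h \<in> N"
      using m unfolding perfectly_displaced_def by blast
    show ?thesis
    proof (rule elliptic_if_conj_in_perfect_centralizer[of m h K])
      show "m \<in> carrier G" using m unfolding perfectly_displaced_def by blast
    qed (use hK in blast)+
  qed
  have "\<exists>x\<in>V. \<forall>g\<in>generate G S. \<phi> g x = x"
  proof (rule common_fixed_point[OF S(1,2)])
    show "elliptic s" if "s \<in> S" for s using ell'[OF ell[OF that]] .
    show "s \<otimes>\<^bsub>G\<^esub> t = t \<otimes>\<^bsub>G\<^esub> s \<or> elliptic (s \<otimes>\<^bsub>G\<^esub> t)" if "s \<in> S" "t \<in> S" for s t
      using pairs[OF that] ell' by blast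
  qed
  then obtain x where "x \<in> V" "\<forall>g\<in>generate G S. \<phi> g x = x" by blast
  then show "\<exists>p\<in>realization V E. \<forall>g\<in>carrier G. realization_map (\<phi> g) p = p"
    using fixed_vertex_realization[of x V "carrier G" \<phi> E] S(3) by blast
qed

section \<open>Affine isometric actions\<close>

text \<open>The form may be degenerate. Vectors of length 0 are divided out only in the
  completion.\<close>

locale semi_inner_space =
  fixes E :: "('a \<Rightarrow> real) set" and ip :: "('a \<Rightarrow> real) \<Rightarrow> ('a \<Rightarrow> real) \<Rightarrow> real"
  assumes zero_in: "(\<lambda>_. 0) \<in> E"
    and add_in: "\<lbrakk>u \<in> E; v \<in> E\<rbrakk> \<Longrightarrow> (\<lambda>x. u x + v x) \<in> E"
    and scale_in: "u \<in> E \<Longrightarrow> (\<lambda>x. c * u x) \<in> E"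
    and ip_sym: "\<lbrakk>u \<in> E; v \<in> E\<rbrakk> \<Longrightarrow> ip u v = ip v u"
    and ip_add: "\<lbrakk>u \<in> E; v \<in> E; w \<in> E\<rbrakk> \<Longrightarrow> ip (\<lambda>x. u x + v x) w = ip u w + ip v w"
    and ip_scale: "\<lbrakk>u \<in> E; v \<in> E\<rbrakk> \<Longrightarrow> ip (\<lambda>x. c * u x) v = c * ip u v"
    and ip_nonneg: "u \<in> E \<Longrightarrow> ip u u \<ge> 0"
begin

definition sub :: "('a \<Rightarrow> real) \<Rightarrow> ('a \<Rightarrow> real) \<Rightarrow> 'a \<Rightarrow> real" where
  "sub u v = (\<lambda>x. u x - v x)"

definition nm :: "('a \<Rightarrow> real) \<Rightarrow> real" where "nm u = sqrt (ip u u)"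

lemma sub_in: "\<lbrakk>u \<in> E; v \<in> E\<rbrakk> \<Longrightarrow> sub u v \<in> E"
  using add_in[OF _ scale_in[of v "-1"], of u] unfolding sub_def by simp

lemma ip_sub: "\<lbrakk>u \<in> E; v \<in> E; w \<in> E\<rbrakk> \<Longrightarrow> ip (sub u v) w = ip u w - ip v w"
  using ip_add[OF _ scale_in[of v "-1"], of u w] ip_scale[of v w "-1"] unfolding sub_def by simp

lemma ip_sub': "\<lbrakk>u \<in> E; v \<in> E; w \<in> E\<rbrakk> \<Longrightarrow> ip w (sub u v) = ip w u - ip w v"
  using ip_sub[of u v w] ip_sym[of w u] ip_sym[of w v] ip_sym[of w "sub u v"] sub_in by simp

lemma ip_add': "\<lbrakk>u \<in> E; v \<in> E; w \<in> E\<rbrakk> \<Longrightarrow> ip w (\<lambda>x. u x + v x) = ip w u + ip w v"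
  using ip_add[of u v w] ip_sym[of w u] ip_sym[of w v] ip_sym[of w "\<lambda>x. u x + v x"] add_in by simp

lemma ip_scale': "\<lbrakk>u \<in> E; v \<in> E\<rbrakk> \<Longrightarrow> ip v (\<lambda>x. c * u x) = c * ip v u"
  using ip_scale[of u v c] ip_sym[of u v] ip_sym[of v "\<lambda>x. c * u x"] scale_in[of u c] by simp

lemma nm_nonneg: "u \<in> E \<Longrightarrow> nm u \<ge> 0"
  using ip_nonneg unfolding nm_def by simp

lemma nm_sq: "u \<in> E \<Longrightarrow> (nm u)\<^sup>2 = ip u u"
  using ip_nonneg unfolding nm_def by simp

lemma cauchy_schwarz:
  assumes "u \<in> E" "v \<in> E"
  shows "\<bar>ip u v\<bar> \<le> nm u * nm v"
proof -
  have q: "0 \<le> ip u u + 2 * c * ip u v + c\<^sup>2 * ip v v" for c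
  proof -
    have s: "(\<lambda>x. c * v x) \<in> E" using scale_in assms by blast
    have "0 \<le> ip (\<lambda>x. u x + c * v x) (\<lambda>x. u x + c * v x)"
      using ip_nonneg[OF add_in[OF assms(1) s]] .
    also have "\<dots> = ip u u + 2 * c * ip u v + c\<^sup>2 * ip v v"
      using assms s ip_add[OF assms(1) s add_in[OF assms(1) s]] ip_add'[OF assms(1) s assms(1)]
        ip_add'[OF assms(1) s s] ip_scale[OF assms(2,1)] ip_scale'[OF assms(2,1)]
        ip_scale[OF assms(2) s] ip_scale'[OF assms(2,2)] ip_sym[OF assms]
      by (simp add: power2_eq_square algebra_simps)
    finally show ?thesis .
  qed
  have "(ip u v)\<^sup>2 \<le> ip u u * ip v v"
  proof (cases "ip v v = 0")
    case True
    have "ip u v = 0"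
    proof (rule ccontr)
      assume ne: "ip u v \<noteq> 0"
      \<comment> \<open>For \<open>ip v v = 0\<close> the quadratic in c is affine, and c is chosen
        to give it the value -1.\<close>
      have "0 \<le> ip u u + 2 * (- (ip u u + 1) / (2 * ip u v)) * ip u v"
        using q[of "- (ip u u + 1) / (2 * ip u v)"] True by simp
      also have "\<dots> = -1" using ne by (simp add: field_simps)
      finally show False by simp
    qed
    then show ?thesis using True by simp
  next
    case False
    then have pos: "ip v v > 0" using ip_nonneg[OF assms(2)] by simp
    \<comment> \<open>The value of c at which the quadratic attains its minimum.\<close>
    have "0 \<le> ip u u + 2 * (- ip u v / ip v v) * ip u v + (- ip u v / ip v v)\<^sup>2 * ip v v" by (rule q)
    also have "\<dots> = ip u u - (ip u v)\<^sup>2 / ip v v"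
      using pos by (simp add: field_simps power2_eq_square)
    finally show ?thesis using pos by (simp add: field_simps)
  qed
  then have "sqrt ((ip u v)\<^sup>2) \<le> sqrt (ip u u * ip v v)" by (rule real_sqrt_le_mono)
  then show ?thesis unfolding nm_def by (simp add: real_sqrt_mult)
qed

lemma nm_add:
  assumes "u \<in> E" "v \<in> E"
  shows "nm (\<lambda>x. u x + v x) \<le> nm u + nm v"
proof -
  have s: "(\<lambda>x. u x + v x) \<in> E" using add_in assms by blast
  have "(nm (\<lambda>x. u x + v x))\<^sup>2 = ip u u + 2 * ip u v + ip v v"
    unfolding nm_sq[OF s] ip_add[OF assms s] ip_add'[OF assms assms(1)] ip_add'[OF assms assms(2)]
    using ip_sym[OF assms] by linarith
  also have "\<dots> \<le> (nm u + nm v)\<^sup>2"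
    using cauchy_schwarz[OF assms] nm_sq assms by (simp add: power2_sum)
  finally show ?thesis
    by (rule power2_le_imp_le) (use nm_nonneg assms in \<open>simp add: add_nonneg_nonneg\<close>)
qed

lemma nm_sub_triangle:
  assumes "u \<in> E" "v \<in> E" "w \<in> E"
  shows "nm (sub u w) \<le> nm (sub u v) + nm (sub v w)"
proof -
  have "sub u w = (\<lambda>x. sub u v x + sub v w x)" unfolding sub_def by auto
  then show ?thesis using nm_add[OF sub_in sub_in] assms by metis
qed

lemma nm_scale: "u \<in> E \<Longrightarrow> nm (\<lambda>x. c * u x) = \<bar>c\<bar> * nm u"
  using ip_scale[of u "\<lambda>x. c * u x" c] ip_scale'[of u u c] scale_in[of u c]
  unfolding nm_def by (simp add: real_sqrt_mult flip: power2_eq_square mult.assoc)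

lemma nm_sub_sym: "\<lbrakk>u \<in> E; v \<in> E\<rbrakk> \<Longrightarrow> nm (sub u v) = nm (sub v u)"
  using nm_scale[OF sub_in, of u v "-1"] unfolding sub_def by simp

lemma sub_zero: "sub u (\<lambda>_. 0) = u"
  unfolding sub_def by simp

lemma nm_diff: "\<lbrakk>u \<in> E; v \<in> E\<rbrakk> \<Longrightarrow> \<bar>nm u - nm v\<bar> \<le> nm (sub u v)"
  using nm_sub_triangle[of u v "\<lambda>_. 0"] nm_sub_triangle[of v u "\<lambda>_. 0"] zero_in nm_sub_sym[of u v]
  unfolding sub_zero by auto

lemma nm_zero: "nm (\<lambda>_. 0) = 0"
  using nm_scale[OF zero_in, of 0] by simp

section \<open>The completion of a semi-inner product space\<close>

definition cauchy :: "(nat \<Rightarrow> 'a \<Rightarrow> real) \<Rightarrow> bool" where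
  "cauchy u \<longleftrightarrow> (\<forall>n. u n \<in> E) \<and> (\<forall>e>0. \<exists>N. \<forall>m\<ge>N. \<forall>n\<ge>N. nm (sub (u m) (u n)) < e)"

lemma cauchy_in: "cauchy u \<Longrightarrow> u n \<in> E"
  unfolding cauchy_def by blast

lemma cauchy_const: "u \<in> E \<Longrightarrow> cauchy (\<lambda>_. u)"
  unfolding cauchy_def using nm_zero by (simp add: sub_def)

lemma cauchy_add:
  assumes "cauchy u" "cauchy v"
  shows "cauchy (\<lambda>n x. u n x + v n x)"
  unfolding cauchy_def
proof safe
  show "(\<lambda>x. u n x + v n x) \<in> E" for n using add_in cauchy_in assms by blast
  fix e :: real assume "e > 0"
  then have e: "e / 2 > 0" by simp
  obtain N M where N: "\<forall>m\<ge>N. \<forall>n\<ge>N. nm (sub (u m) (u n)) < e / 2"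
    and M: "\<forall>m\<ge>M. \<forall>n\<ge>M. nm (sub (v m) (v n)) < e / 2"
    using assms e unfolding cauchy_def by meson
  have "nm (sub (\<lambda>x. u m x + v m x) (\<lambda>x. u n x + v n x)) < e" if "m \<ge> max N M" "n \<ge> max N M" for m n
  proof -
    have "sub (\<lambda>x. u m x + v m x) (\<lambda>x. u n x + v n x) = (\<lambda>x. sub (u m) (u n) x + sub (v m) (v n) x)"
      unfolding sub_def by auto
    then have "nm (sub (\<lambda>x. u m x + v m x) (\<lambda>x. u n x + v n x)) \<le> nm (sub (u m) (u n)) + nm (sub (v m) (v n))"
      using nm_add[OF sub_in sub_in] cauchy_in assms by metis
    moreover have "nm (sub (u m) (u n)) < e / 2" "nm (sub (v m) (v n)) < e / 2" using N M that by auto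
    ultimately show ?thesis by linarith
  qed
  then show "\<exists>N. \<forall>m\<ge>N. \<forall>n\<ge>N. nm (sub (\<lambda>x. u m x + v m x) (\<lambda>x. u n x + v n x)) < e" by blast
qed

lemma cauchy_scale:
  assumes "cauchy u"
  shows "cauchy (\<lambda>n x. c * u n x)"
  unfolding cauchy_def
proof safe
  show "(\<lambda>x. c * u n x) \<in> E" for n using scale_in cauchy_in assms by blast
  fix e :: real assume "e > 0"
  then have e: "e / (\<bar>c\<bar> + 1) > 0" by simp
  obtain N where N: "\<forall>m\<ge>N. \<forall>n\<ge>N. nm (sub (u m) (u n)) < e / (\<bar>c\<bar> + 1)"
    using assms e unfolding cauchy_def by meson
  have "nm (sub (\<lambda>x. c * u m x) (\<lambda>x. c * u n x)) < e" if "m \<ge> N" "n \<ge> N" for m n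
  proof -
    have "sub (\<lambda>x. c * u m x) (\<lambda>x. c * u n x) = (\<lambda>x. c * sub (u m) (u n) x)"
      unfolding sub_def by (auto simp: algebra_simps)
    then have "nm (sub (\<lambda>x. c * u m x) (\<lambda>x. c * u n x)) = \<bar>c\<bar> * nm (sub (u m) (u n))"
      using nm_scale[OF sub_in] cauchy_in assms by metis
    also have "\<dots> \<le> (\<bar>c\<bar> + 1) * nm (sub (u m) (u n))"
      using nm_nonneg[OF sub_in] cauchy_in assms by (intro mult_right_mono) auto
    also have "\<dots> < (\<bar>c\<bar> + 1) * (e / (\<bar>c\<bar> + 1))" using N that by (intro mult_strict_left_mono) auto
    finally show ?thesis by simp
  qed
  then show "\<exists>N. \<forall>m\<ge>N. \<forall>n\<ge>N. nm (sub (\<lambda>x. c * u m x) (\<lambda>x. c * u n x)) < e" by blast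
qed

lemma cauchy_sub:
  assumes "cauchy u" "cauchy v"
  shows "cauchy (\<lambda>n. sub (u n) (v n))"
  using cauchy_add[OF assms(1) cauchy_scale[OF assms(2), of "-1"]] unfolding sub_def by simp

lemma nm_convergent:
  assumes "cauchy u"
  shows "convergent (\<lambda>n. nm (u n))"
proof -
  have "Cauchy (\<lambda>n. nm (u n))"
  proof (rule metric_CauchyI)
    fix e :: real assume "e > 0"
    then obtain N where N: "\<forall>m\<ge>N. \<forall>n\<ge>N. nm (sub (u m) (u n)) < e"
      using assms unfolding cauchy_def by meson
    have "dist (nm (u m)) (nm (u n)) < e" if "m \<ge> N" "n \<ge> N" for m n
      using nm_diff[of "u m" "u n"] cauchy_in[OF assms] N that by (force simp: dist_real_def)
    then show "\<exists>N. \<forall>m\<ge>N. \<forall>n\<ge>N. dist (nm (u m)) (nm (u n)) < e" by blast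
  qed
  then show ?thesis by (simp add: Cauchy_convergent_iff)
qed

lemma nm_bounded:
  assumes "cauchy u"
  obtains C where "C > 0" "\<And>n. nm (u n) \<le> C"
proof -
  obtain K where "K > 0" "\<And>n. norm (nm (u n)) \<le> K"
    using convergent_imp_Bseq[OF nm_convergent[OF assms]] unfolding Bseq_def by blast
  then show ?thesis using that[of K] by (metis abs_le_D1 real_norm_def)
qed

text \<open>Polarization reduces the claim to norms, which converge by
  \<open>nm_convergent\<close>.\<close>

lemma ip_convergent:
  assumes "cauchy u" "cauchy v"
  shows "convergent (\<lambda>n. ip (u n) (v n))"
proof -
  let ?w = "\<lambda>n x. u n x + v n x"
  have "ip (u n) (v n) = ((nm (?w n))\<^sup>2 - (nm (u n))\<^sup>2 - (nm (v n))\<^sup>2) / 2" for n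
  proof -
    have m: "u n \<in> E" "v n \<in> E" using cauchy_in assms by auto
    note s = add_in[OF m]
    show ?thesis
      unfolding nm_sq[OF s] nm_sq[OF m(1)] nm_sq[OF m(2)] ip_add[OF m s] ip_add'[OF m m(1)] ip_add'[OF m m(2)]
      using ip_sym[OF m] by (simp add: field_simps)
  qed
  moreover have "convergent (\<lambda>n. ((nm (?w n))\<^sup>2 - (nm (u n))\<^sup>2 - (nm (v n))\<^sup>2) / 2)"
  proof -
    obtain a b c where "(\<lambda>n. nm (?w n)) \<longlonglongrightarrow> a" "(\<lambda>n. nm (u n)) \<longlonglongrightarrow> b" "(\<lambda>n. nm (v n)) \<longlonglongrightarrow> c"
      using nm_convergent[OF cauchy_add[OF assms]] nm_convergent[OF assms(1)] nm_convergent[OF assms(2)]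
      unfolding convergent_def by blast
    then have "(\<lambda>n. ((nm (?w n))\<^sup>2 - (nm (u n))\<^sup>2 - (nm (v n))\<^sup>2) / 2) \<longlonglongrightarrow> (a\<^sup>2 - b\<^sup>2 - c\<^sup>2) / 2"
      by (intro tendsto_intros) auto
    then show ?thesis unfolding convergent_def by blast
  qed
  ultimately show ?thesis by presburger
qed

lemma ip_null:
  assumes "cauchy u" "cauchy v" "(\<lambda>n. nm (u n)) \<longlonglongrightarrow> 0"
  shows "(\<lambda>n. ip (u n) (v n)) \<longlonglongrightarrow> 0"
proof -
  obtain C where C: "C > 0" "\<And>n. nm (v n) \<le> C" using nm_bounded[OF assms(2)] by blast
  have "norm (ip (u n) (v n)) \<le> nm (u n) * C" for n
    using cauchy_schwarz[of "u n" "v n"] mult_left_mono[OF C(2)[of n] nm_nonneg[of "u n"]] cauchy_in assms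
    by fastforce
  moreover have "(\<lambda>n. nm (u n) * C) \<longlonglongrightarrow> 0" using tendsto_mult_left_zero[OF assms(3)] .
  ultimately show ?thesis by (rule Lim_null_comparison[OF always_eventually[OF allI]])
qed

text \<open>The class of a Cauchy sequence in the completion is encoded by the linear form that it
  defines on E, which avoids quotients. The completion then consists of functions of type
  \<open>('a \<Rightarrow> real) \<Rightarrow> real\<close>, which is the type of the vectors in
  \<open>has_property_T\<close> if the group elements are functions of type
  \<open>'a \<Rightarrow> real\<close>. The value 0 outside E makes the encoding unique.\<close>

definition functional :: "(nat \<Rightarrow> 'a \<Rightarrow> real) \<Rightarrow> ('a \<Rightarrow> real) \<Rightarrow> real" where
  "functional u = (\<lambda>v. if v \<in> E then lim (\<lambda>n. ip (u n) v) else 0)"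

lemma functional_tendsto:
  assumes "cauchy u" "v \<in> E"
  shows "(\<lambda>n. ip (u n) v) \<longlonglongrightarrow> functional u v"
  using ip_convergent[OF assms(1) cauchy_const[OF assms(2)]] assms(2)
  unfolding functional_def by (simp add: convergent_LIMSEQ_iff)

lemma functional_outside: "v \<notin> E \<Longrightarrow> functional u v = 0"
  unfolding functional_def by simp

lemma functional_eqI:
  assumes "cauchy u" "\<And>v. v \<in> E \<Longrightarrow> (\<lambda>n. ip (u n) v) \<longlonglongrightarrow> L v" "\<And>v. v \<notin> E \<Longrightarrow> L v = 0"
  shows "functional u = L"
proof
  fix v show "functional u v = L v"
    using LIMSEQ_unique[OF functional_tendsto[OF assms(1)] assms(2), of v]
      assms(3)[of v] functional_outside[of v u] by metis
qed

text \<open>Equal linear forms mean that the differences w n tend weakly to 0. For a Cauchy sequence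
  this is convergence in norm: \<open>ip (w n) (w n)\<close> is compared with
  \<open>ip (w n) (w N)\<close> for a fixed late N, which is small by weak convergence, while the
  error is small by the Cauchy property.\<close>

lemma functional_eq_iff:
  assumes u: "cauchy u" and v: "cauchy v"
  shows "functional u = functional v \<longleftrightarrow> (\<lambda>n. nm (sub (u n) (v n))) \<longlonglongrightarrow> 0"
proof
  let ?w = "\<lambda>n. sub (u n) (v n)"
  have w: "cauchy ?w" using cauchy_sub[OF u v] .
  have wE: "?w n \<in> E" for n using cauchy_in[OF w] .
  assume eq: "functional u = functional v"
  have lim0: "(\<lambda>n. ip (?w n) z) \<longlonglongrightarrow> 0" if "z \<in> E" for z
    using tendsto_diff[OF functional_tendsto[OF u that] functional_tendsto[OF v that]] eq
      ip_sub[OF cauchy_in[OF u] cauchy_in[OF v] that] by simp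
  obtain C where C: "C > 0" "\<And>n. nm (?w n) \<le> C" using nm_bounded[OF w] by blast
  have "(\<lambda>n. ip (?w n) (?w n)) \<longlonglongrightarrow> 0"
  proof (rule LIMSEQ_I)
    fix e :: real assume e: "e > 0"
    then have "e / (2 * C) > 0" using C by simp
    then obtain N where N: "\<forall>m\<ge>N. \<forall>n\<ge>N. nm (sub (?w m) (?w n)) < e / (2 * C)"
      using w unfolding cauchy_def by meson
    obtain M where M: "\<forall>n\<ge>M. norm (ip (?w n) (?w N)) < e / 2"
      using LIMSEQ_D[OF lim0[OF wE[of N]], of "e / 2"] e by auto
    have "norm (ip (?w n) (?w n) - 0) < e" if n: "n \<ge> max N M" for n
    proof -
      have "ip (?w n) (?w n) = ip (?w n) (sub (?w n) (?w N)) + ip (?w n) (?w N)"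
        using ip_sub'[OF wE wE wE] by simp
      moreover have "\<bar>ip (?w n) (sub (?w n) (?w N))\<bar> \<le> nm (?w n) * nm (sub (?w n) (?w N))"
        using cauchy_schwarz wE sub_in by blast
      moreover have "nm (?w n) * nm (sub (?w n) (?w N)) \<le> C * nm (sub (?w n) (?w N))"
        using C nm_nonneg[OF sub_in[OF wE wE]] by (intro mult_right_mono) auto
      moreover have "C * nm (sub (?w n) (?w N)) < C * (e / (2 * C))"
        using N n C by (intro mult_strict_left_mono) auto
      moreover have "C * (e / (2 * C)) = e / 2" using C by simp
      moreover have "norm (ip (?w n) (?w N)) < e / 2" using M n by simp
      ultimately show ?thesis by simp
    qed
    then show "\<exists>no. \<forall>n\<ge>no. norm (ip (?w n) (?w n) - 0) < e" by blast
  qed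
  then have "(\<lambda>n. sqrt (ip (?w n) (?w n))) \<longlonglongrightarrow> sqrt 0" by (rule tendsto_real_sqrt)
  then show "(\<lambda>n. nm (?w n)) \<longlonglongrightarrow> 0" unfolding nm_def by simp
next
  assume 0: "(\<lambda>n. nm (sub (u n) (v n))) \<longlonglongrightarrow> 0"
  show "functional u = functional v"
  proof (rule functional_eqI[OF u])
    fix z assume z: "z \<in> E"
    have "(\<lambda>n. ip (sub (u n) (v n)) z + ip (v n) z) \<longlonglongrightarrow> 0 + functional v z"
      by (intro tendsto_add ip_null[OF cauchy_sub[OF u v] cauchy_const[OF z] 0] functional_tendsto[OF v z])
    then show "(\<lambda>n. ip (u n) z) \<longlonglongrightarrow> functional v z"
      using ip_sub[OF cauchy_in[OF u] cauchy_in[OF v] z] by simp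
  qed (rule functional_outside)
qed

definition H :: "(('a \<Rightarrow> real) \<Rightarrow> real) set" where "H = functional ` {u. cauchy u}"

definition rep :: "(('a \<Rightarrow> real) \<Rightarrow> real) \<Rightarrow> nat \<Rightarrow> 'a \<Rightarrow> real" where
  "rep L = (SOME u. cauchy u \<and> functional u = L)"

lemma rep:
  assumes "L \<in> H"
  shows "cauchy (rep L)" "functional (rep L) = L"
proof -
  have "\<exists>u. cauchy u \<and> functional u = L" using assms unfolding H_def by auto
  then have "cauchy (rep L) \<and> functional (rep L) = L" unfolding rep_def by (rule someI_ex)
  then show "cauchy (rep L)" "functional (rep L) = L" by auto
qed

lemma functional_in_H: "cauchy u \<Longrightarrow> functional u \<in> H"
  unfolding H_def by blast

definition ipH :: "(('a \<Rightarrow> real) \<Rightarrow> real) \<Rightarrow> (('a \<Rightarrow> real) \<Rightarrow> real) \<Rightarrow> real" where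
  "ipH L M = lim (\<lambda>n. ip (rep L n) (rep M n))"

text \<open>Exchanging the chosen representatives changes both arguments by null sequences, which do
  not affect the limit.\<close>

lemma ipH_tendsto:
  assumes u: "cauchy u" and v: "cauchy v"
  shows "(\<lambda>n. ip (u n) (v n)) \<longlonglongrightarrow> ipH (functional u) (functional v)"
proof -
  define u' v' where "u' = rep (functional u)" and "v' = rep (functional v)"
  have r: "cauchy u'" "functional u' = functional u" "cauchy v'" "functional v' = functional v"
    using rep functional_in_H u v unfolding u'_def v'_def by auto
  have l: "(\<lambda>n. ip (u' n) (v' n)) \<longlonglongrightarrow> ipH (functional u) (functional v)"
    using ip_convergent[OF r(1,3)] unfolding ipH_def u'_def v'_def by (simp add: convergent_LIMSEQ_iff)
  have "(\<lambda>n. nm (sub (u n) (u' n))) \<longlonglongrightarrow> 0" "(\<lambda>n. nm (sub (v n) (v' n))) \<longlonglongrightarrow> 0"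
    using functional_eq_iff[OF u r(1)] functional_eq_iff[OF v r(3)] r by simp_all
  then have "(\<lambda>n. ip (sub (u n) (u' n)) (v n)) \<longlonglongrightarrow> 0" "(\<lambda>n. ip (sub (v n) (v' n)) (u' n)) \<longlonglongrightarrow> 0"
    using ip_null cauchy_sub u v r by blast+
  then have "(\<lambda>n. ip (sub (u n) (u' n)) (v n) + ip (sub (v n) (v' n)) (u' n) + ip (u' n) (v' n))
    \<longlonglongrightarrow> 0 + 0 + ipH (functional u) (functional v)"
    using l by (intro tendsto_add)
  moreover have "ip (sub (u n) (u' n)) (v n) + ip (sub (v n) (v' n)) (u' n) + ip (u' n) (v' n) = ip (u n) (v n)" for n
  proof -
    have m: "u n \<in> E" "v n \<in> E" "u' n \<in> E" "v' n \<in> E" using cauchy_in u v r by auto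
    show ?thesis using ip_sub[OF m(1,3,2)] ip_sub[OF m(2,4,3)] ip_sym[OF m(2,3)] ip_sym[OF m(4,3)] by simp
  qed
  ultimately show ?thesis by simp
qed

lemma functional_add:
  assumes "cauchy u" "cauchy v"
  shows "functional (\<lambda>n x. u n x + v n x) = (\<lambda>z. functional u z + functional v z)"
proof (rule functional_eqI[OF cauchy_add[OF assms]])
  fix z assume z: "z \<in> E"
  show "(\<lambda>n. ip (\<lambda>x. u n x + v n x) z) \<longlonglongrightarrow> functional u z + functional v z"
    using tendsto_add[OF functional_tendsto[OF assms(1) z] functional_tendsto[OF assms(2) z]]
      ip_add[OF cauchy_in[OF assms(1)] cauchy_in[OF assms(2)] z] by simp
qed (simp add: functional_outside)

lemma functional_scale:
  assumes "cauchy u"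
  shows "functional (\<lambda>n x. c * u n x) = (\<lambda>z. c * functional u z)"
proof (rule functional_eqI[OF cauchy_scale[OF assms]])
  fix z assume z: "z \<in> E"
  show "(\<lambda>n. ip (\<lambda>x. c * u n x) z) \<longlonglongrightarrow> c * functional u z"
    using tendsto_mult_left[OF functional_tendsto[OF assms(1) z], of c]
      ip_scale[OF cauchy_in[OF assms(1)] z] by simp
qed (simp add: functional_outside)

lemma functional_sub:
  assumes "cauchy u" "cauchy v"
  shows "functional (\<lambda>n. sub (u n) (v n)) = (\<lambda>z. functional u z - functional v z)"
  using functional_add[OF assms(1) cauchy_scale[OF assms(2), of "-1"]] functional_scale[OF assms(2), of "-1"]
  unfolding sub_def by simp

lemma functional_zero: "functional (\<lambda>_ _. 0) = (\<lambda>_. 0)"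
  using functional_scale[OF cauchy_const[OF zero_in], of 0] by simp

definition VH :: "(real, ('a \<Rightarrow> real) \<Rightarrow> real) module" where
  "VH = \<lparr>carrier = H, mult = (\<lambda>L _. L), one = (\<lambda>_. 0), zero = (\<lambda>_. 0),
     add = (\<lambda>L M z. L z + M z), smult = (\<lambda>t L z. t * L z)\<rparr>"

lemma VH_simps [simp]:
  "carrier VH = H" "zero VH = (\<lambda>_. 0)" "add VH = (\<lambda>L M z. L z + M z)" "smult VH = (\<lambda>t L z. t * L z)"
  by (simp_all add: VH_def)

lemma H_add: "\<lbrakk>L \<in> H; M \<in> H\<rbrakk> \<Longrightarrow> (\<lambda>z. L z + M z) \<in> H"
  using functional_add[OF rep(1) rep(1), of L M] rep functional_in_H[OF cauchy_add[OF rep(1) rep(1)]]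
  by metis

lemma H_scale: "L \<in> H \<Longrightarrow> (\<lambda>z. c * L z) \<in> H"
  using functional_scale[OF rep(1), of L c] rep functional_in_H[OF cauchy_scale[OF rep(1)]]
  by metis

lemma H_zero: "(\<lambda>_. 0) \<in> H"
  using functional_in_H[OF cauchy_const[OF zero_in]] functional_zero by simp

lemma abelian_group_VH: "abelian_group VH"
proof (rule abelian_groupI)
  fix L assume "L \<in> carrier VH"
  then show "\<exists>M\<in>carrier VH. M \<oplus>\<^bsub>VH\<^esub> L = \<zero>\<^bsub>VH\<^esub>"
    using H_scale[of L "-1"] by (intro bexI[of _ "\<lambda>z. -1 * L z"]) auto
qed (use H_add H_zero in \<open>auto simp: add.assoc add.commute\<close>)

lemma VH_minus:
  assumes "L \<in> H" "M \<in> H"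
  shows "L \<ominus>\<^bsub>VH\<^esub> M = (\<lambda>z. L z - M z)"
proof -
  interpret abelian_group VH by (rule abelian_group_VH)
  have "\<ominus>\<^bsub>VH\<^esub> M = (\<lambda>z. - M z)"
    by (rule minus_equality) (use H_scale[OF assms(2), of "-1"] assms in auto)
  then show ?thesis by (simp add: a_minus_def)
qed

lemma ipH_eqI:
  assumes "cauchy u" "cauchy v" "(\<lambda>n. ip (u n) (v n)) \<longlonglongrightarrow> c"
  shows "ipH (functional u) (functional v) = c"
  using LIMSEQ_unique[OF ipH_tendsto[OF assms(1,2)] assms(3)] .

text \<open>The identities pass to the limit. As to definiteness, \<open>ipH L L = 0\<close> makes
  the representing sequence null, and then L is the zero form.\<close>

lemma real_inner_space_VH: "real_inner_space VH ipH"
proof -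
  interpret cring "ring_of_type_algebra :: real ring"
    by (rule cring_from_type_algebra)
  interpret M: Module.module "ring_of_type_algebra :: real ring" VH
  proof (rule Module.moduleI)
    show "cring (ring_of_type_algebra :: real ring)" by (rule cring_from_type_algebra)
    show "abelian_group VH" by (rule abelian_group_VH)
  qed (auto simp: ring_of_type_algebra_def H_scale algebra_simps)
  show ?thesis
  proof
    fix L M assume L: "L \<in> carrier VH" and M: "M \<in> carrier VH"
    then have r: "cauchy (rep L)" "functional (rep L) = L" "cauchy (rep M)" "functional (rep M) = M"
      using rep by auto
    show "ipH L M = ipH M L"
      using ipH_eqI[OF r(1,3), of "ipH M L"] ipH_tendsto[OF r(3,1)] r
        ip_sym[OF cauchy_in[OF r(1)] cauchy_in[OF r(3)]] by simp
    show "ipH (t \<odot>\<^bsub>VH\<^esub> L) M = t * ipH L M" for t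
      using ipH_eqI[OF cauchy_scale[OF r(1)] r(3), of t "t * ipH L M"]
        tendsto_mult_left[OF ipH_tendsto[OF r(1,3)], of t] r functional_scale[OF r(1)]
        ip_scale[OF cauchy_in[OF r(1)] cauchy_in[OF r(3)]] by simp
    fix K assume K: "K \<in> carrier VH"
    then have k: "cauchy (rep K)" "functional (rep K) = K" using rep by auto
    show "ipH (L \<oplus>\<^bsub>VH\<^esub> M) K = ipH L K + ipH M K"
      using ipH_eqI[OF cauchy_add[OF r(1,3)] k(1), of "ipH L K + ipH M K"]
        tendsto_add[OF ipH_tendsto[OF r(1) k(1)] ipH_tendsto[OF r(3) k(1)]] r k
        functional_add[OF r(1,3)] ip_add[OF cauchy_in[OF r(1)] cauchy_in[OF r(3)] cauchy_in[OF k(1)]]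
      by simp
  next
    fix L assume L: "L \<in> carrier VH" and ne: "L \<noteq> \<zero>\<^bsub>VH\<^esub>"
    have r: "cauchy (rep L)" "functional (rep L) = L" using rep L by auto
    have l: "(\<lambda>n. ip (rep L n) (rep L n)) \<longlonglongrightarrow> ipH L L" using ipH_tendsto[OF r(1) r(1)] r by simp
    have "ipH L L \<ge> 0"
      by (rule LIMSEQ_le_const[OF l]) (use ip_nonneg cauchy_in[OF r(1)] in auto)
    moreover have "ipH L L \<noteq> 0"
    proof
      assume "ipH L L = 0"
      then have "(\<lambda>n. nm (rep L n)) \<longlonglongrightarrow> 0" using tendsto_real_sqrt[OF l] unfolding nm_def by simp
      then have "functional (rep L) = functional (\<lambda>_ _. 0)"
        using functional_eq_iff[OF r(1) cauchy_const[OF zero_in]] sub_zero by simp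
      then show False using ne r functional_zero by simp
    qed
    ultimately show "ipH L L > 0" by simp
  qed
qed

lemma ip_dist_tendsto:
  assumes "cauchy u" "cauchy v"
  shows "(\<lambda>n. nm (sub (u n) (v n))) \<longlonglongrightarrow> ip_dist VH ipH (functional u) (functional v)"
proof -
  have "(\<lambda>n. ip (sub (u n) (v n)) (sub (u n) (v n))) \<longlonglongrightarrow>
     ipH (functional (\<lambda>n. sub (u n) (v n))) (functional (\<lambda>n. sub (u n) (v n)))"
    by (rule ipH_tendsto[OF cauchy_sub[OF assms] cauchy_sub[OF assms]])
  then show ?thesis
    unfolding ip_dist_def nm_def
    using VH_minus[OF functional_in_H[OF assms(1)] functional_in_H[OF assms(2)]]
      functional_sub[OF assms] by (simp add: tendsto_real_sqrt)
qed

text \<open>A diagonal argument: each \<open>s n\<close> is approximated within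
  \<open>1 / Suc n\<close> by a single vector w n of E. The sequence w is Cauchy, and its class is
  the limit of s.\<close>

lemma real_hilbert_space_VH: "real_hilbert_space VH ipH"
proof -
  interpret real_inner_space VH ipH by (rule real_inner_space_VH)
  show ?thesis
  proof
    fix s :: "nat \<Rightarrow> ('a \<Rightarrow> real) \<Rightarrow> real"
    assume s: "\<And>n. s n \<in> carrier VH"
      and C: "\<And>e. e > 0 \<Longrightarrow> \<exists>N. \<forall>m\<ge>N. \<forall>n\<ge>N. ip_dist VH ipH (s m) (s n) < e"
    have r: "cauchy (rep (s n))" "functional (rep (s n)) = s n" for n using rep s by auto
    have "\<exists>w\<in>E. ip_dist VH ipH (s n) (functional (\<lambda>_. w)) \<le> 1 / Suc n" for n
    proof -
      have "(1::real) / Suc n > 0" by simp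
      then obtain N where N: "\<forall>m\<ge>N. \<forall>k\<ge>N. nm (sub (rep (s n) m) (rep (s n) k)) < 1 / Suc n"
        using r(1)[of n] unfolding cauchy_def by meson
      let ?w = "rep (s n) N"
      have w: "?w \<in> E" using cauchy_in r by blast
      have "ip_dist VH ipH (s n) (functional (\<lambda>_. ?w)) \<le> 1 / Suc n"
      proof (rule LIMSEQ_le_const2)
        show "(\<lambda>m. nm (sub (rep (s n) m) ?w)) \<longlonglongrightarrow> ip_dist VH ipH (s n) (functional (\<lambda>_. ?w))"
          using ip_dist_tendsto[OF r(1)[of n] cauchy_const[OF w]] r(2)[of n] by simp
        show "\<exists>M. \<forall>m\<ge>M. nm (sub (rep (s n) m) ?w) \<le> 1 / Suc n" using N by (auto intro!: exI[of _ N] less_imp_le)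
      qed
      then show ?thesis using w by blast
    qed
    then obtain w where w: "\<And>n. w n \<in> E" "\<And>n. ip_dist VH ipH (s n) (functional (\<lambda>_. w n)) \<le> 1 / Suc n"
      by metis
    have tri: "ip_dist VH ipH L M \<le> ip_dist VH ipH L K + ip_dist VH ipH K M"
      if "L \<in> H" "M \<in> H" "K \<in> H" for L M K
    proof -
      note q = rep[OF that(1)] rep[OF that(2)] rep[OF that(3)]
      show ?thesis
      proof (rule LIMSEQ_le)
        show "(\<lambda>n. nm (sub (rep L n) (rep M n))) \<longlonglongrightarrow> ip_dist VH ipH L M"
          using ip_dist_tendsto[OF q(1,3)] q by simp
        show "(\<lambda>n. nm (sub (rep L n) (rep K n)) + nm (sub (rep K n) (rep M n))) \<longlonglongrightarrow>
           ip_dist VH ipH L K + ip_dist VH ipH K M"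
          using tendsto_add[OF ip_dist_tendsto[OF q(1,5)] ip_dist_tendsto[OF q(5,3)]] q by simp
        show "\<exists>N. \<forall>n\<ge>N. nm (sub (rep L n) (rep M n)) \<le> nm (sub (rep L n) (rep K n)) + nm (sub (rep K n) (rep M n))"
          using nm_sub_triangle cauchy_in q by blast
      qed
    qed
    have dsym: "ip_dist VH ipH L M = ip_dist VH ipH M L" if "L \<in> H" "M \<in> H" for L M
    proof -
      note q = rep[OF that(1)] rep[OF that(2)]
      show ?thesis
        using LIMSEQ_unique[OF ip_dist_tendsto[OF q(1,3)], of "ip_dist VH ipH M L"]
          ip_dist_tendsto[OF q(3,1)] q nm_sub_sym[OF cauchy_in[OF q(1)] cauchy_in[OF q(3)]] by simp
    qed
    have wH: "functional (\<lambda>_. w n) \<in> H" for n using functional_in_H cauchy_const w by blast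
    have sH: "s n \<in> H" for n using s by simp
    have dw: "nm (sub (w m) (w n)) = ip_dist VH ipH (functional (\<lambda>_. w m)) (functional (\<lambda>_. w n))" for m n
      using LIMSEQ_unique[OF ip_dist_tendsto[OF cauchy_const[OF w(1)[of m]] cauchy_const[OF w(1)[of n]]]]
      by (metis tendsto_const)
    have small: "\<exists>N. \<forall>n\<ge>N. 1 / real (Suc n) < e" if e: "e > 0" for e :: real
      using LIMSEQ_D[OF LIMSEQ_inverse_real_of_nat e] by (auto simp: inverse_eq_divide)
    have cw: "cauchy w"
      unfolding cauchy_def
    proof safe
      show "w n \<in> E" for n by (rule w)
      fix e :: real assume "e > 0"
      then have e: "e / 3 > 0" by simp
      obtain N M where N: "\<forall>n\<ge>N. 1 / real (Suc n) < e / 3"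
        and M: "\<forall>m\<ge>M. \<forall>n\<ge>M. ip_dist VH ipH (s m) (s n) < e / 3"
        using small[OF e] C[OF e] by blast
      have "nm (sub (w m) (w n)) < e" if "m \<ge> max N M" "n \<ge> max N M" for m n
      proof -
        have "nm (sub (w m) (w n)) \<le> ip_dist VH ipH (functional (\<lambda>_. w m)) (s m) +
            (ip_dist VH ipH (s m) (s n) + ip_dist VH ipH (s n) (functional (\<lambda>_. w n)))"
          unfolding dw using tri[OF wH wH sH, of m n m] tri[OF sH wH sH, of m n n] by linarith
        moreover have "ip_dist VH ipH (functional (\<lambda>_. w m)) (s m) < e / 3"
          using dsym[OF wH sH, of m m] w(2)[of m] N that by force
        moreover have "ip_dist VH ipH (s n) (functional (\<lambda>_. w n)) < e / 3"
          using w(2)[of n] N that by force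
        moreover have "ip_dist VH ipH (s m) (s n) < e / 3" using M that by auto
        ultimately show ?thesis by linarith
      qed
      then show "\<exists>N. \<forall>m\<ge>N. \<forall>n\<ge>N. nm (sub (w m) (w n)) < e" by blast
    qed
    have "(\<lambda>n. ip_dist VH ipH (s n) (functional w)) \<longlonglongrightarrow> 0"
    proof (rule LIMSEQ_I)
      fix e :: real assume "e > 0"
      then have e: "e / 3 > 0" by simp
      obtain N M where N: "\<forall>n\<ge>N. 1 / real (Suc n) < e / 3"
        and M: "\<forall>m\<ge>M. \<forall>n\<ge>M. nm (sub (w m) (w n)) < e / 3"
        using small[OF e] cw e unfolding cauchy_def by meson
      have "norm (ip_dist VH ipH (s n) (functional w) - 0) < e" if n: "n \<ge> max N M" for n
      proof -
        have "ip_dist VH ipH (functional (\<lambda>_. w n)) (functional w) \<le> e / 3"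
        proof (rule LIMSEQ_le_const2[OF ip_dist_tendsto[OF cauchy_const[OF w(1)[of n]] cw]])
          show "\<exists>K. \<forall>k\<ge>K. nm (sub (w n) (w k)) \<le> e / 3" using M n by (auto intro!: exI[of _ M] less_imp_le)
        qed
        moreover have "ip_dist VH ipH (s n) (functional (\<lambda>_. w n)) < e / 3"
          using w(2)[of n] N n by force
        moreover have "ip_dist VH ipH (s n) (functional w) \<le>
            ip_dist VH ipH (s n) (functional (\<lambda>_. w n)) + ip_dist VH ipH (functional (\<lambda>_. w n)) (functional w)"
          by (rule tri[OF sH functional_in_H[OF cw] wH])
        moreover have "ip_dist VH ipH (s n) (functional w) \<ge> 0"
          by (rule LIMSEQ_le_const[OF ip_dist_tendsto[OF r(1)[of n] cw, unfolded r(2)]])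
             (use nm_nonneg sub_in cauchy_in r cw in blast)
        ultimately show ?thesis using e by simp
      qed
      then show "\<exists>no. \<forall>n\<ge>no. norm (ip_dist VH ipH (s n) (functional w) - 0) < e" by blast
    qed
    then show "\<exists>x\<in>carrier VH. (\<lambda>n. ip_dist VH ipH (s n) x) \<longlonglongrightarrow> 0"
      using functional_in_H[OF cw] by auto
  qed
qed

section \<open>Extending affine isometries to the completion\<close>

definition affine_isom :: "(('a \<Rightarrow> real) \<Rightarrow> 'a \<Rightarrow> real) \<Rightarrow> bool" where
  "affine_isom F \<longleftrightarrow> (\<forall>u\<in>E. F u \<in> E) \<and> (\<forall>u\<in>E. \<forall>v\<in>E. nm (sub (F u) (F v)) = nm (sub u v)) \<and>
     (\<forall>u\<in>E. \<forall>v\<in>E. \<forall>t. F (\<lambda>x. (1 - t) * u x + t * v x) = (\<lambda>x. (1 - t) * F u x + t * F v x))"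

definition extension :: "(('a \<Rightarrow> real) \<Rightarrow> 'a \<Rightarrow> real) \<Rightarrow> (('a \<Rightarrow> real) \<Rightarrow> real) \<Rightarrow> ('a \<Rightarrow> real) \<Rightarrow> real" where
  "extension F L = functional (\<lambda>n. F (rep L n))"

lemma cauchy_map:
  assumes "affine_isom F" "cauchy u"
  shows "cauchy (\<lambda>n. F (u n))"
  using assms unfolding affine_isom_def cauchy_def by simp

text \<open>Two Cauchy sequences of the same class differ by a null sequence. The isometry F keeps
  it null, so the representative chosen in \<open>extension\<close> is immaterial.\<close>

lemma extension_functional:
  assumes F: "affine_isom F" and u: "cauchy u"
  shows "extension F (functional u) = functional (\<lambda>n. F (u n))"
proof -
  note r = rep[OF functional_in_H[OF u]]
  have "(\<lambda>n. nm (sub (rep (functional u) n) (u n))) \<longlonglongrightarrow> 0"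
    using functional_eq_iff[OF r(1) u] r(2) by simp
  then have "(\<lambda>n. nm (sub (F (rep (functional u) n)) (F (u n)))) \<longlonglongrightarrow> 0"
    using F cauchy_in[OF r(1)] cauchy_in[OF u] unfolding affine_isom_def by simp
  then show ?thesis
    unfolding extension_def using functional_eq_iff[OF cauchy_map[OF F r(1)] cauchy_map[OF F u]] by simp
qed

lemma extension_in: "\<lbrakk>affine_isom F; L \<in> H\<rbrakk> \<Longrightarrow> extension F L \<in> H"
  unfolding extension_def using functional_in_H cauchy_map rep by blast

lemma extension_affine_isometry:
  assumes F: "affine_isom F"
  shows "affine_isometry VH ipH (restrict (extension F) H)"
  unfolding affine_isometry_def
proof (intro conjI ballI allI)
  fix L M assume LM: "L \<in> carrier VH" "M \<in> carrier VH"
  then have r: "cauchy (rep L)" "functional (rep L) = L" "cauchy (rep M)" "functional (rep M) = M"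
    using rep by auto
  have e: "extension F L = functional (\<lambda>n. F (rep L n))" "extension F M = functional (\<lambda>n. F (rep M n))"
    by (simp_all add: extension_def)
  have "(\<lambda>n. nm (sub (F (rep L n)) (F (rep M n)))) \<longlonglongrightarrow> ip_dist VH ipH (extension F L) (extension F M)"
    unfolding e by (rule ip_dist_tendsto[OF cauchy_map[OF F r(1)] cauchy_map[OF F r(3)]])
  moreover have "nm (sub (F (rep L n)) (F (rep M n))) = nm (sub (rep L n) (rep M n))" for n
    using F cauchy_in[OF r(1)] cauchy_in[OF r(3)] unfolding affine_isom_def by blast
  ultimately have "ip_dist VH ipH (extension F L) (extension F M) = ip_dist VH ipH L M"
    using LIMSEQ_unique ip_dist_tendsto[OF r(1,3)] r by simp
  then show "ip_dist VH ipH (restrict (extension F) H L) (restrict (extension F) H M) = ip_dist VH ipH L M"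
    using LM by simp
  fix t :: real
  define w where "w = (\<lambda>n x. (1 - t) * rep L n x + t * rep M n x)"
  have w: "cauchy w" unfolding w_def by (intro cauchy_add cauchy_scale r)
  have "functional w = (\<lambda>z. (1 - t) * L z + t * M z)"
    unfolding w_def functional_add[OF cauchy_scale[OF r(1)] cauchy_scale[OF r(3)]]
      functional_scale[OF r(1)] functional_scale[OF r(3)] r ..
  moreover have "extension F (functional w) = functional (\<lambda>n. F (w n))"
    by (rule extension_functional[OF F w])
  moreover have "F (w n) = (\<lambda>x. (1 - t) * F (rep L n) x + t * F (rep M n) x)" for n
    using F cauchy_in[OF r(1)] cauchy_in[OF r(3)] unfolding affine_isom_def w_def by blast
  moreover have "functional (\<lambda>n x. (1 - t) * F (rep L n) x + t * F (rep M n) x)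
      = (\<lambda>z. (1 - t) * extension F L z + t * extension F M z)"
    unfolding e functional_add[OF cauchy_scale[OF cauchy_map[OF F r(1)]] cauchy_scale[OF cauchy_map[OF F r(3)]]]
      functional_scale[OF cauchy_map[OF F r(1)]] functional_scale[OF cauchy_map[OF F r(3)]] ..
  moreover have "(\<lambda>z. (1 - t) * L z + t * M z) \<in> H" using functional_in_H[OF w] calculation(1) by simp
  ultimately show "restrict (extension F) H ((1 - t) \<odot>\<^bsub>VH\<^esub> L \<oplus>\<^bsub>VH\<^esub> t \<odot>\<^bsub>VH\<^esub> M) =
      (1 - t) \<odot>\<^bsub>VH\<^esub> restrict (extension F) H L \<oplus>\<^bsub>VH\<^esub> t \<odot>\<^bsub>VH\<^esub> restrict (extension F) H M"
    using LM by simp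
qed

text \<open>The extended action has a fixed point L. Vectors approximating L are almost fixed by
  each g, and the origin moves at most twice its distance from an almost fixed vector. The detour
  through \<open>rep L\<close> is necessary because L need not come from E.\<close>

theorem property_T_imp_bounded_orbit:
  fixes G :: "('a \<Rightarrow> real, 'm) monoid_scheme"
  assumes T: "has_property_T G" and G: "group G"
    and F: "\<And>g. g \<in> carrier G \<Longrightarrow> affine_isom (F g)"
    and mult: "\<And>g h u. \<lbrakk>g \<in> carrier G; h \<in> carrier G; u \<in> E\<rbrakk> \<Longrightarrow> F (g \<otimes>\<^bsub>G\<^esub> h) u = F g (F h u)"
    and one: "\<And>u. u \<in> E \<Longrightarrow> F \<one>\<^bsub>G\<^esub> u = u"
  shows "\<exists>C. \<forall>g\<in>carrier G. nm (F g (\<lambda>_. 0)) \<le> C"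
proof -
  interpret group G by fact
  define \<phi> where "\<phi> g = restrict (extension (F g)) H" for g
  have m: "extension (F (g \<otimes>\<^bsub>G\<^esub> h)) L = extension (F g) (extension (F h) L)"
    if "g \<in> carrier G" "h \<in> carrier G" "L \<in> H" for g h L
  proof -
    note r = rep[OF that(3)]
    have "extension (F g) (extension (F h) L) = functional (\<lambda>n. F g (F h (rep L n)))"
      unfolding extension_def[of "F h"]
      by (rule extension_functional[OF F[OF that(1)] cauchy_map[OF F[OF that(2)] r(1)]])
    then show ?thesis unfolding extension_def[of "F (g \<otimes>\<^bsub>G\<^esub> h)"] using mult that cauchy_in[OF r(1)] by simp
  qed
  have o: "extension (F \<one>\<^bsub>G\<^esub>) L = L" if "L \<in> H" for L
    unfolding extension_def using one cauchy_in[OF rep(1)[OF that]] rep(2)[OF that] by simp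
  have bij: "\<phi> g \<in> Bij H" if g: "g \<in> carrier G" for g
  proof -
    have "bij_betw (extension (F g)) H H"
    proof (rule bij_betw_byWitness[of _ "extension (F (inv\<^bsub>G\<^esub> g))"])
      show "\<forall>L\<in>H. extension (F (inv\<^bsub>G\<^esub> g)) (extension (F g) L) = L"
        "\<forall>L\<in>H. extension (F g) (extension (F (inv\<^bsub>G\<^esub> g)) L) = L"
        using m[of "inv\<^bsub>G\<^esub> g" g] m[of g "inv\<^bsub>G\<^esub> g"] o g by auto
    qed (use extension_in F g in auto)
    then show ?thesis unfolding Bij_def \<phi>_def by auto
  qed
  have "group_action G H \<phi>"
    unfolding group_action_def group_hom_def group_hom_axioms_def
  proof (intro conjI homI)
    show "group G" by fact
    show "group (BijGroup H)" by (rule group_BijGroup)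
    show "\<phi> g \<in> carrier (BijGroup H)" if "g \<in> carrier G" for g
      using bij[OF that] by (simp add: BijGroup_def)
    show "\<phi> (g \<otimes>\<^bsub>G\<^esub> h) = \<phi> g \<otimes>\<^bsub>BijGroup H\<^esub> \<phi> h" if "g \<in> carrier G" "h \<in> carrier G" for g h
      using bij[OF that(1)] bij[OF that(2)] m[OF that] extension_in[OF F[OF that(2)]]
      by (auto simp: BijGroup_def \<phi>_def compose_def fun_eq_iff)
  qed
  then have prem: "real_hilbert_space VH ipH \<and> group_action G (carrier VH) \<phi> \<and>
      (\<forall>g\<in>carrier G. affine_isometry VH ipH (\<phi> g))"
    using real_hilbert_space_VH extension_affine_isometry[OF F] unfolding \<phi>_def by simp
  obtain L where L: "L \<in> H" and fixed: "\<And>g. g \<in> carrier G \<Longrightarrow> \<phi> g L = L"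
    using T[unfolded has_property_T_def, rule_format, OF prem] by auto
  note r = rep[OF L]
  obtain C where C: "\<And>n. nm (rep L n) \<le> C" using nm_bounded[OF r(1)] by blast
  have "nm (F g (\<lambda>_. 0)) \<le> 2 * C" if g: "g \<in> carrier G" for g
  proof -
    have FE: "F g u \<in> E" if "u \<in> E" for u using F[OF g] that unfolding affine_isom_def by blast
    have "functional (\<lambda>n. F g (rep L n)) = functional (rep L)"
      using fixed[OF g] L r(2) unfolding \<phi>_def extension_def by simp
    then have "(\<lambda>n. nm (sub (F g (rep L n)) (rep L n))) \<longlonglongrightarrow> 0"
      using functional_eq_iff[OF cauchy_map[OF F[OF g] r(1)] r(1)] by simp
    then have "(\<lambda>n. nm (sub (F g (rep L n)) (rep L n)) + 2 * C) \<longlonglongrightarrow> 0 + 2 * C"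
      by (intro tendsto_intros)
    moreover have "nm (F g (\<lambda>_. 0)) \<le> nm (sub (F g (rep L n)) (rep L n)) + 2 * C" for n
    proof -
      have u: "rep L n \<in> E" using cauchy_in[OF r(1)] .
      have "nm (sub (F g (\<lambda>_. 0)) (F g (rep L n))) = nm (sub (rep L n) (\<lambda>_. 0))"
        using F[OF g] u zero_in nm_sub_sym[OF u zero_in] unfolding affine_isom_def by simp
      moreover have "nm (sub (F g (\<lambda>_. 0)) (\<lambda>_. 0)) \<le> nm (sub (F g (\<lambda>_. 0)) (F g (rep L n))) + nm (sub (F g (rep L n)) (\<lambda>_. 0))"
        by (rule nm_sub_triangle) (use FE u zero_in in auto)
      moreover have "nm (sub (F g (rep L n)) (\<lambda>_. 0)) \<le> nm (sub (F g (rep L n)) (rep L n)) + nm (sub (rep L n) (\<lambda>_. 0))"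
        by (rule nm_sub_triangle) (use FE u zero_in in auto)
      ultimately show ?thesis using C[of n] unfolding sub_zero by linarith
    qed
    ultimately show ?thesis using LIMSEQ_le_const[of _ "0 + 2 * C" "nm (F g (\<lambda>_. 0))"] by auto
  qed
  then show ?thesis by blast
qed

end

section \<open>Piecewise linear homeomorphisms of the line\<close>

text \<open>HOL-Algebra overrides the usual notation for inverse functions.\<close>

abbreviation hinv :: "(real \<Rightarrow> real) \<Rightarrow> real \<Rightarrow> real" where
  "hinv f \<equiv> inv_into UNIV f"

section \<open>Dyadic rationals\<close>

lemma dyadic_iff: "x \<in> dyadic \<longleftrightarrow> (\<exists>n. x * 2 ^ n \<in> \<int>)"
proof
  assume "x \<in> dyadic"
  then obtain m n where "x = of_int m / 2 ^ n" unfolding dyadic_def by blast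
  then have "x * 2 ^ n = of_int m" by simp
  then show "\<exists>n. x * 2 ^ n \<in> \<int>" by (metis Ints_of_int)
next
  assume "\<exists>n. x * 2 ^ n \<in> \<int>"
  then obtain m n where "x * 2 ^ n = of_int m" by (auto elim: Ints_cases)
  then have "x = of_int m / 2 ^ n" by (simp add: field_simps)
  then show "x \<in> dyadic" unfolding dyadic_def by blast
qed

lemma dyadic_add [intro]:
  assumes "x \<in> dyadic" "y \<in> dyadic"
  shows "x + y \<in> dyadic"
proof -
  obtain m n where "x * 2 ^ m \<in> \<int>" "y * 2 ^ n \<in> \<int>" using assms dyadic_iff by blast
  then have "(x * 2 ^ m) * 2 ^ n + (y * 2 ^ n) * 2 ^ m \<in> \<int>"
    by (intro Ints_add Ints_mult[of "x * 2 ^ m"] Ints_mult[of "y * 2 ^ n"] Ints_power) auto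
  then have "(x + y) * 2 ^ (m + n) \<in> \<int>" by (simp add: power_add algebra_simps)
  then show ?thesis using dyadic_iff by blast
qed

lemma dyadic_minus [intro]: "x \<in> dyadic \<Longrightarrow> - x \<in> dyadic"
  unfolding dyadic_iff by (metis Ints_minus mult_minus_left)

lemma dyadic_diff [intro]: "\<lbrakk>x \<in> dyadic; y \<in> dyadic\<rbrakk> \<Longrightarrow> x - y \<in> dyadic"
  using dyadic_add[of x "- y"] by auto

lemma dyadic_minus_iff [simp]: "- x \<in> dyadic \<longleftrightarrow> x \<in> dyadic"
  using dyadic_minus[of x] dyadic_minus[of "- x"] by auto

lemma dyadic_of_int [simp]: "of_int k \<in> dyadic"
  unfolding dyadic_iff by (rule exI[of _ 0]) simp

lemma dyadic_numerals [simp]: "0 \<in> dyadic" "1 \<in> dyadic" "numeral w \<in> dyadic"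
  using dyadic_of_int[of 0] dyadic_of_int[of 1] dyadic_of_int[of "numeral w"] by simp_all

lemma dyadic_double: "x \<in> dyadic \<Longrightarrow> 2 * x \<in> dyadic"
  using dyadic_add[of x x] by simp

lemma dyadic_half: "x \<in> dyadic \<Longrightarrow> x / 2 \<in> dyadic"
  unfolding dyadic_iff by (metis nonzero_eq_divide_eq power_Suc2 times_divide_eq_left times_divide_eq_right zero_neq_numeral mult.commute)

lemma dyadic_powi:
  assumes "x \<in> dyadic"
  shows "2 powi k * x \<in> dyadic"
proof -
  have 1: "2 ^ n * x \<in> dyadic" for n
    by (induction n) (use assms dyadic_double in \<open>auto simp: mult.assoc\<close>)
  have 2: "x / 2 ^ n \<in> dyadic" for n
  proof (induction n)
    case (Suc n)
    then show ?case using dyadic_half[OF Suc] by (simp add: mult.commute)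
  qed (use assms in simp)
  show ?thesis
  proof (cases "k \<ge> 0")
    case True
    then show ?thesis using 1[of "nat k"] by (simp add: power_int_def)
  next
    case False
    then show ?thesis using 2[of "nat (- k)"] by (simp add: power_int_def field_simps)
  qed
qed

lemma dyadic_powi_iff [simp]: "2 powi k * x \<in> dyadic \<longleftrightarrow> x \<in> dyadic"
proof
  assume "2 powi k * x \<in> dyadic"
  then have "2 powi (- k) * (2 powi k * x) \<in> dyadic" by (rule dyadic_powi)
  then show "x \<in> dyadic" by (simp add: power_int_minus flip: mult.assoc)
qed (rule dyadic_powi)

lemma dyadic_powi_1 [simp]: "2 powi k \<in> dyadic"
  using dyadic_powi[of 1 k] by simp

lemma dyadic_add_cancel: "y \<in> dyadic \<Longrightarrow> x + y \<in> dyadic \<longleftrightarrow> x \<in> dyadic"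
  using dyadic_diff[of "x + y" y] by auto

lemma dyadic_dense:
  assumes "a < (b::real)"
  obtains x where "x \<in> dyadic" "a < x" "x < b"
proof -
  obtain n where n: "1 / 2 ^ n < b - a"
    using real_arch_pow_inv[of "b - a" "1/2"] assms by (auto simp: power_divide)
  define m where "m = \<lfloor>a * 2 ^ n\<rfloor> + 1"
  have "a * 2 ^ n < of_int m" "of_int m \<le> a * 2 ^ n + 1"
    using floor_correct[of "a * 2 ^ n"] unfolding m_def by simp_all
  then have "a < of_int m / 2 ^ n" "of_int m / 2 ^ n \<le> a + 1 / 2 ^ n"
    by (simp_all add: pos_less_divide_eq pos_divide_le_eq distrib_right)
  moreover have "of_int m / 2 ^ n \<in> dyadic" unfolding dyadic_def by blast
  ultimately show ?thesis using that n by force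
qed

lemma powi_2_inj: "(2::real) powi k = 2 powi l \<longleftrightarrow> k = l"
proof -
  have *: "(2::real) powi m = 2 powr of_int m" for m by (simp add: powr_real_of_int')
  show ?thesis unfolding * by (subst powr_inj) auto
qed

lemma powi_cancel [simp]:
  "(2::real) powi k * (2 powi (- k) * z) = z" "(2::real) powi (- k) * (2 powi k * z) = z"
  by (simp_all add: power_int_minus flip: mult.assoc)

text \<open>Conjugation by the reflection at 0. It reduces left germs to right germs, and after
  centring a cell at 0 it becomes the flip.\<close>

definition neg :: "(real \<Rightarrow> real) \<Rightarrow> real \<Rightarrow> real" where "neg f x = - f (- x)"

lemma neg_neg [simp]: "neg (neg f) = f"
  by (auto simp: neg_def)

lemma neg_comp: "neg (f \<circ> g) = neg f \<circ> neg g"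
  by (auto simp: neg_def)

lemma neg_id [simp]: "neg id = id"
  by (auto simp: neg_def)

section \<open>One-sided linear germs whose slopes are powers of 2\<close>

definition rlin :: "(real \<Rightarrow> real) \<Rightarrow> real \<Rightarrow> int \<Rightarrow> bool" where
  "rlin f x k \<longleftrightarrow> (\<exists>e>0. \<forall>y. x \<le> y \<and> y \<le> x + e \<longrightarrow> f y = f x + 2 powi k * (y - x))"

definition llin :: "(real \<Rightarrow> real) \<Rightarrow> real \<Rightarrow> int \<Rightarrow> bool" where
  "llin f x k \<longleftrightarrow> rlin (neg f) (- x) k"

lemma llin_iff: "llin f x k \<longleftrightarrow> (\<exists>e>0. \<forall>y. x - e \<le> y \<and> y \<le> x \<longrightarrow> f y = f x + 2 powi k * (y - x))"
proof
  assume "llin f x k"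
  then obtain e where e: "e > 0" "\<And>y. - x \<le> y \<and> y \<le> - x + e \<Longrightarrow> neg f y = neg f (- x) + 2 powi k * (y + x)"
    unfolding llin_def rlin_def by auto
  have "f y = f x + 2 powi k * (y - x)" if "x - e \<le> y" "y \<le> x" for y
    using e(2)[of "- y"] that by (simp add: neg_def algebra_simps)
  then show "\<exists>e>0. \<forall>y. x - e \<le> y \<and> y \<le> x \<longrightarrow> f y = f x + 2 powi k * (y - x)" using e(1) by blast
next
  assume "\<exists>e>0. \<forall>y. x - e \<le> y \<and> y \<le> x \<longrightarrow> f y = f x + 2 powi k * (y - x)"
  then obtain e where e: "e > 0" "\<And>y. x - e \<le> y \<and> y \<le> x \<Longrightarrow> f y = f x + 2 powi k * (y - x)" by blast
  have "neg f y = neg f (- x) + 2 powi k * (y - (- x))" if "- x \<le> y" "y \<le> - x + e" for y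
    using e(2)[of "- y"] that by (simp add: neg_def algebra_simps)
  then show "llin f x k" unfolding llin_def rlin_def using e(1) by blast
qed

lemma rlin_neg [simp]: "rlin (neg f) x k \<longleftrightarrow> llin f (- x) k"
  and llin_neg [simp]: "llin (neg f) x k \<longleftrightarrow> rlin f (- x) k"
  by (simp_all add: llin_def)

lemma rlin_cong:
  assumes "rlin f x k" "e > 0" "\<And>y. x \<le> y \<and> y \<le> x + e \<Longrightarrow> g y = f y"
  shows "rlin g x k"
proof -
  obtain e' where e': "e' > 0" "\<forall>y. x \<le> y \<and> y \<le> x + e' \<longrightarrow> f y = f x + 2 powi k * (y - x)"
    using assms(1) unfolding rlin_def by blast
  have "g y = g x + 2 powi k * (y - x)" if "x \<le> y \<and> y \<le> x + min e e'" for y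
  proof -
    have "y \<le> x + e" "y \<le> x + e'" using that by auto
    then show ?thesis using assms(3)[of y] assms(3)[of x] e'(2)[rule_format, of y] that assms(2) by simp
  qed
  moreover have "min e e' > 0" using assms(2) e'(1) by simp
  ultimately show ?thesis unfolding rlin_def by blast
qed

lemma llin_cong:
  assumes "llin f x k" "e > 0" "\<And>y. x - e \<le> y \<and> y \<le> x \<Longrightarrow> g y = f y"
  shows "llin g x k"
  unfolding llin_def
proof (rule rlin_cong[OF assms(1)[unfolded llin_def] assms(2)])
  fix y assume "- x \<le> y \<and> y \<le> - x + e"
  then show "neg g y = neg f y" using assms(3)[of "- y"] by (simp add: neg_def)
qed

lemma rlin_unique:
  assumes "rlin f x k" "rlin f x l"
  shows "k = l"
proof -
  obtain a b where ab: "a > 0" "\<forall>y. x \<le> y \<and> y \<le> x + a \<longrightarrow> f y = f x + 2 powi k * (y - x)"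
    "b > 0" "\<forall>y. x \<le> y \<and> y \<le> x + b \<longrightarrow> f y = f x + 2 powi l * (y - x)"
    using assms unfolding rlin_def by blast
  define m where "m = min a b"
  have m: "m > 0" "m \<le> a" "m \<le> b" using ab(1,3) unfolding m_def by auto
  have "f (x + m) = f x + 2 powi k * m" "f (x + m) = f x + 2 powi l * m"
    using ab(2)[rule_format, of "x + m"] ab(4)[rule_format, of "x + m"] m by auto
  then have "2 powi k * m = 2 powi l * m" by linarith
  then have "(2::real) powi k = 2 powi l" using m(1) by (metis mult_right_cancel less_irrefl)
  then show ?thesis using powi_2_inj by blast
qed

lemma llin_unique: "\<lbrakk>llin f x k; llin f x l\<rbrakk> \<Longrightarrow> k = l"
  unfolding llin_def by (rule rlin_unique)

lemma rlin_comp: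
  assumes "rlin f x k" "rlin g (f x) l"
  shows "rlin (g \<circ> f) x (k + l)"
proof -
  obtain a b where ab: "a > 0" "\<forall>y. x \<le> y \<and> y \<le> x + a \<longrightarrow> f y = f x + 2 powi k * (y - x)"
    "b > 0" "\<forall>y. f x \<le> y \<and> y \<le> f x + b \<longrightarrow> g y = g (f x) + 2 powi l * (y - f x)"
    using assms unfolding rlin_def by blast
  \<comment> \<open>As f stretches by \<open>2 powi k\<close>, this bound keeps f y in the interval
    on which g is known to be linear.\<close>
  define e where "e = min a (b / 2 powi k)"
  have "(g \<circ> f) y = (g \<circ> f) x + 2 powi (k + l) * (y - x)" if y: "x \<le> y" "y \<le> x + e" for y
  proof -
    have fy: "f y = f x + 2 powi k * (y - x)" using ab(2)[rule_format, of y] y unfolding e_def by simp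
    have "y - x \<le> b / 2 powi k" using y unfolding e_def by auto
    then have "2 powi k * (y - x) \<le> b" by (simp add: pos_le_divide_eq mult.commute)
    moreover have "0 \<le> 2 powi k * (y - x)" using y by simp
    ultimately have "g (f y) = g (f x) + 2 powi l * (f y - f x)" using ab(4)[rule_format, of "f y"] fy by simp
    then show ?thesis using fy by (simp add: power_int_add)
  qed
  moreover have "e > 0" using ab(1,3) unfolding e_def by simp
  ultimately show ?thesis unfolding rlin_def by blast
qed

lemma llin_comp: "\<lbrakk>llin f x k; llin g (f x) l\<rbrakk> \<Longrightarrow> llin (g \<circ> f) x (k + l)"
  unfolding llin_def neg_comp by (rule rlin_comp) (auto simp: neg_def)

lemma rlin_id: "rlin id x 0"
  unfolding rlin_def by (auto intro!: exI[of _ 1])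

lemma llin_id: "llin id x 0"
  unfolding llin_def by (simp add: rlin_id)

section \<open>Increasing homeomorphisms of the line\<close>

definition homeo :: "(real \<Rightarrow> real) \<Rightarrow> bool" where
  "homeo f \<longleftrightarrow> strict_mono f \<and> surj f"

lemma homeo_less: "homeo f \<Longrightarrow> f x < f y \<longleftrightarrow> x < y"
  and homeo_le: "homeo f \<Longrightarrow> f x \<le> f y \<longleftrightarrow> x \<le> y"
  and homeo_eq: "homeo f \<Longrightarrow> f x = f y \<longleftrightarrow> x = y"
  unfolding homeo_def by (auto simp: strict_mono_less strict_mono_less_eq strict_mono_eq)

lemma homeo_bij: "homeo f \<Longrightarrow> bij f"
  unfolding homeo_def bij_def by (auto simp: strict_mono_imp_inj_on)

lemma homeo_inv_f: "homeo f \<Longrightarrow> hinv f (f x) = x"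
  and homeo_f_inv: "homeo f \<Longrightarrow> f (hinv f x) = x"
  using homeo_bij bij_def by (metis inv_f_f, metis homeo_def surj_f_inv_f)

lemma homeo_id [simp]: "homeo id"
  unfolding homeo_def strict_mono_def by simp

lemma homeo_comp: "\<lbrakk>homeo f; homeo g\<rbrakk> \<Longrightarrow> homeo (g \<circ> f)"
  unfolding homeo_def using comp_surj[of f g] unfolding strict_mono_def comp_apply by blast

lemma homeo_inv:
  assumes "homeo f"
  shows "homeo (hinv f)"
  unfolding homeo_def
proof
  show "strict_mono (hinv f)"
  proof (rule strict_monoI)
    fix x y :: real assume "x < y"
    then have "f (hinv f x) < f (hinv f y)" by (simp add: homeo_f_inv[OF assms])
    then show "hinv f x < hinv f y" by (simp add: homeo_less[OF assms])
  qed
  show "surj (hinv f)" by (rule surjI[of _ f]) (rule homeo_inv_f[OF assms])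
qed

lemma homeo_neg: "homeo f \<Longrightarrow> homeo (neg f)"
  unfolding homeo_def
proof
  assume f: "strict_mono f \<and> surj f"
  show "strict_mono (neg f)" using f by (auto simp: neg_def strict_mono_def)
  show "surj (neg f)"
  proof (rule surjI)
    fix y show "neg f (- hinv f (- y)) = y" using f by (simp add: neg_def surj_f_inv_f)
  qed
qed

lemma neg_inv: "homeo f \<Longrightarrow> neg (hinv f) = hinv (neg f)"
proof
  fix x assume f: "homeo f"
  have "neg f (neg (hinv f) x) = x" by (simp add: neg_def homeo_f_inv[OF f])
  then show "neg (hinv f) x = hinv (neg f) x" using homeo_inv_f[OF homeo_neg[OF f]] by metis
qed

lemma homeo_continuous:
  assumes "homeo f"
  shows "continuous_on S f"
proof -
  have "\<exists>d>0. \<forall>y. \<bar>y - x\<bar> < d \<longrightarrow> \<bar>f y - f x\<bar> < e" if "e > 0" for x e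
  proof -
    define a b where "a = hinv f (f x - e)" and "b = hinv f (f x + e)"
    have ab: "f a = f x - e" "f b = f x + e" unfolding a_def b_def using homeo_f_inv[OF assms] by auto
    then have l: "a < x" "x < b" using homeo_less[OF assms] that by (metis diff_gt_0_iff_gt less_add_same_cancel1 diff_diff_eq2 add_diff_cancel_left', metis less_add_same_cancel1)
    have "\<bar>f y - f x\<bar> < e" if "\<bar>y - x\<bar> < min (x - a) (b - x)" for y
    proof -
      have "a < y" "y < b" using that by auto
      then have "f a < f y" "f y < f b" using homeo_less[OF assms] by auto
      then show ?thesis using ab by auto
    qed
    then show ?thesis using l by (intro exI[of _ "min (x - a) (b - x)"]) auto
  qed
  then have "isCont f x" for x
    unfolding continuous_at_eps_delta dist_real_def by blast
  then show ?thesis by (simp add: continuous_at_imp_continuous_on)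
qed

lemma rlin_inv:
  assumes f: "homeo f" and k: "rlin f x k"
  shows "rlin (hinv f) (f x) (- k)"
proof -
  obtain e where e: "e > 0" "\<forall>y. x \<le> y \<and> y \<le> x + e \<longrightarrow> f y = f x + 2 powi k * (y - x)"
    using k unfolding rlin_def by blast
  have "hinv f y = hinv f (f x) + 2 powi (- k) * (y - f x)" if y: "f x \<le> y" "y \<le> f x + 2 powi k * e" for y
  proof -
    define z where "z = x + 2 powi (- k) * (y - f x)"
    have "0 \<le> 2 powi (- k) * (y - f x)" using y by simp
    moreover have "2 powi (- k) * (y - f x) \<le> e"
      using y by (simp add: power_int_minus field_simps)
    ultimately have "f z = f x + 2 powi k * (z - x)" using e(2)[rule_format, of z] unfolding z_def by simp
    also have "\<dots> = y" unfolding z_def by simp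
    finally have "hinv f y = z" using homeo_inv_f[OF f] by metis
    then show ?thesis unfolding z_def homeo_inv_f[OF f] .
  qed
  moreover have "2 powi k * e > 0" using e(1) by simp
  ultimately show ?thesis unfolding rlin_def by blast
qed

lemma llin_inv: "\<lbrakk>homeo f; llin f x k\<rbrakk> \<Longrightarrow> llin (hinv f) (f x) (- k)"
proof -
  assume f: "homeo f" and k: "llin f x k"
  have "rlin (hinv (neg f)) (neg f (- x)) (- k)"
    by (rule rlin_inv[OF homeo_neg[OF f] k[unfolded llin_def]])
  then show ?thesis unfolding llin_def neg_inv[OF f] by (simp add: neg_def)
qed

text \<open>Preservation of the dyadic points makes the dyadic breaks stable under composition: g
  composed with f may break at x because g breaks at f x. That breaks are finite in number on
  bounded intervals follows from the one-sided germs by compactness.\<close>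

definition PL2 :: "(real \<Rightarrow> real) set" where
  "PL2 = {f. homeo f \<and> (\<forall>x. (\<exists>k. rlin f x k) \<and> (\<exists>k. llin f x k)) \<and>
     (\<forall>x k l. rlin f x k \<longrightarrow> llin f x l \<longrightarrow> k \<noteq> l \<longrightarrow> x \<in> dyadic) \<and>
     (\<forall>x. f x \<in> dyadic \<longleftrightarrow> x \<in> dyadic)}"

lemma PL2_homeo: "f \<in> PL2 \<Longrightarrow> homeo f"
  and PL2_rlin: "f \<in> PL2 \<Longrightarrow> \<exists>k. rlin f x k"
  and PL2_llin: "f \<in> PL2 \<Longrightarrow> \<exists>k. llin f x k"
  and PL2_break: "\<lbrakk>f \<in> PL2; rlin f x k; llin f x l; k \<noteq> l\<rbrakk> \<Longrightarrow> x \<in> dyadic"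
  and PL2_dyadic: "f \<in> PL2 \<Longrightarrow> f x \<in> dyadic \<longleftrightarrow> x \<in> dyadic"
  unfolding PL2_def by simp_all

lemma PL2I:
  assumes "homeo f" "\<And>x. \<exists>k l. rlin f x k \<and> llin f x l \<and> (k \<noteq> l \<longrightarrow> x \<in> dyadic)"
    and "\<And>x. f x \<in> dyadic \<longleftrightarrow> x \<in> dyadic"
  shows "f \<in> PL2"
  unfolding PL2_def using assms rlin_unique llin_unique by blast

lemma PL2_id [simp]: "id \<in> PL2"
  by (rule PL2I) (auto intro!: exI[of _ 0] rlin_id llin_id)

lemma PL2_comp:
  assumes f: "f \<in> PL2" and g: "g \<in> PL2"
  shows "g \<circ> f \<in> PL2"
proof (rule PL2I)
  show "homeo (g \<circ> f)" using homeo_comp PL2_homeo f g by blast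
  fix x
  obtain k l k' l' where *: "rlin f x k" "llin f x l" "rlin g (f x) k'" "llin g (f x) l'"
    using PL2_rlin PL2_llin f g by meson
  have "x \<in> dyadic" if "k + k' \<noteq> l + l'"
    using that PL2_break[OF f *(1,2)] PL2_break[OF g *(3,4)] PL2_dyadic[OF f] by auto
  then show "\<exists>k l. rlin (g \<circ> f) x k \<and> llin (g \<circ> f) x l \<and> (k \<noteq> l \<longrightarrow> x \<in> dyadic)"
    using rlin_comp[OF *(1,3)] llin_comp[OF *(2,4)] by blast
  show "(g \<circ> f) x \<in> dyadic \<longleftrightarrow> x \<in> dyadic" using PL2_dyadic f g by simp
qed

lemma PL2_inv:
  assumes f: "f \<in> PL2"
  shows "hinv f \<in> PL2"
proof (rule PL2I)
  note h = PL2_homeo[OF f]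
  show "homeo (hinv f)" by (rule homeo_inv[OF h])
  fix y
  obtain k l where *: "rlin f (hinv f y) k" "llin f (hinv f y) l" using PL2_rlin PL2_llin f by meson
  have "y \<in> dyadic" if "k \<noteq> l"
    using PL2_break[OF f * that] PL2_dyadic[OF f, of "hinv f y"] homeo_f_inv[OF h] by simp
  then show "\<exists>k l. rlin (hinv f) y k \<and> llin (hinv f) y l \<and> (k \<noteq> l \<longrightarrow> y \<in> dyadic)"
    using rlin_inv[OF h *(1)] llin_inv[OF h *(2)] homeo_f_inv[OF h] by auto
  show "hinv f y \<in> dyadic \<longleftrightarrow> y \<in> dyadic"
    using PL2_dyadic[OF f, of "hinv f y"] homeo_f_inv[OF h] by simp
qed

lemma PL2_neg:
  assumes f: "f \<in> PL2"
  shows "neg f \<in> PL2"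
proof (rule PL2I)
  show "homeo (neg f)" using homeo_neg PL2_homeo f by blast
  fix x
  obtain k l where *: "rlin f (- x) k" "llin f (- x) l" using PL2_rlin PL2_llin f by meson
  then show "\<exists>k l. rlin (neg f) x k \<and> llin (neg f) x l \<and> (k \<noteq> l \<longrightarrow> x \<in> dyadic)"
    using PL2_break[OF f *] by auto
  show "neg f x \<in> dyadic \<longleftrightarrow> x \<in> dyadic"
    using PL2_dyadic[OF f, of "- x"] by (simp add: neg_def)
qed

definition rs :: "(real \<Rightarrow> real) \<Rightarrow> real \<Rightarrow> int" where "rs f x = (THE k. rlin f x k)"

definition ls :: "(real \<Rightarrow> real) \<Rightarrow> real \<Rightarrow> int" where "ls f x = (THE k. llin f x k)"

lemma rs_eq: "rlin f x k \<Longrightarrow> rs f x = k"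
  unfolding rs_def using rlin_unique by blast

lemma ls_eq: "llin f x k \<Longrightarrow> ls f x = k"
  unfolding ls_def using llin_unique by blast

lemma rlin_rs: "f \<in> PL2 \<Longrightarrow> rlin f x (rs f x)"
  using PL2_rlin rs_eq by metis

lemma llin_ls: "f \<in> PL2 \<Longrightarrow> llin f x (ls f x)"
  using PL2_llin ls_eq by metis

lemma rs_comp: "\<lbrakk>f \<in> PL2; g \<in> PL2\<rbrakk> \<Longrightarrow> rs (g \<circ> f) x = rs f x + rs g (f x)"
  by (intro rs_eq rlin_comp rlin_rs)

lemma ls_comp: "\<lbrakk>f \<in> PL2; g \<in> PL2\<rbrakk> \<Longrightarrow> ls (g \<circ> f) x = ls f x + ls g (f x)"
  by (intro ls_eq llin_comp llin_ls)

definition aff :: "int \<Rightarrow> real \<Rightarrow> real \<Rightarrow> real" where "aff n t x = 2 powi n * x + t"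

lemma aff_homeo: "homeo (aff n t)"
  unfolding homeo_def
proof
  show "strict_mono (aff n t)" by (auto simp: strict_mono_def aff_def)
  show "surj (aff n t)"
    by (rule surjI[of _ "\<lambda>y. 2 powi (- n) * (y - t)"]) (simp add: aff_def)
qed

lemma aff_inv: "hinv (aff n t) y = 2 powi (- n) * (y - t)"
proof -
  have "aff n t (2 powi (- n) * (y - t)) = y" by (simp add: aff_def)
  then show ?thesis using homeo_inv_f[OF aff_homeo] by metis
qed

lemma aff_PL2: "t \<in> dyadic \<Longrightarrow> aff n t \<in> PL2"
proof (rule PL2I[OF aff_homeo])
  fix x
  have "rlin (aff n t) x n" unfolding rlin_def aff_def by (auto intro!: exI[of _ 1] simp: algebra_simps)
  moreover have "llin (aff n t) x n" unfolding llin_iff aff_def by (auto intro!: exI[of _ 1] simp: algebra_simps)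
  ultimately show "\<exists>k l. rlin (aff n t) x k \<and> llin (aff n t) x l \<and> (k \<noteq> l \<longrightarrow> x \<in> dyadic)" by blast
  assume t: "t \<in> dyadic"
  show "aff n t x \<in> dyadic \<longleftrightarrow> x \<in> dyadic"
    unfolding aff_def using dyadic_add_cancel[OF t] by simp
qed

text \<open>A single change of slope at p, with the identity to the left. All explicit elements of
  \<open>PL2\<close> with several breaks are composed of these.\<close>

definition kink :: "real \<Rightarrow> int \<Rightarrow> real \<Rightarrow> real" where
  "kink p k x = (if x \<le> p then x else p + 2 powi k * (x - p))"

lemma kink_PL2:
  assumes p: "p \<in> dyadic"
  shows "kink p k \<in> PL2"
proof (rule PL2I)
  show "homeo (kink p k)"
    unfolding homeo_def
  proof
    show "strict_mono (kink p k)"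
    proof (rule strict_monoI)
      fix x y :: real assume "x < y"
      moreover have "0 < 2 powi k * (y - p)" if "y > p" using that by simp
      moreover have "2 powi k * (x - p) < 2 powi k * (y - p)" using \<open>x < y\<close> by simp
      ultimately show "kink p k x < kink p k y"
        unfolding kink_def by (cases "x \<le> p"; cases "y \<le> p") (simp, smt (verit), linarith, simp)
    qed
    show "surj (kink p k)"
    proof (rule surjI[of _ "kink p (- k)"])
      fix y show "kink p k (kink p (- k) y) = y"
      proof (cases "y \<le> p")
        case False
        define z where "z = 2 powi (- k) * (y - p)"
        have "0 < z" "2 powi k * z = y - p" "kink p (- k) y = p + z"
          using False unfolding z_def by (auto simp: kink_def)
        then show ?thesis by (simp add: kink_def)
      qed (simp add: kink_def)
    qed
  qed
  fix x
  have "rlin (kink p k) x (if x < p then 0 else k)"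
  proof (cases "x < p")
    case True
    then show ?thesis unfolding rlin_def by (auto intro!: exI[of _ "p - x"] simp: kink_def)
  next
    case False
    then show ?thesis unfolding rlin_def by (auto intro!: exI[of _ 1] simp: kink_def algebra_simps)
  qed
  moreover have "llin (kink p k) x (if x \<le> p then 0 else k)"
  proof (cases "x \<le> p")
    case True
    then show ?thesis unfolding llin_iff by (auto intro!: exI[of _ 1] simp: kink_def)
  next
    case False
    have "kink p k y = kink p k x + 2 powi k * (y - x)" if "x - (x - p)/2 \<le> y \<and> y \<le> x" for y
    proof -
      have "p < y" using that False by (simp add: field_simps)
      then show ?thesis using False by (simp add: kink_def algebra_simps)
    qed
    moreover have "(x - p)/2 > 0" using False by simp
    ultimately have "llin (kink p k) x k" unfolding llin_iff by blast
    then show ?thesis using False by simp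
  qed
  ultimately show "\<exists>k' l. rlin (kink p k) x k' \<and> llin (kink p k) x l \<and> (k' \<noteq> l \<longrightarrow> x \<in> dyadic)"
    using p by (metis linorder_less_linear order_less_le)
  show "kink p k x \<in> dyadic \<longleftrightarrow> x \<in> dyadic"
  proof (cases "x \<le> p")
    case False
    then have "kink p k x \<in> dyadic \<longleftrightarrow> 2 powi k * (x - p) + p \<in> dyadic" by (simp add: kink_def add.commute)
    also have "\<dots> \<longleftrightarrow> x - p \<in> dyadic" using dyadic_add_cancel[OF p] by simp
    also have "\<dots> \<longleftrightarrow> x \<in> dyadic" using dyadic_add_cancel[OF dyadic_minus[OF p], of x] by simp
    finally show ?thesis .
  qed (simp add: kink_def)
qed

section \<open>Maps with bounded support\<close>

definition F_on :: "real \<Rightarrow> real \<Rightarrow> (real \<Rightarrow> real) set" where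
  "F_on a b = {f \<in> PL2. \<forall>x. x \<le> a \<or> b \<le> x \<longrightarrow> f x = x}"

text \<open>Support in a compact part of the open interval. For (-1/2, 1/2) this is the centred form
  of the commutator subgroup of Thompson's group; the ends a and b may be arbitrary reals, dyadic or
  not.\<close>

definition Q_on :: "real \<Rightarrow> real \<Rightarrow> (real \<Rightarrow> real) set" where
  "Q_on a b = (\<Union>c\<in>{a<..}. \<Union>d\<in>{c..<b}. F_on c d)"

lemma Q_on_iff: "f \<in> Q_on a b \<longleftrightarrow> (\<exists>c d. a < c \<and> c \<le> d \<and> d < b \<and> f \<in> F_on c d)"
  unfolding Q_on_def by fastforce

lemma F_on_PL2: "f \<in> F_on a b \<Longrightarrow> f \<in> PL2"
  and F_on_homeo: "f \<in> F_on a b \<Longrightarrow> homeo f"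
  and F_on_outside: "\<lbrakk>f \<in> F_on a b; x \<le> a \<or> b \<le> x\<rbrakk> \<Longrightarrow> f x = x"
  unfolding F_on_def using PL2_homeo by auto

text \<open>The end points of the interval are fixed too: otherwise a point strictly between x and f
  x, or its preimage, would lie in the fixed region and contradict monotonicity.\<close>

lemma F_on_closed_outside:
  assumes "f \<in> PL2" "\<And>x. x < a \<or> b < x \<Longrightarrow> f x = x"
  shows "f \<in> F_on a b"
proof -
  note h = PL2_homeo[OF assms(1)]
  have ends: "f x = x" if xe: "x = a \<or> x = b" for x
  proof (rule ccontr)
    assume ne: "f x \<noteq> x"
    define z where "z = (x + f x) / 2"
    have z: "(x < z \<and> z < f x) \<or> (f x < z \<and> z < x)" using ne unfolding z_def by (auto simp: field_simps)
    have "f y = y" if "y < a \<or> b < y" for y using assms(2) that by blast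
    obtain w where w: "f w = z" using homeo_f_inv[OF h] by blast
    have "f x < x \<or> x < f x" using ne by linarith
    then consider "x = a" "f x < x" | "x = a" "x < f x" | "x = b" "f x < x" | "x = b" "x < f x"
      using xe by blast
    then show False
    proof cases
      case 1
      then have "z < a" using z by auto
      then have "f z = z" using assms(2) by blast
      then show False using homeo_less[OF h, of x z] 1 z by auto
    next
      case 2
      then have "w < x" using w z homeo_less[OF h, of w x] by auto
      then have "f w = w" using assms(2) 2 by blast
      then show False using w z 2 \<open>w < x\<close> by auto
    next
      case 3
      then have "x < w" using w z homeo_less[OF h, of x w] by auto
      then have "f w = w" using assms(2) 3 by blast
      then show False using w z 3 \<open>x < w\<close> by auto
    next
      case 4
      then have "b < z" using z by auto
      then have "f z = z" using assms(2) by blast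
      then show False using homeo_less[OF h, of z x] 4 z by auto
    qed
  qed
  have "f x = x" if "x \<le> a \<or> b \<le> x" for x
  proof -
    have "(x < a \<or> b < x) \<or> (x = a \<or> x = b)" using that by linarith
    then show ?thesis using assms(2) ends by blast
  qed
  then show ?thesis unfolding F_on_def using assms(1) by blast
qed

lemma F_on_id [simp]: "id \<in> F_on a b"
  unfolding F_on_def by simp

lemma F_on_comp: "\<lbrakk>f \<in> F_on a b; g \<in> F_on a b\<rbrakk> \<Longrightarrow> g \<circ> f \<in> F_on a b"
  unfolding F_on_def using PL2_comp by auto

lemma F_on_inv:
  assumes "f \<in> F_on a b"
  shows "hinv f \<in> F_on a b"
proof -
  have "hinv f x = x" if "x \<le> a \<or> b \<le> x" for x
    using F_on_outside[OF assms that] homeo_inv_f[OF F_on_homeo[OF assms], of x] by simp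
  then show ?thesis unfolding F_on_def using PL2_inv[OF F_on_PL2[OF assms]] by blast
qed

lemma F_on_mono: "\<lbrakk>f \<in> F_on a b; a' \<le> a; b \<le> b'\<rbrakk> \<Longrightarrow> f \<in> F_on a' b'"
  unfolding F_on_def by auto

lemma F_on_neg: "f \<in> F_on a b \<Longrightarrow> neg f \<in> F_on (- b) (- a)"
  unfolding F_on_def using PL2_neg by (auto simp: neg_def)

lemma F_on_conj:
  assumes f: "f \<in> F_on a b" and q: "q \<in> PL2"
  shows "q \<circ> f \<circ> hinv q \<in> F_on (q a) (q b)"
proof -
  note h = PL2_homeo[OF q]
  have "(q \<circ> f \<circ> hinv q) x = x" if "x \<le> q a \<or> q b \<le> x" for x
  proof -
    have "hinv q x \<le> a \<or> b \<le> hinv q x"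
      using that homeo_le[OF h, of "hinv q x" a] homeo_le[OF h, of b "hinv q x"] homeo_f_inv[OF h, of x] by simp
    then show ?thesis using F_on_outside[OF f] homeo_f_inv[OF h] by simp
  qed
  then show ?thesis
    unfolding F_on_def using PL2_comp[OF PL2_inv[OF q] PL2_comp[OF F_on_PL2[OF f] q]] by (auto simp: comp_assoc)
qed

lemma F_on_maps:
  assumes f: "f \<in> F_on a b" and "a < x" "x < b"
  shows "a < f x" "f x < b"
proof -
  have "f a < f x" "f x < f b" using homeo_less[OF F_on_homeo[OF f]] assms by auto
  then show "a < f x" "f x < b" using F_on_outside[OF f, of a] F_on_outside[OF f, of b] by auto
qed

lemma Q_on_PL2: "f \<in> Q_on a b \<Longrightarrow> f \<in> PL2"
  and Q_on_homeo: "f \<in> Q_on a b \<Longrightarrow> homeo f"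
  using F_on_PL2 F_on_homeo unfolding Q_on_iff by blast+

lemma Q_on_imp_F_on: "f \<in> Q_on a b \<Longrightarrow> f \<in> F_on a b"
  unfolding Q_on_iff using F_on_mono by (metis order_less_imp_le)

lemma F_on_imp_Q_on:
  assumes "f \<in> F_on c d" "a < c" "d < b" "a < b"
  shows "f \<in> Q_on a b"
proof (cases "c \<le> d")
  case True
  then show ?thesis using assms Q_on_iff by blast
next
  case False
  then have "f = id" using F_on_outside[OF assms(1)] by (intro ext) force
  then have "f \<in> F_on ((a + b)/2) ((a + b)/2)" by simp
  then show ?thesis unfolding Q_on_iff using assms(4) by (intro exI[of _ "(a+b)/2"]) auto
qed

lemma Q_on_id: "a < b \<Longrightarrow> id \<in> Q_on a b"
  by (rule F_on_imp_Q_on[of _ "(a + b)/2" "(a + b)/2"]) (auto simp: field_simps)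

lemma Q_on_common:
  assumes "f \<in> Q_on a b" "g \<in> Q_on a b"
  obtains c d where "a < c" "c \<le> d" "d < b" "f \<in> F_on c d" "g \<in> F_on c d"
proof -
  obtain c d c' d' where "a < c" "c \<le> d" "d < b" "f \<in> F_on c d" "a < c'" "c' \<le> d'" "d' < b" "g \<in> F_on c' d'"
    using assms unfolding Q_on_iff by blast
  then show ?thesis
    using that[of "min c c'" "max d d'"] F_on_mono[of f c d "min c c'" "max d d'"]
      F_on_mono[of g c' d' "min c c'" "max d d'"] by auto
qed

lemma Q_on_comp:
  assumes "f \<in> Q_on a b" "g \<in> Q_on a b"
  shows "g \<circ> f \<in> Q_on a b"
proof -
  obtain c d where "a < c" "c \<le> d" "d < b" "f \<in> F_on c d" "g \<in> F_on c d"
    using Q_on_common[OF assms] .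
  then show ?thesis using F_on_comp Q_on_iff by blast
qed

lemma Q_on_inv: "f \<in> Q_on a b \<Longrightarrow> hinv f \<in> Q_on a b"
  unfolding Q_on_iff using F_on_inv by blast

lemma Q_on_mono: "\<lbrakk>f \<in> Q_on a b; a' \<le> a; b \<le> b'\<rbrakk> \<Longrightarrow> f \<in> Q_on a' b'"
  unfolding Q_on_iff by (meson order_le_less_trans order_less_le_trans)

lemma Q_on_neg:
  assumes "f \<in> Q_on a b"
  shows "neg f \<in> Q_on (- b) (- a)"
proof -
  obtain c d where "a < c" "c \<le> d" "d < b" "f \<in> F_on c d" using assms Q_on_iff by blast
  then show ?thesis unfolding Q_on_iff using F_on_neg by (intro exI[of _ "- d"] exI[of _ "- c"]) auto
qed

lemma Q_on_conj:
  assumes "f \<in> Q_on a b" "q \<in> PL2"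
  shows "q \<circ> f \<circ> hinv q \<in> Q_on (q a) (q b)"
proof -
  obtain c d where "a < c" "c \<le> d" "d < b" "f \<in> F_on c d" using assms Q_on_iff by blast
  then show ?thesis
    unfolding Q_on_iff using F_on_conj[OF _ assms(2)] homeo_less[OF PL2_homeo[OF assms(2)]]
      homeo_le[OF PL2_homeo[OF assms(2)]] by (intro exI[of _ "q c"] exI[of _ "q d"]) auto
qed

lemma disjoint_commute:
  assumes "inj g" "inj h" "\<And>x. g x = x \<or> h x = x"
  shows "g \<circ> h = h \<circ> g"
proof
  fix x
  show "(g \<circ> h) x = (h \<circ> g) x"
  proof (cases "h x = x")
    case True
    show ?thesis
    proof (cases "g x = x")
      case False
      then have "g (g x) \<noteq> g x" using assms(1) by (meson injD)
      then have "h (g x) = g x" using assms(3) by blast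
      then show ?thesis using True by simp
    qed (use True in simp)
  next
    case False
    then have "g x = x" using assms(3) by blast
    have "h (h x) \<noteq> h x" using assms(2) False by (meson injD)
    then have "g (h x) = h x" using assms(3) by blast
    then show ?thesis using \<open>g x = x\<close> by simp
  qed
qed

text \<open>The map doubles on [p, p + \<delta>] and halves on [p + \<delta>, p + 3 \<delta>]. The
  break of each kink is a position in the image of the preceding ones, so p + 2 \<delta> stands for
  the point p + \<delta>; the last kink restores slope 1.\<close>

definition bump :: "real \<Rightarrow> real \<Rightarrow> real \<Rightarrow> real" where
  "bump p \<delta> = kink (p + 3 * \<delta>) 1 \<circ> (kink (p + 2 * \<delta>) (-2) \<circ> kink p 1)"

lemma bump_eq:
  assumes "\<delta> > 0"
  shows "bump p \<delta> y = (if y \<le> p \<or> p + 3 * \<delta> \<le> y then y else if y \<le> p + \<delta> then y + (y - p)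
    else y + (p + 3 * \<delta> - y) / 2)"
  using assms by (auto simp: bump_def kink_def power_int_minus field_simps)

lemma bump_F_on:
  assumes "p \<in> dyadic" "\<delta> \<in> dyadic" "\<delta> > 0"
  shows "bump p \<delta> \<in> F_on p (p + 3 * \<delta>)"
proof -
  have d: "2 * \<delta> \<in> dyadic" "3 * \<delta> \<in> dyadic"
    using dyadic_double[OF assms(2)] dyadic_add[OF dyadic_double[OF assms(2)] assms(2)] by auto
  have "bump p \<delta> \<in> PL2"
    unfolding bump_def using assms d by (intro PL2_comp kink_PL2) auto
  then show ?thesis unfolding F_on_def using bump_eq[OF assms(3)] by auto
qed

lemma funpow_F_on: "f \<in> F_on a b \<Longrightarrow> f ^^ n \<in> F_on a b"
  by (induction n) (auto intro: F_on_comp)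

text \<open>Powers of a single bump with support from some p < c to beyond e: it moves the points
  from c to e by a definite amount, so the orbit of c passes e.\<close>

lemma push_right:
  assumes "a < c" "c < b" "e < b"
  shows "\<exists>q\<in>Q_on a b. e < q c"
proof -
  obtain p where p: "p \<in> dyadic" "a < p" "p < c" using dyadic_dense[OF assms(1)] by blast
  define e' where "e' = max e c"
  have e': "e' < b" "e \<le> e'" "c \<le> e'" using assms unfolding e'_def by auto
  then have "(e' - p) / 3 < (b - p) / 3" by simp
  then obtain \<delta> where \<delta>: "\<delta> \<in> dyadic" "(e' - p) / 3 < \<delta>" "\<delta> < (b - p) / 3" using dyadic_dense by blast
  define y where "y = p + 3 * \<delta>"
  have y: "e' < y" "y < b" using \<delta> unfolding y_def by auto
  have pos: "\<delta> > 0" using \<delta>(2) e' p by simp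
  define \<beta> where "\<beta> = bump p \<delta>"
  have \<beta>: "\<beta> \<in> F_on p y" unfolding \<beta>_def y_def using bump_F_on p \<delta> pos by blast
  \<comment> \<open>The displacement of z is z - p on the doubling part and (y - z)/2 on the halving
    part; this bounds both from below on [c, e'].\<close>
  define \<eta> where "\<eta> = min (c - p) ((y - e') / 2)"
  have \<eta>: "\<eta> > 0" using p y unfolding \<eta>_def by simp
  have step: "\<beta> z \<ge> z + \<eta>" if "c \<le> z" "z \<le> e'" for z
    unfolding \<beta>_def bump_eq[OF pos] using that p y unfolding \<eta>_def y_def by (auto simp: min_def field_simps)
  have "\<exists>n. (\<beta> ^^ n) c > e'"
  proof (rule ccontr)
    assume "\<not> ?thesis"
    then have le: "(\<beta> ^^ n) c \<le> e'" for n by (meson not_less)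
    have "(\<beta> ^^ n) c \<ge> c + real n * \<eta>" for n
    proof (induction n)
      case (Suc n)
      have "(\<beta> ^^ n) c \<ge> c" using Suc \<eta> by (meson add_increasing2 le_add_same_cancel1 less_imp_le mult_nonneg_nonneg of_nat_0_le_iff order_trans)
      then have "\<beta> ((\<beta> ^^ n) c) \<ge> (\<beta> ^^ n) c + \<eta>" using step le by blast
      then show ?case using Suc by (simp add: algebra_simps)
    qed simp
    moreover obtain n where "real n * \<eta> > e' - c" using reals_Archimedean3[OF \<eta>] by blast
    ultimately show False using le[of n] by (smt (verit))
  qed
  then obtain n where n: "(\<beta> ^^ n) c > e'" by blast
  have "\<beta> ^^ n \<in> Q_on a b"
    by (rule F_on_imp_Q_on[OF funpow_F_on[OF \<beta>]]) (use p y assms in auto)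
  then show ?thesis using n e' by force
qed

lemma push_left:
  assumes "a < d" "d < b" "a < e"
  shows "\<exists>q\<in>Q_on a b. q d < e"
proof -
  obtain q where q: "q \<in> Q_on (- b) (- a)" "- e < q (- d)"
    using push_right[of "- b" "- d" "- a" "- e"] assms by auto
  have "neg q \<in> Q_on a b" using Q_on_neg[OF q(1)] by simp
  then show ?thesis using q(2) by (intro bexI[of _ "neg q"]) (auto simp: neg_def)
qed

text \<open>The push to the right comes before the push to the left, which has its support to the
  right of a' and therefore cannot undo it.\<close>

lemma mover:
  assumes "a < c" "c \<le> d" "d < b" "a \<le> a'" "a' < b'" "b' \<le> b"
  shows "\<exists>q\<in>Q_on a b. a' < q c \<and> q d < b'"
proof -
  obtain q1 where q1: "q1 \<in> Q_on a b" "a' < q1 c" using push_right[of a c b a'] assms by auto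
  have d1: "q1 d < b" using F_on_maps(2)[OF Q_on_imp_F_on[OF q1(1)], of d] assms by auto
  have cd: "q1 c \<le> q1 d" using homeo_le[OF Q_on_homeo[OF q1(1)]] assms by simp
  then obtain q2 where q2: "q2 \<in> Q_on a' b" "q2 (q1 d) < b'"
    using push_left[of a' "q1 d" b b'] d1 q1 assms by auto
  have "a' < q2 (q1 c)" using F_on_maps(1)[OF Q_on_imp_F_on[OF q2(1)], of "q1 c"] q1 cd d1 by auto
  moreover have "q2 \<circ> q1 \<in> Q_on a b" using Q_on_comp[OF q1(1)] Q_on_mono[OF q2(1)] assms by auto
  ultimately show ?thesis using q2 by (intro bexI[of _ "q2 \<circ> q1"]) auto
qed

lemma local_slopes:
  assumes k: "rlin f x k" and l: "llin f x l"
  obtains e where "e > 0"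
    "\<And>y. x < y \<Longrightarrow> y < x + e \<Longrightarrow> rlin f y k \<and> llin f y k \<and> f y = f x + 2 powi k * (y - x)"
    "\<And>y. x - e < y \<Longrightarrow> y < x \<Longrightarrow> rlin f y l \<and> llin f y l \<and> f y = f x + 2 powi l * (y - x)"
proof -
  have piece: "rlin f y m \<and> llin f y m"
    if "u < y" "y < v" "\<forall>z\<in>{u..v}. f z = f x + 2 powi m * (z - x)" for u v y m
  proof
    have fy: "f y = f x + 2 powi m * (y - x)" using that by simp
    have *: "f z = f y + 2 powi m * (z - y)" if "z \<in> {u..v}" for z
      using \<open>\<forall>z\<in>{u..v}. f z = f x + 2 powi m * (z - x)\<close>[rule_format, OF that] fy by (simp add: algebra_simps)
    have "z \<in> {u..v}" if "y \<le> z \<and> z \<le> y + (v - y)" for z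
      using that \<open>u < y\<close> by simp
    moreover have "z \<in> {u..v}" if "y - (y - u) \<le> z \<and> z \<le> y" for z
      using that \<open>y < v\<close> by simp
    ultimately have "\<forall>z. y \<le> z \<and> z \<le> y + (v - y) \<longrightarrow> f z = f y + 2 powi m * (z - y)"
      "\<forall>z. y - (y - u) \<le> z \<and> z \<le> y \<longrightarrow> f z = f y + 2 powi m * (z - y)"
      using * by blast+
    then show "rlin f y m" "llin f y m"
      unfolding rlin_def llin_iff using that(1,2) diff_gt_0_iff_gt by blast+
  qed
  obtain a where a: "a > 0" "\<forall>y. x \<le> y \<and> y \<le> x + a \<longrightarrow> f y = f x + 2 powi k * (y - x)"
    using k unfolding rlin_def by blast
  obtain b where b: "b > 0" "\<forall>y. x - b \<le> y \<and> y \<le> x \<longrightarrow> f y = f x + 2 powi l * (y - x)"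
    using l unfolding llin_iff by blast
  have "rlin f y k \<and> llin f y k \<and> f y = f x + 2 powi k * (y - x)" if "x < y" "y < x + min a b" for y
  proof -
    have A: "\<forall>z\<in>{x..x + a}. f z = f x + 2 powi k * (z - x)" using a(2) atLeastAtMost_iff by blast
    have y: "y < x + a" "y \<in> {x..x + a}" using that by auto
    show ?thesis using piece[OF that(1) y(1) A] A y(2) by blast
  qed
  moreover have "rlin f y l \<and> llin f y l \<and> f y = f x + 2 powi l * (y - x)" if "x - min a b < y" "y < x" for y
  proof -
    have A: "\<forall>z\<in>{x - b..x}. f z = f x + 2 powi l * (z - x)" using b(2) atLeastAtMost_iff by blast
    have y: "x - b < y" "y \<in> {x - b..x}" using that by auto
    show ?thesis using piece[OF y(1) that(2) A] A y(2) by blast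
  qed
  moreover have "min a b > 0" using a(1) b(1) by simp
  ultimately show ?thesis using that by blast
qed

text \<open>Compactness by bisection: the property passes to unions of adjacent intervals, and on a
  small interval around x the only possible break is x itself.\<close>

lemma PL2_finite_breaks:
  assumes f: "f \<in> PL2" and "a \<le> b"
  shows "finite {x\<in>{a..b}. rs f x \<noteq> ls f x} \<and> (\<exists>M. \<forall>x\<in>{a..b}. \<bar>rs f x\<bar> \<le> M \<and> \<bar>ls f x\<bar> \<le> M)"
  using assms(2)
proof (rule Bolzano)
  fix a b c :: real
  assume 1: "finite {x\<in>{a..b}. rs f x \<noteq> ls f x} \<and> (\<exists>M. \<forall>x\<in>{a..b}. \<bar>rs f x\<bar> \<le> M \<and> \<bar>ls f x\<bar> \<le> M)"
    and 2: "finite {x\<in>{b..c}. rs f x \<noteq> ls f x} \<and> (\<exists>M. \<forall>x\<in>{b..c}. \<bar>rs f x\<bar> \<le> M \<and> \<bar>ls f x\<bar> \<le> M)"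
    and abc: "a \<le> b" "b \<le> c"
  have U: "{a..c} = {a..b} \<union> {b..c}" using abc by auto
  have "{x\<in>{a..c}. rs f x \<noteq> ls f x} = {x\<in>{a..b}. rs f x \<noteq> ls f x} \<union> {x\<in>{b..c}. rs f x \<noteq> ls f x}"
    using U by auto
  moreover obtain M M' where "\<forall>x\<in>{a..b}. \<bar>rs f x\<bar> \<le> M \<and> \<bar>ls f x\<bar> \<le> M" "\<forall>x\<in>{b..c}. \<bar>rs f x\<bar> \<le> M' \<and> \<bar>ls f x\<bar> \<le> M'"
    using 1 2 by blast
  then have "\<forall>x\<in>{a..c}. \<bar>rs f x\<bar> \<le> max M M' \<and> \<bar>ls f x\<bar> \<le> max M M'" unfolding U by (auto simp: le_max_iff_disj)
  ultimately show "finite {x\<in>{a..c}. rs f x \<noteq> ls f x} \<and> (\<exists>M. \<forall>x\<in>{a..c}. \<bar>rs f x\<bar> \<le> M \<and> \<bar>ls f x\<bar> \<le> M)"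
    using 1 2 by auto
next
  fix x
  obtain e where e: "e > 0" "\<And>y. x < y \<Longrightarrow> y < x + e \<Longrightarrow> rlin f y (rs f x) \<and> llin f y (rs f x)"
    "\<And>y. x - e < y \<Longrightarrow> y < x \<Longrightarrow> rlin f y (ls f x) \<and> llin f y (ls f x)"
    using local_slopes[OF rlin_rs[OF f] llin_ls[OF f], of x] by metis
  have eq: "rs f y = rs f x \<and> ls f y = rs f x" if "x < y" "y < x + e" for y using e(2)[OF that] rs_eq ls_eq by blast
  have eq': "rs f y = ls f x \<and> ls f y = ls f x" if "x - e < y" "y < x" for y using e(3)[OF that] rs_eq ls_eq by blast
  have "finite {y\<in>{a..b}. rs f y \<noteq> ls f y} \<and> (\<exists>M. \<forall>y\<in>{a..b}. \<bar>rs f y\<bar> \<le> M \<and> \<bar>ls f y\<bar> \<le> M)"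
    if ab: "a \<le> x" "x \<le> b" "b - a < e" for a b
  proof
    have "{y\<in>{a..b}. rs f y \<noteq> ls f y} \<subseteq> {x}"
    proof safe
      fix y assume y: "y \<in> {a..b}" "rs f y \<noteq> ls f y"
      consider "y < x" | "y = x" | "x < y" by linarith
      then show "y = x" by cases (use eq[of y] eq'[of y] y ab in auto)
    qed
    then show "finite {y\<in>{a..b}. rs f y \<noteq> ls f y}" using finite_subset by blast
    have "\<bar>rs f y\<bar> \<le> max \<bar>rs f x\<bar> \<bar>ls f x\<bar> \<and> \<bar>ls f y\<bar> \<le> max \<bar>rs f x\<bar> \<bar>ls f x\<bar>" if y: "y \<in> {a..b}" for y
    proof -
      consider "y < x" | "y = x" | "x < y" by linarith
      then show ?thesis by cases (use eq[of y] eq'[of y] y ab in auto)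
    qed
    then show "\<exists>M. \<forall>y\<in>{a..b}. \<bar>rs f y\<bar> \<le> M \<and> \<bar>ls f y\<bar> \<le> M" by blast
  qed
  then show "\<exists>d>0. \<forall>a b. a \<le> x \<and> x \<le> b \<and> b - a < d \<longrightarrow>
      finite {x\<in>{a..b}. rs f x \<noteq> ls f x} \<and> (\<exists>M. \<forall>x\<in>{a..b}. \<bar>rs f x\<bar> \<le> M \<and> \<bar>ls f x\<bar> \<le> M)"
    using e(1) by blast
qed

subsection \<open>Thompson's group\<close>

lemma right_derivative_slope:
  fixes f :: "real \<Rightarrow> real"
  assumes d: "(f has_real_derivative d) (at t within {a..b})" and t: "a \<le> t" "t < b"
    and e: "e > 0" "\<And>y. t \<le> y \<Longrightarrow> y \<le> t + e \<Longrightarrow> f y = f t + m * (y - t)"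
  shows "d = m"
proof -
  have "((\<lambda>y. (f y - f t) / (y - t)) \<longlongrightarrow> d) (at t within {a..b})"
    using d by (simp add: has_field_derivative_iff)
  then have "((\<lambda>y. (f y - f t) / (y - t)) \<longlongrightarrow> d) (at t within {t..b})"
    by (rule tendsto_within_subset) (use t in auto)
  then have 1: "((\<lambda>y. (f y - f t) / (y - t)) \<longlongrightarrow> d) (at_right t)"
    using at_within_Icc_at_right[OF t(2)] by simp
  have "\<forall>\<^sub>F y in at_right t. (f y - f t) / (y - t) = m"
    unfolding eventually_at_right[OF t(2)]
  proof (intro exI[of _ "min b (t + e)"] conjI allI impI)
    show "t < min b (t + e)" using t e by simp
    fix y assume y: "t < y" "y < min b (t + e)"
    then have "f y = f t + m * (y - t)" using e(2)[of y] by simp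
    then show "(f y - f t) / (y - t) = m" using y by simp
  qed
  then have 2: "((\<lambda>y. (f y - f t) / (y - t)) \<longlongrightarrow> m) (at_right t)"
    by (rule tendsto_eventually)
  show ?thesis using tendsto_unique[OF _ 1 2] by simp
qed

lemma left_derivative_slope:
  fixes f :: "real \<Rightarrow> real"
  assumes d: "(f has_real_derivative d) (at t within {a..b})" and t: "a < t" "t \<le> b"
    and e: "e > 0" "\<And>y. t - e \<le> y \<Longrightarrow> y \<le> t \<Longrightarrow> f y = f t + m * (y - t)"
  shows "d = m"
proof -
  have "((\<lambda>y. (f y - f t) / (y - t)) \<longlongrightarrow> d) (at t within {a..b})"
    using d by (simp add: has_field_derivative_iff)
  then have "((\<lambda>y. (f y - f t) / (y - t)) \<longlongrightarrow> d) (at t within {a..t})"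
    by (rule tendsto_within_subset) (use t in auto)
  then have 1: "((\<lambda>y. (f y - f t) / (y - t)) \<longlongrightarrow> d) (at_left t)"
    using at_within_Icc_at_left[OF t(1)] by simp
  have "\<forall>\<^sub>F y in at_left t. (f y - f t) / (y - t) = m"
    unfolding eventually_at_left[OF t(1)]
  proof (intro exI[of _ "max a (t - e)"] conjI allI impI)
    show "max a (t - e) < t" using t e by simp
    fix y assume y: "max a (t - e) < y" "y < t"
    then have "f y = f t + m * (y - t)" using e(2)[of y] by simp
    then show "(f y - f t) / (y - t) = m" using y by simp
  qed
  then have 2: "((\<lambda>y. (f y - f t) / (y - t)) \<longlongrightarrow> m) (at_left t)"
    by (rule tendsto_eventually)
  show ?thesis using tendsto_unique[OF _ 1 2] by simp
qed

text \<open>At a break a, the intercept \<open>f x - 2 powi (rs f x) * x\<close> of the local linear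
  piece changes by a difference of terms \<open>2 powi k * a\<close>, which is dyadic since a is.
  Whether the intercept is dyadic is thus locally constant, hence the same everywhere as at the
  fixed point x0.\<close>

lemma local_slopes_dyadic:
  assumes k: "\<And>x. \<exists>k. rlin f x k" and l: "\<And>x. \<exists>l. llin f x l"
    and br: "\<And>x k l. \<lbrakk>rlin f x k; llin f x l; k \<noteq> l\<rbrakk> \<Longrightarrow> x \<in> dyadic"
    and x0: "x0 \<in> dyadic" "f x0 = x0"
  shows "f x \<in> dyadic \<longleftrightarrow> x \<in> dyadic"
proof -
  have r: "rlin f x (rs f x)" "llin f x (ls f x)" for x
    using k l rs_eq ls_eq by metis+
  define off where "off x = (f x - 2 powi (rs f x) * x \<in> dyadic)" for x
  have "off x = off x0"
  proof (rule connected_local_const[OF connected_UNIV, of x x0 off])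
    show "\<forall>a\<in>UNIV. eventually (\<lambda>b. off a = off b) (at a)"
    proof
      fix a :: real
      obtain e where e: "e > 0"
        "\<And>y. a < y \<Longrightarrow> y < a + e \<Longrightarrow> rlin f y (rs f a) \<and> llin f y (rs f a) \<and> f y = f a + 2 powi (rs f a) * (y - a)"
        "\<And>y. a - e < y \<Longrightarrow> y < a \<Longrightarrow> rlin f y (ls f a) \<and> llin f y (ls f a) \<and> f y = f a + 2 powi (ls f a) * (y - a)"
        using local_slopes[OF r(1)[of a] r(2)[of a]] by metis
      have "off a = off y" if y: "y \<noteq> a" "dist y a < e" for y
      proof (cases "a < y")
        case True
        then have *: "rs f y = rs f a" "f y = f a + 2 powi (rs f a) * (y - a)"
          using e(2)[of y] rs_eq y by (auto simp: dist_real_def)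
        show ?thesis unfolding off_def * by (simp add: algebra_simps)
      next
        case False
        then have *: "rs f y = ls f a" "f y = f a + 2 powi (ls f a) * (y - a)"
          using e(3)[of y] rs_eq y by (auto simp: dist_real_def)
        have "f a - 2 powi (ls f a) * a = (f a - 2 powi (rs f a) * a) + (2 powi (rs f a) * a - 2 powi (ls f a) * a)"
          by simp
        moreover have "2 powi (rs f a) * a - 2 powi (ls f a) * a \<in> dyadic"
        proof (cases "rs f a = ls f a")
          case False
          then have "a \<in> dyadic" using br[OF r] by blast
          then show ?thesis by (intro dyadic_diff dyadic_powi)
        qed simp
        ultimately have "(f a - 2 powi (ls f a) * a \<in> dyadic) = off a"
          unfolding off_def using dyadic_add_cancel by metis
        moreover have "f y - 2 powi (rs f y) * y = f a - 2 powi (ls f a) * a"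
          unfolding * by (simp add: algebra_simps)
        ultimately show ?thesis unfolding off_def by simp
      qed
      then show "eventually (\<lambda>b. off a = off b) (at a)"
        unfolding eventually_at using e(1) by blast
    qed
  qed auto
  moreover have "off x0" unfolding off_def x0(2) using x0(1) by (intro dyadic_diff dyadic_powi)
  ultimately have "f x - 2 powi (rs f x) * x \<in> dyadic" unfolding off_def by simp
  then have "2 powi (rs f x) * x + (f x - 2 powi (rs f x) * x) \<in> dyadic \<longleftrightarrow> 2 powi (rs f x) * x \<in> dyadic"
    by (rule dyadic_add_cancel)
  then show ?thesis by simp
qed

text \<open>Moves the unit interval to [-1/2, 1/2] and extends by the identity. Groups on the
  interval become groups on the line, and \<open>flip\<close> becomes \<open>neg\<close>.\<close>

definition cen :: "(real \<Rightarrow> real) \<Rightarrow> real \<Rightarrow> real" where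
  "cen \<nu> x = (if \<bar>x\<bar> \<le> 1/2 then \<nu> (x + 1/2) - 1/2 else x)"

definition dec :: "(real \<Rightarrow> real) \<Rightarrow> real \<Rightarrow> real" where
  "dec f = (\<lambda>t\<in>unit_interval. f (t - 1/2) + 1/2)"

definition interval_homeo :: "(real \<Rightarrow> real) \<Rightarrow> bool" where
  "interval_homeo \<nu> \<longleftrightarrow> \<nu> 0 = 0 \<and> \<nu> 1 = 1 \<and> strict_mono_on unit_interval \<nu> \<and> \<nu> ` unit_interval = unit_interval"

lemma Homeo_plus_interval_homeo:
  assumes "\<nu> \<in> carrier (Homeo_plus unit_interval)"
  shows "interval_homeo \<nu>"
proof -
  have mono: "strict_mono_on unit_interval \<nu>" and im: "\<nu> ` unit_interval = unit_interval"
    using assms unfolding Homeo_plus_def Homeo_def homeomorphism_def by auto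
  obtain s t where st: "s \<in> unit_interval" "\<nu> s = 0" "t \<in> unit_interval" "\<nu> t = 1"
    using im by (metis (no_types, lifting) atLeastAtMost_iff imageE order_refl zero_le_one)
  have in01: "\<nu> 0 \<in> unit_interval" "\<nu> 1 \<in> unit_interval" using im by auto
  have "\<nu> 0 = 0"
  proof (rule ccontr)
    assume "\<nu> 0 \<noteq> 0"
    then have "0 < s" using st by (metis atLeastAtMost_iff order_le_less)
    then have "\<nu> 0 < \<nu> s" using strict_mono_onD[OF mono, of 0 s] st by auto
    then show False using st in01 by auto
  qed
  moreover have "\<nu> 1 = 1"
  proof (rule ccontr)
    assume "\<nu> 1 \<noteq> 1"
    then have "t < 1" using st by (metis atLeastAtMost_iff order_le_less)
    then have "\<nu> t < \<nu> 1" using strict_mono_onD[OF mono, of t 1] st by auto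
    then show False using st in01 by auto
  qed
  ultimately show ?thesis using mono im unfolding interval_homeo_def by simp
qed

lemma interval_homeo_maps:
  assumes "interval_homeo \<nu>" "0 \<le> t" "t \<le> 1"
  shows "0 \<le> \<nu> t" "\<nu> t \<le> 1"
proof -
  have "\<nu> t \<in> \<nu> ` unit_interval" using assms by auto
  then show "0 \<le> \<nu> t" "\<nu> t \<le> 1" using assms unfolding interval_homeo_def by auto
qed

lemma cen_outside: "interval_homeo \<nu> \<Longrightarrow> x \<le> -1/2 \<or> 1/2 \<le> x \<Longrightarrow> cen \<nu> x = x"
proof -
  assume \<nu>: "interval_homeo \<nu>" and "x \<le> -1/2 \<or> 1/2 \<le> x"
  then consider "x = 1/2" | "x = -1/2" | "\<not> \<bar>x\<bar> \<le> 1/2" by linarith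
  moreover have "cen \<nu> (1/2) = 1/2" "cen \<nu> (-1/2) = -1/2"
    using \<nu> by (simp_all add: cen_def interval_homeo_def)
  moreover have "cen \<nu> x = x" if "\<not> \<bar>x\<bar> \<le> 1/2" using that by (simp add: cen_def)
  ultimately show "cen \<nu> x = x" by metis
qed

lemma cen_homeo:
  assumes \<nu>: "interval_homeo \<nu>"
  shows "homeo (cen \<nu>)"
  unfolding homeo_def
proof
  have m: "\<nu> s < \<nu> t" if "0 \<le> s" "s < t" "t \<le> 1" for s t
    using \<nu> that strict_mono_onD[of unit_interval \<nu> s t] unfolding interval_homeo_def by auto
  show "strict_mono (cen \<nu>)"
  proof (rule strict_monoI)
    fix x y :: real assume xy: "x < y"
    have b: "\<nu> (z + 1/2) \<in> {0..1}" if "\<bar>z\<bar> \<le> 1/2" for z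
      using interval_homeo_maps[OF \<nu>, of "z + 1/2"] that unfolding abs_le_iff by auto
    consider "\<bar>x\<bar> \<le> 1/2" "\<bar>y\<bar> \<le> 1/2" | "\<bar>x\<bar> \<le> 1/2" "\<not> \<bar>y\<bar> \<le> 1/2" | "\<not> \<bar>x\<bar> \<le> 1/2" "\<bar>y\<bar> \<le> 1/2"
      | "\<not> \<bar>x\<bar> \<le> 1/2" "\<not> \<bar>y\<bar> \<le> 1/2" by blast
    then show "cen \<nu> x < cen \<nu> y"
    proof cases
      case 1
      then show ?thesis using m[of "x + 1/2" "y + 1/2"] xy by (auto simp: cen_def abs_le_iff)
    next
      case 2
      then show ?thesis using b[of x] xy by (auto simp: cen_def abs_le_iff)
    next
      case 3
      then show ?thesis using b[of y] xy by (auto simp: cen_def abs_le_iff)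
    qed (use xy in \<open>auto simp: cen_def\<close>)
  qed
  have "\<exists>x. cen \<nu> x = y" for y
  proof (cases "\<bar>y\<bar> \<le> 1/2")
    case True
    then have "y + 1/2 \<in> \<nu> ` unit_interval" using \<nu> unfolding interval_homeo_def by (auto simp: abs_le_iff)
    then obtain t where "0 \<le> t" "t \<le> 1" "\<nu> t = y + 1/2" by force
    moreover from this have "\<bar>t - 1/2\<bar> \<le> 1/2" by linarith
    ultimately have "cen \<nu> (t - 1/2) = y" by (simp add: cen_def)
    then show ?thesis by blast
  next
    case False
    then have "cen \<nu> y = y" by (simp add: cen_def)
    then show ?thesis by blast
  qed
  then show "surj (cen \<nu>)" by (metis surjI)
qed

text \<open>The slope is the derivative at the midpoint of the piece, where the condition on
  derivatives in Thompson's group applies.\<close>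

lemma thompson_affine_piece:
  assumes \<nu>: "\<nu> \<in> thompson_F" and uv: "0 \<le> u" "u < v" "v \<le> 1"
    and aff: "\<forall>x\<in>{u..v}. \<nu> x = m * x + c"
  obtains k :: int where "m = 2 powi k"
proof -
  define s where "s = (u + v) / 2"
  have s: "u < s" "s < v" using uv unfolding s_def by auto
  have "((\<lambda>x. m * x + c) has_real_derivative m) (at s within unit_interval)"
    by (auto intro!: derivative_eq_intros)
  then have "(\<nu> has_real_derivative m) (at s within unit_interval)"
  proof (rule has_field_derivative_transform_within[where d = "min (s - u) (v - s)"])
    show "m * x + c = \<nu> x" if "x \<in> unit_interval" "dist x s < min (s - u) (v - s)" for x
      using that aff by (auto simp: dist_real_def abs_less_iff)
  qed (use s uv in auto)
  then obtain k :: int where "m = 2 powi k"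
    using \<nu> s uv unfolding thompson_F_def by force
  then show ?thesis using that by blast
qed

text \<open>Up to the next point of P the map is affine, which yields the germs. A break inside the
  interval is a point where the map is not differentiable, hence lies in D and is dyadic.
  Preservation of dyadic points follows from \<open>local_slopes_dyadic\<close> with the fixed point
  1/2.\<close>

lemma cen_PL2:
  assumes \<nu>: "\<nu> \<in> thompson_F"
  shows "cen \<nu> \<in> F_on (-1/2) (1/2)"
proof -
  have ih: "interval_homeo \<nu>"
    using \<nu> Homeo_plus_interval_homeo unfolding thompson_F_def by blast
  obtain P where P: "finite P" "\<And>u v. 0 \<le> u \<and> u < v \<and> v \<le> 1 \<and> P \<inter> {u<..<v} = {} \<Longrightarrow>
      \<exists>m c. \<forall>x\<in>{u..v}. \<nu> x = m * x + c"
    using \<nu> unfolding thompson_F_def piecewise_linear_def by auto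
  obtain D where D: "D \<subseteq> dyadic" "\<forall>x\<in>unit_interval - D. \<nu> differentiable (at x within unit_interval)"
    using \<nu> unfolding thompson_F_def by auto
  have R: "\<exists>k. rlin (cen \<nu>) x k" for x
  proof (cases "x \<ge> 1/2 \<or> x < -1/2")
    case True
    have "rlin (cen \<nu>) x 0"
    proof (rule rlin_cong[OF rlin_id])
      show "(if x \<ge> 1/2 then 1 else -1/2 - x) > 0" using True by auto
      show "cen \<nu> y = id y" if "x \<le> y \<and> y \<le> x + (if x \<ge> 1/2 then 1 else -1/2 - x)" for y
        using cen_outside[OF ih, of y] that True by (auto split: if_splits)
    qed
    then show ?thesis by blast
  next
    case False
    define t where "t = x + 1/2"
    have t: "0 \<le> t" "t < 1" using False unfolding t_def by auto
    define v where "v = Min (insert 1 {p\<in>P. t < p})"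
    have fin: "finite (insert 1 {p\<in>P. t < p})" using P by simp
    have v: "t < v" "v \<le> 1" unfolding v_def using fin t by (auto simp: Min_gr_iff)
    have "P \<inter> {t<..<v} = {}"
      using Min_le[OF fin] unfolding v_def by fastforce
    then obtain m c where mc: "\<forall>x\<in>{t..v}. \<nu> x = m * x + c" using P(2)[of t v] t v by blast
    then obtain k where k: "m = 2 powi k" using thompson_affine_piece[OF \<nu> t(1) v mc] by blast
    have "cen \<nu> y = cen \<nu> x + 2 powi k * (y - x)" if y: "x \<le> y" "y \<le> x + (v - t)" for y
    proof -
      have "\<bar>y\<bar> \<le> 1/2" "\<bar>x\<bar> \<le> 1/2" using y t v unfolding t_def by auto
      moreover have "\<nu> (y + 1/2) = m * (y + 1/2) + c" "\<nu> (x + 1/2) = m * (x + 1/2) + c"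
        using mc y v unfolding t_def by auto
      ultimately show ?thesis unfolding cen_def k by (simp add: algebra_simps)
    qed
    moreover have "v - t > 0" using v by simp
    ultimately show ?thesis unfolding rlin_def by blast
  qed
  have L: "\<exists>k. llin (cen \<nu>) x k" for x
  proof (cases "x > 1/2 \<or> x \<le> -1/2")
    case True
    have "llin (cen \<nu>) x 0"
    proof (rule llin_cong[OF llin_id])
      show "(if x > 1/2 then x - 1/2 else 1) > 0" using True by auto
      show "cen \<nu> y = id y" if "x - (if x > 1/2 then x - 1/2 else 1) \<le> y \<and> y \<le> x" for y
        using cen_outside[OF ih, of y] that True by (auto split: if_splits)
    qed
    then show ?thesis by blast
  next
    case False
    define t where "t = x + 1/2"
    have t: "0 < t" "t \<le> 1" using False unfolding t_def by auto
    define v where "v = Max (insert 0 {p\<in>P. p < t})"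
    have fin: "finite (insert 0 {p\<in>P. p < t})" using P by simp
    have v: "v < t" "0 \<le> v" unfolding v_def using fin t by (auto simp: Max_less_iff)
    have "P \<inter> {v<..<t} = {}"
      using Max_ge[OF fin] unfolding v_def by fastforce
    then obtain m c where mc: "\<forall>x\<in>{v..t}. \<nu> x = m * x + c" using P(2)[of v t] t v by blast
    then obtain k where k: "m = 2 powi k" using thompson_affine_piece[OF \<nu> v(2,1) t(2) mc] by blast
    have "cen \<nu> y = cen \<nu> x + 2 powi k * (y - x)" if y: "x - (t - v) \<le> y" "y \<le> x" for y
    proof -
      have "\<bar>y\<bar> \<le> 1/2" "\<bar>x\<bar> \<le> 1/2" using y t v unfolding t_def by auto
      moreover have "\<nu> (y + 1/2) = m * (y + 1/2) + c" "\<nu> (x + 1/2) = m * (x + 1/2) + c"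
        using mc y v unfolding t_def by auto
      ultimately show ?thesis unfolding cen_def k by (simp add: algebra_simps)
    qed
    moreover have "t - v > 0" using v by simp
    ultimately show ?thesis unfolding llin_iff by blast
  qed
  have half: "1/2 \<in> dyadic" "-1/2 \<in> dyadic" using dyadic_half[of 1] dyadic_half[of "-1"] by auto
  have break: "x \<in> dyadic" if k: "rlin (cen \<nu>) x k" and l: "llin (cen \<nu>) x l" and ne: "k \<noteq> l" for x k l
  proof -
    consider "x = 1/2" | "x = -1/2" | "x < -1/2 \<or> 1/2 < x" | "-1/2 < x" "x < 1/2" by linarith
    then show ?thesis
    proof cases
      case 1
      then show ?thesis using half by (simp only:)
    next
      case 2
      then show ?thesis using half by (simp only:)
    next
      case 3
      define e where "e = (if x < -1/2 then -1/2 - x else x - 1/2)"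
      have "e > 0" using 3 unfolding e_def by auto
      have o: "cen \<nu> y = id y" if "x - e \<le> y" "y \<le> x + e" for y
        using cen_outside[OF ih, of y] that 3 unfolding e_def by (auto split: if_splits)
      have "rlin (cen \<nu>) x 0" "llin (cen \<nu>) x 0"
        using rlin_cong[OF rlin_id \<open>e > 0\<close>, of x "cen \<nu>"] llin_cong[OF llin_id \<open>e > 0\<close>, of x "cen \<nu>"] o \<open>e > 0\<close> by auto
      then show ?thesis using rlin_unique[OF k] llin_unique[OF l] ne by metis
    next
      case 4
      define t where "t = x + 1/2"
      have t: "0 < t" "t < 1" using 4 unfolding t_def by auto
      have "t \<in> D"
      proof (rule ccontr)
        assume "t \<notin> D"
        then obtain d where d: "(\<nu> has_real_derivative d) (at t within {0..1})"
          using D t unfolding real_differentiable_def by force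
        obtain a where a: "a > 0" "\<forall>y. x \<le> y \<and> y \<le> x + a \<longrightarrow> cen \<nu> y = cen \<nu> x + 2 powi k * (y - x)"
          using k unfolding rlin_def by blast
        obtain b where b: "b > 0" "\<forall>y. x - b \<le> y \<and> y \<le> x \<longrightarrow> cen \<nu> y = cen \<nu> x + 2 powi l * (y - x)"
          using l unfolding llin_iff by blast
        have "d = 2 powi k"
        proof (rule right_derivative_slope[OF d])
          show "min a (1 - t) > 0" using a(1) t by simp
          fix s assume s: "t \<le> s" "s \<le> t + min a (1 - t)"
          have "cen \<nu> (s - 1/2) = cen \<nu> x + 2 powi k * (s - 1/2 - x)"
            using a(2)[rule_format, of "s - 1/2"] s unfolding t_def by simp
          moreover have "\<bar>s - 1/2\<bar> \<le> 1/2" "\<bar>x\<bar> \<le> 1/2" using s t 4 by linarith+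
          ultimately show "\<nu> s = \<nu> t + 2 powi k * (s - t)" unfolding cen_def t_def by (simp add: algebra_simps)
        qed (use t in auto)
        moreover have "d = 2 powi l"
        proof (rule left_derivative_slope[OF d])
          show "min b t > 0" using b(1) t by simp
          fix s assume s: "t - min b t \<le> s" "s \<le> t"
          have "cen \<nu> (s - 1/2) = cen \<nu> x + 2 powi l * (s - 1/2 - x)"
            using b(2)[rule_format, of "s - 1/2"] s unfolding t_def by simp
          moreover have "\<bar>s - 1/2\<bar> \<le> 1/2" "\<bar>x\<bar> \<le> 1/2" using s t 4 by linarith+
          ultimately show "\<nu> s = \<nu> t + 2 powi l * (s - t)" unfolding cen_def t_def by (simp add: algebra_simps)
        qed (use t in auto)
        ultimately show False using ne powi_2_inj by metis
      qed
      then have "t + - (1/2) \<in> dyadic" using D half by (intro dyadic_add) auto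
      then show ?thesis unfolding t_def by simp
    qed
  qed
  have "cen \<nu> \<in> PL2"
    unfolding PL2_def
    using cen_homeo[OF ih] R L break local_slopes_dyadic[OF R L break half(1) cen_outside[OF ih]] by auto
  then show ?thesis unfolding F_on_def using cen_outside[OF ih] by simp
qed

lemma cen_F_on:
  assumes "\<nu> \<in> thompson_F_on r s" "0 \<le> r" "s \<le> 1"
  shows "cen \<nu> \<in> F_on (r - 1/2) (s - 1/2)"
proof (rule F_on_closed_outside)
  have \<nu>: "\<nu> \<in> thompson_F" "Supp \<nu> \<subseteq> {r..s}" using assms unfolding thompson_F_on_def by auto
  show "cen \<nu> \<in> PL2" using F_on_PL2[OF cen_PL2[OF \<nu>(1)]] .
  fix x assume x: "x < r - 1/2 \<or> s - 1/2 < x"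
  show "cen \<nu> x = x"
  proof (cases "\<bar>x\<bar> \<le> 1/2")
    case True
    then have "x + 1/2 \<in> unit_interval" "x + 1/2 \<notin> {r..s}" using x by auto
    then have "\<nu> (x + 1/2) = x + 1/2" using \<nu>(2) unfolding Supp_def by blast
    then show ?thesis using True unfolding cen_def by simp
  qed (simp add: cen_def)
qed

text \<open>Slope and intercept are locally constant on the open interval, hence constant by
  connectedness. The one-sided germs extend the formula to both ends.\<close>

lemma PL2_affine_piece:
  assumes f: "f \<in> PL2" and ab: "a < b" and nb: "\<And>x. a < x \<Longrightarrow> x < b \<Longrightarrow> rs f x = ls f x"
  shows "\<forall>x\<in>{a..b}. f x = f a + 2 powi (rs f a) * (x - a)"
proof -
  note r = rlin_rs[OF f] llin_ls[OF f]
  obtain ea where ea: "ea > 0" "\<And>y. a < y \<Longrightarrow> y < a + ea \<Longrightarrow> rlin f y (rs f a) \<and> llin f y (rs f a) \<and> f y = f a + 2 powi (rs f a) * (y - a)"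
    using local_slopes[OF r(1)[of a] r(2)[of a]] by metis
  obtain eb where eb: "eb > 0" "\<And>y. b - eb < y \<Longrightarrow> y < b \<Longrightarrow> rlin f y (ls f b) \<and> llin f y (ls f b) \<and> f y = f b + 2 powi (ls f b) * (y - b)"
    using local_slopes[OF r(1)[of b] r(2)[of b]] by metis
  define g where "g x = (rs f x, f x - 2 powi (rs f x) * x)" for x
  have const: "g x = g y" if "x \<in> {a<..<b}" "y \<in> {a<..<b}" for x y
  proof (rule connected_local_const[of "{a<..<b}" x y g])
    show "\<forall>c\<in>{a<..<b}. eventually (\<lambda>y. g c = g y) (at c within {a<..<b})"
    proof
      fix c assume c: "c \<in> {a<..<b}"
      obtain e where e: "e > 0"
        "\<And>y. c < y \<Longrightarrow> y < c + e \<Longrightarrow> rlin f y (rs f c) \<and> llin f y (rs f c) \<and> f y = f c + 2 powi (rs f c) * (y - c)"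
        "\<And>y. c - e < y \<Longrightarrow> y < c \<Longrightarrow> rlin f y (ls f c) \<and> llin f y (ls f c) \<and> f y = f c + 2 powi (ls f c) * (y - c)"
        using local_slopes[OF r(1)[of c] r(2)[of c]] by metis
      have "rs f c = ls f c" using nb c by simp
      then have "rs f y = rs f c \<and> f y = f c + 2 powi (rs f c) * (y - c)" if "y \<noteq> c" "dist y c < e" for y
        using e(2)[of y] e(3)[of y] rs_eq that by (cases "c < y") (auto simp: dist_real_def)
      then have "g c = g y" if "y \<noteq> c" "dist y c < e" for y
        using that unfolding g_def by (simp add: algebra_simps)
      then show "eventually (\<lambda>y. g c = g y) (at c within {a<..<b})"
        unfolding eventually_at using e(1) by blast
    qed
  qed (use that in auto)
  obtain x0 where x0: "a < x0" "x0 < a + ea" "x0 < b"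
    using dense[of a "min (a + ea) b"] ea(1) ab by auto
  have g0: "g x0 = (rs f a, f a - 2 powi (rs f a) * a)"
    using ea(2)[OF x0(1,2)] rs_eq[of f x0] unfolding g_def by (auto simp: algebra_simps)
  have inner: "rs f x = rs f a \<and> f x = f a + 2 powi (rs f a) * (x - a)" if "a < x" "x < b" for x
  proof -
    have "g x = (rs f a, f a - 2 powi (rs f a) * a)" using const[of x x0] g0 that x0 by simp
    then have "rs f x = rs f a" "f x - 2 powi (rs f x) * x = f a - 2 powi (rs f a) * a"
      unfolding g_def by auto
    then show ?thesis by (simp add: algebra_simps)
  qed
  obtain x1 where x1: "a < x1" "b - eb < x1" "x1 < b"
    using dense[of "max a (b - eb)" b] eb(1) ab by auto
  have "ls f b = rs f a" "f x1 = f b + 2 powi (ls f b) * (x1 - b)"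
    using eb(2)[OF x1(2,3)] inner[OF x1(1,3)] rs_eq[of f x1] by auto
  then have "f b = f a + 2 powi (rs f a) * (b - a)"
    using inner[OF x1(1,3)] by (simp add: algebra_simps)
  then show ?thesis using inner by (metis add.right_neutral atLeastAtMost_iff diff_self mult_zero_right order_le_less)
qed

text \<open>The converse of \<open>cen_F_on\<close>. The two passages identify the subgroups
  \<open>thompson_F_on r s\<close> with \<open>F_on\<close>, where composition is plain composition
  of maps of the line.\<close>

lemma dec_thompson:
  assumes f: "f \<in> F_on (r - 1/2) (s - 1/2)" and rs01: "0 \<le> r" "s \<le> 1"
  shows "dec f \<in> thompson_F_on r s" "cen (dec f) = f"
proof -
  note P = F_on_PL2[OF f] and h = F_on_homeo[OF f]
  have f': "f \<in> F_on (-1/2) (1/2)" by (rule F_on_mono[OF f]) (use rs01 in auto)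
  have map: "f x \<in> {-1/2..1/2} \<longleftrightarrow> x \<in> {-1/2..1/2}" for x
    using homeo_le[OF h, of "-1/2" x] homeo_le[OF h, of x "1/2"] F_on_outside[OF f', of "-1/2"] F_on_outside[OF f', of "1/2"]
    by simp
  have dec: "dec f t = f (t - 1/2) + 1/2" if "t \<in> unit_interval" for t using that unfolding dec_def by simp
  have mono: "strict_mono_on unit_interval (dec f)"
    using homeo_less[OF h] dec by (auto intro!: strict_mono_onI)
  have into: "dec f t \<in> unit_interval" if "t \<in> unit_interval" for t
    using map[of "t - 1/2"] that dec[OF that] by simp
  have inv_into: "hinv f (y - 1/2) + 1/2 \<in> unit_interval" if "y \<in> unit_interval" for y
    using map[of "hinv f (y - 1/2)"] homeo_f_inv[OF h] that by auto
  have "homeomorphism unit_interval unit_interval (dec f) (\<lambda>y. hinv f (y - 1/2) + 1/2)"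
    unfolding homeomorphism_def
  proof (intro conjI ballI)
    show "continuous_on unit_interval (dec f)"
      by (rule continuous_on_eq[of _ "\<lambda>t. f (t - 1/2) + 1/2"])
         (auto simp: dec intro!: continuous_intros continuous_on_compose2[OF homeo_continuous[OF h, of UNIV]])
    show "continuous_on unit_interval (\<lambda>y. hinv f (y - 1/2) + 1/2)"
      by (intro continuous_intros continuous_on_compose2[OF homeo_continuous[OF homeo_inv[OF h], of UNIV]]) auto
    show 1: "hinv f (dec f x - 1/2) + 1/2 = x" if "x \<in> unit_interval" for x
      using dec[OF that] homeo_inv_f[OF h] by simp
    show 2: "dec f (hinv f (y - 1/2) + 1/2) = y" if "y \<in> unit_interval" for y
      using dec[OF inv_into[OF that]] homeo_f_inv[OF h] by simp
    show "dec f ` unit_interval = unit_interval"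
    proof
      show "dec f ` unit_interval \<subseteq> unit_interval" using into by blast
      show "unit_interval \<subseteq> dec f ` unit_interval" using 2 inv_into by (metis imageI subsetI)
    qed
    show "(\<lambda>y. hinv f (y - 1/2) + 1/2) ` unit_interval = unit_interval"
    proof
      show "(\<lambda>y. hinv f (y - 1/2) + 1/2) ` unit_interval \<subseteq> unit_interval" using inv_into by blast
      show "unit_interval \<subseteq> (\<lambda>y. hinv f (y - 1/2) + 1/2) ` unit_interval"
        using 1 into by (metis (no_types, lifting) image_eqI subsetI)
    qed
  qed
  then have carr: "dec f \<in> carrier (Homeo_plus unit_interval)"
    unfolding Homeo_plus_def Homeo_def using mono by (auto simp: dec_def)
  define Z where "Z = {x\<in>{-1/2..1/2}. rs f x \<noteq> ls f x}"
  have Z: "finite Z" unfolding Z_def using PL2_finite_breaks[OF P, of "-1/2" "1/2"] by simp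
  have half: "1/2 \<in> dyadic" using dyadic_half[of 1] by auto
  have pl: "piecewise_linear (dec f)"
    unfolding piecewise_linear_def
  proof (intro exI[of _ "(\<lambda>x. x + 1/2) ` Z"] conjI allI impI)
    show "finite ((\<lambda>x. x + 1/2) ` Z)" using Z by simp
    fix u v assume uv: "0 \<le> u \<and> u < v \<and> v \<le> 1 \<and> (\<lambda>x. x + 1/2) ` Z \<inter> {u<..<v} = {}"
    have "\<forall>x\<in>{u - 1/2..v - 1/2}. f x = f (u - 1/2) + 2 powi (rs f (u - 1/2)) * (x - (u - 1/2))"
    proof (rule PL2_affine_piece[OF P])
      show "u - 1/2 < v - 1/2" using uv by simp
      fix x assume x: "u - 1/2 < x" "x < v - 1/2"
      then have "x + 1/2 \<in> {u<..<v}" by simp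
      then have "x \<notin> Z" using uv by blast
      then show "rs f x = ls f x" using x uv unfolding Z_def by auto
    qed
    from this[THEN bspec, of "x - 1/2" for x]
    have *: "f (x - 1/2) = f (u - 1/2) + 2 powi (rs f (u - 1/2)) * (x - 1/2 - (u - 1/2))" if "x \<in> {u..v}" for x
      by this (use that in auto)
    have "dec f x = 2 powi (rs f (u - 1/2)) * x + (f (u - 1/2) + 1/2 - 2 powi (rs f (u - 1/2)) * u)"
      if "x \<in> {u..v}" for x
      using dec[of x] *[OF that] that uv by (simp add: algebra_simps)
    then show "\<exists>m c. \<forall>x\<in>{u..v}. dec f x = m * x + c" by blast
  qed
  have slopes: "\<exists>e>0. \<forall>s\<in>unit_interval. t \<le> s \<and> s \<le> t + e \<longrightarrow> dec f s = dec f t + 2 powi (rs f (t - 1/2)) * (s - t)"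
    "\<exists>e>0. \<forall>s\<in>unit_interval. t - e \<le> s \<and> s \<le> t \<longrightarrow> dec f s = dec f t + 2 powi (ls f (t - 1/2)) * (s - t)"
    if t: "t \<in> unit_interval" for t
  proof -
    obtain a where a: "a > 0" "\<forall>y. t - 1/2 \<le> y \<and> y \<le> t - 1/2 + a \<longrightarrow> f y = f (t - 1/2) + 2 powi (rs f (t - 1/2)) * (y - (t - 1/2))"
      using rlin_rs[OF P, of "t - 1/2"] unfolding rlin_def by blast
    have "dec f s = dec f t + 2 powi (rs f (t - 1/2)) * (s - t)" if "s \<in> unit_interval" "t \<le> s" "s \<le> t + a" for s
      using a(2)[rule_format, of "s - 1/2"] dec[OF t] dec[OF that(1)] that by simp
    then show "\<exists>e>0. \<forall>s\<in>unit_interval. t \<le> s \<and> s \<le> t + e \<longrightarrow> dec f s = dec f t + 2 powi (rs f (t - 1/2)) * (s - t)"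
      using a(1) by blast
    obtain b where b: "b > 0" "\<forall>y. t - 1/2 - b \<le> y \<and> y \<le> t - 1/2 \<longrightarrow> f y = f (t - 1/2) + 2 powi (ls f (t - 1/2)) * (y - (t - 1/2))"
      using llin_ls[OF P, of "t - 1/2"] unfolding llin_iff by blast
    have "dec f s = dec f t + 2 powi (ls f (t - 1/2)) * (s - t)" if "s \<in> unit_interval" "t - b \<le> s" "s \<le> t" for s
      using b(2)[rule_format, of "s - 1/2"] dec[OF t] dec[OF that(1)] that by simp
    then show "\<exists>e>0. \<forall>s\<in>unit_interval. t - e \<le> s \<and> s \<le> t \<longrightarrow> dec f s = dec f t + 2 powi (ls f (t - 1/2)) * (s - t)"
      using b(1) by blast
  qed
  have diff: "dec f differentiable (at t within unit_interval)" if t: "t \<in> unit_interval - (\<lambda>x. x + 1/2) ` Z" for t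
  proof -
    have "t - 1/2 \<notin> Z" using t by (metis DiffD2 diff_add_cancel image_eqI)
    then have eq: "ls f (t - 1/2) = rs f (t - 1/2)" using t unfolding Z_def by auto
    have t': "t \<in> unit_interval" using t by blast
    obtain a b where ab: "a > 0" "\<forall>s\<in>unit_interval. t \<le> s \<and> s \<le> t + a \<longrightarrow> dec f s = dec f t + 2 powi (rs f (t - 1/2)) * (s - t)"
      "b > 0" "\<forall>s\<in>unit_interval. t - b \<le> s \<and> s \<le> t \<longrightarrow> dec f s = dec f t + 2 powi (rs f (t - 1/2)) * (s - t)"
      using slopes[OF t'] unfolding eq by blast
    have "((\<lambda>s. dec f t + 2 powi (rs f (t - 1/2)) * (s - t)) has_real_derivative 2 powi (rs f (t - 1/2))) (at t within unit_interval)"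
      by (auto intro!: derivative_eq_intros)
    then have "(dec f has_real_derivative 2 powi (rs f (t - 1/2))) (at t within unit_interval)"
    proof (rule has_field_derivative_transform_within[where d = "min a b"])
      show "dec f t + 2 powi (rs f (t - 1/2)) * (s - t) = dec f s" if s: "s \<in> unit_interval" "dist s t < min a b" for s
      proof (cases "t \<le> s")
        case True
        then have "s \<le> t + a" using s by (auto simp: dist_real_def)
        then show ?thesis using ab(2)[rule_format, OF s(1)] True by simp
      next
        case False
        then have "t - b \<le> s" using s by (auto simp: dist_real_def)
        then show ?thesis using ab(4)[rule_format, OF s(1)] False by simp
      qed
    qed (use ab(1,3) t' in auto)
    then show ?thesis unfolding real_differentiable_def by blast
  qed
  have pow: "\<exists>k::int. d = 2 powi k" if t: "t \<in> unit_interval" and d: "(dec f has_real_derivative d) (at t within unit_interval)" for t d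
  proof (cases "t < 1")
    case True
    obtain a where a: "a > 0" "\<forall>s\<in>unit_interval. t \<le> s \<and> s \<le> t + a \<longrightarrow> dec f s = dec f t + 2 powi (rs f (t - 1/2)) * (s - t)"
      using slopes(1)[OF t] by blast
    have "d = 2 powi (rs f (t - 1/2))"
    proof (rule right_derivative_slope[OF d])
      show "min a (1 - t) > 0" using a(1) True by simp
      show "dec f s = dec f t + 2 powi rs f (t - 1 / 2) * (s - t)" if "t \<le> s" "s \<le> t + min a (1 - t)" for s
        using a(2)[rule_format, of s] that t by auto
    qed (use t True in auto)
    then show ?thesis by blast
  next
    case False
    then have t1: "t = 1" using t by simp
    obtain a where a: "a > 0" "\<forall>s\<in>unit_interval. t - a \<le> s \<and> s \<le> t \<longrightarrow> dec f s = dec f t + 2 powi (ls f (t - 1/2)) * (s - t)"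
      using slopes(2)[OF t] by blast
    have "d = 2 powi (ls f (t - 1/2))"
    proof (rule left_derivative_slope[OF d])
      show "min a 1 > 0" using a(1) by simp
      show "dec f s = dec f t + 2 powi ls f (t - 1 / 2) * (s - t)" if "t - min a 1 \<le> s" "s \<le> t" for s
        using a(2)[rule_format, of s] that t1 by auto
    qed (use t1 in auto)
    then show ?thesis by blast
  qed
  have Zd: "(\<lambda>x. x + 1/2) ` Z \<subseteq> dyadic"
    using PL2_break[OF P rlin_rs[OF P] llin_ls[OF P]] half unfolding Z_def by auto
  have F: "dec f \<in> thompson_F"
    unfolding thompson_F_def using carr pl diff pow Zd Z by blast
  have "Supp (dec f) \<subseteq> {r..s}"
  proof
    fix t assume "t \<in> Supp (dec f)"
    then have "t \<in> unit_interval" "f (t - 1/2) \<noteq> t - 1/2" using dec unfolding Supp_def by auto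
    then show "t \<in> {r..s}" using F_on_outside[OF f, of "t - 1/2"] by force
  qed
  then show "dec f \<in> thompson_F_on r s" using F unfolding thompson_F_on_def by simp
  show "cen (dec f) = f"
  proof
    fix x show "cen (dec f) x = f x"
    proof (cases "\<bar>x\<bar> \<le> 1/2")
      case True
      then have "0 \<le> x + 1/2" "x + 1/2 \<le> 1" by linarith+
      then show ?thesis using True by (simp add: cen_def dec_def)
    next
      case False
      then have "x \<le> -1/2 \<or> 1/2 \<le> x" by linarith
      then show ?thesis using F_on_outside[OF f'] False by (simp add: cen_def)
    qed
  qed
qed

subsection \<open>Perfectness\<close>

abbreviation HP :: "(real \<Rightarrow> real) monoid" where "HP \<equiv> Homeo_plus UNIV"

lemma HP_mult [simp]: "f \<otimes>\<^bsub>HP\<^esub> g = g \<circ> f"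
  by (simp add: Homeo_plus_def Homeo_def compose_def fun_eq_iff)

lemma HP_one [simp]: "\<one>\<^bsub>HP\<^esub> = id"
  by (simp add: Homeo_plus_def Homeo_def fun_eq_iff)

lemma HP_carrier: "f \<in> carrier HP \<longleftrightarrow> homeo f"
proof
  assume "f \<in> carrier HP"
  then show "homeo f"
    unfolding Homeo_plus_def Homeo_def homeomorphism_def homeo_def by auto
next
  assume f: "homeo f"
  have "homeomorphism UNIV UNIV f (hinv f)"
    unfolding homeomorphism_def
    using homeo_continuous[OF f] homeo_continuous[OF homeo_inv[OF f]] homeo_inv_f[OF f] homeo_f_inv[OF f]
      f homeo_inv[OF f] unfolding homeo_def by simp
  then show "f \<in> carrier HP"
    using f unfolding Homeo_plus_def Homeo_def homeo_def by auto
qed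

lemma group_HP: "group HP"
proof (rule groupI)
  show "f \<otimes>\<^bsub>HP\<^esub> g \<in> carrier HP" if "f \<in> carrier HP" "g \<in> carrier HP" for f g
    using that homeo_comp by (simp add: HP_carrier)
  show "\<one>\<^bsub>HP\<^esub> \<in> carrier HP" by (simp add: HP_carrier)
  show "\<exists>g\<in>carrier HP. g \<otimes>\<^bsub>HP\<^esub> f = \<one>\<^bsub>HP\<^esub>" if "f \<in> carrier HP" for f
    using that homeo_inv homeo_f_inv by (intro bexI[of _ "hinv f"]) (auto simp: HP_carrier fun_eq_iff)
qed (auto simp: comp_assoc)

lemma HP_inv: "homeo f \<Longrightarrow> inv\<^bsub>HP\<^esub> f = hinv f"
proof -
  assume f: "homeo f"
  interpret group HP by (rule group_HP)
  show ?thesis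
    by (rule inv_equality) (use f homeo_inv homeo_f_inv in \<open>auto simp: HP_carrier fun_eq_iff\<close>)
qed

lemma group_Homeo: "group (Homeo S)"
proof (rule groupI)
  fix f g assume f: "f \<in> carrier (Homeo S)" and g: "g \<in> carrier (Homeo S)"
  obtain f' g' where h: "homeomorphism S S f f'" "homeomorphism S S g g'"
    using f g unfolding Homeo_def by auto
  have "homeomorphism S S (g \<circ> f) (f' \<circ> g')" by (rule homeomorphism_compose[OF h])
  then have "homeomorphism S S (compose S g f) (f' \<circ> g')"
    by (rule homeomorphism_cong) (auto simp: compose_def)
  then show "f \<otimes>\<^bsub>Homeo S\<^esub> g \<in> carrier (Homeo S)"
    unfolding Homeo_def by auto
next
  have "homeomorphism S S (\<lambda>x\<in>S. x) (\<lambda>x. x)"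
    unfolding homeomorphism_def by (auto intro: continuous_on_eq[OF continuous_on_id])
  then show "\<one>\<^bsub>Homeo S\<^esub> \<in> carrier (Homeo S)" unfolding Homeo_def by auto
next
  fix f g h assume f: "f \<in> carrier (Homeo S)"
  then have "f \<in> S \<rightarrow> S" unfolding Homeo_def homeomorphism_def by auto
  then show "f \<otimes>\<^bsub>Homeo S\<^esub> g \<otimes>\<^bsub>Homeo S\<^esub> h = f \<otimes>\<^bsub>Homeo S\<^esub> (g \<otimes>\<^bsub>Homeo S\<^esub> h)"
    using compose_assoc[of f S S h g] by (simp add: Homeo_def)
next
  fix f assume f: "f \<in> carrier (Homeo S)"
  then show "\<one>\<^bsub>Homeo S\<^esub> \<otimes>\<^bsub>Homeo S\<^esub> f = f"
    by (auto simp: Homeo_def compose_def extensional_def restrict_def)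
  obtain f' where h: "homeomorphism S S f f'" using f unfolding Homeo_def by auto
  have "homeomorphism S S (restrict f' S) f"
    by (rule homeomorphism_cong[OF homeomorphism_symD[OF h]]) auto
  moreover have "compose S f (restrict f' S) = (\<lambda>x\<in>S. x)"
    using h unfolding homeomorphism_def compose_def by (auto simp: restrict_def)
  ultimately show "\<exists>g\<in>carrier (Homeo S). g \<otimes>\<^bsub>Homeo S\<^esub> f = \<one>\<^bsub>Homeo S\<^esub>"
    by (intro bexI[of _ "restrict f' S"]) (auto simp: Homeo_def)
qed

lemma Homeo_maps:
  assumes "f \<in> carrier (Homeo unit_interval)" "0 \<le> t" "t \<le> 1"
  shows "0 \<le> f t \<and> f t \<le> 1"
  using assms unfolding Homeo_def homeomorphism_def by force

lemma cen_mult: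
  assumes "f \<in> carrier (Homeo unit_interval)"
  shows "cen (f \<otimes>\<^bsub>Homeo unit_interval\<^esub> g) = cen g \<circ> cen f"
proof
  fix x show "cen (f \<otimes>\<^bsub>Homeo unit_interval\<^esub> g) x = (cen g \<circ> cen f) x"
  proof (cases "\<bar>x\<bar> \<le> 1/2")
    case True
    then have t: "0 \<le> x + 1/2" "x + 1/2 \<le> 1" by linarith+
    have "\<bar>f (x + 1/2) - 1/2\<bar> \<le> 1/2" using Homeo_maps[OF assms t] by linarith
    then show ?thesis using True t by (simp add: cen_def Homeo_def compose_def)
  qed (simp add: cen_def)
qed

lemma cen_one: "cen \<one>\<^bsub>Homeo unit_interval\<^esub> = id"
proof
  fix x show "cen \<one>\<^bsub>Homeo unit_interval\<^esub> x = id x"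
  proof (cases "\<bar>x\<bar> \<le> 1/2")
    case True
    then have "0 \<le> x + 1/2" "x + 1/2 \<le> 1" by linarith+
    then show ?thesis using True by (simp add: cen_def Homeo_def)
  qed (simp add: cen_def)
qed

text \<open>Congruence modulo M is compatible with products because M contains all commutators.
  Modulo M the two generators commute, so the powers in a word can be collected.\<close>

lemma (in group) two_generated_mod:
  assumes ab: "a \<in> carrier G" "b \<in> carrier G" and gen: "carrier G = generate G {a, b}"
    and M: "subgroup M G" and comm: "\<And>x y. \<lbrakk>x \<in> carrier G; y \<in> carrier G\<rbrakk> \<Longrightarrow> x \<otimes> y \<otimes> inv x \<otimes> inv y \<in> M"
    and x: "x \<in> carrier G"
  shows "\<exists>(i::int) (j::int). x \<otimes> inv (a [^] i \<otimes> b [^] j) \<in> M"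
proof -
  define eq where "eq x y \<longleftrightarrow> x \<otimes> inv y \<in> M" for x y
  have mG: "m \<in> carrier G" if "m \<in> M" for m using subgroup.mem_carrier[OF M that] .
  have cancel: "inv y \<otimes> (y \<otimes> w) = w" "y \<otimes> (inv y \<otimes> w) = w" if "y \<in> carrier G" "w \<in> carrier G" for y w
    using that by (simp_all add: m_assoc[symmetric])
  have refl: "eq x x" if "x \<in> carrier G" for x
    using that subgroup.one_closed[OF M] by (simp add: eq_def)
  have sym: "eq y x" if "eq x y" "x \<in> carrier G" "y \<in> carrier G" for x y
  proof -
    have "inv (x \<otimes> inv y) \<in> M" using that(1) subgroup.m_inv_closed[OF M] unfolding eq_def by blast
    then show ?thesis using that by (simp add: eq_def inv_mult_group)
  qed
  have trans: "eq x z" if "eq x y" "eq y z" "x \<in> carrier G" "y \<in> carrier G" "z \<in> carrier G" for x y z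
  proof -
    have "(x \<otimes> inv y) \<otimes> (y \<otimes> inv z) \<in> M" using that subgroup.m_closed[OF M] unfolding eq_def by blast
    then show ?thesis using that by (simp add: eq_def m_assoc cancel)
  qed
  have right: "eq (x \<otimes> z) (y \<otimes> z)" if "eq x y" "x \<in> carrier G" "y \<in> carrier G" "z \<in> carrier G" for x y z
    using that by (simp add: eq_def inv_mult_group m_assoc cancel)
  have swap: "eq (x \<otimes> y) (y \<otimes> x)" if "x \<in> carrier G" "y \<in> carrier G" for x y
    using comm[OF that] that by (simp add: eq_def inv_mult_group m_assoc)
  have left: "eq (z \<otimes> x) (z \<otimes> y)" if "eq x y" "x \<in> carrier G" "y \<in> carrier G" "z \<in> carrier G" for x y z
    using trans[OF swap[OF that(4,2)] trans[OF right[OF that(1-4)] swap[OF that(3,4)]]] that by simp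
  have cong: "eq (x \<otimes> x') (y \<otimes> y')" if "eq x y" "eq x' y'" "x \<in> carrier G" "y \<in> carrier G" "x' \<in> carrier G" "y' \<in> carrier G" for x y x' y'
    using trans[OF right[OF that(1,3,4,5)] left[OF that(2,5,6,4)]] that by simp
  have P: "\<exists>(i::int) (j::int). eq x (a [^] i \<otimes> b [^] j)" if "x \<in> generate G {a, b}" for x
    using that
  proof induction
    case one
    show ?case using refl[of \<one>] by (intro exI[of _ "0::int"]) simp
  next
    case (incl h)
    have "eq a (a [^] (1::int) \<otimes> b [^] (0::int))" "eq b (a [^] (0::int) \<otimes> b [^] (1::int))"
      using ab refl int_pow_1 by auto
    then show ?case using incl by blast
  next
    case (inv h)
    have "eq (inv a) (a [^] (-1::int) \<otimes> b [^] (0::int))" "eq (inv b) (a [^] (0::int) \<otimes> b [^] (-1::int))"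
      using ab refl by (auto simp: int_pow_neg int_pow_1)
    then show ?case using inv by blast
  next
    case (eng h1 h2)
    then obtain i j i' j' :: int where ij: "eq h1 (a [^] i \<otimes> b [^] j)" "eq h2 (a [^] i' \<otimes> b [^] j')" by blast
    have hG: "h1 \<in> carrier G" "h2 \<in> carrier G" using eng gen by auto
    let ?A = "a [^] i" and ?B = "b [^] j" and ?A' = "a [^] i'" and ?B' = "b [^] j'"
    have c: "?A \<in> carrier G" "?B \<in> carrier G" "?A' \<in> carrier G" "?B' \<in> carrier G" using ab by auto
    have "eq (h1 \<otimes> h2) ((?A \<otimes> ?B) \<otimes> (?A' \<otimes> ?B'))" using cong[OF ij] hG c by simp
    moreover have "(?A \<otimes> ?B) \<otimes> (?A' \<otimes> ?B') = ?A \<otimes> ((?B \<otimes> ?A') \<otimes> ?B')" using c by (simp add: m_assoc)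
    moreover have "eq (?A \<otimes> ((?B \<otimes> ?A') \<otimes> ?B')) (?A \<otimes> ((?A' \<otimes> ?B) \<otimes> ?B'))"
      using left[OF right[OF swap[OF c(2,3)]]] c by simp
    moreover have "?A \<otimes> ((?A' \<otimes> ?B) \<otimes> ?B') = a [^] (i + i') \<otimes> b [^] (j + j')"
      using c ab by (simp add: int_pow_mult m_assoc)
    ultimately have "eq (h1 \<otimes> h2) (a [^] (i + i') \<otimes> b [^] (j + j'))"
      using trans[of "h1 \<otimes> h2" "?A \<otimes> ((?B \<otimes> ?A') \<otimes> ?B')" "?A \<otimes> ((?A' \<otimes> ?B) \<otimes> ?B')"] hG c ab by simp
    then show ?case by blast
  qed
  show ?thesis using P x gen unfolding eq_def by blast
qed

text \<open>A group with two generators that maps onto a group isomorphic to \<open>\<int>\<^sup>2\<close> has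
  abelianization \<open>\<int>\<^sup>2\<close>, so the kernel of the map is generated by commutators.\<close>

lemma (in group) two_generated_kernel:
  fixes \<alpha> \<mu> :: "'a \<Rightarrow> int"
  assumes ab: "a \<in> carrier G" "b \<in> carrier G" and gen: "carrier G = generate G {a, b}"
    and lam: "\<And>x y. \<lbrakk>x \<in> carrier G; y \<in> carrier G\<rbrakk> \<Longrightarrow> \<alpha> (x \<otimes> y) = \<alpha> x + \<alpha> y"
    and mu: "\<And>x y. \<lbrakk>x \<in> carrier G; y \<in> carrier G\<rbrakk> \<Longrightarrow> \<mu> (x \<otimes> y) = \<mu> x + \<mu> y"
    and u: "u \<in> carrier G" "\<alpha> u = 1" "\<mu> u = 0" and v: "v \<in> carrier G" "\<alpha> v = 0" "\<mu> v = -1"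
    and N: "subgroup N G" and comm: "\<And>x y. \<lbrakk>x \<in> carrier G; y \<in> carrier G\<rbrakk> \<Longrightarrow> x \<otimes> y \<otimes> inv x \<otimes> inv y \<in> N"
    and x: "x \<in> carrier G" "\<alpha> x = 0" "\<mu> x = 0"
  shows "x \<in> N"
proof -
  have one: "f \<one> = 0" and inv: "y \<in> carrier G \<Longrightarrow> f (inv y) = - f y"
    and pow: "y \<in> carrier G \<Longrightarrow> f (y [^] (k::int)) = k * f y"
    if f: "\<And>x y. \<lbrakk>x \<in> carrier G; y \<in> carrier G\<rbrakk> \<Longrightarrow> f (x \<otimes> y) = f x + f y" for f :: "'a \<Rightarrow> int" and y k
  proof -
    show o: "f \<one> = 0" using f[of \<one> \<one>] by simp
    have i: "f (inv y) = - f y" if "y \<in> carrier G" for y using f[of y "inv y"] that o by simp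
    then show "y \<in> carrier G \<Longrightarrow> f (inv y) = - f y" .
    have n: "f (y [^] (m::nat)) = int m * f y" if "y \<in> carrier G" for y m
      by (induction m) (use o f that in \<open>auto simp: algebra_simps\<close>)
    assume y: "y \<in> carrier G"
    show "f (y [^] k) = k * f y"
    proof (cases "k \<ge> 0")
      case True
      then obtain m where m: "k = int m" using nonneg_int_cases by blast
      show ?thesis unfolding m int_pow_int by (rule n[OF y])
    next
      case False
      then have "k \<le> 0" by simp
      then obtain m where m: "k = - int m" using nonpos_int_cases by blast
      show ?thesis unfolding m int_pow_neg[OF y] int_pow_int using i[of "y [^] m"] n[OF y, of m] y by simp
    qed
  qed
  \<comment> \<open>Like N it contains the commutators, but congruence modulo M also preserves
    \<alpha> and \<mu>.\<close>
  define M where "M = {n \<in> N. \<alpha> n = 0 \<and> \<mu> n = 0}"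
  have nG: "n \<in> carrier G" if "n \<in> N" for n using subgroup.mem_carrier[OF N that] .
  have M: "subgroup M G"
  proof (rule subgroupI)
    show "M \<subseteq> carrier G" using nG M_def by auto
    show "M \<noteq> {}" using one[OF lam] one[OF mu] subgroup.one_closed[OF N] M_def by blast
  qed (use subgroup.m_inv_closed[OF N] subgroup.m_closed[OF N] nG lam mu inv[OF lam] inv[OF mu] in \<open>auto simp: M_def\<close>)
  have commM: "x \<otimes> y \<otimes> inv x \<otimes> inv y \<in> M" if "x \<in> carrier G" "y \<in> carrier G" for x y
    using comm[OF that] that lam mu inv[OF lam] inv[OF mu] by (simp add: M_def)
  have rep: "\<exists>i j. \<alpha> y = i * \<alpha> a + j * \<alpha> b \<and> \<mu> y = i * \<mu> a + j * \<mu> b \<and> y \<otimes> inv (a [^] i \<otimes> b [^] j) \<in> M"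
    if y: "y \<in> carrier G" for y
  proof -
    obtain i j :: int where ij: "y \<otimes> inv (a [^] i \<otimes> b [^] j) \<in> M"
      using two_generated_mod[OF ab gen M commM y] by blast
    then have "\<alpha> (y \<otimes> inv (a [^] i \<otimes> b [^] j)) = 0" "\<mu> (y \<otimes> inv (a [^] i \<otimes> b [^] j)) = 0"
      unfolding M_def by auto
    then have "\<alpha> y = i * \<alpha> a + j * \<alpha> b" "\<mu> y = i * \<mu> a + j * \<mu> b"
      using y ab by (auto simp: lam mu inv[OF lam] inv[OF mu] pow[OF lam] pow[OF mu])
    then show ?thesis using ij by blast
  qed
  obtain i j where ij: "1 = i * \<alpha> a + j * \<alpha> b" "0 = i * \<mu> a + j * \<mu> b" using rep[OF u(1)] u by auto
  obtain i' j' where ij': "0 = i' * \<alpha> a + j' * \<alpha> b" "-1 = i' * \<mu> a + j' * \<mu> b" using rep[OF v(1)] v by auto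
  obtain p q where pq: "0 = p * \<alpha> a + q * \<alpha> b" "0 = p * \<mu> a + q * \<mu> b" "x \<otimes> inv (a [^] p \<otimes> b [^] q) \<in> M"
    using rep[OF x(1)] x by auto
  \<comment> \<open>The determinant of (\<alpha>, \<mu>) on the generators. The exponents of u and v
    show that it divides -1, so it is not 0, and the exponents p and q of x must vanish.\<close>
  define D where "D = \<alpha> a * \<mu> b - \<alpha> b * \<mu> a"
  have "(i * j' - i' * j) * D = (i * \<alpha> a + j * \<alpha> b) * (i' * \<mu> a + j' * \<mu> b) - (i * \<mu> a + j * \<mu> b) * (i' * \<alpha> a + j' * \<alpha> b)"
    unfolding D_def by (simp add: algebra_simps)
  also have "\<dots> = -1" using ij ij' by (metis mult_1 mult_zero_left diff_zero)
  finally have D: "D \<noteq> 0" by auto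
  have "p * D = (p * \<alpha> a + q * \<alpha> b) * \<mu> b - (p * \<mu> a + q * \<mu> b) * \<alpha> b"
    "q * D = (p * \<mu> a + q * \<mu> b) * \<alpha> a - (p * \<alpha> a + q * \<alpha> b) * \<mu> a"
    unfolding D_def by (simp_all add: algebra_simps)
  then have "p * D = 0" "q * D = 0" using pq by (metis mult_zero_left diff_self)+
  then have "p = 0" "q = 0" using D by auto
  then show ?thesis using pq(3) x(1) unfolding M_def by simp
qed

locale generated_F =
  fixes \<nu>2 \<nu>3 :: "real \<Rightarrow> real"
  assumes nu_carrier: "\<nu>2 \<in> carrier (Homeo unit_interval)" "\<nu>3 \<in> carrier (Homeo unit_interval)"
    and nu_generate: "generate (Homeo unit_interval) {\<nu>2, \<nu>3} = thompson_F_on (1/16) (15/16)"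
begin

text \<open>The bounds are 1/16 and 15/16 after centring.\<close>

abbreviation F0 :: "(real \<Rightarrow> real) set" where "F0 \<equiv> F_on (-7/16) (7/16)"

lemma cen_nu: "cen \<nu>2 \<in> F0" "cen \<nu>3 \<in> F0"
proof -
  have "\<nu>2 \<in> thompson_F_on (1/16) (15/16)" "\<nu>3 \<in> thompson_F_on (1/16) (15/16)"
    unfolding nu_generate[symmetric] by (auto intro: generate.incl)
  then show "cen \<nu>2 \<in> F0" "cen \<nu>3 \<in> F0"
    using cen_F_on[of _ "1/16" "15/16"] by (auto simp: field_simps)
qed

text \<open>As \<open>dec\<close> is inverted by \<open>cen\<close>, every element of F0 is the
  centred image of a word in \<nu>2 and \<nu>3.\<close>

lemma F0_induct:
  assumes f: "f \<in> F0" and Y: "id \<in> Y" "cen \<nu>2 \<in> Y" "cen \<nu>3 \<in> Y"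
    "\<And>f g. \<lbrakk>f \<in> Y; g \<in> Y; f \<in> F0; g \<in> F0\<rbrakk> \<Longrightarrow> g \<circ> f \<in> Y" "\<And>f. \<lbrakk>f \<in> Y; f \<in> F0\<rbrakk> \<Longrightarrow> hinv f \<in> Y"
  shows "f \<in> Y"
proof -
  interpret U: group "Homeo unit_interval" by (rule group_Homeo)
  have sub: "{\<nu>2, \<nu>3} \<subseteq> carrier (Homeo unit_interval)" using nu_carrier by auto
  have "cen h \<in> Y \<and> cen h \<in> F0" if "h \<in> generate (Homeo unit_interval) {\<nu>2, \<nu>3}" for h
    using that
  proof induction
    case one
    show ?case unfolding cen_one using Y(1) F_on_id by blast
  next
    case (incl h)
    then show ?case using Y cen_nu by blast
  next
    case (inv h)
    have h: "h \<in> carrier (Homeo unit_interval)" "cen h \<in> Y" "cen h \<in> F0" using inv sub Y cen_nu by auto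
    have "cen (inv\<^bsub>Homeo unit_interval\<^esub> h) = hinv (cen h)"
    proof
      fix y
      have "cen h \<circ> cen (inv\<^bsub>Homeo unit_interval\<^esub> h) = id"
        using cen_mult[of "inv\<^bsub>Homeo unit_interval\<^esub> h" h] h cen_one by simp
      then have "cen h (cen (inv\<^bsub>Homeo unit_interval\<^esub> h) y) = y" by (metis comp_apply id_apply)
      then show "cen (inv\<^bsub>Homeo unit_interval\<^esub> h) y = hinv (cen h) y"
        using homeo_inv_f[OF F_on_homeo[OF h(3)]] by metis
    qed
    then show ?case using Y(5) h F_on_inv by simp
  next
    case (eng h1 h2)
    have h1: "h1 \<in> carrier (Homeo unit_interval)" using U.generate_in_carrier[OF sub eng(1)] .
    show ?case unfolding cen_mult[OF h1] using eng Y(4) F_on_comp by blast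
  qed
  moreover have "dec f \<in> thompson_F_on (1/16) (15/16)" "cen (dec f) = f"
    using dec_thompson[of f "1/16" "15/16"] f by (auto simp: field_simps)
  ultimately show ?thesis using nu_generate by metis
qed

lemma F0_subgroup: "subgroup (F_on a b) HP"
proof -
  interpret group HP by (rule group_HP)
  show ?thesis
  proof (rule subgroupI)
    show "F_on a b \<subseteq> carrier HP" using F_on_homeo HP_carrier by blast
    show "F_on a b \<noteq> {}" using F_on_id by blast
  qed (use F_on_homeo HP_inv F_on_inv F_on_comp in auto)
qed

text \<open>The logarithms of the slopes at both ends are homomorphisms that vanish on f and map the
  two-generated group F0 onto a free abelian group of rank 2. Hence
  \<open>two_generated_kernel\<close> applies, and no presentation of Thompson's group is
  involved.\<close>

lemma F0_commutators:
  assumes N: "subgroup N HP" and comm: "\<And>f g. \<lbrakk>f \<in> F0; g \<in> F0\<rbrakk> \<Longrightarrow> f \<otimes>\<^bsub>HP\<^esub> g \<otimes>\<^bsub>HP\<^esub> inv\<^bsub>HP\<^esub> f \<otimes>\<^bsub>HP\<^esub> inv\<^bsub>HP\<^esub> g \<in> N"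
    and f: "f \<in> Q_on (-7/16) (7/16)"
  shows "f \<in> N"
proof -
  interpret HPg: group HP by (rule group_HP)
  define K where "K = HP\<lparr>carrier := F0\<rparr>"
  interpret K: group K unfolding K_def by (rule HPg.subgroup_imp_group[OF F0_subgroup])
  have Kc: "carrier K = F0" and Km: "x \<otimes>\<^bsub>K\<^esub> y = y \<circ> x" and K1: "\<one>\<^bsub>K\<^esub> = id" for x y
    unfolding K_def by simp_all
  have Ki: "inv\<^bsub>K\<^esub> x = inv\<^bsub>HP\<^esub> x" "inv\<^bsub>K\<^esub> x = hinv x" if "x \<in> F0" for x
    using HPg.m_inv_consistent[OF F0_subgroup that] HP_inv[OF F_on_homeo[OF that]] unfolding K_def by auto
  have gen: "carrier K = generate K {cen \<nu>2, cen \<nu>3}"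
  proof
    show "generate K {cen \<nu>2, cen \<nu>3} \<subseteq> carrier K"
      using K.generate_incl[of "{cen \<nu>2, cen \<nu>3}"] cen_nu Kc by simp
    show "carrier K \<subseteq> generate K {cen \<nu>2, cen \<nu>3}"
    proof
      fix f assume "f \<in> carrier K"
      then have f: "f \<in> F0" using Kc by simp
      show "f \<in> generate K {cen \<nu>2, cen \<nu>3}"
      proof (rule F0_induct[OF f])
        show "id \<in> generate K {cen \<nu>2, cen \<nu>3}" using generate.one[of K] K1 by simp
        show "g \<circ> f \<in> generate K {cen \<nu>2, cen \<nu>3}"
          if "f \<in> generate K {cen \<nu>2, cen \<nu>3}" "g \<in> generate K {cen \<nu>2, cen \<nu>3}" for f g
          using generate.eng[OF that] Km by simp
        show "hinv f \<in> generate K {cen \<nu>2, cen \<nu>3}" if "f \<in> generate K {cen \<nu>2, cen \<nu>3}" "f \<in> F0" for f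
          using K.generate_m_inv_closed[OF _ that(1)] cen_nu Kc Ki[OF that(2)] by simp
      qed (auto intro: generate.incl)
    qed
  qed
  have e16: "1/16 \<in> dyadic" "1/4 \<in> dyadic" "-7/16 \<in> dyadic"
    using dyadic_powi[of 1 "-4"] dyadic_powi[of 1 "-2"] dyadic_powi[of "-7" "-4"]
    by (auto simp: power_int_minus)
  \<comment> \<open>One bump starts at the left end with slope 2, the other arrives at the right end
    with slope 1/2, since 1/4 + 3/16 = 7/16. Their pairs of logarithmic end slopes are (1, 0) and
    (0, -1).\<close>
  define u v where "u = bump (-7/16) (1/16)" and "v = bump (1/4) (1/16)"
  have "u \<in> F_on (-7/16) (-7/16 + 3 * (1/16))" "v \<in> F_on (1/4) (1/4 + 3 * (1/16))"
    unfolding u_def v_def by (rule bump_F_on; use e16 in simp)+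
  then have uF: "u \<in> F0" and vF: "v \<in> F0" by (auto elim!: F_on_mono)
  have u1: "rs u (-7/16) = 1"
  proof (rule rs_eq)
    show "rlin u (-7/16) 1" unfolding rlin_def
      by (rule exI[of _ "1/16"]) (auto simp: u_def bump_eq)
  qed
  have u2: "ls u (7/16) = 0"
  proof (rule ls_eq)
    show "llin u (7/16) 0" unfolding llin_iff
      by (rule exI[of _ "1/16"]) (auto simp: u_def bump_eq)
  qed
  have v1: "rs v (-7/16) = 0"
  proof (rule rs_eq)
    show "rlin v (-7/16) 0" unfolding rlin_def
      by (rule exI[of _ "1/16"]) (auto simp: v_def bump_eq)
  qed
  have v2: "ls v (7/16) = -1"
  proof (rule ls_eq)
    show "llin v (7/16) (-1)" unfolding llin_iff
      by (rule exI[of _ "1/16"]) (auto simp: v_def bump_eq power_int_minus field_simps)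
  qed
  define N' where "N' = N \<inter> F0"
  have N': "subgroup N' K"
  proof (rule K.subgroupI)
    show "N' \<subseteq> carrier K" using Kc N'_def by auto
    show "N' \<noteq> {}" using subgroup.one_closed[OF N] N'_def by auto
    show "inv\<^bsub>K\<^esub> x \<in> N'" if "x \<in> N'" for x
      using that subgroup.m_inv_closed[OF N] F_on_inv Ki unfolding N'_def by (metis IntD1 IntD2 IntI)
    show "x \<otimes>\<^bsub>K\<^esub> y \<in> N'" if "x \<in> N'" "y \<in> N'" for x y
      using that subgroup.m_closed[OF N, of x y] F_on_comp[of x _ _ y] Km unfolding N'_def by auto
  qed
  have "f \<in> N'"
  proof (rule K.two_generated_kernel[OF _ _ gen, where \<alpha> = "\<lambda>f. rs f (-7/16)" and \<mu> = "\<lambda>f. ls f (7/16)" and u = u and v = v])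
    show "rs (x \<otimes>\<^bsub>K\<^esub> y) (-7/16) = rs x (-7/16) + rs y (-7/16)" if "x \<in> carrier K" "y \<in> carrier K" for x y
      using that Kc Km rs_comp[OF F_on_PL2 F_on_PL2, of x _ _ y] F_on_outside[of x _ _ "-7/16"] by auto
    show "ls (x \<otimes>\<^bsub>K\<^esub> y) (7/16) = ls x (7/16) + ls y (7/16)" if "x \<in> carrier K" "y \<in> carrier K" for x y
    proof -
      have xy: "x \<in> F0" "y \<in> F0" using that Kc by auto
      have "x (7/16) = 7/16" by (rule F_on_outside[OF xy(1)]) simp
      then show ?thesis unfolding Km ls_comp[OF F_on_PL2[OF xy(1)] F_on_PL2[OF xy(2)]] by (simp only:)
    qed
    show "x \<otimes>\<^bsub>K\<^esub> y \<otimes>\<^bsub>K\<^esub> inv\<^bsub>K\<^esub> x \<otimes>\<^bsub>K\<^esub> inv\<^bsub>K\<^esub> y \<in> N'" if "x \<in> carrier K" "y \<in> carrier K" for x y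
    proof -
      have "x \<in> F0" "y \<in> F0" using that Kc by auto
      then have "x \<otimes>\<^bsub>K\<^esub> y \<otimes>\<^bsub>K\<^esub> inv\<^bsub>K\<^esub> x \<otimes>\<^bsub>K\<^esub> inv\<^bsub>K\<^esub> y \<in> N"
        using comm[of x y] Ki(1) unfolding K_def by simp
      moreover have "x \<otimes>\<^bsub>K\<^esub> y \<otimes>\<^bsub>K\<^esub> inv\<^bsub>K\<^esub> x \<otimes>\<^bsub>K\<^esub> inv\<^bsub>K\<^esub> y \<in> carrier K" using that by simp
      ultimately show ?thesis using Kc N'_def by simp
    qed
    obtain c d where cd: "-7/16 < c" "d < 7/16" "f \<in> F_on c d" using f unfolding Q_on_iff by blast
    show "rs f (-7/16) = 0"
    proof (rule rs_eq)
      show "rlin f (-7/16) 0" unfolding rlin_def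
        by (rule exI[of _ "c + 7/16"]) (use cd F_on_outside[OF cd(3)] in auto)
    qed
    show "ls f (7/16) = 0"
    proof (rule ls_eq)
      show "llin f (7/16) 0" unfolding llin_iff
        by (rule exI[of _ "7/16 - d"]) (use cd F_on_outside[OF cd(3)] in auto)
    qed
    show "f \<in> carrier K" using Q_on_imp_F_on[OF f] Kc by simp
  qed (use cen_nu uF vF u1 u2 v1 v2 Kc N' in auto)
  then show ?thesis unfolding N'_def by simp
qed

text \<open>Some q of the same group conjugates f into a small affine copy of F0 inside (a, b),
  where \<open>F0_commutators\<close> puts the conjugate f' into N. As f' and f differ by the
  commutator of the inverse of q with f, also f lies in N.\<close>

theorem Q_on_perfect:
  assumes ab: "a < b" and N: "subgroup N HP"
    and comm: "\<And>f g. \<lbrakk>f \<in> Q_on a b; g \<in> Q_on a b\<rbrakk> \<Longrightarrow> f \<otimes>\<^bsub>HP\<^esub> g \<otimes>\<^bsub>HP\<^esub> inv\<^bsub>HP\<^esub> f \<otimes>\<^bsub>HP\<^esub> inv\<^bsub>HP\<^esub> g \<in> N"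
    and f: "f \<in> Q_on a b"
  shows "f \<in> N"
proof -
  interpret HPg: group HP by (rule group_HP)
  define e where "e = (b - a) / 4"
  have e: "e > 0" using ab unfolding e_def by simp
  obtain t where t: "t \<in> dyadic" "(a + b)/2 - e < t" "t < (a + b)/2 + e"
    using dyadic_dense[of "(a + b)/2 - e" "(a + b)/2 + e"] e by auto
  obtain n where n: "(1/2::real) ^ n < e" using real_arch_pow_inv[OF e, of "1/2"] by auto
  \<comment> \<open>A dyadic translation and a slope that is a power of 2 keep A in
    \<open>PL2\<close>. The image of [-7/16, 7/16] is a short interval near the middle of (a, b),
    whose ends need not be dyadic.\<close>
  define A where "A = aff (- int n) t"
  have A: "A \<in> PL2" unfolding A_def by (rule aff_PL2[OF t(1)])
  note hA = PL2_homeo[OF A]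
  have An: "A x = (1/2) ^ n * x + t" for x
    unfolding A_def aff_def by (simp add: power_int_minus power_one_over inverse_eq_divide)
  define a' b' where "a' = A (-7/16)" and "b' = A (7/16)"
  define r where "r = (1/2::real) ^ n"
  have r: "0 < r" "r < e" using n unfolding r_def by auto
  have te: "a + e < t" "t + e < b" using t(2,3) unfolding e_def by (simp_all add: field_simps)
  have ab': "a < a'" "a' < b'" "b' < b"
    unfolding a'_def b'_def An r_def[symmetric] using r te by simp_all
  obtain c d where cd: "a < c" "c \<le> d" "d < b" "f \<in> F_on c d" using f unfolding Q_on_iff by blast
  obtain q where q: "q \<in> Q_on a b" "a' < q c" "q d < b'"
    using mover[OF cd(1-3), of a' b'] ab' by auto
  note hq = Q_on_homeo[OF q(1)] and hf = Q_on_homeo[OF f]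
  define f' where "f' = q \<circ> f \<circ> hinv q"
  have f'F: "f' \<in> F_on (q c) (q d)" unfolding f'_def by (rule F_on_conj[OF cd(4) Q_on_PL2[OF q(1)]])
  define g where "g = hinv A \<circ> f' \<circ> A"
  have inv2: "hinv (hinv A) = A" using homeo_bij[OF hA] by (rule inv_inv_eq)
  have "g \<in> F_on (hinv A (q c)) (hinv A (q d))"
    using F_on_conj[OF f'F PL2_inv[OF A]] unfolding g_def inv2 .
  moreover have "-7/16 < hinv A (q c)" "hinv A (q d) < 7/16"
    using q homeo_less[OF hA, of "-7/16" "hinv A (q c)"] homeo_less[OF hA, of "hinv A (q d)" "7/16"] homeo_f_inv[OF hA]
    unfolding a'_def b'_def by auto
  ultimately have g: "g \<in> Q_on (-7/16) (7/16)" using F_on_imp_Q_on by fastforce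
  \<comment> \<open>The preimage of N under conjugation by A, which transports the statement about
    F0 to its affine copy.\<close>
  define N' where "N' = {h. homeo h \<and> A \<circ> h \<circ> hinv A \<in> N}"
  have conj_comp: "A \<circ> (k \<circ> h) \<circ> hinv A = (A \<circ> k \<circ> hinv A) \<circ> (A \<circ> h \<circ> hinv A)" for h k
    using homeo_inv_f[OF hA] by (auto simp: fun_eq_iff)
  have conj_inv: "A \<circ> hinv h \<circ> hinv A = inv\<^bsub>HP\<^esub> (A \<circ> h \<circ> hinv A)" if "homeo h" for h
  proof -
    have "homeo (A \<circ> h \<circ> hinv A)" using homeo_comp homeo_inv hA that by (metis comp_assoc)
    moreover have "homeo (A \<circ> hinv h \<circ> hinv A)" using homeo_comp homeo_inv hA that by (metis comp_assoc)
    ultimately show ?thesis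
      by (intro HPg.inv_equality[symmetric])
         (auto simp: HP_carrier fun_eq_iff homeo_inv_f[OF hA] homeo_f_inv[OF hA] homeo_f_inv[OF that])
  qed
  have conj_F: "A \<circ> h \<circ> hinv A \<in> Q_on a b" if "h \<in> F0" for h
    using F_on_imp_Q_on[OF F_on_conj[OF that A]] ab' ab unfolding a'_def b'_def by auto
  have "g \<in> N'"
  proof (rule F0_commutators[OF _ _ g])
    show "subgroup N' HP"
    proof (rule HPg.subgroupI)
      show "N' \<subseteq> carrier HP" unfolding N'_def using HP_carrier by auto
      have "A \<circ> id \<circ> hinv A = id" using homeo_f_inv[OF hA] by auto
      then show "N' \<noteq> {}" using subgroup.one_closed[OF N] unfolding N'_def by (metis (mono_tags, lifting) HP_one empty_Collect_eq homeo_id)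
      show "inv\<^bsub>HP\<^esub> h \<in> N'" if "h \<in> N'" for h
        using that homeo_inv conj_inv subgroup.m_inv_closed[OF N] unfolding N'_def by (auto simp: HP_inv)
      show "h \<otimes>\<^bsub>HP\<^esub> k \<in> N'" if "h \<in> N'" "k \<in> N'" for h k
        using that homeo_comp subgroup.m_closed[OF N] conj_comp[of k h] unfolding N'_def by auto
    qed
    show "h \<otimes>\<^bsub>HP\<^esub> k \<otimes>\<^bsub>HP\<^esub> inv\<^bsub>HP\<^esub> h \<otimes>\<^bsub>HP\<^esub> inv\<^bsub>HP\<^esub> k \<in> N'" if "h \<in> F0" "k \<in> F0" for h k
    proof -
      have hh: "homeo h" "homeo k" using that F_on_homeo by auto
      have "homeo (h \<otimes>\<^bsub>HP\<^esub> k \<otimes>\<^bsub>HP\<^esub> inv\<^bsub>HP\<^esub> h \<otimes>\<^bsub>HP\<^esub> inv\<^bsub>HP\<^esub> k)"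
        using hh HP_carrier HPg.m_closed HPg.inv_closed by (metis)
      moreover have "A \<circ> (h \<otimes>\<^bsub>HP\<^esub> k \<otimes>\<^bsub>HP\<^esub> inv\<^bsub>HP\<^esub> h \<otimes>\<^bsub>HP\<^esub> inv\<^bsub>HP\<^esub> k) \<circ> hinv A =
        (A \<circ> h \<circ> hinv A) \<otimes>\<^bsub>HP\<^esub> (A \<circ> k \<circ> hinv A) \<otimes>\<^bsub>HP\<^esub> inv\<^bsub>HP\<^esub> (A \<circ> h \<circ> hinv A) \<otimes>\<^bsub>HP\<^esub> inv\<^bsub>HP\<^esub> (A \<circ> k \<circ> hinv A)"
        unfolding conj_inv[OF hh(1), symmetric] conj_inv[OF hh(2), symmetric]
        by (simp only: HP_mult HP_inv[OF hh(1)] HP_inv[OF hh(2)] conj_comp)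
      ultimately show ?thesis
        using comm[OF conj_F[OF that(1)] conj_F[OF that(2)]] unfolding N'_def by simp
    qed
  qed
  then have "A \<circ> g \<circ> hinv A \<in> N" unfolding N'_def by simp
  moreover have "A \<circ> g \<circ> hinv A = f'" unfolding g_def using homeo_f_inv[OF hA] by (auto simp: fun_eq_iff)
  ultimately have f'N: "f' \<in> N" by simp
  have c: "inv\<^bsub>HP\<^esub> q \<in> Q_on a b" using Q_on_inv[OF q(1)] HP_inv[OF hq] by simp
  have carr: "q \<in> carrier HP" "f \<in> carrier HP" using hq hf HP_carrier by auto
  have "inv\<^bsub>HP\<^esub> q \<otimes>\<^bsub>HP\<^esub> f \<otimes>\<^bsub>HP\<^esub> q \<otimes>\<^bsub>HP\<^esub> inv\<^bsub>HP\<^esub> f \<in> N"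
    using comm[OF c f] carr by simp
  moreover have "inv\<^bsub>HP\<^esub> q \<otimes>\<^bsub>HP\<^esub> f \<otimes>\<^bsub>HP\<^esub> q = f'"
    unfolding f'_def HP_inv[OF hq] by (simp add: comp_assoc)
  ultimately have w: "f' \<otimes>\<^bsub>HP\<^esub> inv\<^bsub>HP\<^esub> f \<in> N" by simp
  have f'c: "f' \<in> carrier HP" using subgroup.mem_carrier[OF N f'N] .
  have "inv\<^bsub>HP\<^esub> (f' \<otimes>\<^bsub>HP\<^esub> inv\<^bsub>HP\<^esub> f) \<otimes>\<^bsub>HP\<^esub> f' \<in> N"
    using subgroup.m_closed[OF N subgroup.m_inv_closed[OF N w] f'N] .
  moreover have "inv\<^bsub>HP\<^esub> (f' \<otimes>\<^bsub>HP\<^esub> inv\<^bsub>HP\<^esub> f) \<otimes>\<^bsub>HP\<^esub> f' = f"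
    using carr(2) f'c HPg.inv_mult_group[of f' "inv\<^bsub>HP\<^esub> f"] HPg.m_assoc[of f "inv\<^bsub>HP\<^esub> f'" f']
    by (simp del: HP_mult HP_one add: HPg.l_inv)
  ultimately show ?thesis by simp
qed

end

section \<open>Cell maps\<close>

text \<open>The map \<open>m i\<close> uses the coordinate measured from the left end of the i-th
  cell.\<close>

definition cmap :: "real \<Rightarrow> real \<Rightarrow> (int \<Rightarrow> real \<Rightarrow> real) \<Rightarrow> real \<Rightarrow> real" where
  "cmap z w m x = (let i = \<lfloor>(x - z) / w\<rfloor>; c = z + w * of_int i in c + m i (x - c))"

definition cellwise :: "real \<Rightarrow> (int \<Rightarrow> real \<Rightarrow> real) \<Rightarrow> bool" where
  "cellwise w m \<longleftrightarrow> w > 0 \<and> (\<forall>i. homeo (m i) \<and> (\<forall>x. x \<le> 0 \<or> w \<le> x \<longrightarrow> m i x = x))"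

lemma cellwise_homeo: "cellwise w m \<Longrightarrow> homeo (m i)"
  and cellwise_fix: "\<lbrakk>cellwise w m; x \<le> 0 \<or> w \<le> x\<rbrakk> \<Longrightarrow> m i x = x"
  and cellwise_pos: "cellwise w m \<Longrightarrow> w > 0"
  unfolding cellwise_def by blast+

lemma cellwise_maps:
  assumes "cellwise w m" "0 \<le> y" "y \<le> w"
  shows "0 \<le> m i y" "m i y \<le> w"
  using homeo_le[OF cellwise_homeo[OF assms(1)], of i 0 y] homeo_le[OF cellwise_homeo[OF assms(1)], of i y w]
    cellwise_fix[OF assms(1), of 0 i] cellwise_fix[OF assms(1), of w i] assms by auto

lemma cellwise_maps_less:
  assumes "cellwise w m" "y < w"
  shows "m i y < w"
  using homeo_less[OF cellwise_homeo[OF assms(1)], of i y w] cellwise_fix[OF assms(1), of w i] assms by auto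

lemma cell_cases:
  assumes "w > (0::real)"
  obtains i :: int and y where "0 \<le> y" "y < w" "x = z + w * of_int i + y"
proof -
  define i where "i = \<lfloor>(x - z) / w\<rfloor>"
  have i: "of_int i \<le> (x - z) / w" "(x - z) / w < of_int i + 1" unfolding i_def by linarith+
  have "w * of_int i \<le> x - z" "x - z < w * (of_int i + 1)"
    using i assms by (simp_all add: pos_le_divide_eq pos_divide_less_eq mult.commute)
  then show ?thesis using that[of "x - z - w * of_int i" i] by (simp add: algebra_simps)
qed

lemma cmap_less:
  assumes "w > 0" "0 \<le> y" "y < w"
  shows "cmap z w m (z + w * of_int i + y) = z + w * of_int i + m i y"
proof -
  have "(z + w * of_int i + y - z) / w = of_int i + y / w" using assms(1) by (simp add: add_divide_distrib)
  moreover have "0 \<le> y / w" "y / w < 1" using assms by auto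
  ultimately have "\<lfloor>(z + w * of_int i + y - z) / w\<rfloor> = i" by (simp add: floor_eq_iff)
  then show ?thesis by (simp add: cmap_def Let_def)
qed

text \<open>The right end of a cell is assigned to the next cell; the formula holds there as well
  because the maps of both cells fix it.\<close>

lemma cmap_at:
  assumes m: "cellwise w m" and y: "0 \<le> y" "y \<le> w"
  shows "cmap z w m (z + w * of_int i + y) = z + w * of_int i + m i y"
proof (cases "y = w")
  case False
  then show ?thesis using cmap_less[OF cellwise_pos[OF m]] y by simp
next
  case True
  have "cmap z w m (z + w * of_int (i + 1) + 0) = z + w * of_int (i + 1) + m (i + 1) 0"
    by (rule cmap_less) (use cellwise_pos[OF m] in auto)
  moreover have "m (i + 1) 0 = 0" "m i w = w" using cellwise_fix[OF m] by auto
  ultimately show ?thesis using True by (simp add: algebra_simps)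
qed

lemma cmap_comp:
  assumes m: "cellwise w m"
  shows "cmap z w m' \<circ> cmap z w m = cmap z w (\<lambda>i. m' i \<circ> m i)"
proof
  fix x
  obtain i y where y: "0 \<le> y" "y < w" "x = z + w * of_int i + y" using cell_cases[OF cellwise_pos[OF m]] .
  have y': "0 \<le> m i y" "m i y < w" using cellwise_maps(1)[OF m, of y i] cellwise_maps_less[OF m, of y i] y by auto
  show "(cmap z w m' \<circ> cmap z w m) x = cmap z w (\<lambda>i. m' i \<circ> m i) x"
    unfolding y(3) comp_apply cmap_less[OF cellwise_pos[OF m] y(1,2)] cmap_less[OF cellwise_pos[OF m] y'] ..
qed

lemma cmap_id: "w > 0 \<Longrightarrow> cmap z w (\<lambda>_. id) = id"
  by (auto simp: cmap_def Let_def)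

lemma cellwise_inv: "cellwise w m \<Longrightarrow> cellwise w (\<lambda>i. hinv (m i))"
  unfolding cellwise_def using homeo_inv homeo_inv_f by metis

lemma cmap_homeo:
  assumes m: "cellwise w m"
  shows "homeo (cmap z w m)"
  unfolding homeo_def
proof
  have w: "w > 0" using cellwise_pos[OF m] .
  show "strict_mono (cmap z w m)"
  proof (rule strict_monoI)
    fix x x' :: real assume xx': "x < x'"
    obtain i y where y: "0 \<le> y" "y < w" "x = z + w * of_int i + y" using cell_cases[OF w] .
    obtain i' y' where y': "0 \<le> y'" "y' < w" "x' = z + w * of_int i' + y'" using cell_cases[OF w] .
    have "\<not> i' < i"
    proof
      assume "i' < i"
      then have "of_int i' + 1 \<le> (of_int i :: real)" by linarith
      then have "w * (of_int i' + 1) \<le> w * of_int i" using w by simp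
      then show False using xx' y y' by (simp add: algebra_simps)
    qed
    then consider "i = i'" | "i < i'" by linarith
    then show "cmap z w m x < cmap z w m x'"
    proof cases
      case 1
      then have "y < y'" using xx' y y' by simp
      then show ?thesis
        unfolding y(3) y'(3) cmap_less[OF w y(1,2)] cmap_less[OF w y'(1,2)] 1
        using homeo_less[OF cellwise_homeo[OF m]] by simp
    next
      case 2
      then have "of_int i + 1 \<le> (of_int i' :: real)" by linarith
      then have "w * (of_int i + 1) \<le> w * of_int i'" using w by simp
      then show ?thesis
        unfolding y(3) y'(3) cmap_less[OF w y(1,2)] cmap_less[OF w y'(1,2)]
        using cellwise_maps_less[OF m y(2), of i] cellwise_maps(1)[OF m y'(1), of i'] y' by (simp add: algebra_simps)
    qed
  qed
  have "cmap z w m \<circ> cmap z w (\<lambda>i. hinv (m i)) = id"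
    using cmap_comp[OF cellwise_inv[OF m], of z m] homeo_f_inv[OF cellwise_homeo[OF m]] cmap_id[OF w]
    by (simp add: comp_def id_def)
  then show "surj (cmap z w m)" by (metis comp_apply id_apply surjI)
qed

lemma hinv_eqI: "\<lbrakk>homeo f; f \<circ> g = id\<rbrakk> \<Longrightarrow> hinv f = g"
proof
  fix x assume "homeo f" "f \<circ> g = id"
  then show "hinv f x = g x" using homeo_inv_f[of f "g x"] by (metis comp_apply id_apply)
qed

lemma cmap_inv:
  assumes m: "cellwise w m"
  shows "hinv (cmap z w m) = cmap z w (\<lambda>i. hinv (m i))"
proof (rule hinv_eqI[OF cmap_homeo[OF m]])
  show "cmap z w m \<circ> cmap z w (\<lambda>i. hinv (m i)) = id"
    using cmap_comp[OF cellwise_inv[OF m], of z m] homeo_f_inv[OF cellwise_homeo[OF m]] cmap_id[OF cellwise_pos[OF m]]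
    by (simp add: comp_def id_def)
qed

definition sh :: "real \<Rightarrow> (real \<Rightarrow> real) \<Rightarrow> real \<Rightarrow> real" where "sh t f y = f (y - t) + t"

text \<open>The sign of the label: a cell whose label is an inverse letter is read
  backwards.\<close>

definition sg :: "bool \<Rightarrow> (real \<Rightarrow> real) \<Rightarrow> real \<Rightarrow> real" where "sg b f = (if b then f else neg f)"

lemma sh_comp: "sh t (g \<circ> f) = sh t g \<circ> sh t f"
  and sh_id [simp]: "sh t id = id"
  by (auto simp: sh_def)

lemma sg_comp: "sg b (g \<circ> f) = sg b g \<circ> sg b f"
  and sg_id [simp]: "sg b id = id"
  by (auto simp: sg_def neg_comp)

lemma sh_aff: "sh t f = aff 0 t \<circ> f \<circ> hinv (aff 0 t)"
  by (auto simp: sh_def aff_inv aff_def)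

lemma sh_F_on: "\<lbrakk>f \<in> F_on a b; t \<in> dyadic\<rbrakk> \<Longrightarrow> sh t f \<in> F_on (a + t) (b + t)"
  using F_on_conj[OF _ aff_PL2[of t 0], of f a b] unfolding sh_aff[symmetric] by (simp add: aff_def)

lemma sh_Q_on: "\<lbrakk>f \<in> Q_on a b; t \<in> dyadic\<rbrakk> \<Longrightarrow> sh t f \<in> Q_on (a + t) (b + t)"
  using Q_on_conj[OF _ aff_PL2[of t 0], of f a b] unfolding sh_aff[symmetric] by (simp add: aff_def)

lemma sh_homeo: "homeo f \<Longrightarrow> homeo (sh t f)"
  unfolding sh_aff using homeo_comp[OF homeo_inv[OF aff_homeo] homeo_comp[OF _ aff_homeo]] by (simp add: comp_assoc)

lemma sg_homeo: "homeo f \<Longrightarrow> homeo (sg b f)"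
  unfolding sg_def using homeo_neg by simp

definition centred :: "(real \<Rightarrow> real) set" where
  "centred = {f. homeo f \<and> (\<forall>x. x \<le> -1/2 \<or> 1/2 \<le> x \<longrightarrow> f x = x)}"

lemma F_on_centred: "\<lbrakk>f \<in> F_on a b; -1/2 \<le> a; b \<le> 1/2\<rbrakk> \<Longrightarrow> f \<in> centred"
  unfolding centred_def using F_on_homeo F_on_outside by auto

lemma Q_on_centred: "\<lbrakk>f \<in> Q_on a b; -1/2 \<le> a; b \<le> 1/2\<rbrakk> \<Longrightarrow> f \<in> centred"
  using F_on_centred Q_on_imp_F_on by blast

lemma id_centred [simp]: "id \<in> centred"
  by (simp add: centred_def)

lemma centred_comp: "\<lbrakk>f \<in> centred; g \<in> centred\<rbrakk> \<Longrightarrow> g \<circ> f \<in> centred"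
  unfolding centred_def using homeo_comp by auto

lemma centred_inv: "f \<in> centred \<Longrightarrow> hinv f \<in> centred"
proof -
  assume "f \<in> centred"
  then have h: "homeo f" and fx: "f x = x" if "x \<le> -1/2 \<or> 1/2 \<le> x" for x using that unfolding centred_def by blast+
  then have "hinv f x = x" if "x \<le> -1/2 \<or> 1/2 \<le> x" for x using homeo_inv_f[of f x] that by metis
  then show ?thesis using homeo_inv[of f] h[of 1] unfolding centred_def by simp
qed

lemma half_dyadic [simp]: "1/2 \<in> dyadic" "-1/2 \<in> dyadic" "- (1/2) \<in> dyadic"
  using dyadic_half[of 1] dyadic_half[of "-1"] by auto

section \<open>Maps acting in all cells as a labelling prescribes\<close>

locale pattern =
  fixes s :: "int \<Rightarrow> bool"
begin

text \<open>The cells have width 1 and centres k/2 with k of the parity of p, and \<open>m k\<close>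
  is written in the coordinate centred there. For p = 1 these are the cells of \<open>zeta\<close>,
  for p = 0 those of \<open>chi\<close>.\<close>

definition pat :: "int \<Rightarrow> (int \<Rightarrow> real \<Rightarrow> real) \<Rightarrow> real \<Rightarrow> real" where
  "pat p m = cmap ((of_int p - 1) / 2) 1 (\<lambda>i. sh (1/2) (sg (s (2 * i + p)) (m (2 * i + p))))"

definition hp :: "(int \<Rightarrow> real \<Rightarrow> real) \<Rightarrow> real \<Rightarrow> real" where "hp m = cmap 0 (1/2) m"

lemma pat_cellwise:
  assumes "\<And>k. m k \<in> centred"
  shows "cellwise 1 (\<lambda>i. sh (1/2) (sg (s (2 * i + p)) (m (2 * i + p))))"
  unfolding cellwise_def
proof (intro conjI allI impI)
  fix i
  show "homeo (sh (1/2) (sg (s (2 * i + p)) (m (2 * i + p))))"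
    using assms sh_homeo sg_homeo unfolding centred_def by blast
  fix x :: real assume "x \<le> 0 \<or> 1 \<le> x"
  then show "sh (1/2) (sg (s (2 * i + p)) (m (2 * i + p))) x = x"
    using assms unfolding centred_def sh_def sg_def neg_def by auto
qed simp

lemma pat_comp:
  assumes "\<And>k. m k \<in> centred"
  shows "pat p m' \<circ> pat p m = pat p (\<lambda>k. m' k \<circ> m k)"
  unfolding pat_def sg_comp sh_comp by (rule cmap_comp[OF pat_cellwise[OF assms]])

lemma pat_id [simp]: "pat p (\<lambda>_. id) = id"
  unfolding pat_def using cmap_id by simp

lemma pat_homeo: "(\<And>k. m k \<in> centred) \<Longrightarrow> homeo (pat p m)"
  unfolding pat_def by (rule cmap_homeo[OF pat_cellwise])

lemma pat_inv:
  assumes "\<And>k. m k \<in> centred"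
  shows "hinv (pat p m) = pat p (\<lambda>k. hinv (m k))"
proof (rule hinv_eqI[OF pat_homeo[OF assms]])
  have "m k \<circ> hinv (m k) = id" for k
    using assms[of k] homeo_f_inv unfolding centred_def by auto
  then show "pat p m \<circ> pat p (\<lambda>k. hinv (m k)) = id"
    unfolding pat_comp[of "\<lambda>k. hinv (m k)", OF centred_inv[OF assms]] by simp
qed

lemma pat_at:
  assumes m: "\<And>k. m k \<in> centred" and k: "even (k - p)" and y: "\<bar>y\<bar> \<le> 1/2"
  shows "pat p m (of_int k / 2 + y) = of_int k / 2 + sg (s k) (m k) y"
proof -
  obtain i where i: "k = 2 * i + p" using k by (metis add.commute diff_eq_eq dvdE)
  have e1: "of_int k / 2 + y = (of_int p - 1) / 2 + 1 * of_int i + (y + 1/2)"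
    unfolding i by (simp add: add_divide_distrib diff_divide_distrib)
  have e2: "cmap ((of_int p - 1) / 2) 1 (\<lambda>i. sh (1/2) (sg (s (2 * i + p)) (m (2 * i + p)))) ((of_int p - 1) / 2 + 1 * of_int i + (y + 1/2))
     = (of_int p - 1) / 2 + 1 * of_int i + sh (1/2) (sg (s (2 * i + p)) (m (2 * i + p))) (y + 1/2)"
    by (rule cmap_at[OF pat_cellwise[OF m]]; use y in linarith)
  show ?thesis
    unfolding pat_def e1 e2 unfolding sh_def i by (simp add: add_divide_distrib diff_divide_distrib)
qed

text \<open>Twice the centre of the p-cell that contains the half cell from j/2 to (j+1)/2.\<close>

definition ctr :: "int \<Rightarrow> int \<Rightarrow> int" where "ctr p j = (if even (j - p) then j else j + 1)"

definition dir :: "int \<Rightarrow> int \<Rightarrow> bool" where "dir p j = s (ctr p j)"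

text \<open>Whether the half cell from \<open>j/2\<close> to \<open>(j+1)/2\<close> is the right half, in reading direction, of the
  adjacent cell whose centre has the parity of \<open>p\<close>.\<close>

definition rt :: "int \<Rightarrow> int \<Rightarrow> bool" where "rt p j = ((ctr p j = j) = dir p j)"

text \<open>The half cell of the cell around k/2 on the given side in reading direction, where True
  means right. Geometrically, k is the right half and k - 1 the left half.\<close>

definition half_of :: "bool \<Rightarrow> int \<Rightarrow> int" where "half_of side k = (if s k = side then k else k - 1)"

definition refl :: "(real \<Rightarrow> real) \<Rightarrow> real \<Rightarrow> real" where "refl f y = 1/2 - f (1/2 - y)"

definition ori :: "bool \<Rightarrow> (real \<Rightarrow> real) \<Rightarrow> real \<Rightarrow> real" where "ori b f = (if b then f else refl f)"

text \<open>Places a map of [0, 1/2] into the right or left half of the centred cell, by translation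
  and without reflection.\<close>

definition emb :: "bool \<Rightarrow> (real \<Rightarrow> real) \<Rightarrow> real \<Rightarrow> real" where "emb side f = (if side then f else sh (-1/2) f)"

lemma refl_sh: "refl f = sh (1/2) (neg f)"
  by (auto simp: refl_def sh_def neg_def)

lemma refl_Q_on:
  assumes "f \<in> Q_on 0 (1/2)"
  shows "refl f \<in> Q_on 0 (1/2)"
  using sh_Q_on[OF Q_on_neg[OF assms] half_dyadic(1)] unfolding refl_sh by simp

lemma ori_Q_on: "f \<in> Q_on 0 (1/2) \<Longrightarrow> ori b f \<in> Q_on 0 (1/2)"
  unfolding ori_def using refl_Q_on by simp

lemma ori_comp: "ori b (g \<circ> f) = ori b g \<circ> ori b f"
  and ori_id [simp]: "ori b id = id"
  and refl_refl [simp]: "refl (refl f) = f"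
  by (auto simp: ori_def refl_def emb_def sh_def)

lemma ori_inv: "homeo f \<Longrightarrow> homeo (ori b f) \<Longrightarrow> ori b (hinv f) = hinv (ori b f)"
proof -
  assume h: "homeo f" and ho: "homeo (ori b f)"
  have "f \<circ> hinv f = id" by (rule ext) (simp add: homeo_f_inv[OF h])
  then have "ori b f \<circ> ori b (hinv f) = id" unfolding ori_comp[symmetric] by (simp only: ori_id)
  then show ?thesis using hinv_eqI[OF ho] by metis
qed

lemma emb_Q_on:
  assumes "f \<in> Q_on 0 (1/2)"
  shows "emb side f \<in> Q_on (-1/2) (1/2)" "emb True f \<in> Q_on 0 (1/2)" "emb False f \<in> Q_on (-1/2) 0"
proof -
  show 1: "emb True f \<in> Q_on 0 (1/2)" using assms by (simp add: emb_def)
  show 2: "emb False f \<in> Q_on (-1/2) 0"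
    using sh_Q_on[OF assms half_dyadic(2)] by (simp add: emb_def)
  show "emb side f \<in> Q_on (-1/2) (1/2)" using Q_on_mono[OF 1] Q_on_mono[OF 2] by (cases side) auto
qed

lemma emb_centred: "f \<in> Q_on 0 (1/2) \<Longrightarrow> emb side f \<in> centred"
  by (rule Q_on_centred[OF emb_Q_on(1)]) auto

lemma hp_cellwise:
  assumes "\<And>j. m j \<in> Q_on 0 (1/2)"
  shows "cellwise (1/2) m"
  unfolding cellwise_def
  by (intro conjI allI impI Q_on_homeo[OF assms] F_on_outside[OF Q_on_imp_F_on[OF assms]]) simp_all

lemma hp_comp: "(\<And>j. m j \<in> Q_on 0 (1/2)) \<Longrightarrow> hp m' \<circ> hp m = hp (\<lambda>j. m' j \<circ> m j)"
  unfolding hp_def by (rule cmap_comp[OF hp_cellwise])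

lemma hp_inv: "(\<And>j. m j \<in> Q_on 0 (1/2)) \<Longrightarrow> hinv (hp m) = hp (\<lambda>j. hinv (m j))"
  unfolding hp_def by (rule cmap_inv[OF hp_cellwise])

lemma hp_id [simp]: "hp (\<lambda>_. id) = id"
  unfolding hp_def using cmap_id by simp

lemma half_cell_cases:
  fixes x :: real
  obtains j :: int and y where "0 \<le> y" "y \<le> 1/2" "x = of_int j / 2 + y"
proof -
  obtain i :: int and y where y: "0 \<le> y" "y < 1/2" "x = 0 + 1/2 * of_int i + y"
    by (rule cell_cases[where w = "1/2" and x = x and z = 0]) simp_all
  show ?thesis by (rule that[of y i]) (use y in auto)
qed

lemma hp_at: "\<lbrakk>\<And>j. m j \<in> Q_on 0 (1/2); 0 \<le> y; y \<le> 1/2\<rbrakk> \<Longrightarrow> hp m (of_int j / 2 + y) = of_int j / 2 + m j y"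
  using cmap_at[OF hp_cellwise[of m], of y 0 j] unfolding hp_def by simp

lemma half_zero: "id \<in> Q_on 0 (1/2)" by (rule Q_on_id) simp

text \<open>Flipping a cell exchanges its halves and reflects each of them, which is recorded by
  \<open>rt\<close> and \<open>ori\<close>. Geometrically, half cell j is the right half of its
  p-cell if j - p is even and the left half otherwise; hence the two cases.\<close>

lemma pat_half:
  assumes f: "f \<in> Q_on 0 (1/2)"
  shows "pat p (\<lambda>k. if D (half_of side k) then emb side f else id) =
    hp (\<lambda>j. if rt p j = side \<and> D j then ori (dir p j) f else id)"
proof
  fix x :: real
  let ?m = "\<lambda>k. if D (half_of side k) then emb side f else id"
  let ?h = "\<lambda>j. if rt p j = side \<and> D j then ori (dir p j) f else id"
  have m: "?m k \<in> centred" for k using emb_centred[OF f] by simp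
  have h: "?h j \<in> Q_on 0 (1/2)" for j using ori_Q_on[OF f] half_zero by simp
  obtain j y where y: "0 \<le> y" "y \<le> 1/2" "x = of_int j / 2 + y" using half_cell_cases .
  have out: "f z = z" if "z \<le> 0 \<or> 1/2 \<le> z" for z using F_on_outside[OF Q_on_imp_F_on[OF f] that] .
  have H: "hp ?h x = of_int j / 2 + ?h j y" unfolding y(3) by (rule hp_at[OF h y(1,2)])
  show "pat p ?m x = hp ?h x"
  proof (cases "even (j - p)")
    case True
    have P: "pat p ?m x = of_int j / 2 + sg (s j) (?m j) y" unfolding y(3) by (rule pat_at[OF m True]) (use y in auto)
    have c: "ctr p j = j" "dir p j = s j" "rt p j = s j" using True by (auto simp: ctr_def dir_def rt_def)
    show ?thesis
      unfolding P H using y(1,2) c out[of "- y"] out[of "y + 1/2"]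
      by (auto simp: half_of_def sg_def emb_def neg_def ori_def refl_def sh_def algebra_simps)
  next
    case False
    have e: "even (j + 1 - p)" using False by presburger
    have x: "x = of_int (j + 1) / 2 + (y - 1/2)" unfolding y(3) by (simp add: add_divide_distrib)
    have P: "pat p ?m x = of_int (j + 1) / 2 + sg (s (j + 1)) (?m (j + 1)) (y - 1/2)"
      unfolding x by (rule pat_at[OF m e]) (use y in auto)
    have c: "ctr p j = j + 1" "dir p j = s (j + 1)" "rt p j = (\<not> s (j + 1))"
      using False by (auto simp: ctr_def dir_def rt_def)
    have h: "of_int (j + 1) / 2 = of_int j / 2 + (1/2 :: real)" by (simp add: add_divide_distrib)
    have o: "f (y - 1/2) = y - 1/2" "f (1 - y) = 1 - y" using out[of "y - 1/2"] out[of "1 - y"] y(1,2) by auto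
    show ?thesis
      unfolding P H h c
      by (cases "s (j + 1)"; cases side) (auto simp: o half_of_def sg_def emb_def neg_def ori_def refl_def sh_def algebra_simps)
  qed
qed

text \<open>Acts in the half cells with a prescribed position in both cells that contain them:
  \<open>side\<close> in the p-cell and \<open>val\<close> in the cell of the other family.\<close>

definition T :: "int \<Rightarrow> bool \<Rightarrow> bool \<Rightarrow> (real \<Rightarrow> real) \<Rightarrow> real \<Rightarrow> real" where
  "T p side val f = hp (\<lambda>j. if rt p j = side \<and> rt (1 - p) j = val then ori (dir p j) f else id)"

text \<open>The \<open>side\<close> half of a p-cell is also half of a cell of the other family; its
  position there selects f or g. Such pairs multiply componentwise.\<close>

definition E :: "int \<Rightarrow> bool \<Rightarrow> (real \<Rightarrow> real) \<Rightarrow> (real \<Rightarrow> real) \<Rightarrow> real \<Rightarrow> real" where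
  "E p side f g = pat p (\<lambda>k. if rt (1 - p) (half_of side k) then f else g)"

lemma E_same: "E p side f f = pat p (\<lambda>_. f)"
  by (simp add: E_def)

lemma E_comp:
  assumes "f \<in> centred" "g \<in> centred"
  shows "E p side f' g' \<circ> E p side f g = E p side (f' \<circ> f) (g' \<circ> g)"
proof -
  let ?c = "\<lambda>k. rt (1 - p) (half_of side k)"
  have "pat p (\<lambda>k. if ?c k then f' else g') \<circ> pat p (\<lambda>k. if ?c k then f else g) =
      pat p (\<lambda>k. (if ?c k then f' else g') \<circ> (if ?c k then f else g))"
    by (rule pat_comp) (simp add: assms)
  moreover have "(\<lambda>k. (if ?c k then f' else g') \<circ> (if ?c k then f else g)) = (\<lambda>k. if ?c k then f' \<circ> f else g' \<circ> g)"
    by (rule ext) simp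
  ultimately show ?thesis unfolding E_def by (simp only:)
qed

lemma E_inv:
  assumes "f \<in> centred" "g \<in> centred"
  shows "hinv (E p side f g) = E p side (hinv f) (hinv g)"
proof -
  let ?c = "\<lambda>k. rt (1 - p) (half_of side k)"
  have "hinv (pat p (\<lambda>k. if ?c k then f else g)) = pat p (\<lambda>k. hinv (if ?c k then f else g))"
    by (rule pat_inv) (simp add: assms)
  moreover have "(\<lambda>k. hinv (if ?c k then f else g)) = (\<lambda>k. if ?c k then hinv f else hinv g)"
    by (rule ext) simp
  ultimately show ?thesis unfolding E_def by (simp only:)
qed

lemma T_E:
  assumes "f \<in> Q_on 0 (1/2)"
  shows "T p side val f = E p side (if val then emb side f else id) (if val then id else emb side f)"
  unfolding T_def E_def pat_half[OF assms, of p "\<lambda>j. rt (1 - p) j = val" side, symmetric]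
  by (rule arg_cong[of _ _ "pat p"]) auto

lemma hp_mem: "f \<in> Q_on 0 (1/2) \<Longrightarrow> (if P then ori b f else id) \<in> Q_on 0 (1/2)"
  using ori_Q_on half_zero by simp

lemma T_comp:
  assumes "f \<in> Q_on 0 (1/2)"
  shows "T p side val g \<circ> T p side val f = T p side val (g \<circ> f)"
  unfolding T_def hp_comp[OF hp_mem[OF assms]]
  by (rule arg_cong[where f = hp], rule ext) (simp add: ori_comp)

text \<open>The supports are made up of different half cells.\<close>

lemma T_commute:
  assumes f: "f \<in> Q_on 0 (1/2)" and g: "g \<in> Q_on 0 (1/2)" and ne: "(side, val) \<noteq> (side', val')"
  shows "T p side val f \<circ> T p side' val' g = T p side' val' g \<circ> T p side val f"
  unfolding T_def hp_comp[OF hp_mem[OF f]] hp_comp[OF hp_mem[OF g]]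
  by (rule arg_cong[of _ _ hp]) (use ne in auto)

lemma T_sum:
  assumes f: "f \<in> Q_on 0 (1/2)"
  shows "T p side True f \<circ> T p side False f = pat p (\<lambda>_. emb side f)"
proof -
  have "pat p (\<lambda>_. emb side f) = hp (\<lambda>j. if rt p j = side then ori (dir p j) f else id)"
    using pat_half[OF f, of p "\<lambda>_. True" side] by simp
  also have "\<dots> = T p side True f \<circ> T p side False f"
    unfolding T_def hp_comp[OF hp_mem[OF f]] by (rule arg_cong[of _ _ hp]) auto
  finally show ?thesis ..
qed

lemma T_inv:
  assumes f: "f \<in> Q_on 0 (1/2)"
  shows "hinv (T p side val f) = T p side val (hinv f)"
  unfolding T_def hp_inv[OF hp_mem[OF f]]
  by (rule arg_cong[of _ _ hp]) (use ori_inv Q_on_homeo[OF f] Q_on_homeo[OF ori_Q_on[OF f]] in auto)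

text \<open>Geometrically, a half cell is the right half of one of its two cells and the left half
  of the other. So its positions in reading direction differ exactly if both cells are read in the
  same direction.\<close>

lemma rt_neq_dir: "p = 0 \<or> p = 1 \<Longrightarrow> (rt p j \<noteq> rt (1 - p) j) = (dir p j = dir (1 - p) j)"
  unfolding rt_def dir_def ctr_def by auto

text \<open>Equal positions in the two cells mean opposite reading directions, which costs a
  reflection of the half cell.\<close>

lemma T_swap:
  assumes p: "p = 0 \<or> p = 1" and f: "f \<in> Q_on 0 (1/2)"
  shows "T p side val f = T (1 - p) val side (if side = val then refl f else f)"
proof -
  have e: "(if rt p j = side \<and> rt (1 - p) j = val then ori (dir p j) f else id) =
    (if rt (1 - p) j = val \<and> rt (1 - (1 - p)) j = side then ori (dir (1 - p) j) (if side = val then refl f else f) else id)" for j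
    using rt_neq_dir[OF p, of j] by (auto simp: ori_def)
  show ?thesis unfolding T_def by (rule arg_cong[where f = hp], rule ext, rule e)
qed

text \<open>This is the source of the maps that depend on both labels. The commutator is trivial
  wherever one of the two maps is; where both act, \<open>side \<noteq> val\<close> makes the
  reading directions agree, so f and g are commuted in the same coordinate.\<close>

lemma T_commutator:
  assumes p: "p = 0 \<or> p = 1" and f: "f \<in> Q_on 0 (1/2)" and g: "g \<in> Q_on 0 (1/2)" and ne: "side \<noteq> val"
  shows "hinv (pat (1 - p) (\<lambda>_. emb val g)) \<circ> (hinv (pat p (\<lambda>_. emb side f)) \<circ>
      (pat (1 - p) (\<lambda>_. emb val g) \<circ> pat p (\<lambda>_. emb side f))) =
    T p side val (hinv g \<circ> (hinv f \<circ> (g \<circ> f)))"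
proof -
  let ?F = "\<lambda>j. if rt p j = side then ori (dir p j) f else id"
  let ?G = "\<lambda>j. if rt (1 - p) j = val then ori (dir (1 - p) j) g else id"
  have F: "pat p (\<lambda>_. emb side f) = hp ?F" using pat_half[OF f, of p "\<lambda>_. True" side] by simp
  have G: "pat (1 - p) (\<lambda>_. emb val g) = hp ?G" using pat_half[OF g, of "1 - p" "\<lambda>_. True" val] by simp
  have mF: "?F j \<in> Q_on 0 (1/2)" and mG: "?G j \<in> Q_on 0 (1/2)" for j using hp_mem f g by auto
  have m1: "?G j \<circ> ?F j \<in> Q_on 0 (1/2)" for j using Q_on_comp[OF mF mG] .
  have m2: "hinv (?F j) \<circ> (?G j \<circ> ?F j) \<in> Q_on 0 (1/2)" for j using Q_on_comp[OF m1 Q_on_inv[OF mF]] .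
  have "hinv (hp ?G) \<circ> (hinv (hp ?F) \<circ> (hp ?G \<circ> hp ?F)) =
      hp (\<lambda>j. hinv (?G j) \<circ> (hinv (?F j) \<circ> (?G j \<circ> ?F j)))"
    unfolding hp_inv[OF mF] hp_inv[OF mG] hp_comp[OF mF] hp_comp[OF m1] hp_comp[OF m2] ..
  also have "\<dots> = T p side val (hinv g \<circ> (hinv f \<circ> (g \<circ> f)))"
    unfolding T_def
  proof (rule arg_cong[of _ _ hp], rule ext)
    fix j
    note hf = Q_on_homeo[OF f] and hg = Q_on_homeo[OF g]
    have ho: "homeo (ori b f)" "homeo (ori b g)" for b
      using Q_on_homeo[OF ori_Q_on[OF f]] Q_on_homeo[OF ori_Q_on[OF g]] by auto
    have cf: "hinv (ori b f) \<circ> ori b f = id" "hinv (ori b g) \<circ> ori b g = id" for b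
      using homeo_inv_f[OF ho(1)] homeo_inv_f[OF ho(2)] by auto
    show "hinv (?G j) \<circ> (hinv (?F j) \<circ> (?G j \<circ> ?F j)) =
       (if rt p j = side \<and> rt (1 - p) j = val then ori (dir p j) (hinv g \<circ> (hinv f \<circ> (g \<circ> f))) else id)"
    proof (cases "rt p j = side \<and> rt (1 - p) j = val")
      case True
      then have "dir (1 - p) j = dir p j" using rt_neq_dir[OF p, of j] ne by auto
      then show ?thesis using True ori_comp ori_inv[OF hf ho(1)] ori_inv[OF hg ho(2)] by simp
    next
      case False
      then show ?thesis using cf by auto
    qed
  qed
  finally show ?thesis unfolding F G .
qed

text \<open>The middle halves of the p-cells and those of the other cells meet in end points
  only.\<close>

lemma pat_commute:
  assumes p: "p = 0 \<or> p = 1" and f: "f \<in> F_on (-1/4) (1/4)" and g: "g \<in> F_on (-1/4) (1/4)"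
  shows "pat p (\<lambda>_. f) \<circ> pat (1 - p) (\<lambda>_. g) = pat (1 - p) (\<lambda>_. g) \<circ> pat p (\<lambda>_. f)"
proof (rule disjoint_commute)
  have c: "f \<in> centred" "g \<in> centred" using F_on_centred f g by auto
  show "inj (pat p (\<lambda>_. f))" by (rule bij_is_inj[OF homeo_bij[OF pat_homeo]], rule c(1))
  show "inj (pat (1 - p) (\<lambda>_. g))" by (rule bij_is_inj[OF homeo_bij[OF pat_homeo]], rule c(2))
  have fixd: "sg b h z = z" if "h \<in> F_on (-1/4) (1/4)" "z \<le> -1/4 \<or> 1/4 \<le> z" for b h z
    using F_on_outside[OF that(1), of z] F_on_outside[OF that(1), of "- z"] that(2) by (auto simp: sg_def neg_def)
  fix x :: real
  obtain j y where y: "0 \<le> y" "y \<le> 1/2" "x = of_int j / 2 + y" using half_cell_cases .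
  have L: "pat q (\<lambda>_. h) x = x" if h: "h \<in> F_on (-1/4) (1/4)" "even (j - q)" "1/4 \<le> y" for h q
  proof -
    have "h \<in> centred" using F_on_centred h by auto
    then have "pat q (\<lambda>_. h) x = of_int j / 2 + sg (s j) h y"
      unfolding y(3) by (intro pat_at h) (use y in auto)
    then show ?thesis using fixd[OF h(1), of y] h(3) y(3) by simp
  qed
  have R: "pat q (\<lambda>_. h) x = x" if h: "h \<in> F_on (-1/4) (1/4)" "odd (j - q)" "y \<le> 1/4" for h q
  proof -
    have "h \<in> centred" using F_on_centred h by auto
    have x: "x = of_int (j + 1) / 2 + (y - 1/2)" unfolding y(3) by (simp add: add_divide_distrib)
    have "even (j + 1 - q)" using h(2) by presburger
    then have "pat q (\<lambda>_. h) x = of_int (j + 1) / 2 + sg (s (j + 1)) h (y - 1/2)"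
      unfolding x by (intro pat_at \<open>h \<in> centred\<close>) (use y in auto)
    then show ?thesis using fixd[OF h(1), of "y - 1/2"] h(3) x by simp
  qed
  show "pat p (\<lambda>_. f) x = x \<or> pat (1 - p) (\<lambda>_. g) x = x"
  proof (cases "even (j - p)")
    case True
    then have e: "odd (j - (1 - p))" by presburger
    show ?thesis using L[OF f True] R[OF g e] by (cases "1/4 \<le> y") auto
  next
    case False
    then have e: "even (j - (1 - p))" by presburger
    show ?thesis using R[OF f False] L[OF g e] by (cases "1/4 \<le> y") auto
  qed
qed

end

section \<open>The group \<open>G_\<rho>\<close> has property (FA)\<close>

text \<open>Prepares for Helly's theorem, which concerns finitely many sets.\<close>

lemma generate_finite_subset:
  assumes "x \<in> generate G S"
  shows "\<exists>S'\<subseteq>S. finite S' \<and> x \<in> generate G S'"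
  using assms
proof induction
  case one
  then show ?case by (intro exI[of _ "{}"]) (auto intro: generate.one)
next
  case (incl h)
  then show ?case by (intro exI[of _ "{h}"]) (auto intro: generate.incl)
next
  case (inv h)
  then show ?case by (intro exI[of _ "{h}"]) (auto intro: generate.inv)
next
  case (eng h1 h2)
  then obtain S1 S2 where S: "S1 \<subseteq> S" "finite S1" "h1 \<in> generate G S1" "S2 \<subseteq> S" "finite S2" "h2 \<in> generate G S2"
    by blast
  have mono: "x \<in> generate G (S1 \<union> S2)" if "x \<in> generate G S'" "S' \<subseteq> S1 \<union> S2" for x S'
    using that by induction (auto intro: generate.intros)
  have "h1 \<otimes>\<^bsub>G\<^esub> h2 \<in> generate G (S1 \<union> S2)"
    by (rule generate.eng) (use mono S in blast)+
  then show ?case using S by (intro exI[of _ "S1 \<union> S2"]) auto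
qed

section \<open>The generators as cell maps\<close>

locale rho_group = generated_F +
  fixes \<rho> :: "real \<Rightarrow> letter" and c0 :: "real \<Rightarrow> real"
  assumes c0_F: "c0 \<in> thompson_F" and c0_Supp: "Supp c0 = {0<..<1/4}"
    and c0_up: "\<And>x. x \<in> {0<..<1/4} \<Longrightarrow> c0 x > x"
    and c0_double: "\<And>t. t \<in> {0<..<1/16} \<Longrightarrow> c0 t = 2 * t"
begin

definition positive :: "int \<Rightarrow> bool" where
  "positive k = (if odd k then \<rho> (of_int k / 2) = B else \<rho> (of_int k / 2) = A)"

sublocale pattern positive .

definition c' :: "real \<Rightarrow> real" where "c' = cen c0"

text \<open>The centred form of \<nu>1, as shown in \<open>cen_nu1\<close>: c' at the left end of
  the cell and its mirror image at the right end.\<close>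

definition \<kappa> :: "real \<Rightarrow> real" where "\<kappa> = neg c' \<circ> c'"

lemma c'_F: "c' \<in> F_on (-1/2) (-1/4)"
proof -
  have "c0 \<in> thompson_F_on 0 (1/4)" using c0_F c0_Supp unfolding thompson_F_on_def by auto
  from cen_F_on[OF this] show ?thesis unfolding c'_def by simp
qed

lemma neg_c'_F: "neg c' \<in> F_on (1/4) (1/2)"
  using F_on_neg[OF c'_F] by simp

lemma c0_unit: "interval_homeo c0"
  using c0_F Homeo_plus_interval_homeo unfolding thompson_F_def by blast

lemma \<kappa>_F: "\<kappa> \<in> F_on (-1/2) (1/2)"
  unfolding \<kappa>_def by (rule F_on_comp) (rule F_on_mono[OF c'_F] F_on_mono[OF neg_c'_F]; simp)+

text \<open>The two factors have disjoint supports and commute, and reflection exchanges them. Hence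
  \<kappa> acts alike in cells with either label.\<close>

lemma neg_\<kappa>: "neg \<kappa> = \<kappa>"
proof -
  have "neg c' x = x \<or> c' x = x" for x
    using F_on_outside[OF c'_F, of x] F_on_outside[OF neg_c'_F, of x] by linarith
  then have "neg c' \<circ> c' = c' \<circ> neg c'"
    using disjoint_commute[of "neg c'" c'] homeo_bij[OF F_on_homeo[OF c'_F]] homeo_bij[OF F_on_homeo[OF neg_c'_F]] bij_is_inj
    by blast
  then show ?thesis unfolding \<kappa>_def neg_comp by simp
qed

lemma \<kappa>_left: "x \<le> 1/4 \<Longrightarrow> \<kappa> x = c' x"
proof -
  assume "x \<le> 1/4"
  have "c' x \<le> 1/4"
  proof (cases "x \<le> -1/4")
    case True
    then have "c' x \<le> c' (-1/4)" using homeo_le[OF F_on_homeo[OF c'_F]] by simp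
    then show ?thesis using F_on_outside[OF c'_F, of "-1/4"] by simp
  next
    case False
    then show ?thesis using F_on_outside[OF c'_F, of x] \<open>x \<le> 1/4\<close> by simp
  qed
  then show ?thesis unfolding \<kappa>_def using F_on_outside[OF neg_c'_F, of "c' x"] by simp
qed

lemma \<kappa>_right: "-1/4 \<le> x \<Longrightarrow> \<kappa> x = neg c' x"
  unfolding \<kappa>_def using F_on_outside[OF c'_F, of x] by simp

lemma nu1_eq: "t \<in> unit_interval \<Longrightarrow> nu1 c0 t = 1 - c0 (1 - c0 t)"
proof -
  assume t: "t \<in> unit_interval"
  have "c0 t \<in> unit_interval" using interval_homeo_maps[OF c0_unit, of t] t by auto
  moreover have "c0 (1 - c0 t) \<in> unit_interval" using interval_homeo_maps[OF c0_unit, of "1 - c0 t"] calculation by auto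
  ultimately show ?thesis
    using t flip_apply[of "c0 t" c0] by (simp add: nu1_def Homeo_def compose_def iota0_def)
qed

lemma cen_nu1: "cen (nu1 c0) = \<kappa>"
proof
  fix x show "cen (nu1 c0) x = \<kappa> x"
  proof (cases "\<bar>x\<bar> \<le> 1/2")
    case True
    then have t: "x + 1/2 \<in> unit_interval" unfolding atLeastAtMost_iff by linarith
    have m: "0 \<le> c0 (x + 1/2)" "c0 (x + 1/2) \<le> 1" using interval_homeo_maps[OF c0_unit, of "x + 1/2"] t by auto
    have "c' x = c0 (x + 1/2) - 1/2" using True by (simp add: c'_def cen_def)
    moreover have "neg c' (c0 (x + 1/2) - 1/2) = 1/2 - c0 (1 - c0 (x + 1/2))"
    proof -
      have "\<bar>- (c0 (x + 1/2) - 1/2)\<bar> \<le> 1/2" using m by linarith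
      then show ?thesis by (simp add: neg_def c'_def cen_def)
    qed
    ultimately show ?thesis using True nu1_eq[OF t] by (simp add: cen_def \<kappa>_def)
  next
    case False
    then have "\<kappa> x = x" using F_on_outside[OF \<kappa>_F, of x] by linarith
    then show ?thesis using False by (simp add: cen_def)
  qed
qed

lemma nu_flip:
  assumes "\<forall>t\<in>unit_interval. \<nu> t \<in> unit_interval" "0 \<le> t" "t \<le> 1"
  shows "sh (1/2) (cen \<nu>) t = \<nu> t" "sh (1/2) (neg (cen \<nu>)) t = flip \<nu> t"
proof -
  have t: "\<bar>t - 1/2\<bar> \<le> 1/2" "\<bar>- (t - 1/2)\<bar> \<le> 1/2" using assms(2,3) by linarith+
  show "sh (1/2) (cen \<nu>) t = \<nu> t" unfolding sh_def cen_def using t by simp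
  have "\<nu> (1 - t) \<in> unit_interval" using assms by auto
  then have "flip \<nu> t = 1 - \<nu> (1 - t)" using flip_apply[of t \<nu>] assms by (simp add: iota0_def)
  then show "sh (1/2) (neg (cen \<nu>)) t = flip \<nu> t"
    unfolding sh_def cen_def neg_def using t by simp
qed

lemma zeta_pat:
  assumes "\<forall>t\<in>unit_interval. \<nu> t \<in> unit_interval"
  shows "zeta \<rho> \<nu> = pat 1 (\<lambda>_. cen \<nu>)"
proof
  fix x :: real
  have f: "0 \<le> frac x" "frac x \<le> 1" "x - of_int \<lfloor>x\<rfloor> = frac x"
    using frac_ge_0[of x] frac_lt_1[of x] by (auto simp: frac_def)
  have "of_int (2 * \<lfloor>x\<rfloor> + 1) / 2 = of_int \<lfloor>x\<rfloor> + (1/2 :: real)" by (simp add: add_divide_distrib)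
  then show "zeta \<rho> \<nu> x = pat 1 (\<lambda>_. cen \<nu>) x"
    using f nu_flip[OF assms f(1,2)] by (simp add: zeta_def pat_def cmap_def Let_def sg_def positive_def)
qed

lemma chi_pat:
  assumes "\<forall>t\<in>unit_interval. \<nu> t \<in> unit_interval"
  shows "chi \<rho> \<nu> = pat 0 (\<lambda>_. cen \<nu>)"
proof
  fix x :: real
  let ?z = "x + 1/2"
  have f: "0 \<le> frac ?z" "frac ?z \<le> 1" "?z - of_int \<lfloor>?z\<rfloor> = frac ?z"
    using frac_ge_0[of ?z] frac_lt_1[of ?z] by (auto simp: frac_def)
  have e: "x - ((0 - 1) / 2 + of_int \<lfloor>?z\<rfloor>) = frac ?z" using f(3) by simp
  have fl: "\<lfloor>x - (0 - 1) / 2\<rfloor> = \<lfloor>?z\<rfloor>" by simp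
  have "pat 0 (\<lambda>_. cen \<nu>) x = (0 - 1) / 2 + of_int \<lfloor>?z\<rfloor> +
      sh (1/2) (sg (\<rho> (of_int (2 * \<lfloor>?z\<rfloor>) / 2) = A) (cen \<nu>)) (frac ?z)"
    unfolding pat_def cmap_def Let_def positive_def using e fl by simp
  then show "chi \<rho> \<nu> x = pat 0 (\<lambda>_. cen \<nu>) x"
    using nu_flip[OF assms f(1,2)] by (simp add: chi_def Let_def sg_def)
qed

definition gens :: "(real \<Rightarrow> real) set" where
  "gens = {pat p (\<lambda>_. f) | p f. (p = 0 \<or> p = 1) \<and> f \<in> {\<kappa>, cen \<nu>2, cen \<nu>3}}"

definition Gc :: "(real \<Rightarrow> real) set" where "Gc = generate HP gens"

lemma G_rho_eq: "G_rho \<rho> (nu1 c0) \<nu>2 \<nu>3 = HP\<lparr>carrier := Gc\<rparr>"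
proof -
  have m1: "\<forall>t\<in>unit_interval. nu1 c0 t \<in> unit_interval"
  proof
    fix t :: real assume t: "t \<in> unit_interval"
    have "c0 t \<in> unit_interval" using interval_homeo_maps[OF c0_unit, of t] t by auto
    then have "c0 (1 - c0 t) \<in> unit_interval" using interval_homeo_maps[OF c0_unit, of "1 - c0 t"] by auto
    then show "nu1 c0 t \<in> unit_interval" using nu1_eq[OF t] by simp
  qed
  have m2: "\<forall>t\<in>unit_interval. \<nu>2 t \<in> unit_interval" "\<forall>t\<in>unit_interval. \<nu>3 t \<in> unit_interval"
    using Homeo_maps[OF nu_carrier(1)] Homeo_maps[OF nu_carrier(2)] by auto
  have "gens = {zeta \<rho> (nu1 c0), zeta \<rho> \<nu>2, zeta \<rho> \<nu>3, chi \<rho> (nu1 c0), chi \<rho> \<nu>2, chi \<rho> \<nu>3}"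
    unfolding gens_def zeta_pat[OF m1] zeta_pat[OF m2(1)] zeta_pat[OF m2(2)]
      chi_pat[OF m1] chi_pat[OF m2(1)] chi_pat[OF m2(2)] cen_nu1 by blast
  then show ?thesis unfolding G_rho_def Gc_def by simp
qed

lemma gen_centred: "f \<in> {\<kappa>, cen \<nu>2, cen \<nu>3} \<Longrightarrow> f \<in> centred"
  using F_on_centred[OF \<kappa>_F] F_on_centred[OF cen_nu(1)] F_on_centred[OF cen_nu(2)] by auto

lemma gens_carrier: "gens \<subseteq> carrier HP"
proof
  fix g assume "g \<in> gens"
  then obtain p f where g: "g = pat p (\<lambda>_. f)" "f \<in> {\<kappa>, cen \<nu>2, cen \<nu>3}" unfolding gens_def by blast
  have "homeo g" unfolding g(1) by (rule pat_homeo) (rule gen_centred[OF g(2)])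
  then show "g \<in> carrier HP" using HP_carrier by blast
qed

lemma Gc_subgroup: "subgroup Gc HP"
  unfolding Gc_def by (rule group.generate_is_subgroup[OF group_HP gens_carrier])

lemma Gc_homeo: "g \<in> Gc \<Longrightarrow> homeo g"
  using subgroup.mem_carrier[OF Gc_subgroup] HP_carrier by blast

lemma Gc_comp: "\<lbrakk>f \<in> Gc; g \<in> Gc\<rbrakk> \<Longrightarrow> g \<circ> f \<in> Gc"
  using subgroup.m_closed[OF Gc_subgroup, of f g] by simp

lemma Gc_inv: "f \<in> Gc \<Longrightarrow> hinv f \<in> Gc"
  using subgroup.m_inv_closed[OF Gc_subgroup, of f] HP_inv[OF Gc_homeo] by simp

lemma Gc_id: "id \<in> Gc"
  using subgroup.one_closed[OF Gc_subgroup] by simp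

lemma Gc_pat_F0:
  assumes p: "p = 0 \<or> p = 1" and f: "f \<in> F0"
  shows "pat p (\<lambda>_. f) \<in> Gc"
proof -
  have g: "pat p (\<lambda>_. h) \<in> Gc" if "h \<in> {\<kappa>, cen \<nu>2, cen \<nu>3}" for h
    unfolding Gc_def by (rule generate.incl) (use that p in \<open>auto simp: gens_def\<close>)
  have c: "h \<in> centred" if "h \<in> F0" for h using F_on_centred[OF that] by simp
  have "f \<in> {h \<in> F0. pat p (\<lambda>_. h) \<in> Gc}"
  proof (rule F0_induct[OF f])
    show "id \<in> {h \<in> F0. pat p (\<lambda>_. h) \<in> Gc}" using Gc_id by simp
    show "cen \<nu>2 \<in> {h \<in> F0. pat p (\<lambda>_. h) \<in> Gc}" "cen \<nu>3 \<in> {h \<in> F0. pat p (\<lambda>_. h) \<in> Gc}"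
      using cen_nu g by auto
    show "k \<circ> h \<in> {h \<in> F0. pat p (\<lambda>_. h) \<in> Gc}"
      if "h \<in> {h \<in> F0. pat p (\<lambda>_. h) \<in> Gc}" "k \<in> {h \<in> F0. pat p (\<lambda>_. h) \<in> Gc}" for h k
      using that F_on_comp Gc_comp[of "pat p (\<lambda>_. h)" "pat p (\<lambda>_. k)"] pat_comp[of "\<lambda>_. h" p "\<lambda>_. k"] c by auto
    show "hinv h \<in> {h \<in> F0. pat p (\<lambda>_. h) \<in> Gc}" if "h \<in> {h \<in> F0. pat p (\<lambda>_. h) \<in> Gc}" for h
      using that F_on_inv Gc_inv[of "pat p (\<lambda>_. h)"] pat_inv[of "\<lambda>_. h" p] c by auto
  qed
  then show ?thesis by simp
qed

lemma \<kappa>_pow_F: "\<kappa> ^^ n \<in> F_on (-1/2) (1/2)"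
  by (rule funpow_F_on[OF \<kappa>_F])

lemma neg_\<kappa>_pow: "neg (\<kappa> ^^ n) = \<kappa> ^^ n"
proof (induction n)
  case 0
  show ?case by (auto simp: neg_def)
next
  case (Suc n)
  show ?case by (simp only: funpow.simps neg_comp neg_\<kappa> Suc)
qed

lemma c'_eq: "-1/2 \<le> x \<Longrightarrow> x \<le> 1/2 \<Longrightarrow> c' x = c0 (x + 1/2) - 1/2"
proof -
  assume "-1/2 \<le> x" "x \<le> 1/2"
  then have "\<bar>x\<bar> \<le> 1/2" by linarith
  then show ?thesis by (simp add: c'_def cen_def)
qed

text \<open>The bound -7/16 corresponds to 1/16 in the unit interval, a point that c0 moves
  up.\<close>

lemma \<kappa>_stays: "-7/16 \<le> x \<Longrightarrow> -7/16 \<le> \<kappa> x"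
proof -
  assume "-7/16 \<le> x"
  then have "\<kappa> (-7/16) \<le> \<kappa> x" using homeo_le[OF F_on_homeo[OF \<kappa>_F]] by simp
  moreover have "\<kappa> (-7/16) = c0 (1/16) - 1/2" using \<kappa>_left[of "-7/16"] c'_eq[of "-7/16"] by simp
  moreover have "c0 (1/16) > 1/16" by (rule c0_up) simp
  ultimately show ?thesis by simp
qed

lemma \<kappa>_pow_stays: "-7/16 \<le> (\<kappa> ^^ n) x \<Longrightarrow> -7/16 \<le> (\<kappa> ^^ (n + m)) x"
proof (induction m)
  case (Suc m)
  from \<kappa>_stays[OF Suc.IH[OF Suc.prems]] show ?case by simp
qed simp

text \<open>Below -7/16 each step doubles the distance from -1/2, because c0 doubles on (0,
  1/16).\<close>

lemma \<kappa>_pow_escape: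
  assumes "-1/2 < x"
  shows "\<exists>n. -7/16 \<le> (\<kappa> ^^ n) x"
proof (rule ccontr)
  assume "\<not> ?thesis"
  then have l: "(\<kappa> ^^ n) x < -7/16" for n by (meson not_le)
  have e: "(\<kappa> ^^ n) x = -1/2 + 2 ^ n * (x + 1/2)" for n
  proof (induction n)
    case (Suc n)
    let ?z = "(\<kappa> ^^ n) x"
    have "2 ^ n * (x + 1/2) > 0" using assms by simp
    then have z: "-1/2 < ?z" "?z < -7/16" using Suc l[of n] by auto
    have "\<kappa> ?z = c0 (?z + 1/2) - 1/2" using \<kappa>_left[of ?z] c'_eq[of ?z] z by simp
    also have "c0 (?z + 1/2) = 2 * (?z + 1/2)" by (rule c0_double) (use z in auto)
    finally have "(\<kappa> ^^ Suc n) x = 2 * (?z + 1/2) - 1/2" by simp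
    also have "\<dots> = -1/2 + 2 ^ Suc n * (x + 1/2)" unfolding Suc.IH by (simp add: algebra_simps)
    finally show ?case .
  qed simp
  obtain n where "1 / (x + 1/2) < 2 ^ n" using real_arch_pow[of 2 "1 / (x + 1/2)"] by auto
  moreover have "x + 1/2 > 0" using assms by simp
  ultimately have "1 < 2 ^ n * (x + 1/2)" by (simp only: pos_divide_less_eq)
  then show False using l[of n] e[of n] by simp
qed

text \<open>Powers of \<kappa> push compact subsets of the open cell into [-7/16, 7/16]. Conjugating
  by such a power in all cells reduces f to an element of F0.\<close>

lemma Gc_pat_Q:
  assumes p: "p = 0 \<or> p = 1" and f: "f \<in> Q_on (-1/2) (1/2)"
  shows "pat p (\<lambda>_. f) \<in> Gc"
proof -
  obtain c d where cd: "-1/2 < c" "c \<le> d" "d < 1/2" "f \<in> F_on c d" using f unfolding Q_on_iff by blast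
  obtain n1 where n1: "-7/16 \<le> (\<kappa> ^^ n1) c" using \<kappa>_pow_escape[OF cd(1)] by blast
  obtain n2 where n2: "-7/16 \<le> (\<kappa> ^^ n2) (- d)" using \<kappa>_pow_escape[of "- d"] cd(3) by auto
  \<comment> \<open>One exponent for both ends: more steps do no harm, and by the symmetry of
    \<kappa> the image of d mirrors that of -d.\<close>
  define n where "n = n1 + n2"
  let ?k = "\<kappa> ^^ n"
  have k: "?k \<in> PL2" "homeo ?k" "?k \<in> centred"
    using F_on_PL2[OF \<kappa>_pow_F] F_on_homeo[OF \<kappa>_pow_F] F_on_centred[OF \<kappa>_pow_F] by auto
  have a: "-7/16 \<le> ?k c" using \<kappa>_pow_stays[OF n1, of n2] n_def by simp
  have "-7/16 \<le> ?k (- d)" using \<kappa>_pow_stays[OF n2, of n1] n_def by (simp add: add.commute)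
  moreover have "?k (- d) = - ?k d" using neg_\<kappa>_pow[of n] unfolding neg_def by (metis minus_minus)
  ultimately have b: "?k d \<le> 7/16" by simp
  define g where "g = ?k \<circ> f \<circ> hinv ?k"
  have g: "g \<in> F0" unfolding g_def by (rule F_on_mono[OF F_on_conj[OF cd(4) k(1)]]) (use a b in auto)
  have gc: "g \<in> centred" using F_on_centred[OF g] by simp
  have \<kappa>c: "\<kappa> \<in> centred" using gen_centred by simp
  have kG: "pat p (\<lambda>_. \<kappa> ^^ m) \<in> Gc" for m
  proof (induction m)
    case 0
    then show ?case using Gc_id by (simp flip: id_def)
  next
    case (Suc m)
    have a: "pat p (\<lambda>_. \<kappa>) \<in> Gc"
      unfolding Gc_def by (rule generate.incl) (use p in \<open>auto simp: gens_def\<close>)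
    have b: "pat p (\<lambda>_. \<kappa>) \<circ> pat p (\<lambda>_. \<kappa> ^^ m) = pat p (\<lambda>_. \<kappa> ^^ Suc m)"
      by (subst pat_comp) (use F_on_centred[OF \<kappa>_pow_F] in auto)
    show ?case using Gc_comp[OF Suc a] unfolding b .
  qed
  have "hinv (pat p (\<lambda>_. ?k)) \<circ> (pat p (\<lambda>_. g) \<circ> pat p (\<lambda>_. ?k)) = pat p (\<lambda>_. hinv ?k \<circ> (g \<circ> ?k))"
    using k(3) gc by (simp add: pat_inv pat_comp centred_comp)
  moreover have "hinv ?k \<circ> (g \<circ> ?k) = f"
    unfolding g_def using homeo_inv_f[OF k(2)] by (auto simp: fun_eq_iff)
  ultimately show ?thesis using Gc_comp[OF Gc_comp[OF kG[of n] Gc_pat_F0[OF p g]] Gc_inv[OF kG[of n]]] by simp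
qed

text \<open>For different positions \<open>T_commutator\<close> puts the commutators into the group,
  and perfectness of \<open>Q_on 0 (1/2)\<close> gives the rest. For equal positions, T is the
  quotient of a map acting in all \<open>side\<close> halves by the T with the other value.\<close>

lemma Gc_T:
  assumes p: "p = 0 \<or> p = 1" and f: "f \<in> Q_on 0 (1/2)"
  shows "T p side val f \<in> Gc"
proof -
  have p': "1 - p = 0 \<or> 1 - p = 1" using p by auto
  have ne: "T p side val f \<in> Gc" if ne: "side \<noteq> val" and f: "f \<in> Q_on 0 (1/2)" for side val f
  proof -
    define N where "N = {f \<in> Q_on 0 (1/2). T p side val f \<in> Gc}"
    have "f \<in> N"
    proof (rule Q_on_perfect[of 0 "1/2" N])
      show "subgroup N HP"
      proof (rule group.subgroupI[OF group_HP])
        show "N \<subseteq> carrier HP" unfolding N_def using Q_on_homeo HP_carrier by blast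
        have "T p side val id = id" unfolding T_def by (simp cong: if_cong)
        then have "id \<in> N" unfolding N_def using half_zero Gc_id by simp
        then show "N \<noteq> {}" by blast
        show "inv\<^bsub>HP\<^esub> g \<in> N" if "g \<in> N" for g
          using that HP_inv[OF Q_on_homeo, of g] Q_on_inv[of g] Gc_inv[of "T p side val g"] T_inv[of g p side val]
          unfolding N_def by auto
        show "g \<otimes>\<^bsub>HP\<^esub> h \<in> N" if "g \<in> N" "h \<in> N" for g h
          using that Q_on_comp[of g _ _ h] Gc_comp[of "T p side val g" "T p side val h"] T_comp[of g p side val h]
          unfolding N_def by auto
      qed
      show "g \<otimes>\<^bsub>HP\<^esub> h \<otimes>\<^bsub>HP\<^esub> inv\<^bsub>HP\<^esub> g \<otimes>\<^bsub>HP\<^esub> inv\<^bsub>HP\<^esub> h \<in> N"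
        if g: "g \<in> Q_on 0 (1/2)" and h: "h \<in> Q_on 0 (1/2)" for g h
      proof -
        have "g \<otimes>\<^bsub>HP\<^esub> h \<otimes>\<^bsub>HP\<^esub> inv\<^bsub>HP\<^esub> g \<otimes>\<^bsub>HP\<^esub> inv\<^bsub>HP\<^esub> h = hinv h \<circ> (hinv g \<circ> (h \<circ> g))"
          using HP_inv[OF Q_on_homeo[OF g]] HP_inv[OF Q_on_homeo[OF h]] by simp
        moreover have "hinv h \<circ> (hinv g \<circ> (h \<circ> g)) \<in> Q_on 0 (1/2)"
          using g h Q_on_comp Q_on_inv by blast
        moreover have "T p side val (hinv h \<circ> (hinv g \<circ> (h \<circ> g))) \<in> Gc"
          unfolding T_commutator[OF p g h ne, symmetric]
          by (intro Gc_comp Gc_inv Gc_pat_Q[OF p emb_Q_on(1)[OF g]] Gc_pat_Q[OF p' emb_Q_on(1)[OF h]])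
        ultimately show ?thesis unfolding N_def by simp
      qed
    qed (use f in auto)
    then show ?thesis unfolding N_def by simp
  qed
  show ?thesis
  proof (cases "side = val")
    case False
    show ?thesis by (rule ne[OF False f])
  next
    case True
    have P: "pat p (\<lambda>_. emb side f) \<in> Gc" by (rule Gc_pat_Q[OF p emb_Q_on(1)[OF f]])
    have O: "T p side (\<not> side) f \<in> Gc" using ne[OF _ f, of side "\<not> side"] by simp
    have sum: "T p side side f \<circ> T p side (\<not> side) f = pat p (\<lambda>_. emb side f)"
    proof (cases side)
      case True
      then show ?thesis using T_sum[OF f, of p side] by simp
    next
      case False
      have "T p side False f \<circ> T p side True f = T p side True f \<circ> T p side False f"
        by (rule T_commute[OF f f]) simp
      then show ?thesis using T_sum[OF f, of p side] False by simp
    qed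
    have "T p side side f = pat p (\<lambda>_. emb side f) \<circ> hinv (T p side (\<not> side) f)"
      unfolding sum[symmetric] using homeo_f_inv[OF Gc_homeo[OF O]] by (auto simp: fun_eq_iff)
    then show ?thesis using Gc_comp[OF Gc_inv[OF O] P] True by simp
  qed
qed

text \<open>Conjugation by the same q in all cells pushes h into one half, where the pair with the
  identity is a T. A general pair (f, g) is the product of (g, g) with the pair of
  \<open>hinv g \<circ> f\<close> and the identity.\<close>

lemma Gc_E:
  assumes p: "p = 0 \<or> p = 1" and f: "f \<in> Q_on (-1/2) (1/2)" and g: "g \<in> Q_on (-1/2) (1/2)"
  shows "E p side f g \<in> Gc"
proof -
  have one: "E p side h id \<in> Gc" if h: "h \<in> Q_on (-1/2) (1/2)" for h
  proof -
    obtain c d where cd: "-1/2 < c" "c \<le> d" "d < 1/2" "h \<in> F_on c d" using h unfolding Q_on_iff by blast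
    have "\<exists>q\<in>Q_on (-1/2) (1/2). \<exists>k\<in>Q_on 0 (1/2). q \<circ> h \<circ> hinv q = emb side k"
    proof (cases side)
      case True
      obtain q where q: "q \<in> Q_on (-1/2) (1/2)" "0 < q c" using push_right[of "-1/2" c "1/2" 0] cd by auto
      have "q d < 1/2" using F_on_maps(2)[OF Q_on_imp_F_on[OF q(1)], of d] cd by auto
      then have "q \<circ> h \<circ> hinv q \<in> Q_on 0 (1/2)"
        by (intro F_on_imp_Q_on[OF F_on_conj[OF cd(4) Q_on_PL2[OF q(1)]]]) (use q in auto)
      then show ?thesis using q True unfolding emb_def by auto
    next
      case False
      obtain q where q: "q \<in> Q_on (-1/2) (1/2)" "q d < 0" using push_left[of "-1/2" d "1/2" 0] cd by auto
      have "-1/2 < q c" using F_on_maps(1)[OF Q_on_imp_F_on[OF q(1)], of c] cd by auto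
      then have k: "q \<circ> h \<circ> hinv q \<in> Q_on (-1/2) 0"
        by (intro F_on_imp_Q_on[OF F_on_conj[OF cd(4) Q_on_PL2[OF q(1)]]]) (use q in auto)
      have "sh (1/2) (q \<circ> h \<circ> hinv q) \<in> Q_on 0 (1/2)" using sh_Q_on[OF k half_dyadic(1)] by simp
      moreover have "emb side (sh (1/2) (q \<circ> h \<circ> hinv q)) = q \<circ> h \<circ> hinv q"
        using False by (auto simp: emb_def sh_def)
      ultimately show ?thesis using q by metis
    qed
    then obtain q k where q: "q \<in> Q_on (-1/2) (1/2)" and k: "k \<in> Q_on 0 (1/2)" and eq: "q \<circ> h \<circ> hinv q = emb side k" by blast
    have qc: "q \<in> centred" and kc: "emb side k \<in> centred" using Q_on_centred[OF q] emb_centred[OF k] by auto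
    note hq = Q_on_homeo[OF q]
    have tk: "E p side (emb side k) id \<in> Gc" using Gc_T[OF p k, of side True] T_E[OF k, of p side True] by simp
    have qG: "E p side q q \<in> Gc" using Gc_pat_Q[OF p q] E_same by simp
    have "hinv (E p side q q) \<circ> (E p side (emb side k) id \<circ> E p side q q) =
        E p side (hinv q \<circ> (emb side k \<circ> q)) (hinv q \<circ> (id \<circ> q))"
      using qc kc by (simp add: E_inv E_comp centred_comp)
    moreover have "hinv q \<circ> (emb side k \<circ> q) = h" "hinv q \<circ> (id \<circ> q) = id"
      unfolding eq[symmetric] using homeo_inv_f[OF hq] by (auto simp: fun_eq_iff)
    ultimately show ?thesis using Gc_comp[OF Gc_comp[OF qG tk] Gc_inv[OF qG]] by simp
  qed
  have "hinv g \<circ> f \<in> Q_on (-1/2) (1/2)" using Q_on_comp[OF f Q_on_inv[OF g]] .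
  then have "E p side g g \<circ> E p side (hinv g \<circ> f) id \<in> Gc"
    using Gc_comp[OF one] Gc_pat_Q[OF p g] E_same by simp
  moreover have "E p side g g \<circ> E p side (hinv g \<circ> f) id = E p side (g \<circ> (hinv g \<circ> f)) (g \<circ> id)"
    by (rule E_comp) (use Q_on_centred[OF \<open>hinv g \<circ> f \<in> _\<close>] in auto)
  moreover have "g \<circ> (hinv g \<circ> f) = f" using homeo_f_inv[OF Q_on_homeo[OF g]] by (auto simp: fun_eq_iff)
  ultimately show ?thesis by simp
qed

section \<open>Perfectly displaced generators\<close>

abbreviation G where "G \<equiv> HP\<lparr>carrier := Gc\<rparr>"

lemma group_G: "group G"
  by (rule group.subgroup_imp_group[OF group_HP Gc_subgroup])

lemma G_inv: "g \<in> Gc \<Longrightarrow> inv\<^bsub>G\<^esub> g = hinv g"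
  using group.m_inv_consistent[OF group_HP Gc_subgroup] HP_inv[OF Gc_homeo] by simp

text \<open>The pair has its supports in [c, d], and K consists of the pairs with supports in (d,
  1/2), which commute with it. A q with d < q c conjugates it into K, and K is generated by
  commutators because each of its two coordinates ranges over a perfect group.\<close>

lemma E_perfectly_displaced:
  assumes p: "p = 0 \<or> p = 1" and f: "f \<in> Q_on (-1/2) (1/2)" and g: "g \<in> Q_on (-1/2) (1/2)"
  shows "perfectly_displaced G (E p side f g)"
proof -
  obtain c d where cd: "-1/2 < c" "c \<le> d" "d < 1/2" "f \<in> F_on c d" "g \<in> F_on c d"
    using Q_on_common[OF f g] .
  obtain q where q: "q \<in> Q_on (-1/2) (1/2)" "d < q c" using push_right[of "-1/2" c "1/2" d] cd by auto
  note hq = Q_on_homeo[OF q(1)]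
  have qd: "q d < 1/2" using F_on_maps(2)[OF Q_on_imp_F_on[OF q(1)], of d] cd by auto
  have cen: "f \<in> centred" "g \<in> centred" "q \<in> centred" using Q_on_centred f g q by auto
  have sub: "k \<in> Q_on (-1/2) (1/2)" if "k \<in> Q_on d (1/2)" for k using Q_on_mono[OF that] cd by auto
  have subc: "k \<in> centred" if "k \<in> Q_on d (1/2)" for k using Q_on_centred[OF sub[OF that]] by simp
  have id: "id \<in> Q_on d (1/2)" by (rule Q_on_id[OF cd(3)])
  define K where "K = {E p side k1 k2 | k1 k2. k1 \<in> Q_on d (1/2) \<and> k2 \<in> Q_on d (1/2)}"
  have K: "subgroup K G"
  proof (rule group.subgroupI[OF group_G])
    show "K \<subseteq> carrier G" using Gc_E[OF p] sub unfolding K_def by auto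
    show "K \<noteq> {}" using id unfolding K_def by blast
    show "inv\<^bsub>G\<^esub> x \<in> K" if xK: "x \<in> K" for x
    proof -
      obtain k1 k2 where k: "x = E p side k1 k2" "k1 \<in> Q_on d (1/2)" "k2 \<in> Q_on d (1/2)" using xK unfolding K_def by blast
      have "inv\<^bsub>G\<^esub> x = E p side (hinv k1) (hinv k2)"
        using G_inv[OF Gc_E[OF p sub[OF k(2)] sub[OF k(3)]]] E_inv[OF subc[OF k(2)] subc[OF k(3)]] k(1) by simp
      then show ?thesis using Q_on_inv k unfolding K_def by blast
    qed
    show "x \<otimes>\<^bsub>G\<^esub> y \<in> K" if xy: "x \<in> K" "y \<in> K" for x y
    proof -
      obtain k1 k2 l1 l2 where k: "x = E p side k1 k2" "k1 \<in> Q_on d (1/2)" "k2 \<in> Q_on d (1/2)"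
        "y = E p side l1 l2" "l1 \<in> Q_on d (1/2)" "l2 \<in> Q_on d (1/2)" using xy unfolding K_def by blast
      have "x \<otimes>\<^bsub>G\<^esub> y = E p side (l1 \<circ> k1) (l2 \<circ> k2)"
        using E_comp[OF subc[OF k(2)] subc[OF k(3)]] k by simp
      then show ?thesis using Q_on_comp k unfolding K_def by blast
    qed
  qed
  have comm: "k \<otimes>\<^bsub>G\<^esub> E p side f g = E p side f g \<otimes>\<^bsub>G\<^esub> k" if kK: "k \<in> K" for k
  proof -
    obtain k1 k2 where k: "k = E p side k1 k2" "k1 \<in> Q_on d (1/2)" "k2 \<in> Q_on d (1/2)" using kK unfolding K_def by blast
    have dj: "h \<circ> k = k \<circ> h" if "h \<in> F_on c d" "k \<in> Q_on d (1/2)" for h k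
    proof (rule disjoint_commute)
      show "inj h" "inj k" using homeo_bij F_on_homeo[OF that(1)] Q_on_homeo[OF that(2)] bij_is_inj by blast+
      show "h x = x \<or> k x = x" for x
        using F_on_outside[OF that(1), of x] F_on_outside[OF Q_on_imp_F_on[OF that(2)], of x] by linarith
    qed
    show ?thesis
      unfolding k(1) using E_comp[OF cen(1,2)] E_comp[OF subc[OF k(2)] subc[OF k(3)]]
        dj[OF cd(4) k(2)] dj[OF cd(5) k(3)] by simp
  qed
  \<comment> \<open>The inverse appears because the group product applies the left factor before the
    right one.\<close>
  define h where "h = hinv (E p side q q)"
  have qG: "E p side q q \<in> Gc" by (rule Gc_E[OF p q(1) q(1)])
  have hG: "h \<in> Gc" unfolding h_def by (rule Gc_inv[OF qG])
  have mG: "E p side f g \<in> Gc" by (rule Gc_E[OF p f g])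
  have hh: "inv\<^bsub>G\<^esub> h = E p side q q"
    using G_inv[OF hG] homeo_bij[OF Gc_homeo[OF qG]] unfolding h_def by (simp add: inv_inv_eq)
  define f' g' where "f' = q \<circ> f \<circ> hinv q" and "g' = q \<circ> g \<circ> hinv q"
  have fg': "f' \<in> Q_on d (1/2)" "g' \<in> Q_on d (1/2)"
    unfolding f'_def g'_def
    by (intro F_on_imp_Q_on[OF F_on_conj[OF cd(4) Q_on_PL2[OF q(1)]]] F_on_imp_Q_on[OF F_on_conj[OF cd(5) Q_on_PL2[OF q(1)]]]; use q(2) qd cd in simp)+
  have conj: "h \<otimes>\<^bsub>G\<^esub> E p side f g \<otimes>\<^bsub>G\<^esub> inv\<^bsub>G\<^esub> h = E p side f' g'"
  proof -
    have "E p side q q \<circ> (E p side f g \<circ> E p side (hinv q) (hinv q)) = E p side (q \<circ> (f \<circ> hinv q)) (q \<circ> (g \<circ> hinv q))"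
      using cen centred_inv[OF cen(3)] by (simp add: E_comp centred_comp)
    then show ?thesis unfolding hh f'_def g'_def by (simp add: h_def E_inv[OF cen(3,3)] comp_assoc)
  qed
  have k0: "E p side f' g' \<in> K" using fg' unfolding K_def by blast
  have perf: "E p side f' g' \<in> N"
    if N: "subgroup N G" and cN: "\<forall>a\<in>K. \<forall>b\<in>K. a \<otimes>\<^bsub>G\<^esub> b \<otimes>\<^bsub>G\<^esub> inv\<^bsub>G\<^esub> a \<otimes>\<^bsub>G\<^esub> inv\<^bsub>G\<^esub> b \<in> N" for N
  proof -
    have Nin: "hinv x \<in> N" if "x \<in> N" for x
      using subgroup.m_inv_closed[OF N that] G_inv subgroup.mem_carrier[OF N that] by simp
    have Nco: "y \<circ> x \<in> N" if "x \<in> N" "y \<in> N" for x y using subgroup.m_closed[OF N that] by simp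
    have Nid: "id \<in> N" using subgroup.one_closed[OF N] by simp
    \<comment> \<open>Treats one coordinate at a time: \<Phi> will be the embedding of
      \<open>Q_on d (1/2)\<close> as the first or the second component of a pair.\<close>
    have half: "\<Phi> k \<in> N"
      if \<Phi>: "\<And>k. k \<in> Q_on d (1/2) \<Longrightarrow> \<Phi> k \<in> K"
        "\<And>k l. \<lbrakk>k \<in> Q_on d (1/2); l \<in> Q_on d (1/2)\<rbrakk> \<Longrightarrow> \<Phi> l \<circ> \<Phi> k = \<Phi> (l \<circ> k)"
        "\<And>k. k \<in> Q_on d (1/2) \<Longrightarrow> hinv (\<Phi> k) = \<Phi> (hinv k)" "\<Phi> id = id"
        and k: "k \<in> Q_on d (1/2)" for \<Phi> and k :: "real \<Rightarrow> real"
    proof -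
      have KG: "x \<in> Gc" if "x \<in> K" for x using subgroup.mem_carrier[OF K that] by simp
      define M where "M = {k \<in> Q_on d (1/2). \<Phi> k \<in> N}"
      have "k \<in> M"
      proof (rule Q_on_perfect[OF cd(3) _ _ k])
        show "subgroup M HP"
        proof (rule group.subgroupI[OF group_HP])
          show "M \<subseteq> carrier HP" unfolding M_def using Q_on_homeo HP_carrier by blast
          have "id \<in> M" using id \<Phi>(4) Nid unfolding M_def by simp
          then show "M \<noteq> {}" by blast
          show "inv\<^bsub>HP\<^esub> x \<in> M" if "x \<in> M" for x
            using that HP_inv[OF Q_on_homeo, of x] Q_on_inv[of x] \<Phi>(3)[of x] Nin[of "\<Phi> x"] unfolding M_def by auto
          show "x \<otimes>\<^bsub>HP\<^esub> y \<in> M" if "x \<in> M" "y \<in> M" for x y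
            using that Q_on_comp[of x _ _ y] \<Phi>(2)[of x y] Nco[of "\<Phi> x" "\<Phi> y"] unfolding M_def by auto
        qed
        show "x \<otimes>\<^bsub>HP\<^esub> y \<otimes>\<^bsub>HP\<^esub> inv\<^bsub>HP\<^esub> x \<otimes>\<^bsub>HP\<^esub> inv\<^bsub>HP\<^esub> y \<in> M"
          if x: "x \<in> Q_on d (1/2)" and y: "y \<in> Q_on d (1/2)" for x y
        proof -
          have e: "x \<otimes>\<^bsub>HP\<^esub> y \<otimes>\<^bsub>HP\<^esub> inv\<^bsub>HP\<^esub> x \<otimes>\<^bsub>HP\<^esub> inv\<^bsub>HP\<^esub> y = hinv y \<circ> (hinv x \<circ> (y \<circ> x))"
            using HP_inv[OF Q_on_homeo[OF x]] HP_inv[OF Q_on_homeo[OF y]] by simp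
          have m: "y \<circ> x \<in> Q_on d (1/2)" "hinv x \<circ> (y \<circ> x) \<in> Q_on d (1/2)" "hinv y \<circ> (hinv x \<circ> (y \<circ> x)) \<in> Q_on d (1/2)"
            using x y Q_on_comp Q_on_inv by blast+
          have "\<Phi> (hinv y \<circ> (hinv x \<circ> (y \<circ> x))) = hinv (\<Phi> y) \<circ> (hinv (\<Phi> x) \<circ> (\<Phi> y \<circ> \<Phi> x))"
            using x y m Q_on_inv by (simp add: \<Phi>(2) \<Phi>(3))
          also have "\<dots> = \<Phi> x \<otimes>\<^bsub>G\<^esub> \<Phi> y \<otimes>\<^bsub>G\<^esub> inv\<^bsub>G\<^esub> \<Phi> x \<otimes>\<^bsub>G\<^esub> inv\<^bsub>G\<^esub> \<Phi> y"
            using G_inv[OF KG[OF \<Phi>(1)[OF x]]] G_inv[OF KG[OF \<Phi>(1)[OF y]]] by simp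
          also have "\<dots> \<in> N" using cN \<Phi>(1)[OF x] \<Phi>(1)[OF y] by blast
          finally show ?thesis using m(3) unfolding M_def e by simp
        qed
      qed
      then show ?thesis unfolding M_def by simp
    qed
    have idK: "E p side id id = id" using E_same by simp
    have idc: "id \<in> centred" by simp
    have 1: "E p side k id \<in> N" if k: "k \<in> Q_on d (1/2)" for k
    proof (rule half[of "\<lambda>k. E p side k id", OF _ _ _ idK k])
      fix k l :: "real \<Rightarrow> real" assume k: "k \<in> Q_on d (1/2)"
      show "E p side k id \<in> K" using k id unfolding K_def by blast
      show "hinv (E p side k id) = E p side (hinv k) id" using E_inv[OF subc[OF k] idc] by (simp add: hinv_eqI)
      show "E p side l id \<circ> E p side k id = E p side (l \<circ> k) id" using E_comp[OF subc[OF k] idc] by simp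
    qed
    have 2: "E p side id k \<in> N" if k: "k \<in> Q_on d (1/2)" for k
    proof (rule half[of "\<lambda>k. E p side id k", OF _ _ _ idK k])
      fix k l :: "real \<Rightarrow> real" assume k: "k \<in> Q_on d (1/2)"
      show "E p side id k \<in> K" using k id unfolding K_def by blast
      show "hinv (E p side id k) = E p side id (hinv k)" using E_inv[OF idc subc[OF k]] by (simp add: hinv_eqI)
      show "E p side id l \<circ> E p side id k = E p side id (l \<circ> k)" using E_comp[OF idc subc[OF k]] by simp
    qed
    have "E p side f' id \<circ> E p side id g' = E p side f' g'" using E_comp[OF idc subc[OF fg'(2)]] by simp
    then show ?thesis using Nco[OF 2[OF fg'(2)] 1[OF fg'(1)]] by simp
  qed
  show ?thesis
    unfolding perfectly_displaced_def
  proof (intro conjI bexI[of _ h] exI[of _ K] ballI allI impI)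
    show "h \<otimes>\<^bsub>G\<^esub> E p side f g \<otimes>\<^bsub>G\<^esub> inv\<^bsub>G\<^esub> h \<in> K" unfolding conj by (rule k0)
    show "h \<otimes>\<^bsub>G\<^esub> E p side f g \<otimes>\<^bsub>G\<^esub> inv\<^bsub>G\<^esub> h \<in> N"
      if "subgroup N G \<and> (\<forall>a\<in>K. \<forall>b\<in>K. a \<otimes>\<^bsub>G\<^esub> b \<otimes>\<^bsub>G\<^esub> inv\<^bsub>G\<^esub> a \<otimes>\<^bsub>G\<^esub> inv\<^bsub>G\<^esub> b \<in> N)" for N
      unfolding conj using perf that by blast
  qed (use K comm mG hG in auto)
qed

text \<open>The maps T are listed for p = 0 only, since \<open>T_swap\<close> turns those for p = 1
  into them.\<close>

definition Z :: "(real \<Rightarrow> real) set" where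
  "Z = {pat p (\<lambda>_. f) | p f. (p = 0 \<or> p = 1) \<and> f \<in> Q_on (-1/4) (1/4)} \<union>
       {T 0 side val f | side val f. f \<in> Q_on 0 (1/2)}"

lemma Z_Gc: "Z \<subseteq> Gc"
proof -
  have "pat p (\<lambda>_. f) \<in> Gc" if "p = 0 \<or> p = 1" "f \<in> Q_on (-1/4) (1/4)" for p f
    using Gc_pat_Q[OF that(1) Q_on_mono[OF that(2)]] by simp
  then show ?thesis unfolding Z_def using Gc_T by auto
qed

lemma id_Q: "id \<in> Q_on (-1/2) (1/2)" by (rule Q_on_id) simp

text \<open>A map T belongs to both families, so it can be written as a pair over whichever family
  its partner in a product uses.\<close>

lemma T_form:
  assumes "p = 0 \<or> p = 1" "f \<in> Q_on 0 (1/2)"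
  obtains side' h1 h2 where "T 0 side val f = E p side' h1 h2" "h1 \<in> Q_on (-1/2) (1/2)" "h2 \<in> Q_on (-1/2) (1/2)"
proof (cases "p = 0")
  case True
  show ?thesis
    by (rule that[of side "if val then emb side f else id" "if val then id else emb side f"])
       (use T_E[OF assms(2), of 0 side val] True emb_Q_on(1)[OF assms(2)] id_Q in auto)
next
  case False
  then have p: "p = 1" using assms by simp
  define f' where "f' = (if side = val then refl f else f)"
  have f': "f' \<in> Q_on 0 (1/2)" using assms refl_Q_on unfolding f'_def by simp
  have "T 0 side val f = T 1 val side f'" using T_swap[of 0 f side val] assms f'_def by simp
  then show ?thesis
    by (intro that[of val "if side then emb val f' else id" "if side then id else emb val f'"])
       (use T_E[OF f', of 1 val side] p emb_Q_on(1)[OF f'] id_Q in auto)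
qed

lemma Z_cases:
  assumes "s \<in> Z"
  obtains p f where "p = 0 \<or> p = 1" "f \<in> Q_on (-1/4) (1/4)" "s = pat p (\<lambda>_. f)"
  | side val f where "f \<in> Q_on 0 (1/2)" "s = T 0 side val f"
  using assms unfolding Z_def by blast

lemma Z_displaced: "s \<in> Z \<Longrightarrow> perfectly_displaced G s"
proof -
  assume "s \<in> Z"
  then show ?thesis
  proof (cases rule: Z_cases)
    case (1 p f)
    then have "f \<in> Q_on (-1/2) (1/2)" using Q_on_mono by fastforce
    then show ?thesis using E_perfectly_displaced[OF 1(1), of f f True] E_same 1 by simp
  next
    case (2 side val f)
    obtain side' h1 h2 where "T 0 side val f = E 0 side' h1 h2" "h1 \<in> Q_on (-1/2) (1/2)" "h2 \<in> Q_on (-1/2) (1/2)"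
      using T_form[of 0 f side val] 2(1) by auto
    then show ?thesis using E_perfectly_displaced[of 0] 2(2) by simp
  qed
qed

text \<open>Maps of one family multiply within it, and middle halves of different families commute.
  A map T is rewritten in the family of its partner by \<open>T_form\<close>. Two maps T either are
  of the same type and compose, or live in different half cells and commute.\<close>

lemma Z_pairs:
  assumes "s \<in> Z" "t \<in> Z"
  shows "s \<otimes>\<^bsub>G\<^esub> t = t \<otimes>\<^bsub>G\<^esub> s \<or> perfectly_displaced G (s \<otimes>\<^bsub>G\<^esub> t)"
proof -
  have wide: "f \<in> Q_on (-1/2) (1/2)" if "f \<in> Q_on (-1/4) (1/4)" for f using Q_on_mono[OF that] by simp
  have EE: "perfectly_displaced G (E p side f g \<otimes>\<^bsub>G\<^esub> E p side f' g')"
    if "p = 0 \<or> p = 1" "f \<in> Q_on (-1/2) (1/2)" "g \<in> Q_on (-1/2) (1/2)" "f' \<in> Q_on (-1/2) (1/2)" "g' \<in> Q_on (-1/2) (1/2)"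
    for p side f g f' g'
    using E_perfectly_displaced[OF that(1) Q_on_comp[OF that(2,4)] Q_on_comp[OF that(3,5)]]
      E_comp[OF Q_on_centred[OF that(2)] Q_on_centred[OF that(3)]] by simp
  have PTd: "perfectly_displaced G (pat p (\<lambda>_. f) \<otimes>\<^bsub>G\<^esub> T 0 side val h) \<and> perfectly_displaced G (T 0 side val h \<otimes>\<^bsub>G\<^esub> pat p (\<lambda>_. f))"
    if p: "p = 0 \<or> p = 1" and f: "f \<in> Q_on (-1/4) (1/4)" and h: "h \<in> Q_on 0 (1/2)" for p f side val h
  proof -
    obtain side' h1 h2 where e: "T 0 side val h = E p side' h1 h2" "h1 \<in> Q_on (-1/2) (1/2)" "h2 \<in> Q_on (-1/2) (1/2)"
      using T_form[OF p h, of side val] by auto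
    show ?thesis
      unfolding e(1) E_same[symmetric, of p f side'] using EE[OF p] wide[OF f] e(2,3) by blast
  qed
  show ?thesis
    using assms(1)
  proof (cases rule: Z_cases)
    case (1 p f)
    note s = this
    show ?thesis
      using assms(2)
    proof (cases rule: Z_cases)
      case (1 q g)
      show ?thesis
      proof (cases "p = q")
        case True
        then show ?thesis
          using EE[OF s(1) wide[OF s(2)] wide[OF s(2)] wide[OF 1(2)] wide[OF 1(2)], of True] s(3) 1(3) E_same by simp
      next
        case False
        then have "q = 1 - p" using s(1) 1(1) by auto
        then have "pat p (\<lambda>_. f) \<circ> pat q (\<lambda>_. g) = pat q (\<lambda>_. g) \<circ> pat p (\<lambda>_. f)"
          using pat_commute[OF s(1) Q_on_imp_F_on[OF s(2)] Q_on_imp_F_on[OF 1(2)]] by simp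
        then show ?thesis using s(3) 1(3) by simp
      qed
    next
      case (2 side val h)
      show ?thesis using PTd[OF s(1,2) 2(1), of side val] unfolding s(3) 2(2) by (rule disjI2[OF conjunct1])
    qed
  next
    case (2 side val f)
    note s = this
    show ?thesis
      using assms(2)
    proof (cases rule: Z_cases)
      case (1 p g)
      show ?thesis using PTd[OF 1(1,2) s(1), of side val] unfolding s(2) 1(3) by (rule disjI2[OF conjunct2])
    next
      case (2 side' val' g)
      show ?thesis
      proof (cases "(side, val) = (side', val')")
        case True
        obtain sd h1 h2 where "T 0 side val (g \<circ> f) = E 0 sd h1 h2" "h1 \<in> Q_on (-1/2) (1/2)" "h2 \<in> Q_on (-1/2) (1/2)"
          using T_form[of 0 "g \<circ> f" side val] Q_on_comp[OF s(1) 2(1)] by auto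
        then show ?thesis using E_perfectly_displaced[of 0] T_comp[OF s(1), of 0 side val g] s(2) 2(2) True by simp
      next
        case False
        then show ?thesis using T_commute[OF s(1) 2(1) False, of 0] s(2) 2(2) by simp
      qed
    qed
  qed
qed

lemma Z_carrier: "Z \<subseteq> carrier HP"
  using Z_Gc Gc_homeo HP_carrier by blast

lemma Z_gen_comp: "\<lbrakk>f \<in> generate HP Z; g \<in> generate HP Z\<rbrakk> \<Longrightarrow> g \<circ> f \<in> generate HP Z"
  using generate.eng[of f HP Z g] by simp

lemma Z_gen_inv: "f \<in> generate HP Z \<Longrightarrow> hinv f \<in> generate HP Z"
  using group.generate_m_inv_closed[OF group_HP Z_carrier] group.generate_in_carrier[OF group_HP Z_carrier] HP_inv HP_carrier
  by metis

text \<open>A conjugation composed of a map in the left halves and a map in the middle halves brings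
  the support of f into the right halves, where the map is a product of two maps T.\<close>

lemma pat_in_generate_Z:
  assumes p: "p = 0 \<or> p = 1" and f: "f \<in> Q_on (-1/2) (1/2)"
  shows "pat p (\<lambda>_. f) \<in> generate HP Z"
proof -
  have TZ: "T p side val h \<in> generate HP Z" if h: "h \<in> Q_on 0 (1/2)" for side val h
  proof (cases "p = 0")
    case True
    then show ?thesis using h by (intro generate.incl) (auto simp: Z_def)
  next
    case False
    then have "p = 1" using p by simp
    then have "T p side val h = T 0 val side (if side = val then refl h else h)" using T_swap[OF p h, of side val] by simp
    moreover have "(if side = val then refl h else h) \<in> Q_on 0 (1/2)" using h refl_Q_on by simp
    ultimately have "T p side val h \<in> Z" unfolding Z_def by blast
    then show ?thesis by (rule generate.incl)
  qed
  have embZ: "pat p (\<lambda>_. emb side h) \<in> generate HP Z" if h: "h \<in> Q_on 0 (1/2)" for side h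
    using Z_gen_comp[OF TZ[OF h, of side False] TZ[OF h, of side True]] T_sum[OF h, of p side] by simp
  obtain c d where cd: "-1/2 < c" "c \<le> d" "d < 1/2" "f \<in> F_on c d" using f unfolding Q_on_iff by blast
  \<comment> \<open>The point -1/8 lies inside both the left half and the middle half of the cell:
    q1 brings c past it, and q2 carries on from there past the centre.\<close>
  have "\<exists>q1. q1 \<in> Q_on (-1/2) 0 \<and> -1/8 < q1 c"
  proof (cases "c < 0")
    case True
    then show ?thesis using push_right[of "-1/2" c 0 "-1/8"] cd by auto
  next
    case False
    then show ?thesis using Q_on_id[of "-1/2" 0] by (intro exI[of _ id]) auto
  qed
  then obtain q1 where q1: "q1 \<in> Q_on (-1/2) 0" "-1/8 < q1 c" by blast
  obtain q2 where q2: "q2 \<in> Q_on (-1/4) (1/4)" "0 < q2 (-1/8)" using push_right[of "-1/4" "-1/8" "1/4" 0] by auto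
  define q where "q = q2 \<circ> q1"
  have q2w: "q2 \<in> Q_on (-1/2) (1/2)" and q1w: "q1 \<in> Q_on (-1/2) (1/2)"
    using Q_on_mono[OF q2(1)] Q_on_mono[OF q1(1)] by auto
  have q: "q \<in> Q_on (-1/2) (1/2)" unfolding q_def by (rule Q_on_comp[OF q1w q2w])
  note hq = Q_on_homeo[OF q]
  have qc: "0 < q c"
    using q2(2) homeo_less[OF Q_on_homeo[OF q2(1)], of "-1/8" "q1 c"] q1(2) unfolding q_def by simp
  have qd: "q d < 1/2" using F_on_maps(2)[OF Q_on_imp_F_on[OF q], of d] cd by auto
  define f' where "f' = q \<circ> f \<circ> hinv q"
  have f': "f' \<in> Q_on 0 (1/2)"
    unfolding f'_def by (intro F_on_imp_Q_on[OF F_on_conj[OF cd(4) Q_on_PL2[OF q]]]) (use qc qd in auto)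
  define h1 where "h1 = sh (1/2) q1"
  have h1: "h1 \<in> Q_on 0 (1/2)" unfolding h1_def using sh_Q_on[OF q1(1) half_dyadic(1)] by simp
  have "emb False h1 = q1" by (auto simp: emb_def h1_def sh_def)
  then have q1Z: "pat p (\<lambda>_. q1) \<in> generate HP Z" using embZ[OF h1, of False] by simp
  have q2Z: "pat p (\<lambda>_. q2) \<in> generate HP Z" using q2 p by (intro generate.incl) (auto simp: Z_def)
  have c: "q1 \<in> centred" "q2 \<in> centred" "q \<in> centred" "f' \<in> centred" "f \<in> centred"
    using Q_on_centred[OF q1w] Q_on_centred[OF q2w] Q_on_centred[OF q] Q_on_centred[OF f'] Q_on_centred[OF f] by auto
  have qZ: "pat p (\<lambda>_. q) \<in> generate HP Z"
    using Z_gen_comp[OF q1Z q2Z] pat_comp[of "\<lambda>_. q1" p "\<lambda>_. q2"] c(1) unfolding q_def by simp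
  have f'Z: "pat p (\<lambda>_. f') \<in> generate HP Z" using embZ[OF f', of True] by (simp add: emb_def)
  have "hinv (pat p (\<lambda>_. q)) \<circ> (pat p (\<lambda>_. f') \<circ> pat p (\<lambda>_. q)) = pat p (\<lambda>_. hinv q \<circ> (f' \<circ> q))"
    using c by (simp add: pat_inv pat_comp centred_comp)
  moreover have "hinv q \<circ> (f' \<circ> q) = f"
    unfolding f'_def using homeo_inv_f[OF hq] by (auto simp: fun_eq_iff)
  ultimately show ?thesis using Z_gen_comp[OF Z_gen_comp[OF qZ f'Z] Z_gen_inv[OF qZ]] by simp
qed

text \<open>The piece of \<kappa> at the end of one cell and the piece at the beginning of the next,
  joined at their common boundary, which is the centre 0 of a shifted cell.\<close>

definition \<mu> :: "real \<Rightarrow> real" where "\<mu> = sh (1/2) c' \<circ> sh (-1/2) (neg c')"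

lemma \<mu>_Q: "\<mu> \<in> Q_on (-1/2) (1/2)"
proof -
  have "sh (1/2) c' \<in> F_on 0 (1/4)" using sh_F_on[OF c'_F half_dyadic(1)] by simp
  moreover have "sh (-1/2) (neg c') \<in> F_on (-1/4) 0" using sh_F_on[OF neg_c'_F half_dyadic(2)] by simp
  ultimately have "\<mu> \<in> F_on (-1/4) (1/4)" unfolding \<mu>_def by (intro F_on_comp) (auto elim: F_on_mono)
  then show ?thesis by (rule F_on_imp_Q_on) auto
qed

text \<open>Being invariant under the flip, \<open>\<kappa>\<close> acts in the same way in all cells. Read off in the cells
  shifted by \<open>1/2\<close>, it becomes a map with compact support in the interior of each cell.\<close>

lemma pat_\<kappa>:
  assumes p: "p = 0 \<or> p = 1"
  shows "pat p (\<lambda>_. \<kappa>) = pat (1 - p) (\<lambda>_. \<mu>)"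
proof
  fix x :: real
  have \<kappa>c: "\<kappa> \<in> centred" and \<mu>c: "\<mu> \<in> centred" using gen_centred Q_on_centred[OF \<mu>_Q] by auto
  have s1: "sh (1/2) c' y = y" if "y \<le> 0 \<or> 1/4 \<le> y" for y
    using F_on_outside[OF sh_F_on[OF c'_F half_dyadic(1)], of y] that by simp
  have s2: "sh (-1/2) (neg c') y = y" if "y \<le> -1/4 \<or> 0 \<le> y" for y
    using F_on_outside[OF sh_F_on[OF neg_c'_F half_dyadic(2)], of y] that by simp
  have \<mu>r: "\<mu> y = c' (y - 1/2) + 1/2" if "0 \<le> y" for y
    using s2[of y] that by (simp add: \<mu>_def sh_def)
  have \<mu>l: "\<mu> y = neg c' (y + 1/2) - 1/2" if "y \<le> 0" for y
  proof -
    have "sh (-1/2) (neg c') y \<le> 0"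
      using homeo_le[OF sh_homeo[OF F_on_homeo[OF neg_c'_F]], of "-1/2" y 0] s2[of 0] that by simp
    then show ?thesis using s1[of "sh (-1/2) (neg c') y"] by (simp add: \<mu>_def sh_def)
  qed
  have neg_\<mu>: "neg \<mu> = \<mu>"
  proof
    fix y show "neg \<mu> y = \<mu> y"
      by (cases "0 \<le> y") (auto simp: neg_def \<mu>r \<mu>l algebra_simps)
  qed
  have sgk: "sg b \<kappa> = \<kappa>" "sg b \<mu> = \<mu>" for b using neg_\<kappa> neg_\<mu> by (auto simp: sg_def)
  obtain j y where y: "0 \<le> y" "y \<le> 1/2" "x = of_int j / 2 + y" using half_cell_cases .
  have x': "x = of_int (j + 1) / 2 + (y - 1/2)" unfolding y(3) by (simp add: add_divide_distrib)
  have ay: "\<bar>y\<bar> \<le> 1/2" "\<bar>y - 1/2\<bar> \<le> 1/2" using y by auto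
  show "pat p (\<lambda>_. \<kappa>) x = pat (1 - p) (\<lambda>_. \<mu>) x"
  proof (cases "even (j - p)")
    case True
    then have e: "even (j + 1 - (1 - p))" by presburger
    have "pat p (\<lambda>_. \<kappa>) x = of_int j / 2 + \<kappa> y"
      unfolding y(3) using pat_at[of "\<lambda>_. \<kappa>", OF \<kappa>c True ay(1)] sgk by simp
    moreover have "pat (1 - p) (\<lambda>_. \<mu>) x = of_int (j + 1) / 2 + \<mu> (y - 1/2)"
      unfolding x' using pat_at[of "\<lambda>_. \<mu>", OF \<mu>c e ay(2)] sgk by simp
    ultimately show ?thesis using \<kappa>_right[of y] \<mu>l[of "y - 1/2"] y by (simp add: add_divide_distrib)
  next
    case False
    then have e: "even (j + 1 - p)" "even (j - (1 - p))" by presburger+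
    have "pat p (\<lambda>_. \<kappa>) x = of_int (j + 1) / 2 + \<kappa> (y - 1/2)"
      unfolding x' using pat_at[of "\<lambda>_. \<kappa>", OF \<kappa>c e(1) ay(2)] sgk by simp
    moreover have "pat (1 - p) (\<lambda>_. \<mu>) x = of_int j / 2 + \<mu> y"
      unfolding y(3) using pat_at[of "\<lambda>_. \<mu>", OF \<mu>c e(2) ay(1)] sgk by simp
    ultimately show ?thesis using \<kappa>_left[of "y - 1/2"] \<mu>r[of y] y by (simp add: add_divide_distrib)
  qed
qed

theorem G_rho_FA: "has_property_FA TYPE('v) (G_rho \<rho> (nu1 c0) \<nu>2 \<nu>3)"
proof -
  have gZ: "g \<in> generate HP Z" if gg: "g \<in> gens" for g
  proof -
    obtain p f where pf: "g = pat p (\<lambda>_. f)" "p = 0 \<or> p = 1" "f \<in> {\<kappa>, cen \<nu>2, cen \<nu>3}"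
      using gg unfolding gens_def by blast
    have p': "1 - p = 0 \<or> 1 - p = 1" using pf(2) by auto
    show ?thesis
    proof (cases "f = \<kappa>")
      case True
      then show ?thesis using pat_in_generate_Z[OF p' \<mu>_Q] pat_\<kappa>[OF pf(2)] pf(1) by simp
    next
      case False
      then have "f \<in> F0" using pf(3) cen_nu by auto
      then have "f \<in> Q_on (-1/2) (1/2)" by (rule F_on_imp_Q_on) auto
      then show ?thesis using pat_in_generate_Z[OF pf(2)] pf(1) by simp
    qed
  qed
  have fin: "finite gens"
  proof -
    have "gens = (\<lambda>(p, f). pat p (\<lambda>_. f)) ` ({0, 1} \<times> {\<kappa>, cen \<nu>2, cen \<nu>3})" unfolding gens_def by auto
    then show ?thesis by simp
  qed
  \<comment> \<open>The set Z is infinite, but only finitely many of its elements occur in words for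
    the generators.\<close>
  obtain F where F: "\<And>g. g \<in> gens \<Longrightarrow> F g \<subseteq> Z \<and> finite (F g) \<and> g \<in> generate HP (F g)"
    using generate_finite_subset[OF gZ] by metis
  define S where "S = (\<Union>g\<in>gens. F g)"
  have S: "finite S" "S \<subseteq> Z" using fin F unfolding S_def by auto
  interpret HPg: group HP by (rule group_HP)
  have "gens \<subseteq> generate HP S"
    using F HPg.mono_generate[of _ S] unfolding S_def by blast
  then have "Gc \<subseteq> generate HP S"
    unfolding Gc_def using HPg.generate_subgroup_incl[OF _ HPg.generate_is_subgroup, of gens S] S Z_carrier by blast
  moreover have SG: "S \<subseteq> Gc" using S Z_Gc by blast
  then have "generate HP S \<subseteq> Gc" by (rule HPg.generate_subgroup_incl[OF _ Gc_subgroup])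
  ultimately have c: "carrier G = generate G S"
    using HPg.generate_consistent[OF SG Gc_subgroup] by simp
  show ?thesis
    unfolding G_rho_eq
  proof (rule has_property_FA_criterion[OF group_G S(1) _ c])
    show "S \<subseteq> carrier G" using SG by simp
    show "perfectly_displaced G s" if "s \<in> S" for s using Z_displaced S(2) that by blast
    show "s \<otimes>\<^bsub>G\<^esub> t = t \<otimes>\<^bsub>G\<^esub> s \<or> perfectly_displaced G (s \<otimes>\<^bsub>G\<^esub> t)" if "s \<in> S" "t \<in> S" for s t
      by (rule Z_pairs) (use S(2) that in auto)
  qed
qed

end

section \<open>The group \<open>G_\<rho>\<close> does not have property (T)\<close>

text \<open>A filter along which all bounded sequences converge at once. The points a n that list
  the n-th terms of all sequences lie in a product of compact sets and so have a cluster point L;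
  the filter collects the indices n for which a n is close to L.\<close>

lemma exists_limit_filter:
  "\<exists>F. F \<le> sequentially \<and> F \<noteq> bot \<and> (\<forall>s :: nat \<Rightarrow> real. Bseq s \<longrightarrow> (\<exists>l. (s \<longlongrightarrow> l) F))"
proof -
  define B where "B s = (SOME K. \<forall>n. norm (s n) \<le> K)" for s :: "nat \<Rightarrow> real"
  have B: "norm (s n) \<le> B s" if s: "Bseq s" for s n
  proof -
    obtain K where "\<forall>n. norm (s n) \<le> K" using s unfolding Bseq_def by blast
    then have "\<forall>n. norm (s n) \<le> B s" unfolding B_def by (rule someI)
    then show ?thesis by blast
  qed
  \<comment> \<open>Unbounded sequences are replaced by 0, so that every factor of the product is
    compact.\<close>
  define a where "a n = (\<lambda>s :: nat \<Rightarrow> real. if Bseq s then s n else 0)" for n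
  define K where "K = PiE (UNIV :: (nat \<Rightarrow> real) set) (\<lambda>s. if Bseq s then {- B s..B s} else {0})"
  have "compactin (product_topology (\<lambda>_. euclidean) UNIV) K"
    unfolding K_def compactin_PiE by (auto simp: compactin_euclidean_iff)
  then have comp: "compact K"
    unfolding euclidean_product_topology compactin_euclidean_iff .
  have aK: "a n \<in> K" for n
  proof -
    have "s n \<in> {- B s..B s}" if "Bseq s" for s using B[OF that, of n] by (auto simp: abs_le_iff)
    then show ?thesis unfolding K_def a_def by auto
  qed
  define \<Phi> where "\<Phi> = filtermap a sequentially"
  have "\<Phi> \<noteq> bot" unfolding \<Phi>_def by (simp add: filtermap_bot_iff)
  moreover have "eventually (\<lambda>x. x \<in> K) \<Phi>" unfolding \<Phi>_def by (simp add: eventually_filtermap aK)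
  ultimately obtain L where L: "inf (nhds L) \<Phi> \<noteq> bot" using comp unfolding compact_filter by blast
  define F where "F = inf sequentially (filtercomap a (nhds L))"
  have "F \<noteq> bot"
  proof
    assume "F = bot"
    then have "eventually (\<lambda>_. False) F" by simp
    then obtain P Q where PQ: "eventually P sequentially" "eventually Q (filtercomap a (nhds L))" "\<And>n. P n \<Longrightarrow> Q n \<Longrightarrow> False"
      unfolding F_def eventually_inf by blast
    obtain R where R: "eventually R (nhds L)" "\<And>n. R (a n) \<Longrightarrow> Q n" using PQ(2) unfolding eventually_filtercomap by blast
    have "eventually (\<lambda>y. \<exists>n. P n \<and> y = a n) \<Phi>"
      unfolding \<Phi>_def eventually_filtermap using PQ(1) by (rule eventually_mono) blast
    then have "eventually (\<lambda>_. False) (inf (nhds L) \<Phi>)"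
      unfolding eventually_inf using R PQ(3) by blast
    then show False using L by (simp add: eventually_False)
  qed
  moreover have "F \<le> sequentially" unfolding F_def by simp
  moreover have "\<exists>l. (s \<longlongrightarrow> l) F" if s: "Bseq s" for s :: "nat \<Rightarrow> real"
  proof -
    have lim: "(a \<longlongrightarrow> L) F"
      unfolding filterlim_iff_le_filtercomap F_def by simp
    have "((\<lambda>n. a n s) \<longlongrightarrow> L s) F"
    proof (rule topological_tendstoI)
      fix S :: "real set" assume S: "open S" "L s \<in> S"
      have "open ((\<lambda>x :: (nat \<Rightarrow> real) \<Rightarrow> real. x s) -` S)"
        by (rule open_vimage[OF S(1) continuous_on_product_coordinates])
      then have "\<forall>\<^sub>F n in F. a n \<in> (\<lambda>x. x s) -` S"
        by (rule topological_tendstoD[OF lim]) (use S(2) in simp)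
      then show "\<forall>\<^sub>F n in F. a n s \<in> S" by simp
    qed
    moreover have "(\<lambda>n. a n s) = s" using s by (auto simp: a_def)
    ultimately show ?thesis by auto
  qed
  ultimately show ?thesis by blast
qed

definition LF :: "nat filter" where
  "LF = (SOME F. F \<le> sequentially \<and> F \<noteq> bot \<and> (\<forall>s :: nat \<Rightarrow> real. Bseq s \<longrightarrow> (\<exists>l. (s \<longlongrightarrow> l) F)))"

lemma LF: "LF \<le> sequentially" "LF \<noteq> bot" "Bseq s \<Longrightarrow> \<exists>l. ((s :: nat \<Rightarrow> real) \<longlongrightarrow> l) LF"
  using someI_ex[OF exists_limit_filter] unfolding LF_def by blast+

lemma LF_tendsto: "Bseq s \<Longrightarrow> ((s :: nat \<Rightarrow> real) \<longlongrightarrow> Lim LF s) LF"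
  using LF(3)[of s] tendsto_Lim[OF LF(2)] by metis

section \<open>Sparse functions and their mean inner product\<close>

definition supp_on :: "(real \<Rightarrow> real) \<Rightarrow> real \<Rightarrow> real \<Rightarrow> real set" where
  "supp_on u a b = {x. a \<le> x \<and> x < b \<and> u x \<noteq> 0}"

text \<open>The jump function of an element of \<open>G_\<rho>\<close> is in general not square summable, so the inner product
  below is a limit of averages over large intervals.\<close>

definition sparse :: "(real \<Rightarrow> real) set" where
  "sparse = {u. \<exists>b M. \<forall>x a. \<bar>u x\<bar> \<le> b \<and> finite (supp_on u a (a + 1)) \<and> card (supp_on u a (a + 1)) \<le> M}"

text \<open>Windows are half open, so one of length L is split into L unit windows without
  overlap.\<close>

lemma sparseE:
  assumes "u \<in> sparse"
  obtains b M where "b > 0" "\<And>x. \<bar>u x\<bar> \<le> b" "\<And>a L. finite (supp_on u a (a + real L)) \<and> card (supp_on u a (a + real L)) \<le> M * L"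
proof -
  obtain b M where u: "\<And>x. \<bar>u x\<bar> \<le> b" "\<And>a. finite (supp_on u a (a + 1)) \<and> card (supp_on u a (a + 1)) \<le> M"
    using assms unfolding sparse_def by blast
  have "finite (supp_on u a (a + real L)) \<and> card (supp_on u a (a + real L)) \<le> M * L" for a L
  proof (induction L)
    case 0
    have "supp_on u a (a + real 0) = {}" by (auto simp: supp_on_def)
    then show ?case by simp
  next
    case (Suc L)
    have e: "supp_on u a (a + real (Suc L)) = supp_on u a (a + real L) \<union> supp_on u (a + real L) (a + real L + 1)"
      by (auto simp: supp_on_def)
    show ?case
      unfolding e using Suc u(2)[of "a + real L"] card_Un_le[of "supp_on u a (a + real L)" "supp_on u (a + real L) (a + real L + 1)"]
      by auto
  qed
  moreover have "\<bar>u x\<bar> \<le> max b 1" for x using u(1)[of x] by simp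
  ultimately show ?thesis using that[of "max b 1" M] by simp
qed

lemma supp_on_subset: "\<lbrakk>a' \<le> a; b \<le> b'\<rbrakk> \<Longrightarrow> supp_on u a b \<subseteq> supp_on u a' b'"
  unfolding supp_on_def by auto

lemma sparse_finite: "u \<in> sparse \<Longrightarrow> finite (supp_on u a b)"
proof -
  assume "u \<in> sparse"
  then obtain c M where "\<And>a L. finite (supp_on u a (a + real L)) \<and> card (supp_on u a (a + real L)) \<le> M * L"
    using sparseE by metis
  moreover have "supp_on u a b \<subseteq> supp_on u a (a + real (nat \<lceil>b - a\<rceil>))"
    by (rule supp_on_subset) linarith+
  ultimately show ?thesis using finite_subset by blast
qed

lemma sparse_zero: "(\<lambda>_. 0) \<in> sparse"
  unfolding sparse_def supp_on_def by (auto intro!: exI[of _ 0])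

lemma sparse_add:
  assumes "u \<in> sparse" "v \<in> sparse"
  shows "(\<lambda>x. u x + v x) \<in> sparse"
proof -
  obtain b M where u: "\<And>x. \<bar>u x\<bar> \<le> b" "\<And>a. finite (supp_on u a (a + 1)) \<and> card (supp_on u a (a + 1)) \<le> M"
    using assms(1) unfolding sparse_def by blast
  obtain b' M' where v: "\<And>x. \<bar>v x\<bar> \<le> b'" "\<And>a. finite (supp_on v a (a + 1)) \<and> card (supp_on v a (a + 1)) \<le> M'"
    using assms(2) unfolding sparse_def by blast
  have "\<bar>u x + v x\<bar> \<le> b + b' \<and> finite (supp_on (\<lambda>x. u x + v x) a (a + 1)) \<and> card (supp_on (\<lambda>x. u x + v x) a (a + 1)) \<le> M + M'" for x a
  proof -
    have sub: "supp_on (\<lambda>x. u x + v x) a (a + 1) \<subseteq> supp_on u a (a + 1) \<union> supp_on v a (a + 1)"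
      unfolding supp_on_def by auto
    have f: "finite (supp_on u a (a + 1) \<union> supp_on v a (a + 1))" using u v by simp
    have "card (supp_on (\<lambda>x. u x + v x) a (a + 1)) \<le> card (supp_on u a (a + 1) \<union> supp_on v a (a + 1))"
      by (rule card_mono[OF f sub])
    also have "\<dots> \<le> M + M'" using card_Un_le[of "supp_on u a (a + 1)" "supp_on v a (a + 1)"] u(2)[of a] v(2)[of a] by linarith
    finally show ?thesis using u(1)[of x] v(1)[of x] finite_subset[OF sub f] by linarith
  qed
  then show ?thesis unfolding sparse_def by blast
qed

lemma sparse_scale:
  assumes "u \<in> sparse"
  shows "(\<lambda>x. c * u x) \<in> sparse"
proof -
  obtain b M where u: "\<And>x. \<bar>u x\<bar> \<le> b" "\<And>a. finite (supp_on u a (a + 1)) \<and> card (supp_on u a (a + 1)) \<le> M"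
    using assms(1) unfolding sparse_def by blast
  have "\<bar>c * u x\<bar> \<le> \<bar>c\<bar> * b \<and> finite (supp_on (\<lambda>x. c * u x) a (a + 1)) \<and> card (supp_on (\<lambda>x. c * u x) a (a + 1)) \<le> M" for x a
  proof -
    have sub: "supp_on (\<lambda>x. c * u x) a (a + 1) \<subseteq> supp_on u a (a + 1)"
      unfolding supp_on_def by auto
    have f: "finite (supp_on u a (a + 1))" using u by simp
    show ?thesis
      using u(1)[of x] u(2)[of a] finite_subset[OF sub f] card_mono[OF f sub] by (auto simp: abs_mult intro: mult_left_mono)
  qed
  then show ?thesis unfolding sparse_def by blast
qed

text \<open>The injective map g carries a unit window into a window of length 2c + 1, in which the
  support of u is bounded in number.\<close>

lemma sparse_comp:
  assumes u: "u \<in> sparse" and g: "homeo g" "\<And>x. \<bar>g x - x\<bar> \<le> c"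
  shows "(\<lambda>x. u (g x)) \<in> sparse"
proof -
  obtain b M where u: "b > 0" "\<And>x. \<bar>u x\<bar> \<le> b" "\<And>a L. finite (supp_on u a (a + real L)) \<and> card (supp_on u a (a + real L)) \<le> M * L"
    using sparseE[OF u] by metis
  define L where "L = nat \<lceil>2 * c + 1\<rceil>"
  have "\<bar>u (g x)\<bar> \<le> b \<and> finite (supp_on (\<lambda>x. u (g x)) a (a + 1)) \<and> card (supp_on (\<lambda>x. u (g x)) a (a + 1)) \<le> M * L" for x a
  proof -
    have inj: "inj_on g (supp_on (\<lambda>x. u (g x)) a (a + 1))" using homeo_eq[OF g(1)] by (auto simp: inj_on_def)
    have sub: "g ` supp_on (\<lambda>x. u (g x)) a (a + 1) \<subseteq> supp_on u (a - c) (a - c + real L)"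
    proof safe
      fix y assume "y \<in> supp_on (\<lambda>x. u (g x)) a (a + 1)"
      then have y: "a \<le> y" "y < a + 1" "u (g y) \<noteq> 0" unfolding supp_on_def by auto
      have "real L \<ge> 2 * c + 1" unfolding L_def by linarith
      then show "g y \<in> supp_on u (a - c) (a - c + real L)"
        using y g(2)[of y] unfolding supp_on_def by (auto simp: abs_le_iff)
    qed
    have f: "finite (supp_on u (a - c) (a - c + real L))" using u by blast
    have "finite (supp_on (\<lambda>x. u (g x)) a (a + 1))" using finite_imageD[OF finite_subset[OF sub f] inj] .
    moreover have "card (supp_on (\<lambda>x. u (g x)) a (a + 1)) \<le> M * L"
      using card_image[OF inj] card_mono[OF f sub] conjunct2[OF u(3)[of "a - c" L]] by linarith
    ultimately show ?thesis using u(2) by blast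
  qed
  then show ?thesis unfolding sparse_def by blast
qed

definition W :: "nat \<Rightarrow> (real \<Rightarrow> real) \<Rightarrow> (real \<Rightarrow> real) \<Rightarrow> real" where
  "W N u v = (\<Sum>x\<in>supp_on u (- real N) (real N). u x * v x)"

lemma W_eq:
  assumes "finite Y" "supp_on u (- real N) (real N) \<subseteq> Y" "Y \<subseteq> {- real N..<real N}"
  shows "W N u v = (\<Sum>x\<in>Y. u x * v x)"
  unfolding W_def
  by (rule sum.mono_neutral_left[OF assms(1,2)]) (use assms(3) in \<open>auto simp: supp_on_def\<close>)

lemma W_union:
  assumes "u \<in> sparse" "v \<in> sparse"
  defines "Y N \<equiv> supp_on u (- real N) (real N) \<union> supp_on v (- real N) (real N)"
  shows "finite (Y N)" "Y N \<subseteq> {- real N..<real N}" "supp_on u (- real N) (real N) \<subseteq> Y N" "supp_on v (- real N) (real N) \<subseteq> Y N"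
  unfolding Y_def using sparse_finite assms(1,2) by (auto simp: supp_on_def)

lemma W_sym:
  assumes "u \<in> sparse" "v \<in> sparse"
  shows "W N u v = W N v u"
proof -
  note U = W_union[OF assms, of N]
  show ?thesis
    using W_eq[OF U(1,3,2), where v = v] W_eq[OF U(1,4,2), where v = u] by (simp add: mult.commute)
qed

lemma W_add:
  assumes "u \<in> sparse" "v \<in> sparse"
  shows "W N (\<lambda>x. u x + v x) w = W N u w + W N v w"
proof -
  note U = W_union[OF assms, of N]
  have s: "supp_on (\<lambda>x. u x + v x) (- real N) (real N) \<subseteq> supp_on u (- real N) (real N) \<union> supp_on v (- real N) (real N)"
    unfolding supp_on_def by auto
  show ?thesis
    using W_eq[OF U(1,3,2), of w] W_eq[OF U(1,4,2), of w] W_eq[OF U(1) s U(2), of w]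
    by (simp add: distrib_right sum.distrib)
qed

lemma W_scale:
  assumes "u \<in> sparse"
  shows "W N (\<lambda>x. c * u x) w = c * W N u w"
proof -
  have f: "finite (supp_on u (- real N) (real N))" using sparse_finite assms by blast
  have s: "supp_on (\<lambda>x. c * u x) (- real N) (real N) \<subseteq> supp_on u (- real N) (real N)"
    and i: "supp_on u (- real N) (real N) \<subseteq> {- real N..<real N}"
    unfolding supp_on_def by auto
  show ?thesis using W_eq[OF f s i, of w] unfolding W_def[of N u] by (simp add: sum_distrib_left mult.assoc)
qed

lemma W_nonneg: "W N u u \<ge> 0"
  unfolding W_def by (intro sum_nonneg) simp

text \<open>The window of length 2N contains at most 2MN terms, each of size at most b b'.\<close>

lemma W_bounded:
  assumes "u \<in> sparse" "v \<in> sparse"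
  shows "Bseq (\<lambda>N. W N u v / real N)"
proof -
  obtain b M where u: "b > 0" "\<And>x. \<bar>u x\<bar> \<le> b" "\<And>a L. finite (supp_on u a (a + real L)) \<and> card (supp_on u a (a + real L)) \<le> M * L"
    using sparseE[OF assms(1)] by metis
  obtain b' M' where v: "b' > 0" "\<And>x. \<bar>v x\<bar> \<le> b'" using sparseE[OF assms(2)] by metis
  have "norm (W N u v / real N) \<le> 2 * real M * (b * b')" for N
  proof (cases "N = 0")
    case True
    then show ?thesis using u v by simp
  next
    case False
    have c: "card (supp_on u (- real N) (real N)) \<le> M * (2 * N)"
      using u(3)[of "- real N" "2 * N"] by simp
    have "\<bar>W N u v\<bar> \<le> (\<Sum>x\<in>supp_on u (- real N) (real N). \<bar>u x * v x\<bar>)" unfolding W_def by (rule sum_abs)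
    also have "\<dots> \<le> (\<Sum>x\<in>supp_on u (- real N) (real N). b * b')"
      by (intro sum_mono) (use u v in \<open>auto simp: abs_mult intro!: mult_mono\<close>)
    also have "\<dots> = real (card (supp_on u (- real N) (real N))) * (b * b')" by simp
    also have "\<dots> \<le> real (M * (2 * N)) * (b * b')" using c u v by (intro mult_right_mono) (auto simp del: of_nat_mult)
    finally show ?thesis using False by (simp add: field_simps)
  qed
  then show ?thesis by (rule BseqI')
qed

text \<open>The average over a window of length 2N is normalized by N; a constant factor does not
  matter for an inner product.\<close>

definition mean_ip :: "(real \<Rightarrow> real) \<Rightarrow> (real \<Rightarrow> real) \<Rightarrow> real" where
  "mean_ip u v = Lim LF (\<lambda>N. W N u v / real N)"

lemma mean_ip_tendsto: "\<lbrakk>u \<in> sparse; v \<in> sparse\<rbrakk> \<Longrightarrow> ((\<lambda>N. W N u v / real N) \<longlongrightarrow> mean_ip u v) LF"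
  unfolding mean_ip_def by (rule LF_tendsto[OF W_bounded])

lemma mean_ip_eqI: "\<lbrakk>u \<in> sparse; v \<in> sparse; ((\<lambda>N. W N u v / real N) \<longlongrightarrow> l) LF\<rbrakk> \<Longrightarrow> mean_ip u v = l"
  using tendsto_unique[OF LF(2) mean_ip_tendsto] by blast

interpretation sparse: semi_inner_space sparse mean_ip
proof
  fix u v w :: "real \<Rightarrow> real" and c :: real
  show "(\<lambda>_. 0) \<in> sparse" by (rule sparse_zero)
  assume u: "u \<in> sparse"
  show "(\<lambda>x. c * u x) \<in> sparse" by (rule sparse_scale[OF u])
  show "mean_ip u u \<ge> 0"
    by (rule tendsto_lowerbound[OF mean_ip_tendsto[OF u u] _ LF(2)]) (simp add: W_nonneg)
  assume v: "v \<in> sparse"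
  show "(\<lambda>x. u x + v x) \<in> sparse" by (rule sparse_add[OF u v])
  show "mean_ip u v = mean_ip v u" unfolding mean_ip_def using W_sym[OF u v] by simp
  show "mean_ip (\<lambda>x. c * u x) v = c * mean_ip u v"
    using mean_ip_eqI[OF sparse_scale[OF u] v, of c "c * mean_ip u v"] tendsto_mult_left[OF mean_ip_tendsto[OF u v], of c]
      W_scale[OF u] by simp
  assume w: "w \<in> sparse"
  show "mean_ip (\<lambda>x. u x + v x) w = mean_ip u w + mean_ip v w"
    using mean_ip_eqI[OF sparse_add[OF u v] w, of "mean_ip u w + mean_ip v w"]
      tendsto_add[OF mean_ip_tendsto[OF u w] mean_ip_tendsto[OF v w]] W_add[OF u v]
    by (simp add: add_divide_distrib)
qed

text \<open>Substituting g replaces the window by its image, whose ends move by at most c. So a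
  bounded number of bounded terms is gained or lost, and division by N makes them
  negligible.\<close>

lemma mean_ip_comp:
  assumes w: "w \<in> sparse" and g: "homeo g" "\<And>x. \<bar>g x - x\<bar> \<le> c"
  shows "mean_ip (\<lambda>x. w (g x)) (\<lambda>x. w (g x)) = mean_ip w w"
proof (rule mean_ip_eqI)
  note wg = sparse_comp[OF w g]
  show "(\<lambda>x. w (g x)) \<in> sparse" "(\<lambda>x. w (g x)) \<in> sparse" by (rule wg)+
  obtain b M where u: "b > 0" "\<And>x. \<bar>w x\<bar> \<le> b" "\<And>a L. finite (supp_on w a (a + real L)) \<and> card (supp_on w a (a + real L)) \<le> M * L"
    using sparseE[OF w] by metis
  define L where "L = nat \<lceil>c\<rceil>"
  have Lc: "real L \<ge> c" unfolding L_def by linarith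
  define C where "C = real (M * (2 * L) + M * (2 * L)) * b\<^sup>2"
  have diff: "\<bar>W N (\<lambda>x. w (g x)) (\<lambda>x. w (g x)) - W N w w\<bar> \<le> 2 * C" for N
  proof -
    define A where "A = supp_on w (g (- real N)) (g (real N))"
    define B where "B = supp_on w (- real N) (real N)"
    \<comment> \<open>The support within distance L of the two ends of the window contains every
      point at which the two ranges of summation differ.\<close>
    define D where "D = supp_on w (- real N - real L) (- real N - real L + real (2 * L)) \<union> supp_on w (real N - real L) (real N - real L + real (2 * L))"
    have fin: "finite A" "finite B" "finite D" unfolding A_def B_def D_def using sparse_finite[OF w] by auto
    have im: "g ` supp_on (\<lambda>x. w (g x)) (- real N) (real N) = A"
    proof
      show "g ` supp_on (\<lambda>x. w (g x)) (- real N) (real N) \<subseteq> A"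
        unfolding A_def supp_on_def using homeo_less[OF g(1)] homeo_le[OF g(1)] by auto
      show "A \<subseteq> g ` supp_on (\<lambda>x. w (g x)) (- real N) (real N)"
      proof
        fix y assume "y \<in> A"
        then have "hinv g y \<in> supp_on (\<lambda>x. w (g x)) (- real N) (real N)"
          unfolding A_def supp_on_def using homeo_f_inv[OF g(1), of y]
            homeo_le[OF g(1), of "- real N" "hinv g y"] homeo_less[OF g(1), of "hinv g y" "real N"] by simp
        then show "y \<in> g ` supp_on (\<lambda>x. w (g x)) (- real N) (real N)" using homeo_f_inv[OF g(1), of y] by (metis imageI)
      qed
    qed
    have inj: "inj_on g (supp_on (\<lambda>x. w (g x)) (- real N) (real N))" using homeo_eq[OF g(1)] by (auto simp: inj_on_def)
    have WA: "W N (\<lambda>x. w (g x)) (\<lambda>x. w (g x)) = (\<Sum>y\<in>A. w y * w y)"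
      unfolding W_def im[symmetric] sum.reindex[OF inj] by simp
    have WB: "W N w w = (\<Sum>y\<in>B. w y * w y)" unfolding W_def B_def ..
    have gN: "\<bar>g (- real N) - (- real N)\<bar> \<le> real L" "\<bar>g (real N) - real N\<bar> \<le> real L"
      using g(2)[of "- real N"] g(2)[of "real N"] Lc by linarith+
    have AB: "A - B \<subseteq> D" "B - A \<subseteq> D"
      unfolding A_def B_def D_def supp_on_def using gN by auto
    have cD: "real (card D) \<le> real (M * (2 * L) + M * (2 * L))"
      using card_Un_le[of "supp_on w (- real N - real L) (- real N - real L + real (2 * L))" "supp_on w (real N - real L) (real N - real L + real (2 * L))"]
        u(3)[of "- real N - real L" "2 * L"] u(3)[of "real N - real L" "2 * L"] unfolding D_def by linarith
    have sD: "(\<Sum>y\<in>S. w y * w y) \<le> C" if "S \<subseteq> D" for S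
    proof -
      have "(\<Sum>y\<in>S. w y * w y) \<le> (\<Sum>y\<in>D. w y * w y)" by (rule sum_mono2[OF fin(3) that]) simp
      also have "\<dots> \<le> (\<Sum>y\<in>D. b\<^sup>2)"
      proof (rule sum_mono)
        fix y show "w y * w y \<le> b\<^sup>2" using u(2)[of y] by (metis abs_le_square_iff abs_of_pos power2_eq_square u(1))
      qed
      also have "\<dots> = real (card D) * b\<^sup>2" by simp
      also have "\<dots> \<le> C" unfolding C_def by (rule mult_right_mono[OF cD]) simp
      finally show ?thesis .
    qed
    have "(\<Sum>y\<in>A. w y * w y) = (\<Sum>y\<in>A \<inter> B. w y * w y) + (\<Sum>y\<in>A - B. w y * w y)"
      by (rule sum.Int_Diff[OF fin(1)])
    moreover have "(\<Sum>y\<in>B. w y * w y) = (\<Sum>y\<in>A \<inter> B. w y * w y) + (\<Sum>y\<in>B - A. w y * w y)"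
      using sum.Int_Diff[OF fin(2), of "\<lambda>y. w y * w y" A] by (simp add: Int_commute)
    moreover have "(\<Sum>y\<in>A - B. w y * w y) \<ge> 0" "(\<Sum>y\<in>B - A. w y * w y) \<ge> 0" by (intro sum_nonneg; simp)+
    ultimately show ?thesis unfolding WA WB using sD[OF AB(1)] sD[OF AB(2)] by linarith
  qed
  have "(\<lambda>N. (W N (\<lambda>x. w (g x)) (\<lambda>x. w (g x)) - W N w w) / real N) \<longlonglongrightarrow> 0"
  proof (rule Lim_null_comparison)
    show "\<forall>\<^sub>F N in sequentially. norm ((W N (\<lambda>x. w (g x)) (\<lambda>x. w (g x)) - W N w w) / real N) \<le> 2 * C / real N"
      using diff by (auto intro!: always_eventually divide_right_mono)
    show "(\<lambda>N. 2 * C / real N) \<longlonglongrightarrow> 0" by (rule lim_const_over_n)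
  qed
  then have "((\<lambda>N. (W N (\<lambda>x. w (g x)) (\<lambda>x. w (g x)) - W N w w) / real N) \<longlongrightarrow> 0) LF"
    using LF(1) tendsto_mono by blast
  from tendsto_add[OF this mean_ip_tendsto[OF w w]]
  show "((\<lambda>N. W N (\<lambda>x. w (g x)) (\<lambda>x. w (g x)) / real N) \<longlongrightarrow> mean_ip w w) LF"
    by (simp add: diff_divide_distrib)
qed

section \<open>The jump cocycle\<close>

definition jump :: "(real \<Rightarrow> real) \<Rightarrow> real \<Rightarrow> real" where "jump g x = of_int (rs g x - ls g x)"

lemma jump_comp: "\<lbrakk>f \<in> PL2; g \<in> PL2\<rbrakk> \<Longrightarrow> jump (g \<circ> f) x = jump f x + jump g (f x)"
  unfolding jump_def using rs_comp ls_comp by simp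

lemma jump_id: "jump id = (\<lambda>_. 0)"
  unfolding jump_def using rs_eq[OF rlin_id] ls_eq[OF llin_id] by auto

text \<open>Bounded displacement is what makes substitution act isometrically on sparse functions,
  and a sparse jump function is an admissible translation part.\<close>

definition tame :: "(real \<Rightarrow> real) set" where
  "tame = {g \<in> PL2. (\<exists>c. \<forall>x. \<bar>g x - x\<bar> \<le> c) \<and> jump g \<in> sparse}"

lemma tame_comp:
  assumes f: "f \<in> tame" and g: "g \<in> tame"
  shows "g \<circ> f \<in> tame"
proof -
  obtain c where c: "\<And>x. \<bar>f x - x\<bar> \<le> c" using f unfolding tame_def by blast
  obtain d where d: "\<And>x. \<bar>g x - x\<bar> \<le> d" using g unfolding tame_def by blast
  have P: "f \<in> PL2" "g \<in> PL2" "jump f \<in> sparse" "jump g \<in> sparse" using f g unfolding tame_def by auto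
  have "\<bar>(g \<circ> f) x - x\<bar> \<le> c + d" for x using c[of x] d[of "f x"] by simp
  moreover have "jump (g \<circ> f) = (\<lambda>x. jump f x + jump g (f x))" using jump_comp[OF P(1,2)] by auto
  then have "jump (g \<circ> f) \<in> sparse" using sparse_add[OF P(3) sparse_comp[OF P(4) PL2_homeo[OF P(1)] c]] by simp
  ultimately show ?thesis unfolding tame_def using PL2_comp[OF P(1,2)] by blast
qed

lemma tame_inv:
  assumes f: "f \<in> tame"
  shows "hinv f \<in> tame"
proof -
  obtain c where c: "\<And>x. \<bar>f x - x\<bar> \<le> c" using f unfolding tame_def by blast
  have P: "f \<in> PL2" "jump f \<in> sparse" using f unfolding tame_def by auto
  note h = PL2_homeo[OF P(1)]
  have d: "\<bar>hinv f x - x\<bar> \<le> c" for x using c[of "hinv f x"] homeo_f_inv[OF h, of x] by (simp add: abs_minus_commute)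
  have "f \<circ> hinv f = id" using homeo_f_inv[OF h] by auto
  then have "jump (hinv f) x + jump f (hinv f x) = 0" for x
    using jump_comp[OF PL2_inv[OF P(1)] P(1), of x] jump_id by simp
  then have "jump (hinv f) = (\<lambda>x. -1 * jump f (hinv f x))" by (metis add_eq_0_iff2 mult_minus1)
  then have "jump (hinv f) \<in> sparse"
    using sparse_scale[OF sparse_comp[OF P(2) homeo_inv[OF h] d], of "-1"] by simp
  then show ?thesis unfolding tame_def using d PL2_inv[OF P(1)] by blast
qed

lemma tame_id: "id \<in> tame"
  unfolding tame_def using sparse_zero jump_id by (auto intro!: exI[of _ 0])

text \<open>Substitution is the linear part and the jump function the cocycle. Since the group
  product applies the left factor first, substitution is an action from the left.\<close>

definition jump_action :: "(real \<Rightarrow> real) \<Rightarrow> (real \<Rightarrow> real) \<Rightarrow> real \<Rightarrow> real" where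
  "jump_action g u = (\<lambda>x. u (g x) + jump g x)"

lemma jump_action_affine:
  assumes g: "g \<in> tame"
  shows "sparse.affine_isom (jump_action g)"
proof -
  obtain c where c: "\<And>x. \<bar>g x - x\<bar> \<le> c" using g unfolding tame_def by blast
  have P: "g \<in> PL2" "jump g \<in> sparse" using g unfolding tame_def by auto
  note h = PL2_homeo[OF P(1)]
  have iso: "sparse.nm (sparse.sub (jump_action g u) (jump_action g v)) = sparse.nm (sparse.sub u v)"
    if "u \<in> sparse" "v \<in> sparse" for u v
  proof -
    have "sparse.sub (jump_action g u) (jump_action g v) = (\<lambda>x. sparse.sub u v (g x))"
      unfolding sparse.sub_def jump_action_def by auto
    then show ?thesis
      unfolding sparse.nm_def using mean_ip_comp[OF sparse.sub_in[OF that] h c] by simp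
  qed
  show ?thesis
    unfolding sparse.affine_isom_def
  proof (intro conjI ballI allI)
    show "jump_action g u \<in> sparse" if "u \<in> sparse" for u
      unfolding jump_action_def by (rule sparse_add[OF sparse_comp[OF that h c] P(2)])
    show "sparse.nm (sparse.sub (jump_action g u) (jump_action g v)) = sparse.nm (sparse.sub u v)"
      if "u \<in> sparse" "v \<in> sparse" for u v by (rule iso[OF that])
    show "jump_action g (\<lambda>x. (1 - t) * u x + t * v x) = (\<lambda>x. (1 - t) * jump_action g u x + t * jump_action g v x)" for u v t
      unfolding jump_action_def by (auto simp: algebra_simps)
  qed
qed

lemma rlin_sh: "rlin g y k \<Longrightarrow> rlin (sh a g) (y + a) k"
proof -
  assume k: "rlin g y k"
  obtain e where e: "e > 0" "\<forall>z. y \<le> z \<and> z \<le> y + e \<longrightarrow> g z = g y + 2 powi k * (z - y)" using k unfolding rlin_def by blast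
  have "sh a g z = sh a g (y + a) + 2 powi k * (z - (y + a))" if "y + a \<le> z \<and> z \<le> y + a + e" for z
  proof -
    have "g (z - a) = g y + 2 powi k * (z - a - y)" using e(2)[rule_format, of "z - a"] that by simp
    then show ?thesis by (simp add: sh_def algebra_simps)
  qed
  then show ?thesis unfolding rlin_def using e(1) by blast
qed

lemma llin_sh: "llin g y k \<Longrightarrow> llin (sh a g) (y + a) k"
proof -
  assume "llin g y k"
  then have "rlin (sh (- a) (neg g)) (- y + - a) k" unfolding llin_def by (rule rlin_sh)
  moreover have "sh (- a) (neg g) = neg (sh a g)" by (auto simp: sh_def neg_def)
  ultimately show ?thesis unfolding llin_def by simp
qed

section \<open>Breaks of cell maps\<close>

context pattern
begin

lemma pat_right_germ:
  assumes f: "f \<in> F_on (-1/2) (1/2)" and k: "even (k - p)" and y: "-1/2 \<le> y" "y < 1/2"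
  shows "rlin (pat p (\<lambda>_. f)) (of_int k / 2 + y) (rs (sg (s k) f) y)"
proof -
  have sf: "sg (s k) f \<in> PL2" using F_on_PL2[OF f] PL2_neg by (simp add: sg_def)
  have c: "f \<in> centred" using F_on_centred[OF f] by simp
  have "rlin (sh (of_int k / 2) (sg (s k) f)) (y + of_int k / 2) (rs (sg (s k) f) y)"
    by (rule rlin_sh[OF rlin_rs[OF sf]])
  then have "rlin (pat p (\<lambda>_. f)) (y + of_int k / 2) (rs (sg (s k) f) y)"
  proof (rule rlin_cong)
    show "1/2 - y > 0" using y by simp
    fix z assume z: "y + of_int k / 2 \<le> z \<and> z \<le> y + of_int k / 2 + (1/2 - y)"
    then have "\<bar>z - of_int k / 2\<bar> \<le> 1/2" using y by linarith
    then show "pat p (\<lambda>_. f) z = sh (of_int k / 2) (sg (s k) f) z"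
      using pat_at[of "\<lambda>_. f", OF c k, of "z - of_int k / 2"] by (simp add: sh_def)
  qed
  then show ?thesis by (simp add: add.commute)
qed

lemma pat_left_germ:
  assumes f: "f \<in> F_on (-1/2) (1/2)" and k: "even (k - p)" and y: "-1/2 < y" "y \<le> 1/2"
  shows "llin (pat p (\<lambda>_. f)) (of_int k / 2 + y) (ls (sg (s k) f) y)"
proof -
  have sf: "sg (s k) f \<in> PL2" using F_on_PL2[OF f] PL2_neg by (simp add: sg_def)
  have c: "f \<in> centred" using F_on_centred[OF f] by simp
  have "llin (sh (of_int k / 2) (sg (s k) f)) (y + of_int k / 2) (ls (sg (s k) f) y)"
    by (rule llin_sh[OF llin_ls[OF sf]])
  then have "llin (pat p (\<lambda>_. f)) (y + of_int k / 2) (ls (sg (s k) f) y)"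
  proof (rule llin_cong)
    show "y + 1/2 > 0" using y by simp
    fix z assume z: "y + of_int k / 2 - (y + 1/2) \<le> z \<and> z \<le> y + of_int k / 2"
    then have "\<bar>z - of_int k / 2\<bar> \<le> 1/2" using y by linarith
    then show "pat p (\<lambda>_. f) z = sh (of_int k / 2) (sg (s k) f) z"
      using pat_at[of "\<lambda>_. f", OF c k, of "z - of_int k / 2"] by (simp add: sh_def)
  qed
  then show ?thesis by (simp add: add.commute)
qed

lemma cell_rep:
  obtains k and y :: real where "even (k - p)" "-1/2 \<le> y" "y < 1/2" "x = of_int k / 2 + y"
proof -
  obtain i y where y: "0 \<le> y" "y < 1" "x = (of_int p - 1) / 2 + 1 * of_int i + y"
    by (rule cell_cases[where w = 1 and x = x and z = "(of_int p - 1) / 2"]) simp_all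
  show ?thesis
    by (rule that[of "2 * i + p" "y - 1/2"]) (use y in \<open>auto simp: add_divide_distrib diff_divide_distrib\<close>)
qed

text \<open>The breaks are cell boundaries and translates, by half-integers, of the finitely many
  breaks of f and of its flip. This bounds their density and the size of the jumps.\<close>

lemma pat_tame:
  assumes f: "f \<in> F_on (-1/2) (1/2)"
  shows "pat p (\<lambda>_. f) \<in> tame"
proof -
  note P = F_on_PL2[OF f]
  have c: "f \<in> centred" using F_on_centred[OF f] by simp
  have sgP: "sg b f \<in> PL2" for b using P PL2_neg by (simp add: sg_def)
  have sgF: "sg b f \<in> F_on (-1/2) (1/2)" for b using f F_on_neg[OF f] by (simp add: sg_def)
  \<comment> \<open>At a cell boundary the right germ is read at y = -1/2 in the following cell, but
    the left germ at y' = 1/2 in the preceding one.\<close>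
  have left: "\<exists>k' y'. even (k' - p) \<and> -1/2 < y' \<and> y' \<le> 1/2 \<and> x = of_int k' / 2 + y' \<and> (-1/2 < y \<longrightarrow> k' = k \<and> y' = y)"
    if "even (k - p)" "-1/2 \<le> y" "y < 1/2" "x = of_int k / 2 + y" for k :: int and y x :: real
  proof (cases "y = -1/2")
    case True
    then have "x = of_int (k - 2) / 2 + 1/2" unfolding that(4) by (simp add: diff_divide_distrib)
    moreover have "even (k - 2 - p)" using that(1) by presburger
    ultimately show ?thesis using True by (intro exI[of _ "k - 2"] exI[of _ "1/2"]) auto
  next
    case False
    then show ?thesis using that by (intro exI[of _ k] exI[of _ y]) auto
  qed
  have PL: "pat p (\<lambda>_. f) \<in> PL2"
  proof (rule PL2I)
    show "homeo (pat p (\<lambda>_. f))" by (rule pat_homeo[OF c])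
    fix x
    obtain k and y :: real where ky: "even (k - p)" "-1/2 \<le> y" "y < 1/2" "x = of_int k / 2 + y" using cell_rep .
    obtain k' y' where ky': "even (k' - p)" "-1/2 < y'" "y' \<le> 1/2" "x = of_int k' / 2 + y'" "-1/2 < y \<longrightarrow> k' = k \<and> y' = y"
      using left[OF ky] by blast
    have kd: "of_int k / 2 \<in> dyadic" using dyadic_half[OF dyadic_of_int[of k]] .
    have R: "rlin (pat p (\<lambda>_. f)) x (rs (sg (s k) f) y)" unfolding ky(4) by (rule pat_right_germ[OF f ky(1-3)])
    have L: "llin (pat p (\<lambda>_. f)) x (ls (sg (s k') f) y')" unfolding ky'(4) by (rule pat_left_germ[OF f ky'(1-3)])
    have "x \<in> dyadic" if ne: "rs (sg (s k) f) y \<noteq> ls (sg (s k') f) y'"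
    proof (cases "y = -1/2")
      case True
      then show ?thesis unfolding ky(4) using kd by (intro dyadic_add) (simp_all only: half_dyadic)
    next
      case False
      then have "k' = k" "y' = y" using ky(2) ky'(5) by auto
      then have "y \<in> dyadic" using PL2_break[OF sgP rlin_rs[OF sgP] llin_ls[OF sgP]] ne by blast
      then show ?thesis unfolding ky(4) using kd by (intro dyadic_add)
    qed
    then show "\<exists>k l. rlin (pat p (\<lambda>_. f)) x k \<and> llin (pat p (\<lambda>_. f)) x l \<and> (k \<noteq> l \<longrightarrow> x \<in> dyadic)"
      using R L by blast
    have "pat p (\<lambda>_. f) x = sg (s k) f y + of_int k / 2"
      unfolding ky(4) using pat_at[of "\<lambda>_. f", OF c ky(1), of y] ky by (simp add: add.commute)
    then show "pat p (\<lambda>_. f) x \<in> dyadic \<longleftrightarrow> x \<in> dyadic"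
      using dyadic_add_cancel[OF kd, of "sg (s k) f y"] dyadic_add_cancel[OF kd, of y] PL2_dyadic[OF sgP] ky(4) by (simp add: add.commute)
  qed
  have disp: "\<bar>pat p (\<lambda>_. f) x - x\<bar> \<le> 1" for x
  proof -
    obtain k and y :: real where ky: "even (k - p)" "-1/2 \<le> y" "y < 1/2" "x = of_int k / 2 + y" using cell_rep .
    have "sg (s k) f (-1/2) \<le> sg (s k) f y" "sg (s k) f y \<le> sg (s k) f (1/2)"
      using homeo_le[OF F_on_homeo[OF sgF]] ky by simp_all
    then have "-1/2 \<le> sg (s k) f y" "sg (s k) f y \<le> 1/2"
      using F_on_outside[OF sgF, of "-1/2"] F_on_outside[OF sgF, of "1/2"] by simp_all
    moreover have "pat p (\<lambda>_. f) x = of_int k / 2 + sg (s k) f y"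
      unfolding ky(4) using pat_at[of "\<lambda>_. f", OF c ky(1), of y] ky by simp
    ultimately show ?thesis unfolding ky(4) using ky(2,3) by linarith
  qed
  have fb: "finite {y\<in>{-1/2..1/2}. rs (sg b f) y \<noteq> ls (sg b f) y}" "\<exists>M. \<forall>y\<in>{-1/2..1/2}. \<bar>rs (sg b f) y\<bar> \<le> M \<and> \<bar>ls (sg b f) y\<bar> \<le> M" for b
    using PL2_finite_breaks[OF sgP, of "-1/2" "1/2" b] by simp_all
  \<comment> \<open>The cell boundary -1/2 is added because its two germs come from different
    cells.\<close>
  define Y where "Y = insert (-1/2) ({y\<in>{-1/2..1/2}. rs (sg True f) y \<noteq> ls (sg True f) y} \<union> {y\<in>{-1/2..1/2}. rs (sg False f) y \<noteq> ls (sg False f) y})"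
  have Yfin: "finite Y" unfolding Y_def using fb(1) by simp
  have inY: "y \<in> Y" if "-1/2 \<le> y" "y < 1/2" "rs (sg b f) y \<noteq> ls (sg b f) y" for b y
    using that unfolding Y_def by (cases b) auto
  obtain M1 M2 where M: "\<forall>y\<in>{-1/2..1/2}. \<bar>rs (sg True f) y\<bar> \<le> M1 \<and> \<bar>ls (sg True f) y\<bar> \<le> M1"
    "\<forall>y\<in>{-1/2..1/2}. \<bar>rs (sg False f) y\<bar> \<le> M2 \<and> \<bar>ls (sg False f) y\<bar> \<le> M2" using fb(2) by meson
  have bnd: "\<bar>rs (sg b f) y\<bar> \<le> max M1 M2 \<and> \<bar>ls (sg b f) y\<bar> \<le> max M1 M2" if "-1/2 \<le> y" "y \<le> 1/2" for b y
    using M(1)[rule_format, of y] M(2)[rule_format, of y] that by (cases b) auto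
  have J: "\<bar>jump (pat p (\<lambda>_. f)) x\<bar> \<le> 2 * of_int (max M1 M2) \<and>
      (jump (pat p (\<lambda>_. f)) x \<noteq> 0 \<longrightarrow> (\<exists>k. \<exists>y\<in>Y. x = of_int k / 2 + y \<and> -1/2 \<le> y \<and> y < 1/2))" for x
  proof -
    obtain k and y :: real where ky: "even (k - p)" "-1/2 \<le> y" "y < 1/2" "x = of_int k / 2 + y" using cell_rep .
    obtain k' y' where ky': "even (k' - p)" "-1/2 < y'" "y' \<le> 1/2" "x = of_int k' / 2 + y'" "-1/2 < y \<longrightarrow> k' = k \<and> y' = y"
      using left[OF ky] by blast
    have R: "rs (pat p (\<lambda>_. f)) x = rs (sg (s k) f) y" unfolding ky(4) by (rule rs_eq[OF pat_right_germ[OF f ky(1-3)]])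
    have L: "ls (pat p (\<lambda>_. f)) x = ls (sg (s k') f) y'" unfolding ky'(4) by (rule ls_eq[OF pat_left_germ[OF f ky'(1-3)]])
    have "\<bar>rs (sg (s k) f) y - ls (sg (s k') f) y'\<bar> \<le> 2 * max M1 M2"
      using bnd[of y "s k"] bnd[of y' "s k'"] ky ky' by linarith
    then have "\<bar>jump (pat p (\<lambda>_. f)) x\<bar> \<le> 2 * of_int (max M1 M2)" unfolding jump_def R L by linarith
    moreover have "y \<in> Y" if "jump (pat p (\<lambda>_. f)) x \<noteq> 0"
    proof (cases "y = -1/2")
      case False
      then have "k' = k" "y' = y" using ky(2) ky'(5) by auto
      then show ?thesis using inY[OF ky(2,3)] that unfolding jump_def R L by auto
    qed (simp add: Y_def)
    ultimately show ?thesis using ky by blast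
  qed
  have "finite (supp_on (jump (pat p (\<lambda>_. f))) a (a + 1)) \<and> card (supp_on (jump (pat p (\<lambda>_. f))) a (a + 1)) \<le> 6 * card Y" for a
  proof -
    \<comment> \<open>Only six indices k are possible for a point k/2 + y of a unit window with y in
      [-1/2, 1/2).\<close>
    define k0 where "k0 = \<lfloor>2 * a - 1\<rfloor>"
    let ?I = "(\<lambda>(k, y). of_int k / 2 + y) ` ({k0..k0 + 5} \<times> Y)"
    have sub: "supp_on (jump (pat p (\<lambda>_. f))) a (a + 1) \<subseteq> ?I"
    proof
      fix x assume "x \<in> supp_on (jump (pat p (\<lambda>_. f))) a (a + 1)"
      then have x: "a \<le> x" "x < a + 1" "jump (pat p (\<lambda>_. f)) x \<noteq> 0" unfolding supp_on_def by auto
      then obtain k y where ky: "y \<in> Y" "x = of_int k / 2 + y" "-1/2 \<le> y" "y < 1/2" using J[of x] by blast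
      have "2 * a - 1 < of_int k" "of_int k < 2 * a + 3 + 1" using x ky by linarith+
      then have "k0 \<le> k" "k \<le> k0 + 5" unfolding k0_def by linarith+
      then show "x \<in> ?I" using ky by (auto intro!: image_eqI[of _ _ "(k, y)"])
    qed
    have fin: "finite ({k0..k0 + 5} \<times> Y)" using Yfin by simp
    have "card (supp_on (jump (pat p (\<lambda>_. f))) a (a + 1)) \<le> card ?I" using card_mono[OF finite_imageI[OF fin] sub] .
    also have "\<dots> \<le> card ({k0..k0 + 5} \<times> Y)" by (rule card_image_le[OF fin])
    also have "\<dots> = 6 * card Y" by (simp add: card_cartesian_product)
    finally show ?thesis using finite_subset[OF sub finite_imageI[OF fin]] by blast
  qed
  then have "jump (pat p (\<lambda>_. f)) \<in> sparse" unfolding sparse_def using J by blast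
  then show ?thesis unfolding tame_def using PL disp by blast
qed

end

section \<open>An unbounded orbit\<close>

context rho_group
begin

lemma Gc_tame: "g \<in> Gc \<Longrightarrow> g \<in> tame"
proof -
  have gens: "g \<in> tame" if "g \<in> gens" for g
  proof -
    have "f \<in> F_on (-1/2) (1/2)" if "f \<in> {\<kappa>, cen \<nu>2, cen \<nu>3}" for f
      using that \<kappa>_F F_on_mono[OF cen_nu(1)] F_on_mono[OF cen_nu(2)] by auto
    then show ?thesis using pat_tame that unfolding gens_def by blast
  qed
  assume "g \<in> Gc"
  then show "g \<in> tame"
    unfolding Gc_def
  proof induction
    case (inv h)
    then show ?case using tame_inv[OF gens] gens_carrier HP_inv HP_carrier by (metis subsetD)
  next
    case one
    show ?case unfolding HP_one by (rule tame_id)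
  next
    case (incl h)
    then show ?case by (rule gens)
  next
    case (eng h1 h2)
    show ?case unfolding HP_mult by (rule tame_comp[OF eng.IH])
  qed
qed

text \<open>On [-1/4, 1/4] the map is the identity, while c0 moves every point of (0, 1/4) up, so
  slope 1 to the left of -1/4 is impossible.\<close>

lemma \<kappa>_break: "rs \<kappa> (-1/4) = 0" "ls \<kappa> (-1/4) \<noteq> 0"
proof -
  have id: "\<kappa> x = x" if "-1/4 \<le> x" "x \<le> 1/4" for x
    using \<kappa>_left[of x] F_on_outside[OF c'_F, of x] that by simp
  show "rs \<kappa> (-1/4) = 0"
  proof (rule rs_eq)
    show "rlin \<kappa> (-1/4) 0" unfolding rlin_def by (rule exI[of _ "1/4"]) (auto simp: id)
  qed
  show "ls \<kappa> (-1/4) \<noteq> 0"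
  proof
    assume "ls \<kappa> (-1/4) = 0"
    then have "llin \<kappa> (-1/4) 0" using llin_ls[OF F_on_PL2[OF \<kappa>_F], of "-1/4"] by simp
    then obtain e where e: "e > 0" "\<forall>y. -1/4 - e \<le> y \<and> y \<le> -1/4 \<longrightarrow> \<kappa> y = \<kappa> (-1/4) + 2 powi 0 * (y - (-1/4))"
      unfolding llin_iff by blast
    define y where "y = -1/4 - min e (1/8)"
    have y: "-1/4 - e \<le> y" "y < -1/4" "-1/2 < y" using e(1) unfolding y_def by linarith+
    have "\<kappa> y = y" using e(2)[rule_format, of y] y id[of "-1/4"] by simp
    moreover have "\<kappa> y = c0 (y + 1/2) - 1/2" using \<kappa>_left[of y] c'_eq[of y] y by simp
    moreover have "c0 (y + 1/2) > y + 1/2" by (rule c0_up) (use y in auto)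
    ultimately show False by simp
  qed
qed

theorem G_rho_not_T: "\<not> has_property_T (G_rho \<rho> (nu1 c0) \<nu>2 \<nu>3)"
proof
  assume "has_property_T (G_rho \<rho> (nu1 c0) \<nu>2 \<nu>3)"
  then have T: "has_property_T G" unfolding G_rho_eq .
  have "\<exists>C. \<forall>g\<in>carrier G. sparse.nm (jump_action g (\<lambda>_. 0)) \<le> C"
  proof (rule sparse.property_T_imp_bounded_orbit[OF T group_G])
    show "sparse.affine_isom (jump_action g)" if "g \<in> carrier G" for g
      using jump_action_affine Gc_tame that by simp
    show "jump_action (g \<otimes>\<^bsub>G\<^esub> h) u = jump_action g (jump_action h u)" if "g \<in> carrier G" "h \<in> carrier G" for g h u
    proof -
      have "g \<in> PL2" "h \<in> PL2" using Gc_tame that unfolding tame_def by auto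
      then show ?thesis using jump_comp[of g h] unfolding jump_action_def by auto
    qed
    show "jump_action \<one>\<^bsub>G\<^esub> u = u" for u unfolding jump_action_def using jump_id by simp
  qed
  then obtain C where C: "\<And>g. g \<in> Gc \<Longrightarrow> sparse.nm (jump_action g (\<lambda>_. 0)) \<le> C" by auto
  define z where "z = pat 1 (\<lambda>_. \<kappa>)"
  have zG: "z \<in> Gc" unfolding Gc_def z_def by (rule generate.incl) (auto simp: gens_def)
  have zmG: "z ^^ m \<in> Gc" for m
  proof (induction m)
    case 0
    then show ?case using Gc_id by (simp flip: id_def)
  next
    case (Suc m)
    show ?case unfolding funpow.simps by (rule Gc_comp[OF Suc zG])
  qed
  define l where "l = ls \<kappa> (-1/4)"
  have l: "l \<noteq> 0" using \<kappa>_break l_def by simp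
  have sgk: "sg b \<kappa> = \<kappa>" for b using neg_\<kappa> by (simp add: sg_def)
  have \<kappa>c: "\<kappa> \<in> centred" using gen_centred by simp
  \<comment> \<open>The points n + 1/4. In cells with either label they are breaks of z, as \<kappa>
    is invariant under the flip.\<close>
  define x where "x n = of_int (2 * n + 1) / 2 + (-1/4 :: real)" for n :: int
  have zx: "z (x n) = x n" for n
  proof -
    have "\<kappa> (-1/4) = -1/4" using \<kappa>_left[of "-1/4"] F_on_outside[OF c'_F, of "-1/4"] by simp
    then show ?thesis unfolding z_def x_def using pat_at[of "\<lambda>_. \<kappa>" "2 * n + 1" 1 "-1/4"] \<kappa>c sgk by simp
  qed
  have jz: "jump z (x n) = - of_int l" for n
  proof -
    have "rs z (x n) = rs (sg True \<kappa>) (-1/4)" "ls z (x n) = ls (sg True \<kappa>) (-1/4)"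
      unfolding z_def x_def using rs_eq[OF pat_right_germ[OF \<kappa>_F, of "2 * n + 1" 1 "-1/4"]]
        ls_eq[OF pat_left_germ[OF \<kappa>_F, of "2 * n + 1" 1 "-1/4"]] sgk by simp_all
    then show ?thesis unfolding jump_def using \<kappa>_break(1) sgk l_def by simp
  qed
  \<comment> \<open>As z fixes these points, the cocycle identity simply adds up its jumps
    there.\<close>
  have zm: "(z ^^ m) (x n) = x n \<and> jump (z ^^ m) (x n) = - real m * of_int l" for m n
  proof (induction m)
    case 0
    then show ?case using jump_id by (simp flip: id_def)
  next
    case (Suc m)
    have "z ^^ m \<in> PL2" "z \<in> PL2" using Gc_tame zmG[of m] zG unfolding tame_def by auto
    then have j: "jump (z ^^ Suc m) (x n) = jump (z ^^ m) (x n) + jump z ((z ^^ m) (x n))"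
      unfolding funpow.simps by (rule jump_comp)
    show ?case unfolding j using Suc jz[of n] zx[of n] by (simp add: algebra_simps)
  qed
  \<comment> \<open>The window [-N, N) contains x 0, ..., x (N - 1). Each contributes at least m
    squared, since l is a nonzero integer, and there are enough of them to outweigh the division by
    N.\<close>
  have lower: "real m \<le> sparse.nm (jump_action (z ^^ m) (\<lambda>_. 0))" for m
  proof -
    define u where "u = jump (z ^^ m)"
    have u: "u \<in> sparse" using Gc_tame[OF zmG[of m]] unfolding tame_def u_def by blast
    have ja: "jump_action (z ^^ m) (\<lambda>_. 0) = u" unfolding jump_action_def u_def by simp
    have "real m ^ 2 \<le> W N u u / real N" if N: "N > 0" for N
    proof -
      have "inj_on x {0..<int N}" by (auto simp: inj_on_def x_def)
      then have cx: "card (x ` {0..<int N}) = N" by (simp add: card_image)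
      have ux: "u (x n) * u (x n) \<ge> real m ^ 2" for n
      proof -
        have "u (x n) * u (x n) = real m ^ 2 * (of_int l) ^ 2"
          unfolding u_def using zm[of m n] by (simp add: power2_eq_square)
        moreover have "(of_int l :: real) ^ 2 \<ge> 1"
          using l by (metis of_int_1_le_iff of_int_power one_le_power zero_less_power2 int_one_le_iff_zero_less)
        ultimately show ?thesis using mult_left_mono[of 1 "(of_int l :: real) ^ 2" "real m ^ 2"] by simp
      qed
      have fin: "finite (supp_on u (- real N) (real N) \<union> x ` {0..<int N})" using sparse_finite[OF u] by simp
      have xin: "x ` {0..<int N} \<subseteq> {- real N..<real N}"
      proof
        fix y assume "y \<in> x ` {0..<int N}"
        then obtain n where n: "y = x n" "0 \<le> n" "n < int N" by auto
        have "x n = of_int n + 1/4" unfolding x_def by (simp add: add_divide_distrib)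
        moreover have "of_int n + 1 \<le> real N" "0 \<le> (of_int n :: real)" using n by linarith+
        ultimately show "y \<in> {- real N..<real N}" using n by simp
      qed
      have "real N * real m ^ 2 = (\<Sum>y\<in>x ` {0..<int N}. real m ^ 2)" using cx by simp
      also have "\<dots> \<le> (\<Sum>y\<in>x ` {0..<int N}. u y * u y)" by (rule sum_mono) (use ux in auto)
      also have "\<dots> \<le> (\<Sum>y\<in>supp_on u (- real N) (real N) \<union> x ` {0..<int N}. u y * u y)"
        by (rule sum_mono2[OF fin]) auto
      also have "\<dots> = W N u u"
        by (rule W_eq[OF fin, symmetric]) (use xin in \<open>auto simp: supp_on_def\<close>)
      finally show ?thesis using N by (simp add: field_simps)
    qed
    then have "\<forall>\<^sub>F N in sequentially. real m ^ 2 \<le> W N u u / real N"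
      by (intro eventually_sequentiallyI[of 1]) simp
    then have "\<forall>\<^sub>F N in LF. real m ^ 2 \<le> W N u u / real N" using LF(1) unfolding le_filter_def by blast
    then have "real m ^ 2 \<le> mean_ip u u"
      by (rule tendsto_lowerbound[OF mean_ip_tendsto[OF u u] _ LF(2)])
    then show ?thesis unfolding ja sparse.nm_def by (rule real_le_rsqrt)
  qed
  obtain m :: nat where "real m > C" using reals_Archimedean2 by blast
  then show False using lower[of m] C[OF zmG[of m]] by simp
qed

end

theorem theorem1p2:
  fixes \<rho> :: "real \<Rightarrow> letter" and c0 \<nu>2 \<nu>3 :: "real \<Rightarrow> real"
  assumes "c0 \<in> thompson_F"
    and "Supp c0 = {0<..<1/4}"
    and "\<And>x. x \<in> {0<..<1/4} \<Longrightarrow> c0 x > x"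
    and "\<And>t. t \<in> {0<..<1/16} \<Longrightarrow> c0 t = 2 * t"
    and "\<nu>2 \<in> carrier (Homeo unit_interval)" and "Supp \<nu>2 \<subseteq> {1/16<..<15/16}"
    and "\<nu>3 \<in> carrier (Homeo unit_interval)" and "Supp \<nu>3 \<subseteq> {1/16<..<15/16}"
    and "generate (Homeo unit_interval) {\<nu>2, \<nu>3} = thompson_F_on (1/16) (15/16)"
    and "quasi_periodic \<rho>"
  shows "\<not> has_property_T (G_rho \<rho> (nu1 c0) \<nu>2 \<nu>3) \<and>
         has_property_FA TYPE('v) (G_rho \<rho> (nu1 c0) \<nu>2 \<nu>3)"
proof -
  interpret rho_group \<nu>2 \<nu>3 \<rho> c0
    by unfold_locales (fact assms | rule assms, assumption)+
  show ?thesis using G_rho_not_T G_rho_FA by blast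
qed

end
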